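(* Let $\Gamma_t\subset \mathrm{PGL}_{d+1}(\mathbb R)$, $t\in\mathbb R$, be the groups obtained by bending $M$ along $\Sigma$, where $M$ is an orientable finite volume hyperbolic $d$-manifold and $\Sigma\subset M$ is an embedded finite volume totally geodesic hypersurface. Then $\Gamma_t$ is Zariski dense in $\mathrm{PGL}_{d+1}(\mathbb R)$ for every $t\neq 0$.
   Context: Hyperbolic model. Let $d\ge 3$ and $Q_d(x)=x_2^2+\cdots+x_d^2-2x_1x_{d+1}$ on $\mathbb R^{d+1}$ (signature $(d,1)$). $\mathbb H^d=\{[x]\in\mathbb{RP}^d: Q_d(x)<0\}=\{[x_1:\cdots:x_d:1]: x_1>(x_2^2+\cdots+x_d^2)/2\}$; $\mathrm{PSO}(Q_d)\subset\mathrm{PGL}_{d+1}(\mathbb R)$ is the group of orientation-preserving isometries of $\mathbb H^d$; $\mathbb H^{d-1}_0=\mathbb H^d\cap\{x_2=0\}$; $\mathrm{PSO}(Q_d;d-1,1)$ is the subgroup of $\mathrm{PSO}(Q_d)$ preserving $\mathbb H_0^{d-1}$ and each of the two components of $\mathbb H^d\setminus\mathbb H_0^{d-1}$. Put $c_t=\exp\big(t\,\mathrm{diag}(-1,d,-1,\dots,-1)\big)$; it commutes with $\mathrm{PSO}(Q_d;d-1,1)$. Bending. $M$ is a connected orientable complete finite-volume hyperbolic $d$-manifold and $\Sigma\subset M$ a connected embedded finite-volume complete totally geodesic hypersurface. Write $M=\mathbb H^d/\Gamma$ with $\Gamma\subset\mathrm{PSO}(Q_d)$, $\Gamma\cong\pi_1(M)$,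 normalized so that $\mathbb H_0^{d-1}$ is a component of the preimage $\widetilde\Sigma$ of $\Sigma$; let $\Delta\cong\pi_1(\Sigma)$ be the stabilizer of $\mathbb H_0^{d-1}$ in $\Gamma$, assumed to lie in $\mathrm{PSO}(Q_d;d-1,1)$ (i.e. $\Sigma$ is two-sided). (Separating case) If $M\setminus\Sigma=M_1\sqcup M_2$, let $\widetilde N_i$ be the closure in $\mathbb H^d$ of the component of $\mathbb H^d\setminus\widetilde\Sigma$ that lies over $M_i$ and is adjacent to $\mathbb H_0^{d-1}$, and $\Gamma_i$ its stabilizer in $\Gamma$, so $\Gamma=\Gamma_1*_\Delta\Gamma_2$. Define $\rho_t:\Gamma\to\mathrm{PGL}_{d+1}(\mathbb R)$ by $\rho_t(\gamma)=\gamma$ on $\Gamma_1$ and $\rho_t(\gamma)=c_t\gamma c_t^{-1}$ on $\Gamma_2$. (Non-separating case) If $M\setminus\Sigma$ is connected, let $\widetilde N$ and $s\widetilde N$ ($s\in\Gamma$) be the closures of the two components of $\mathbb H^d\setminus\widetilde\Sigma$ adjacent to $\mathbb H_0^{d-1}$, and $\Gamma_\Sigma$ the stabilizer of $\widetilde N$, so $\Gamma=\Gamma_\Sigma *_s$ is an HNN extension with stable letter $s$. Define $\rho_t(\gamma)=\gamma$ on $\Gamma_\Sigma$ and $\rho_t(s)=c_t s$. Finally $\Gamma_t:=\rho_t(\Gamma)$; these are the groups obtained by bending $M$ along $\Sigma$. *)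

theory Defs
  imports "HOL-Analysis.Analysis" "HOL-Algebra.Coset"
begin

definition GL :: "(real^'n^'n) monoid" where
  "GL = \<lparr>carrier = {A. invertible A}, mult = (**), one = mat 1\<rparr>"

definition scalars :: "(real^'n^'n) set" where
  "scalars = {c *\<^sub>R mat 1 | c. c \<noteq> 0}"

text \<open>The elements of \<open>PGL\<close> are the sets \<open>{c A | c \<noteq> 0}\<close> with \<open>A\<close> invertible.\<close>

definition PGL :: "(real^'n^'n) set monoid" where
  "PGL = GL Mod scalars"

definition pgl_class :: "real^'n^'n \<Rightarrow> (real^'n^'n) set" where
  "pgl_class A = scalars #>\<^bsub>GL\<^esub> A"

definition homogeneous_polynomial_function :: "(real^'n^'n \<Rightarrow> real) \<Rightarrow> bool" where
  "homogeneous_polynomial_function f \<longleftrightarrow>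
     real_polynomial_function f \<and> (\<exists>k. \<forall>c A. f (c *\<^sub>R A) = c ^ k * f A)"

text \<open>
  \<open>PGL\<close> is the affine open subset \<open>det \<noteq> 0\<close> of the projective space of matrices. Its regular
  functions are the quotients of a homogeneous polynomial in the matrix entries by a power of
  \<open>det\<close> of the same degree, so the sets below are its basic Zariski open sets.
\<close>

definition zariski_PGL :: "(real^'n^'n) set topology" where
  "zariski_PGL = topology_generated_by
     {{g \<in> carrier PGL. \<forall>A\<in>g. f A \<noteq> 0} | f. homogeneous_polynomial_function f}"

definition zariski_dense_PGL :: "(real^'n^'n) set set \<Rightarrow> bool" where
  "zariski_dense_PGL G \<longleftrightarrow> G \<subseteq> carrier PGL \<and> zariski_PGL closure_of G = carrier PGL"

text \<open>
  The coordinates \<open>x\<^sub>1, \<dots>, x\<^sub>d\<^sub>+\<^sub>1\<close> are indexed, in increasing order, by a finite linearly ordered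
  type with \<open>d + 1\<close> elements.
\<close>

definition ix_first :: "'n::{finite,linorder}" where
  "ix_first = Min UNIV"

definition ix_second :: "'n::{finite,linorder}" where
  "ix_second = Min (UNIV - {ix_first})"

definition ix_last :: "'n::{finite,linorder}" where
  "ix_last = Max UNIV"

definition Q :: "real^'n::{finite,linorder} \<Rightarrow> real" where
  "Q x = (\<Sum>i\<in>UNIV - {ix_first, ix_last}. (x $ i)\<^sup>2) - 2 * x $ ix_first * x $ ix_last"

text \<open>
  A line on which \<open>Q\<close> is negative meets the affine hyperplane \<open>x\<^sub>d\<^sub>+\<^sub>1 = 1\<close> in one point, by which
  it is represented.
\<close>

definition hyp :: "(real^'n::{finite,linorder}) set" where
  "hyp = {x. x $ ix_last = 1 \<and> Q x < 0}"

definition hyp0 :: "(real^'n::{finite,linorder}) set" where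
  "hyp0 = {x \<in> hyp. x $ ix_second = 0}"

text \<open>The result does not depend on the choice of the representative \<open>A\<close>.\<close>

definition act :: "(real^'n::{finite,linorder}^'n::_) set \<Rightarrow> real^'n::_ \<Rightarrow> real^'n::_" where
  "act g x = (let v = (SOME A. A \<in> g) *v x in v /\<^sub>R (v $ ix_last))"

text \<open>
  A matrix preserving \<open>Q\<close> has a unique multiple by \<open>\<plusminus>1\<close> that maps the cone over \<open>hyp\<close> with
  \<open>x\<^sub>d\<^sub>+\<^sub>1 > 0\<close> to itself, and the isometry of \<open>hyp\<close> that it induces preserves the orientation if and
  only if this multiple has determinant 1. (For even \<open>d\<close>, the condition \<open>det A = 1\<close> alone would
  give all isometries.)
\<close>

definition PSO :: "(real^'n::{finite,linorder}^'n::_) set set" where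
  "PSO = {pgl_class A | A. (\<forall>x. Q (A *v x) = Q x) \<and> det A = 1 \<and>
                           (\<forall>x\<in>hyp. 0 < (A *v x) $ ix_last)}"

definition PSO0 :: "(real^'n::{finite,linorder}^'n::_) set set" where
  "PSO0 = {g \<in> PSO. act g ` hyp0 = hyp0 \<and> (\<forall>C\<in>components (hyp - hyp0). act g ` C = C)}"

definition stab :: "(real^'n::{finite,linorder}^'n::_) set set \<Rightarrow> (real^'n::_) set
    \<Rightarrow> (real^'n::_^'n::_) set set" where
  "stab \<Gamma> X = {\<gamma> \<in> \<Gamma>. act \<gamma> ` X = X}"

definition free_properly_discontinuous :: "(real^'n::{finite,linorder}^'n::_) set set \<Rightarrow> bool" where
  "free_properly_discontinuous \<Gamma> \<longleftrightarrow>
     (\<forall>\<gamma>\<in>\<Gamma>. \<forall>x\<in>hyp. act \<gamma> x = x \<longrightarrow> \<gamma> = \<one>\<^bsub>PGL\<^esub>) \<and>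
     (\<forall>K. compact K \<and> K \<subseteq> hyp \<longrightarrow> finite {\<gamma> \<in> \<Gamma>. act \<gamma> ` K \<inter> K \<noteq> {}})"

definition orbit :: "(real^'n::{finite,linorder}^'n::_) set set \<Rightarrow> real^'n::_ \<Rightarrow> (real^'n::_) set" where
  "orbit \<Gamma> x = {act \<gamma> x | \<gamma>. \<gamma> \<in> \<Gamma>}"

text \<open>
  The points of \<open>M = hyp/\<Gamma>\<close> are the orbits. Hence the preimage in \<open>hyp\<close> of a subset \<open>S\<close> of \<open>M\<close> is
  \<open>\<Union>S\<close>.
\<close>

definition hyp_quotient :: "(real^'n::{finite,linorder}^'n::_) set set \<Rightarrow> (real^'n::_) set set" where
  "hyp_quotient \<Gamma> = orbit \<Gamma> ` hyp"

definition quotient_top :: "(real^'n::{finite,linorder}^'n::_) set set \<Rightarrow> (real^'n::_) set topology" where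
  "quotient_top \<Gamma> = topology (\<lambda>U. U \<subseteq> hyp_quotient \<Gamma> \<and> openin (top_of_set hyp) (\<Union>U))"

text \<open>
  Let \<open>J\<close> be the set of all indices, or of all indices but the second. The set \<open>hyp_cone J D\<close> is the
  cone over \<open>D\<close>, truncated at the hyperboloid \<open>Q = -1\<close>, in the coordinate subspace spanned by \<open>J\<close>.
  For a Borel set \<open>D\<close> in \<open>hyp\<close> or \<open>hyp0\<close> respectively, with \<open>k = card J - 1\<close> the dimension of that
  space, \<open>hyp_volume J D\<close> is the hyperbolic volume (for curvature \<open>-1\<close>): writing a point of the cone
  as \<open>r v\<close> with \<open>r > 0\<close> and \<open>v \<in> D\<close>, Lebesgue measure is \<open>r\<^sup>k dr dv\<close> and the truncation is
  \<open>r < (-Q v) powr (-1/2)\<close>, so that the value is the integral over \<open>D\<close> of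
  \<open>(-Q v) powr (-(k+1)/2) dv\<close>. In the upper half-space coordinates \<open>y\<close>, with \<open>y\<^sup>2 = -Q v\<close>, and
  \<open>v\<^sub>i\<close>, for the indices \<open>i\<close> in \<open>J\<close> other than the first and the last, the integrand is
  \<open>dy \<Prod>dv\<^sub>i / y\<^sup>k\<close>.
\<close>

definition hyp_cone :: "'n::{finite,linorder} set \<Rightarrow> (real^'n::_) set \<Rightarrow> ('n \<Rightarrow> real) set" where
  "hyp_cone J D = {f \<in> space (Pi\<^sub>M J (\<lambda>_. lborel)).
     let x = (\<chi> i. if i \<in> J then f i else 0)
     in 0 < x $ ix_last \<and> -1 < Q x \<and> x /\<^sub>R (x $ ix_last) \<in> D}"

definition hyp_volume :: "'n::{finite,linorder} set \<Rightarrow> (real^'n::_) set \<Rightarrow> ennreal" where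
  "hyp_volume J D = of_nat (card J) * emeasure (Pi\<^sub>M J (\<lambda>_. lborel)) (hyp_cone J D)"

text \<open>
  The volume of the quotient \<open>X/\<Gamma>\<close> is that of a Borel set \<open>D\<close> meeting every orbit in one point.
\<close>

definition finite_volume_quotient ::
    "'n::{finite,linorder} set \<Rightarrow> (real^'n::_) set \<Rightarrow> (real^'n::_^'n::_) set set \<Rightarrow> bool" where
  "finite_volume_quotient J X \<Gamma> \<longleftrightarrow>
     (\<exists>D. D \<in> sets borel \<and> D \<subseteq> X \<and> (\<forall>x\<in>X. \<exists>!y. y \<in> D \<inter> orbit \<Gamma> x) \<and> hyp_volume J D < \<infinity>)"

definition geodesic_hyperplane :: "(real^'n::{finite,linorder}) set \<Rightarrow> bool" where
  "geodesic_hyperplane P \<longleftrightarrow> P \<noteq> {} \<and> (\<exists>a. a \<noteq> 0 \<and> P = {x \<in> hyp. a \<bullet> x = 0})"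

text \<open>
  The first clause on \<open>\<Union>S\<close> says that \<open>S\<close> is an embedded totally geodesic hypersurface, the second
  one that it is complete.
\<close>

definition complete_totally_geodesic_hypersurface ::
    "(real^'n::{finite,linorder}^'n::_) set set \<Rightarrow> (real^'n::_) set set \<Rightarrow> bool" where
  "complete_totally_geodesic_hypersurface \<Gamma> S \<longleftrightarrow> S \<subseteq> hyp_quotient \<Gamma> \<and>
     (\<forall>x\<in>\<Union>S. \<exists>U P. open U \<and> x \<in> U \<and> geodesic_hyperplane P \<and> \<Union>S \<inter> U = P \<inter> U) \<and>
     (\<forall>C\<in>components (\<Union>S). geodesic_hyperplane C)"

definition c_mat :: "real \<Rightarrow> real^'n::{finite,linorder}^'n::_" where
  "c_mat t = (\<chi> i j. if i \<noteq> j then 0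
                     else if i = ix_second then exp (t * (real CARD('n) - 1)) else exp (- t))"

definition bend_elt :: "real \<Rightarrow> (real^'n::{finite,linorder}^'n::_) set" where
  "bend_elt t = pgl_class (c_mat t)"

definition adjacent_components :: "(real^'n::{finite,linorder}) set set \<Rightarrow> (real^'n::_) set set" where
  "adjacent_components S = {C \<in> components (hyp - \<Union>S). hyp0 \<subseteq> closure C}"

definition hyp_closure :: "(real^'n::{finite,linorder}) set \<Rightarrow> (real^'n::_) set" where
  "hyp_closure C = hyp \<inter> closure C"

definition bends_separating :: "(real^'n::{finite,linorder}^'n::_) set set \<Rightarrow> (real^'n::_) set set
    \<Rightarrow> real \<Rightarrow> ((real^'n::_^'n::_) set \<Rightarrow> (real^'n::_^'n::_) set) \<Rightarrow> bool" where
  "bends_separating \<Gamma> S t \<rho> \<longleftrightarrow>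
     (\<exists>M\<^sub>1 M\<^sub>2 C\<^sub>1 C\<^sub>2.
        M\<^sub>1 \<noteq> M\<^sub>2 \<and>
        connected_components_of (subtopology (quotient_top \<Gamma>) (hyp_quotient \<Gamma> - S)) = {M\<^sub>1, M\<^sub>2} \<and>
        C\<^sub>1 \<in> adjacent_components S \<and> C\<^sub>1 \<subseteq> \<Union>M\<^sub>1 \<and>
        C\<^sub>2 \<in> adjacent_components S \<and> C\<^sub>2 \<subseteq> \<Union>M\<^sub>2 \<and>
        (\<forall>\<gamma>\<in>stab \<Gamma> (hyp_closure C\<^sub>1). \<rho> \<gamma> = \<gamma>) \<and>
        (\<forall>\<gamma>\<in>stab \<Gamma> (hyp_closure C\<^sub>2).
           \<rho> \<gamma> = bend_elt t \<otimes>\<^bsub>PGL\<^esub> \<gamma> \<otimes>\<^bsub>PGL\<^esub> inv\<^bsub>PGL\<^esub> bend_elt t))"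

definition bends_nonseparating :: "(real^'n::{finite,linorder}^'n::_) set set \<Rightarrow> (real^'n::_) set set
    \<Rightarrow> real \<Rightarrow> ((real^'n::_^'n::_) set \<Rightarrow> (real^'n::_^'n::_) set) \<Rightarrow> bool" where
  "bends_nonseparating \<Gamma> S t \<rho> \<longleftrightarrow>
     connectedin (quotient_top \<Gamma>) (hyp_quotient \<Gamma> - S) \<and>
     (\<exists>C C' s.
        C \<noteq> C' \<and> adjacent_components S = {C, C'} \<and>
        s \<in> \<Gamma> \<and> hyp_closure C' = act s ` hyp_closure C \<and>
        (\<forall>\<gamma>\<in>stab \<Gamma> (hyp_closure C). \<rho> \<gamma> = \<gamma>) \<and>
        \<rho> s = bend_elt t \<otimes>\<^bsub>PGL\<^esub> s)"

text \<open>
  Since \<open>\<Gamma>\<close> is an amalgamated product or an HNN extension of the groups involved, the homomorphism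
  \<open>\<rho>\<close> exists and is determined by \<open>t\<close> and the choices made.
\<close>

definition bending_hom :: "(real^'n::{finite,linorder}^'n::_) set set \<Rightarrow> (real^'n::_) set set
    \<Rightarrow> real \<Rightarrow> ((real^'n::_^'n::_) set \<Rightarrow> (real^'n::_^'n::_) set) \<Rightarrow> bool" where
  "bending_hom \<Gamma> S t \<rho> \<longleftrightarrow> \<rho> \<in> hom (PGL\<lparr>carrier := \<Gamma>\<rparr>) PGL \<and>
     (bends_separating \<Gamma> S t \<rho> \<or> bends_nonseparating \<Gamma> S t \<rho>)"

end

theory Submission
  imports Defs "HOL-Combinatorics.Permutations" "HOL-Computational_Algebra.Polynomial"
begin

text \<open>
  Let \<open>G\<close> be the cone over the bent group and \<open>L\<close> the Lie algebra of its Zariski closure. If \<open>L\<close>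
  contains all matrices, then the derivatives of a homogeneous polynomial vanishing on \<open>G\<close> vanish on
  \<open>G\<close> as well, and by induction on the degree the polynomial is zero.

  A lattice of the hyperplane \<open>x\<^sub>2 = 0\<close> is Zariski dense in the isometry group of the hyperplane (the
  Borel density theorem). Here the reason is dynamical. By Poincare recurrence of the geodesic flow
  modulo the lattice, there are pairs of points in general position for which the translations of
  length \<open>s\<close> along the line through them, multiplied by suitable lattice elements, converge for a
  sequence \<open>s \<rightarrow> \<infinity>\<close> to an isometry commuting with these translations. Comparing top-degree terms of
  the polynomials vanishing on the lattice shows that the translations lie in its Zariski closure.

  Hence \<open>L\<close> contains the infinitesimal isometries of the hyperplane. Conjugation by an element of
  the part of the group that is not bent (in the non-separating case, by the stable letter) yields
  those of another hyperplane, and both generate \<open>so(d, 1)\<close>. In the separating case such an element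
  exists because a half-space has infinite volume. In the same way \<open>L\<close> contains the conjugate of
  \<open>so(d, 1)\<close> by \<open>c\<^sub>t\<close>. For \<open>t \<noteq> 0\<close> the two conjugates generate the Lie algebra of all matrices of
  trace 0, and \<open>L\<close> contains the scalar matrices because \<open>G\<close> is a cone.
\<close>

section \<open>Homogeneous polynomial functions\<close>

text \<open>Polynomials are treated as forms, one degree at a time. The forms of one degree
  vanishing on the group are a finite-dimensional space invariant under left translation by the
  group, so they are one point of a Grassmannian, and a limit of multiples of group elements can be
  tested on its Pluecker coordinates.

  The geodesic flow is replaced by a map on pairs of vectors: a pair goes to its second point and
  the reflection of its first point in the second. This is a skew product whose fibre maps are
  isometries of \<open>Q\<close>, so plain Lebesgue measure is invariant, and no measure on a unit
  tangent bundle has to be constructed. Since the hyperplane itself is a null set, it is thickened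
  to the slab where the second coordinate is less than 1 in absolute value.

  Recurrence, the closedness of the preimage of the hypersurface and the infinite volume of a
  half-space all rest on one inequality: a set whose translates under a countable measure-preserving
  group are disjoint is no larger than a set meeting every orbit through it.\<close>

definition hpoly :: "nat \<Rightarrow> ('a::real_normed_vector \<Rightarrow> real) \<Rightarrow> bool" where
  "hpoly k f \<longleftrightarrow> real_polynomial_function f \<and> (\<forall>c x. f (c *\<^sub>R x) = c ^ k * f x)"

lemma homogeneous_polynomial_function_iff_hpoly:
  "homogeneous_polynomial_function f \<longleftrightarrow> (\<exists>k. hpoly k f)"
  by (auto simp: homogeneous_polynomial_function_def hpoly_def)

text \<open>Derivative of \<open>f\<close> along the vector field \<open>V\<close>. Three kinds of
  fields occur: linear ones preserve the degree of a form, constant ones lower it by one, and the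
  identity is the Euler field.\<close>

definition Dv :: "('a::real_normed_vector \<Rightarrow> 'a) \<Rightarrow> ('a \<Rightarrow> real) \<Rightarrow> 'a \<Rightarrow> real" where
  "Dv V f x = frechet_derivative f (at x) (V x)"

lemma real_polynomial_function_differentiable:
  "real_polynomial_function f \<Longrightarrow> f differentiable (at x)"
  by (simp add: differentiable_at_real_polynomial_function)

lemma real_polynomial_function_has_derivative:
  "real_polynomial_function f \<Longrightarrow> (f has_derivative frechet_derivative f (at x)) (at x)"
  by (simp add: frechet_derivative_works[symmetric] real_polynomial_function_differentiable)

lemma Dv_eqI: "(f has_derivative f') (at x) \<Longrightarrow> Dv V f x = f' (V x)"
  unfolding Dv_def by (metis frechet_derivative_at)

lemma Dv_bounded_linear: "bounded_linear f \<Longrightarrow> Dv V f = (\<lambda>x. f (V x))"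
  by (rule ext, rule Dv_eqI) (rule bounded_linear_imp_has_derivative)

lemma Dv_const: "Dv V (\<lambda>x. c) = (\<lambda>x. 0)"
  by (rule ext, subst Dv_eqI[OF has_derivative_const]) simp

lemma Dv_add:
  assumes "real_polynomial_function f" "real_polynomial_function g"
  shows "Dv V (\<lambda>x. f x + g x) = (\<lambda>x. Dv V f x + Dv V g x)"
  by (rule ext, subst Dv_eqI[OF has_derivative_add])
    (use assms in \<open>auto intro!: real_polynomial_function_has_derivative simp: Dv_def\<close>)

lemma Dv_mult:
  assumes "real_polynomial_function f" "real_polynomial_function g"
  shows "Dv V (\<lambda>x. f x * g x) = (\<lambda>x. f x * Dv V g x + Dv V f x * g x)"
  by (rule ext, subst Dv_eqI[OF has_derivative_mult])
    (use assms in \<open>auto intro!: real_polynomial_function_has_derivative simp: Dv_def\<close>)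

lemma real_polynomial_function_Dv:
  assumes "real_polynomial_function f" "polynomial_function V"
  shows "real_polynomial_function (Dv V f)"
  using assms(1)
proof induction
  case (linear f)
  then have "real_polynomial_function (f \<circ> V)"
    using assms(2) by (auto simp: polynomial_function_def)
  with linear show ?case by (simp add: Dv_bounded_linear o_def)
qed (auto simp: Dv_const Dv_add Dv_mult)

lemma linear_frechet_derivative_poly:
  "real_polynomial_function f \<Longrightarrow> linear (frechet_derivative f (at x))"
  by (meson has_derivative_linear real_polynomial_function_has_derivative)

lemma Dv_compose_linear:
  assumes "real_polynomial_function f" "bounded_linear L"
  shows "Dv V (\<lambda>x. f (L x)) x = frechet_derivative f (at (L x)) (L (V x))"
  using has_derivative_compose[OF bounded_linear_imp_has_derivative[OF assms(2)]
      real_polynomial_function_has_derivative[OF assms(1)]]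
  by (rule Dv_eqI)

lemma polynomial_function_linear: "bounded_linear V \<Longrightarrow> polynomial_function V"
  by (rule polynomial_function_bounded_linear)

lemma real_polynomial_function_compose_linear:
  "real_polynomial_function f \<Longrightarrow> bounded_linear L \<Longrightarrow> real_polynomial_function (\<lambda>x. f (L x))"
  using real_polynomial_function_compose[OF polynomial_function_linear] by (force simp: o_def)

lemma hpoly_compose_linear:
  assumes "hpoly k f" "bounded_linear L"
  shows "hpoly k (\<lambda>x. f (L x))"
  using assms by (auto simp: hpoly_def real_polynomial_function_compose_linear
      linear_cmul bounded_linear.linear)

lemma Dv_homogeneous:
  assumes "hpoly k f" "c \<noteq> 0"
  shows "c * frechet_derivative f (at (c *\<^sub>R x)) v = c ^ k * frechet_derivative f (at x) v"
proof -
  have p: "real_polynomial_function f" and h: "\<And>c x. f (c *\<^sub>R x) = c ^ k * f x"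
    using assms(1) by (auto simp: hpoly_def)
  have "Dv (\<lambda>_. v) (\<lambda>x. f (c *\<^sub>R x)) x = frechet_derivative f (at (c *\<^sub>R x)) (c *\<^sub>R v)"
    by (rule Dv_compose_linear[OF p bounded_linear_scaleR_right])
  moreover have "Dv (\<lambda>_. v) (\<lambda>x. f (c *\<^sub>R x)) x = c ^ k * frechet_derivative f (at x) v"
    unfolding h by (rule Dv_eqI)
      (intro has_derivative_mult_right real_polynomial_function_has_derivative p)
  ultimately show ?thesis
    by (simp add: linear_cmul linear_frechet_derivative_poly p)
qed

lemma hpoly_Dv_linear:
  fixes f :: "'a::euclidean_space \<Rightarrow> real"
  assumes f: "hpoly k f" and V: "bounded_linear V"
  shows "hpoly k (Dv V f)"
proof -
  have p: "real_polynomial_function f" using f by (simp add: hpoly_def)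
  have "Dv V f (c *\<^sub>R x) = c ^ k * Dv V f x" for c x
  proof (cases "c = 0")
    case False
    then show ?thesis
      using Dv_homogeneous[OF f False, of x "V x"]
      by (simp add: Dv_def linear_cmul bounded_linear.linear[OF V] linear_frechet_derivative_poly p)
  next
    case True
    show ?thesis
    proof (cases k)
      case 0
      have "f y = f x" for y x
        using f[unfolded hpoly_def, THEN conjunct2, rule_format, of 0] 0
        by (metis mult_1 power_0 scale_zero_left)
      then have "f = (\<lambda>_. f 0)" by auto
      then have "Dv V f = (\<lambda>_. 0)" by (metis Dv_const)
      then show ?thesis by simp
    next
      case (Suc j)
      with True show ?thesis
        by (simp add: Dv_def linear_0 bounded_linear.linear[OF V] linear_frechet_derivative_poly p)
    qed
  qed
  then show ?thesis
    using p V by (auto simp: hpoly_def intro!: real_polynomial_function_Dv polynomial_function_linear)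
qed

lemma hpoly_Dv_const:
  fixes f :: "'a::euclidean_space \<Rightarrow> real"
  assumes f: "hpoly (Suc k) f"
  shows "hpoly k (Dv (\<lambda>_. v) f)"
proof -
  have p: "real_polynomial_function f" using f by (simp add: hpoly_def)
  then have q: "real_polynomial_function (Dv (\<lambda>_. v) f)"
    by (rule real_polynomial_function_Dv) (auto simp: polynomial_function_const)
  have nz: "Dv (\<lambda>_. v) f (c *\<^sub>R x) = c ^ k * Dv (\<lambda>_. v) f x" if "c \<noteq> 0" for c x
    using Dv_homogeneous[OF f that, of x v] that by (simp add: Dv_def)
  have "Dv (\<lambda>_. v) f (c *\<^sub>R x) = c ^ k * Dv (\<lambda>_. v) f x" for c x
  proof (cases "c = 0")
    \<comment> \<open>For \<open>c = 0\<close> the factor \<open>c\<close> in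
      \<open>Dv_homogeneous\<close> cannot be cancelled; the identity extends to this case by
      continuity.\<close>
    case True
    have cont: "isCont (Dv (\<lambda>_. v) f) y" for y
      using q continuous_real_polymonial_function by blast
    have "((\<lambda>c. Dv (\<lambda>_. v) f (c *\<^sub>R x)) \<longlongrightarrow> Dv (\<lambda>_. v) f (0 *\<^sub>R x)) (at 0)"
      by (intro isCont_tendsto_compose[OF cont] tendsto_intros)
    moreover have "((\<lambda>c. c ^ k * Dv (\<lambda>_. v) f x) \<longlongrightarrow> 0 ^ k * Dv (\<lambda>_. v) f x) (at 0)"
      by (intro tendsto_intros)
    then have "((\<lambda>c. Dv (\<lambda>_. v) f (c *\<^sub>R x)) \<longlongrightarrow> 0 ^ k * Dv (\<lambda>_. v) f x) (at 0)"
      by (rule Lim_transform_eventually) (auto simp: eventually_at_filter nz)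
    ultimately show ?thesis using True by (metis LIM_unique)
  qed (simp add: nz)
  with q show ?thesis by (auto simp: hpoly_def)
qed

lemma Dv_euler:
  assumes f: "hpoly k f"
  shows "Dv (\<lambda>x. x) f x = real k * f x"
proof -
  have p: "real_polynomial_function f" and h: "\<And>c x. f (c *\<^sub>R x) = c ^ k * f x"
    using assms(1) by (auto simp: hpoly_def)
  have "((\<lambda>c. f (c *\<^sub>R x)) has_derivative (\<lambda>c. frechet_derivative f (at (1 *\<^sub>R x)) (c *\<^sub>R x))) (at 1)"
    by (rule has_derivative_compose[OF _ real_polynomial_function_has_derivative[OF p]])
      (auto intro!: derivative_eq_intros)
  moreover have "((\<lambda>c. f (c *\<^sub>R x)) has_derivative (\<lambda>c. real k * c * f x)) (at 1)"
    unfolding h by (auto intro!: derivative_eq_intros)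
  ultimately have "(\<lambda>c. frechet_derivative f (at (1 *\<^sub>R x)) (c *\<^sub>R x)) = (\<lambda>c. real k * c * f x)"
    by (rule has_derivative_unique)
  from fun_cong[OF this, of 1] show ?thesis by (simp add: Dv_def)
qed

text \<open>Both sides are derivations in \<open>f\<close>, so that it suffices to check linear
  \<open>f\<close>. There the derivative along \<open>V\<close> of \<open>f (W x)\<close> is
  \<open>f (W (V x))\<close>, which explains the order on the right.\<close>

lemma Dv_commutator:
  fixes f :: "'a::euclidean_space \<Rightarrow> real"
  assumes f: "real_polynomial_function f" and V: "bounded_linear V" and W: "bounded_linear W"
  shows "Dv V (Dv W f) x - Dv W (Dv V f) x = Dv (\<lambda>x. W (V x) - V (W x)) f x"
  using f
proof (induction arbitrary: x)
  case (linear f)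
  then have "bounded_linear (\<lambda>x. f (V x))" "bounded_linear (\<lambda>x. f (W x))"
    using V W by (auto intro: bounded_linear_compose)
  then show ?case
    using linear by (simp add: Dv_bounded_linear linear_diff bounded_linear.linear)
next
  case (const c)
  then show ?case by (simp add: Dv_const)
next
  case (add f g)
  have "real_polynomial_function (Dv U h)" if "real_polynomial_function h" "U = V \<or> U = W" for h U
    using that V W by (auto intro!: real_polynomial_function_Dv polynomial_function_linear)
  with add show ?case
    by (simp add: Dv_add algebra_simps)
next
  case (mult f g)
  have "real_polynomial_function (Dv U h)" if "real_polynomial_function h" "U = V \<or> U = W" for h U
    using that V W by (auto intro!: real_polynomial_function_Dv polynomial_function_linear)
  note [simp] = this
  have "Dv V (Dv W (\<lambda>x. f x * g x)) x - Dv W (Dv V (\<lambda>x. f x * g x)) x =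
      f x * (Dv V (Dv W g) x - Dv W (Dv V g) x) + (Dv V (Dv W f) x - Dv W (Dv V f) x) * g x"
    using mult by (simp add: Dv_add Dv_mult real_polynomial_function.intros(4) algebra_simps)
  with mult show ?case by (simp add: Dv_mult)
qed

lemma hpoly_0_const: "hpoly 0 f \<Longrightarrow> f x = f y"
  unfolding hpoly_def by (metis mult_1 power_0 scale_zero_left)

section \<open>The Lie algebra of a group of matrices\<close>

definition vanishing :: "(real^'n^'n) set \<Rightarrow> nat \<Rightarrow> (real^'n^'n \<Rightarrow> real) set" where
  "vanishing G k = {f. hpoly k f \<and> (\<forall>A\<in>G. f A = 0)}"

definition matrix_group :: "(real^'n^'n) set \<Rightarrow> bool" where
  "matrix_group G \<longleftrightarrow> mat 1 \<in> G \<and> (\<forall>A\<in>G. \<forall>B\<in>G. A ** B \<in> G) \<and>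
     (\<forall>A\<in>G. \<exists>B\<in>G. A ** B = mat 1 \<and> B ** A = mat 1)"

text \<open>The Lie algebra of the Zariski closure of the cone over \<open>G\<close>, if \<open>G\<close> is a group.\<close>

definition tangent_algebra :: "(real^'n^'n) set \<Rightarrow> (real^'n^'n) set" where
  "tangent_algebra G =
     {X. \<forall>k. \<forall>f\<in>vanishing G k. \<forall>A\<in>G. frechet_derivative f (at A) (X ** A) = 0}"

lemma matrix_add_rdistrib: "(B + C) ** A = B ** A + C ** (A::real^'n^'n)"
  and matrix_diff_rdistrib: "(B - C) ** A = B ** A - C ** (A::real^'n^'n)"
  and matrix_diff_ldistrib: "A ** (B - C) = A ** B - (A::real^'n^'n) ** C"
  by (simp_all add: matrix_matrix_mult_def vec_eq_iff sum.distrib sum_subtractf algebra_simps)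

lemma matrix_scaleR_left: "(c *\<^sub>R A) ** B = c *\<^sub>R (A ** (B::real^'n^'n))"
  and matrix_scaleR_right: "A ** (c *\<^sub>R B) = c *\<^sub>R (A ** (B::real^'n^'n))"
  by (simp_all add: matrix_matrix_mult_def vec_eq_iff sum_distrib_left algebra_simps)

lemma bounded_linear_matrix_mult_left: "bounded_linear (\<lambda>A::real^'n^'n. X ** A)"
  and bounded_linear_matrix_mult_right: "bounded_linear (\<lambda>A::real^'n^'n. A ** X)"
  by (auto intro!: linear_conv_bounded_linear[THEN iffD1] simp: linear_iff matrix_add_ldistrib
      matrix_add_rdistrib matrix_scaleR_left matrix_scaleR_right)

lemma vanishing_hpoly: "f \<in> vanishing G k \<Longrightarrow> hpoly k f"
  and vanishing_poly: "f \<in> vanishing G k \<Longrightarrow> real_polynomial_function f"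
  and vanishing_zero: "f \<in> vanishing G k \<Longrightarrow> A \<in> G \<Longrightarrow> f A = 0"
  by (auto simp: vanishing_def hpoly_def)

lemma vanishing_Dv:
  assumes "X \<in> tangent_algebra G" "f \<in> vanishing G k"
  shows "Dv (\<lambda>A. X ** A) f \<in> vanishing G k"
proof -
  have "hpoly k (Dv (\<lambda>A. X ** A) f)"
    by (rule hpoly_Dv_linear[OF vanishing_hpoly[OF assms(2)] bounded_linear_matrix_mult_left])
  with assms show ?thesis by (auto simp: vanishing_def tangent_algebra_def Dv_def)
qed

lemma vanishing_left_mult:
  assumes "matrix_group G" "B \<in> G" "f \<in> vanishing G k"
  shows "(\<lambda>A. f (B ** A)) \<in> vanishing G k"
  using assms hpoly_compose_linear[OF vanishing_hpoly bounded_linear_matrix_mult_left]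
  by (auto simp: vanishing_def matrix_group_def)

lemma subspace_tangent_algebra: "subspace (tangent_algebra G)"
  unfolding subspace_def tangent_algebra_def
  by (auto simp: matrix_add_rdistrib matrix_scaleR_left linear_0 linear_add linear_cmul
      linear_frechet_derivative_poly vanishing_poly)

lemma mat_1_in_tangent_algebra: "mat 1 \<in> tangent_algebra G"
proof -
  have "frechet_derivative f (at A) A = 0" if "f \<in> vanishing G k" "A \<in> G" for f k A
    using Dv_euler[OF vanishing_hpoly[OF that(1)], of A] vanishing_zero[OF that] by (simp add: Dv_def)
  then show ?thesis by (auto simp: tangent_algebra_def matrix_mul_lid)
qed

lemma tangent_algebra_bracket:
  assumes "X \<in> tangent_algebra G" "Y \<in> tangent_algebra G"
  shows "X ** Y - Y ** X \<in> tangent_algebra G"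
  unfolding tangent_algebra_def
proof clarify
  fix k f A assume f: "f \<in> vanishing G k" and A: "A \<in> G"
  have "Dv (\<lambda>A. Y ** A) (Dv (\<lambda>A. X ** A) f) A - Dv (\<lambda>A. X ** A) (Dv (\<lambda>A. Y ** A) f) A = 0"
    using vanishing_zero[OF vanishing_Dv[OF assms(1) vanishing_Dv[OF assms(2) f]] A]
      vanishing_zero[OF vanishing_Dv[OF assms(2) vanishing_Dv[OF assms(1) f]] A] by simp
  then have "Dv (\<lambda>A. X ** (Y ** A) - Y ** (X ** A)) f A = 0"
    using Dv_commutator[OF vanishing_poly[OF f] bounded_linear_matrix_mult_left
        bounded_linear_matrix_mult_left, of Y X A] by simp
  moreover have "X ** (Y ** A) - Y ** (X ** A) = (X ** Y - Y ** X) ** A"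
    by (simp add: matrix_diff_rdistrib matrix_mul_assoc)
  ultimately show "frechet_derivative f (at A) ((X ** Y - Y ** X) ** A) = 0"
    by (simp add: Dv_def)
qed

text \<open>Precomposition with a conjugation maps forms to forms of the same degree.
  \<open>B\<close> is any invertible matrix: the lemma is applied to \<open>c_mat t\<close> and to
  isometries that are not known to lie in the cone over the bent group.\<close>

lemma tangent_algebra_conj:
  fixes G :: "(real^'n^'n) set" and B B' :: "real^'n^'n"
  assumes B: "B ** B' = mat 1" "B' ** B = mat 1"
    and X: "B ** X ** B' \<in> tangent_algebra ((\<lambda>A. B ** A ** B') ` G)"
  shows "X \<in> tangent_algebra G"
  unfolding tangent_algebra_def
proof clarify
  fix k f A assume f: "f \<in> vanishing G k" and A: "A \<in> G"
  let ?L = "\<lambda>A. B' ** A ** B"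
  have L: "bounded_linear ?L"
    using bounded_linear_compose[OF bounded_linear_matrix_mult_right[of B]
        bounded_linear_matrix_mult_left[of B']] by (simp add: o_def)
  have LL: "?L (B ** A ** B') = A" for A
  proof -
    have "?L (B ** A ** B') = (B' ** B) ** A ** (B' ** B)" by (simp add: matrix_mul_assoc)
    then show ?thesis by (simp add: B matrix_mul_lid matrix_mul_rid)
  qed
  have "(\<lambda>A. f (?L A)) \<in> vanishing ((\<lambda>A. B ** A ** B') ` G) k"
    using hpoly_compose_linear[OF vanishing_hpoly[OF f] L] f by (auto simp: vanishing_def LL)
  with X A have "Dv (\<lambda>C. B ** X ** B' ** C) (\<lambda>A. f (?L A)) (B ** A ** B') = 0"
    by (auto simp: tangent_algebra_def Dv_def)
  then have "frechet_derivative f (at A) (?L (B ** X ** B' ** (B ** A ** B'))) = 0"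
    by (simp add: Dv_compose_linear[OF vanishing_poly[OF f] L] LL)
  moreover have "B ** X ** B' ** (B ** A ** B') = B ** (X ** A) ** B'"
    by (metis B(2) matrix_mul_assoc matrix_mul_lid)
  ultimately show "frechet_derivative f (at A) (X ** A) = 0"
    by (simp only: LL)
qed

lemma matrix_group_conj_id:
  assumes G: "matrix_group G" and "B \<in> G" "B ** B' = mat 1" "B' ** B = mat 1"
  shows "(\<lambda>A. B ** A ** B') ` G = G"
proof -
  obtain C where "C \<in> G" "B ** C = mat 1" "C ** B = mat 1"
    using assms by (auto simp: matrix_group_def)
  then have B': "B' \<in> G" using assms(3,4) by (metis matrix_mul_assoc matrix_mul_lid matrix_mul_rid)
  have "A = B ** (B' ** A ** B) ** B'" for A
    by (metis assms(3) matrix_mul_assoc matrix_mul_lid matrix_mul_rid)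
  moreover have "B ** A ** B' \<in> G" "B' ** A ** B \<in> G" if "A \<in> G" for A
    using that B' assms(2) G by (auto simp: matrix_group_def)
  ultimately show ?thesis by (auto simp: image_iff)
qed

lemma tangent_algebra_Ad:
  assumes G: "matrix_group G" and B: "B \<in> G" "B ** B' = mat 1" "B' ** B = mat 1"
    and X: "X \<in> tangent_algebra G"
  shows "B ** X ** B' \<in> tangent_algebra G"
proof (rule tangent_algebra_conj[OF B(3,2)])
  obtain C where "C \<in> G" "B ** C = mat 1" "C ** B = mat 1"
    using assms by (auto simp: matrix_group_def)
  then have B': "B' \<in> G" using B by (metis matrix_mul_assoc matrix_mul_lid matrix_mul_rid)
  have "B' ** (B ** X ** B') ** B = X"
    by (metis B(3) matrix_mul_assoc matrix_mul_lid matrix_mul_rid)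
  then show "B' ** (B ** X ** B') ** B \<in> tangent_algebra ((\<lambda>A. B' ** A ** B) ` G)"
    using X matrix_group_conj_id[OF G B' B(3,2)] by simp
qed

lemma vanishing_trivial:
  assumes G: "matrix_group G" and T: "tangent_algebra G = UNIV"
  shows "f \<in> vanishing G k \<Longrightarrow> f = (\<lambda>_. 0)"
proof (induction k arbitrary: f)
  case 0
  then have "f A = f (mat 1)" for A using hpoly_0_const[OF vanishing_hpoly[OF 0], of A] by simp
  moreover have "f (mat 1) = 0"
    using vanishing_zero[OF 0] G by (auto simp: matrix_group_def)
  ultimately show ?case by auto
next
  case (Suc k)
  have "Dv (\<lambda>_. V) f \<in> vanishing G k" for V
  proof -
    have "Dv (\<lambda>_. V) f A = 0" if A: "A \<in> G" for A
    proof -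
      obtain B where "B ** A = mat 1" using G A by (auto simp: matrix_group_def)
      \<comment> \<open>Every direction \<open>V\<close> at \<open>A\<close> has the form
        \<open>X ** A\<close>. So all first derivatives of \<open>f\<close> vanish on
        \<open>G\<close>, and the induction hypothesis applies to them.\<close>
      then have "V = (V ** B) ** A" by (metis matrix_mul_assoc matrix_mul_rid)
      moreover have "V ** B \<in> tangent_algebra G" using T by simp
      ultimately show ?thesis using Suc.prems A by (simp add: tangent_algebra_def Dv_def) metis
    qed
    then show ?thesis
      using hpoly_Dv_const[OF vanishing_hpoly[OF Suc.prems]] by (auto simp: vanishing_def)
  qed
  then have "Dv (\<lambda>_. V) f = (\<lambda>_. 0)" for V by (rule Suc.IH)
  then have "Dv (\<lambda>_. A) f A = 0" for A by simp
  then have "Dv (\<lambda>x. x) f A = 0" for A by (simp add: Dv_def)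
  then show ?case
    using Dv_euler[OF vanishing_hpoly[OF Suc.prems]] by auto
qed

section \<open>Determinants of variable size\<close>

text \<open>The size will be the dimension of a space of forms, which changes with the degree; hence
  it is a number and not an index type.\<close>

definition ndet :: "nat \<Rightarrow> (nat \<Rightarrow> nat \<Rightarrow> real) \<Rightarrow> real" where
  "ndet m F = (\<Sum>p | p permutes {..<m}. of_int (sign p) * (\<Prod>i<m. F i (p i)))"

lemma finite_permutes_less: "finite {p. p permutes {..<m::nat}}"
  by (simp add: finite_permutations)

lemma ndet_permute_rows:
  assumes q: "q permutes {..<m}"
  shows "ndet m (\<lambda>i. F (q i)) = of_int (sign q) * ndet m F"
proof -
  have iq: "inv_into UNIV q permutes {..<m}" using q by (rule permutes_inv)
  have "ndet m (\<lambda>i. F (q i)) = (\<Sum>p | p permutes {..<m}. of_int (sign (p \<circ> q)) * (\<Prod>i<m. F (q i) ((p \<circ> q) i)))"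
    unfolding ndet_def by (rule sum_permutations_compose_right[OF q])
  also have "\<dots> = (\<Sum>p | p permutes {..<m}. of_int (sign q) * (of_int (sign p) * (\<Prod>i<m. F i (p i))))"
  proof (rule sum.cong[OF refl])
    fix p assume "p \<in> {p. p permutes {..<m}}"
    then have p: "p permutes {..<m}" by simp
    have "(\<Prod>i<m. F (q i) ((p \<circ> q) i)) = (\<Prod>i<m. F i (p i))"
      using prod.permute[OF q, of "\<lambda>i. F i (p i)"] by (simp add: o_def)
    moreover have "sign (p \<circ> q) = sign p * sign q"
      using p q by (intro sign_compose permutation_permutes[THEN iffD2]) auto
    ultimately show "of_int (sign (p \<circ> q)) * (\<Prod>i<m. F (q i) ((p \<circ> q) i)) =
      of_int (sign q) * (of_int (sign p) * (\<Prod>i<m. F i (p i)))" by simp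
  qed
  finally show ?thesis by (simp add: ndet_def sum_distrib_left)
qed

lemma ndet_identical_rows:
  assumes "i < m" "j < m" "i \<noteq> j" "F i = F j"
  shows "ndet m F = 0"
proof -
  let ?q = "Transposition.transpose i j"
  have q: "?q permutes {..<m}" using assms by (intro permutes_swap_id) auto
  have "(\<lambda>k. F (?q k)) = F" using assms(4) by (auto simp: Transposition.transpose_def fun_eq_iff)
  with ndet_permute_rows[OF q, of F] assms(3) show ?thesis by (simp add: sign_swap_id)
qed

text \<open>Multilinear expansion in the rows gives a sum over all maps \<open>k\<close> choosing
  rows of \<open>F\<close>. A map that is not injective chooses a row twice and contributes 0; the
  others are permutations and contribute a sign.\<close>

lemma ndet_mult:
  "ndet m (\<lambda>i j. \<Sum>k<m. T i k * F k j) = ndet m T * ndet m F"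
proof -
  let ?P = "{p. p permutes {..<m}}"
  let ?K = "Pi\<^sub>E {..<m} (\<lambda>_. {..<m})"
  have finK: "finite ?K" by (intro finite_PiE) auto
  have "ndet m (\<lambda>i j. \<Sum>k<m. T i k * F k j)
      = (\<Sum>p\<in>?P. of_int (sign p) * (\<Sum>k\<in>?K. \<Prod>i<m. T i (k i) * F (k i) (p i)))"
    unfolding ndet_def by (simp add: prod_sum_PiE)
  also have "\<dots> = (\<Sum>k\<in>?K. (\<Prod>i<m. T i (k i)) * ndet m (\<lambda>i. F (k i)))"
    unfolding ndet_def sum_distrib_left prod.distrib
    by (subst sum.swap) (simp add: algebra_simps)
  \<comment> \<open>Permutations are the identity outside \<open>{..<m}\<close> whereas the members
    of \<open>?K\<close> are undefined there, so the two are matched by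
    \<open>restrict\<close>.\<close>
  also have "\<dots> = (\<Sum>k\<in>(\<lambda>p. restrict p {..<m}) ` ?P. (\<Prod>i<m. T i (k i)) * ndet m (\<lambda>i. F (k i)))"
  proof (rule sum.mono_neutral_right[OF finK])
    show "(\<lambda>p. restrict p {..<m}) ` ?P \<subseteq> ?K"
      using permutes_in_image by fastforce
    show "\<forall>k\<in>?K - (\<lambda>p. restrict p {..<m}) ` ?P. (\<Prod>i<m. T i (k i)) * ndet m (\<lambda>i. F (k i)) = 0"
    proof
      fix k assume k: "k \<in> ?K - (\<lambda>p. restrict p {..<m}) ` ?P"
      have "\<not> inj_on k {..<m}"
      proof
        assume inj: "inj_on k {..<m}"
        have "k ` {..<m} \<subseteq> {..<m}" using k by (auto simp: PiE_def)
        then have "k ` {..<m} = {..<m}"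
          by (intro card_subset_eq) (simp_all add: card_image[OF inj])
        then have "bij_betw k {..<m} {..<m}" using inj by (auto simp: bij_betw_def)
        then have "(\<lambda>i. if i \<in> {..<m} then k i else i) permutes {..<m}"
          using bij_betw_cong[of "{..<m}" k "\<lambda>i. if i \<in> {..<m} then k i else i" "{..<m}"]
          by (intro bij_imp_permutes) simp_all
        moreover have "k = restrict (\<lambda>i. if i \<in> {..<m} then k i else i) {..<m}"
          using k by (auto simp: fun_eq_iff PiE_def extensional_def)
        ultimately show False using k by blast
      qed
      then obtain i j where "i < m" "j < m" "i \<noteq> j" "k i = k j" by (auto simp: inj_on_def)
      then have "ndet m (\<lambda>i. F (k i)) = 0" by (intro ndet_identical_rows[of i m j]) auto
      then show "(\<Prod>i<m. T i (k i)) * ndet m (\<lambda>i. F (k i)) = 0" by simp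
    qed
  qed
  also have "\<dots> = (\<Sum>p\<in>?P. (\<Prod>i<m. T i (p i)) * ndet m (\<lambda>i. F (p i)))"
  proof -
    have "inj_on (\<lambda>p. restrict p {..<m}) ?P"
    proof (rule inj_onI)
      fix p q assume *: "p \<in> ?P" "q \<in> ?P" "restrict p {..<m} = restrict q {..<m}"
      have "p i = q i" for i
      proof (cases "i < m")
        case True
        then show ?thesis using fun_cong[OF *(3), of i] by simp
      next
        case False
        then show ?thesis using *(1,2) by (auto simp: permutes_def)
      qed
      then show "p = q" by auto
    qed
    moreover have "ndet m (\<lambda>i. F (if i < m then p i else undefined)) = ndet m (\<lambda>i. F (p i))" for p
      by (auto simp: ndet_def intro!: sum.cong prod.cong)
    ultimately show ?thesis by (simp add: sum.reindex restrict_def)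
  qed
  also have "\<dots> = (\<Sum>p\<in>?P. (of_int (sign p) * (\<Prod>i<m. T i (p i))) * ndet m F)"
    by (intro sum.cong) (auto simp: ndet_permute_rows)
  also have "\<dots> = ndet m T * ndet m F"
    by (simp add: ndet_def[of m T] sum_distrib_right)
  finally show ?thesis .
qed

lemma ndet_zero_column:
  assumes "j < m" "\<And>i. i < m \<Longrightarrow> F i j = 0"
  shows "ndet m F = 0"
  unfolding ndet_def
proof (rule sum.neutral, safe)
  fix p assume p: "p permutes {..<m}"
  then have "inv_into UNIV p j < m" "p (inv_into UNIV p j) = j"
    using assms(1) permutes_in_image[OF permutes_inv[OF p], of j] by (auto simp: permutes_inverses)
  then have "\<exists>i\<in>{..<m}. F i (p i) = 0"
    using assms(2) by (intro bexI[of _ "inv_into UNIV p j"]) auto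
  then show "of_int (sign p) * (\<Prod>i<m. F i (p i)) = 0" by (simp add: prod_zero_iff)
qed

text \<open>A permutation \<open>p\<close> with nonzero product has \<open>p i = i\<close> whenever
  \<open>p i \<noteq> j\<close>, and then injectivity makes it the identity.\<close>

lemma ndet_unit_columns:
  assumes j: "j < m" and F: "\<And>i k. i < m \<Longrightarrow> k < m \<Longrightarrow> k \<noteq> j \<Longrightarrow> F i k = (if i = k then 1 else 0)"
  shows "ndet m F = F j j"
proof -
  have "ndet m F = (\<Sum>p\<in>{id}. of_int (sign p) * (\<Prod>i<m. F i (p i)))"
    unfolding ndet_def
  proof (rule sum.mono_neutral_right[OF finite_permutes_less])
    show "{id} \<subseteq> {p. p permutes {..<m}}" by (auto simp: permutes_id)
    show "\<forall>p\<in>{p. p permutes {..<m}} - {id}. of_int (sign p) * (\<Prod>i<m. F i (p i)) = 0"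
    proof (intro ballI, rule ccontr)
      fix p assume "p \<in> {p. p permutes {..<m}} - {id}"
        and nz: "of_int (sign p) * (\<Prod>i<m. F i (p i)) \<noteq> 0"
      then have p: "p permutes {..<m}" and np: "p \<noteq> id" by auto
      have eq: "p i = i" if "i < m" "p i \<noteq> j" for i
      proof -
        have "p i < m" using p that(1) permutes_in_image[OF p] by force
        with that F[of i "p i"] nz show ?thesis by (auto split: if_splits)
      qed
      have "p i = i" for i
      proof (cases "i < m \<and> p i = j \<and> i \<noteq> j")
        case True
        have "p j \<noteq> j" using True permutes_inj[OF p] by (metis injD)
        then have "p j = j" using eq j by auto
        with \<open>p j \<noteq> j\<close> show ?thesis by simp
      next
        case False
        then show ?thesis using eq p by (cases "i < m") (auto simp: permutes_def)
      qed
      with np show False by (auto simp: fun_eq_iff)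
    qed
  qed
  also have "\<dots> = F j j"
  proof -
    have "(\<Prod>i<m. F i i) = (\<Prod>i<m. if i = j then F j j else 1)"
      using F by (intro prod.cong) auto
    also have "\<dots> = F j j" using j by simp
    finally show ?thesis by simp
  qed
  finally show ?thesis .
qed

section \<open>Finite-dimensional spaces of functions\<close>

definition fspan :: "('a \<Rightarrow> real) set \<Rightarrow> ('a \<Rightarrow> real) set" where
  "fspan E = {f. \<exists>c. f = (\<lambda>x. \<Sum>e\<in>E. c e * e x)}"

lemma fspan_base: "finite E \<Longrightarrow> e \<in> E \<Longrightarrow> e \<in> fspan E"
  unfolding fspan_def
    by (auto intro!: exI[of _ "\<lambda>g. if g = e then 1 else 0"] simp: if_distrib[of "\<lambda>c. c * _"] cong: if_cong)

lemma fspan_add: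
  assumes "f \<in> fspan E" "g \<in> fspan E" shows "(\<lambda>x. f x + g x) \<in> fspan E"
proof -
  obtain c d where "f = (\<lambda>x. \<Sum>e\<in>E. c e * e x)" "g = (\<lambda>x. \<Sum>e\<in>E. d e * e x)"
    using assms by (auto simp: fspan_def)
  then have "(\<lambda>x. f x + g x) = (\<lambda>x. \<Sum>e\<in>E. (c e + d e) * e x)"
    by (simp add: algebra_simps sum.distrib)
  then show ?thesis by (auto simp: fspan_def)
qed

lemma fspan_scale:
  assumes "f \<in> fspan E" shows "(\<lambda>x. r * f x) \<in> fspan E"
proof -
  obtain c where "f = (\<lambda>x. \<Sum>e\<in>E. c e * e x)" using assms by (auto simp: fspan_def)
  then have "(\<lambda>x. r * f x) = (\<lambda>x. \<Sum>e\<in>E. (r * c e) * e x)"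
    by (simp add: algebra_simps sum_distrib_left)
  then show ?thesis by (auto simp: fspan_def)
qed

lemma fspan_zero: "(\<lambda>x. 0) \<in> fspan E"
  unfolding fspan_def by (auto intro!: exI[of _ "\<lambda>_. 0"])

lemma fspan_sum:
  "finite I \<Longrightarrow> (\<And>i. i \<in> I \<Longrightarrow> (\<lambda>x. f i x) \<in> fspan E) \<Longrightarrow> (\<lambda>x. \<Sum>i\<in>I. f i x) \<in> fspan E"
proof (induction I rule: finite_induct)
  case empty
  then show ?case by (simp add: fspan_zero)
next
  case (insert i I)
  then show ?case using fspan_add[of "f i" E "\<lambda>x. \<Sum>i\<in>I. f i x"] by simp
qed

text \<open>By Euler's identity a form of degree \<open>Suc k\<close> is a combination of the
  coordinates times its partial derivatives, which are forms of degree \<open>k\<close>.\<close>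

lemma hpoly_finite_dim:
  "\<exists>E :: ('a::euclidean_space \<Rightarrow> real) set. finite E \<and> {f. hpoly k f} \<subseteq> fspan E"
proof (induction k)
  case 0
  have "f \<in> fspan {\<lambda>_. 1}" if "hpoly 0 f" for f :: "'a \<Rightarrow> real"
  proof -
    have "f = (\<lambda>x. f 0 * 1)" using hpoly_0_const[OF that] by auto
    also have "\<dots> \<in> fspan {\<lambda>_. 1}" by (intro fspan_scale fspan_base) auto
    finally show ?thesis .
  qed
  then show ?case by (intro exI[of _ "{\<lambda>_. 1}"]) auto
next
  case (Suc k)
  then obtain E :: "('a \<Rightarrow> real) set" where E: "finite E" "{f. hpoly k f} \<subseteq> fspan E"
    by blast
  let ?E = "(\<lambda>(b, e) x. (x \<bullet> b) * e x) ` (Basis \<times> E)"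
  have fin: "finite ?E" using E by simp
  have "f \<in> fspan ?E" if f: "hpoly (Suc k) f" for f
  proof -
    have p: "real_polynomial_function f" using f by (simp add: hpoly_def)
    have "Dv (\<lambda>x. x) f x = (\<Sum>b\<in>Basis. (x \<bullet> b) * Dv (\<lambda>_. b) f x)" for x
      using linear_sum[OF linear_frechet_derivative_poly[OF p], of x "\<lambda>b. (x \<bullet> b) *\<^sub>R b" Basis]
      by (simp add: Dv_def euclidean_representation linear_cmul[OF linear_frechet_derivative_poly[OF p]])
    then have eq: "f = (\<lambda>x. (1 / real (Suc k)) * (\<Sum>b\<in>Basis. (x \<bullet> b) * Dv (\<lambda>_. b) f x))"
      using Dv_euler[OF f] by (auto simp: fun_eq_iff field_simps)
    have "(\<lambda>x. (x \<bullet> b) * Dv (\<lambda>_. b) f x) \<in> fspan ?E" if b: "b \<in> Basis" for b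
    proof -
      have "Dv (\<lambda>_. b) f \<in> fspan E" using hpoly_Dv_const[OF f] E by auto
      then obtain c where "Dv (\<lambda>_. b) f = (\<lambda>x. \<Sum>e\<in>E. c e * e x)"
        by (auto simp: fspan_def)
      then have "(\<lambda>x. (x \<bullet> b) * Dv (\<lambda>_. b) f x) = (\<lambda>x. \<Sum>e\<in>E. c e * ((x \<bullet> b) * e x))"
        by (simp add: sum_distrib_left algebra_simps)
      also have "\<dots> \<in> fspan ?E"
        using b E fin by (intro fspan_sum fspan_scale fspan_base) auto
      finally show ?thesis .
    qed
    then show ?thesis by (subst eq) (intro fspan_scale fspan_sum finite_Basis)
  qed
  with fin show ?case by blast
qed

text \<open>Every finite-dimensional space of functions has a basis dual to the evaluation at finitely many
  points.\<close>

lemma interpolation_basis: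
  assumes "finite E" and "I \<subseteq> fspan E"
    and "(\<lambda>_. 0) \<in> I"
    and "\<And>f g. f \<in> I \<Longrightarrow> g \<in> I \<Longrightarrow> (\<lambda>x. f x + g x) \<in> I"
    and "\<And>f r. f \<in> I \<Longrightarrow> (\<lambda>x. r * f x) \<in> I"
  shows "\<exists>(m::nat) f B. (\<forall>a<m. f a \<in> I) \<and> (\<forall>a<m. \<forall>b<m. f a (B b) = (if a = b then 1 else 0)) \<and>
     (\<forall>g\<in>I. \<forall>x. g x = (\<Sum>b<m. g (B b) * f b x))"
  using assms
proof (induction E arbitrary: I rule: finite_induct)
  case empty
  then have "g = (\<lambda>x. 0)" if "g \<in> I" for g using that by (auto simp: fspan_def)
  then show ?case by (intro exI[of _ 0]) auto
next
  case (insert e0 E)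
  let ?I = "I \<inter> fspan E"
  have "\<exists>(m::nat) f B. (\<forall>a<m. f a \<in> ?I) \<and> (\<forall>a<m. \<forall>b<m. f a (B b) = (if a = b then 1 else 0)) \<and>
     (\<forall>g\<in>?I. \<forall>x. g x = (\<Sum>b<m. g (B b) * f b x))"
    by (rule insert.IH) (simp_all add: fspan_zero insert.prems fspan_add fspan_scale)
  then obtain m :: nat and f B where mfB: "\<forall>a<m. f a \<in> ?I"
    "\<forall>a<m. \<forall>b<m. f a (B b) = (if a = b then 1 else 0)"
    "\<forall>g\<in>?I. \<forall>x. g x = (\<Sum>b<m. g (B b) * f b x)" by (elim exE conjE)
  then have f: "\<And>a. a < m \<Longrightarrow> f a \<in> ?I"
    and fB: "\<And>a b. a < m \<Longrightarrow> b < m \<Longrightarrow> f a (B b) = (if a = b then 1 else 0)"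
    and rep: "\<And>g x. g \<in> ?I \<Longrightarrow> g x = (\<Sum>b<m. g (B b) * f b x)"
    by (blast, blast, blast)
  show ?case
  proof (cases "I \<subseteq> fspan E")
    case True
    then have "?I = I" by auto
    then show ?thesis using f fB rep by (intro exI[of _ m] exI[of _ f] exI[of _ B]) auto
  next
    \<comment> \<open>\<open>I\<close> has one dimension more than
      \<open>I \<inter> fspan E\<close>. A function \<open>g1\<close> that is 0 at the old points
      and 1 at a new point \<open>z\<close> is added, and multiples of it are subtracted from the
      old functions to make them vanish at \<open>z\<close>.\<close>
    case False
    note addI = insert.prems(3) and scI = insert.prems(4)
    have sumI: "(\<lambda>x. \<Sum>b\<in>J. c b * f b x) \<in> ?I" if "J \<subseteq> {..<m}" for c J
    proof -
      have "finite J" using that finite_subset by blast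
      then show ?thesis using that
      proof (induction J rule: finite_induct)
        case empty
        then show ?case using insert.prems fspan_zero by auto
      next
        case (insert b J)
        have "(\<lambda>x. c b * f b x) \<in> ?I" using f[of b] insert.prems scI by (auto intro: fspan_scale)
        moreover have "(\<lambda>x. \<Sum>b\<in>J. c b * f b x) \<in> ?I" using insert by auto
        ultimately have "(\<lambda>x. c b * f b x + (\<Sum>b\<in>J. c b * f b x)) \<in> ?I"
          using addI by (auto intro: fspan_add)
        then show ?case using insert by simp
      qed
    qed
    have negI: "(\<lambda>x. g x - h x) \<in> I" if "g \<in> I" "h \<in> I" for g h
      using insert.prems(3)[OF that(1) insert.prems(4)[OF that(2), of "-1"]] by simp
    have negE: "(\<lambda>x. g x - h x) \<in> fspan E" if "g \<in> fspan E" "h \<in> fspan E" for g h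
      using fspan_add[OF that(1) fspan_scale[OF that(2), of "-1"]] by simp
    from False obtain g0 where g0: "g0 \<in> I" "g0 \<notin> fspan E" by auto
    define g where "g = (\<lambda>x. g0 x - (\<Sum>b<m. g0 (B b) * f b x))"
    have gI: "g \<in> I" unfolding g_def using negI g0 sumI[of "{..<m}"] by auto
    have gE: "g \<notin> fspan E"
    proof
      assume "g \<in> fspan E"
      then have "(\<lambda>x. g x + (\<Sum>b<m. g0 (B b) * f b x)) \<in> fspan E"
        using sumI[of "{..<m}"] by (intro fspan_add) auto
      then show False using g0 by (simp add: g_def)
    qed
    have gB: "g (B a) = 0" if "a < m" for a
    proof -
      have "(\<Sum>b<m. g0 (B b) * f b (B a)) = (\<Sum>b<m. if b = a then g0 (B a) else 0)"
        using that by (intro sum.cong) (auto simp: fB)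
      then show ?thesis using that by (simp add: g_def)
    qed
    have "g \<noteq> (\<lambda>x. 0)" using gE fspan_zero by auto
    then obtain z where z: "g z \<noteq> 0" by auto
    define g1 where "g1 = (\<lambda>x. (1 / g z) * g x)"
    have g1: "g1 \<in> I" "g1 z = 1" "\<And>a. a < m \<Longrightarrow> g1 (B a) = 0"
      unfolding g1_def using scI[OF gI, of "1 / g z"] z gB by auto
    define f' where "f' = (\<lambda>a. if a = m then g1 else (\<lambda>x. f a x - f a z * g1 x))"
    define B' where "B' = B(m := z)"
    have f'I: "f' a \<in> I" if "a < Suc m" for a
    proof (cases "a = m")
      case False
      then have "f a \<in> I" using that f[of a] by auto
      then show ?thesis using False negI[OF _ insert.prems(4)[OF g1(1)]] by (auto simp: f'_def)
    qed (simp add: f'_def g1)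
    have f'B: "f' a (B' b) = (if a = b then 1 else 0)" if "a < Suc m" "b < Suc m" for a b
      using that g1 by (auto simp: f'_def B'_def fB less_Suc_eq)
    have "h x = (\<Sum>b<Suc m. h (B' b) * f' b x)" if h: "h \<in> I" for h x
    proof -
      obtain ce where ce: "h = (\<lambda>x. \<Sum>e\<in>insert e0 E. ce e * e x)"
        using h insert.prems(1) by (auto simp: fspan_def)
      obtain cg where cg: "g1 = (\<lambda>x. \<Sum>e\<in>insert e0 E. cg e * e x)"
        using g1 insert.prems(1) by (auto simp: fspan_def)
      have cg0: "cg e0 \<noteq> 0"
      proof
        assume "cg e0 = 0"
        then have "g1 \<in> fspan E" using cg insert.hyps by (auto simp: fspan_def)
        then have "(\<lambda>x. g z * g1 x) \<in> fspan E" by (rule fspan_scale)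
        then show False using gE z by (simp add: g1_def)
      qed
      \<comment> \<open>\<open>r\<close> removes the coefficient of \<open>e0\<close>, which puts
        \<open>h'\<close> into the span of \<open>E\<close>. It exists because \<open>g1\<close> is
        not in that span.\<close>
      define r where "r = ce e0 / cg e0"
      define h' where "h' = (\<lambda>x. h x - r * g1 x)"
      have "h' = (\<lambda>x. \<Sum>e\<in>E. (ce e - r * cg e) * e x)"
        using insert.hyps cg0
        by (simp add: h'_def ce cg fun_eq_iff r_def algebra_simps sum_subtractf sum_distrib_left)
      then have "h' \<in> fspan E" by (auto simp: fspan_def)
      moreover have "h' \<in> I" unfolding h'_def using negI[OF h insert.prems(4)[OF g1(1)]] .
      ultimately have rep': "h' x = (\<Sum>b<m. h' (B b) * f b x)" for x using rep by auto
      have hB: "h' (B b) = h (B b)" if "b < m" for b using that g1 by (simp add: h'_def)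
      have h'z: "h' z = (\<Sum>b<m. h (B b) * f b z)" using rep'[of z] hB by (auto intro!: sum.cong)
      have "(\<Sum>b<Suc m. h (B' b) * f' b x) = (\<Sum>b<m. h (B b) * (f b x - f b z * g1 x)) + h z * g1 x"
        by (auto simp: f'_def B'_def intro!: sum.cong)
      also have "\<dots> = h' x - h' z * g1 x + h z * g1 x"
        using rep'[of x] hB h'z by (simp add: algebra_simps sum_subtractf sum_distrib_left)
      also have "\<dots> = h x" by (simp add: h'_def g1 algebra_simps)
      finally show ?thesis by simp
    qed
    with f'I f'B show ?thesis
      by (intro exI[of _ "Suc m"] exI[of _ f'] exI[of _ B']) auto
  qed
qed

section \<open>Limits of diagonalizable elements\<close>

text \<open>The degree bound is uniform in the curve, so that only finitely many powers of
  \<open>s\<close> occur in all Pluecker coordinates along a quadratic one-parameter group at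
  once.\<close>

lemma real_polynomial_function_quadratic_curve:
  fixes f :: "'a::real_normed_vector \<Rightarrow> real"
  assumes "real_polynomial_function f"
  shows "\<exists>N. \<forall>X Y Z. \<exists>p. degree p \<le> N \<and> (\<forall>s. f (s\<^sup>2 *\<^sub>R X + s *\<^sub>R Y + Z) = poly p s)"
  using assms
proof induction
  case (linear f)
  then have "f (s\<^sup>2 *\<^sub>R X + s *\<^sub>R Y + Z) = poly [:f Z, f Y, f X:] s" for s X Y Z
    by (simp add: linear_add linear_cmul bounded_linear.linear algebra_simps power2_eq_square)
  moreover have "degree [:a, b, c:] \<le> 2" for a b c :: real
    by (simp add: degree_pCons_eq_if)
  ultimately show ?case by (intro exI[of _ 2]) blast
next
  case (const c)
  then show ?case by (intro exI[of _ 0] allI exI[of _ "[:c:]"]) simp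
next
  case (add f g)
  then obtain M N where
    "\<forall>X Y Z. \<exists>p. degree p \<le> M \<and> (\<forall>s. f (s\<^sup>2 *\<^sub>R X + s *\<^sub>R Y + Z) = poly p s)"
    "\<forall>X Y Z. \<exists>p. degree p \<le> N \<and> (\<forall>s. g (s\<^sup>2 *\<^sub>R X + s *\<^sub>R Y + Z) = poly p s)" by blast
  then have "\<exists>p. degree p \<le> max M N \<and> (\<forall>s. f (s\<^sup>2 *\<^sub>R X + s *\<^sub>R Y + Z) + g (s\<^sup>2 *\<^sub>R X + s *\<^sub>R Y + Z) = poly p s)"
    for X Y Z
    by (metis degree_add_le_max max.mono order.trans poly_add)
  then show ?case by blast
next
  case (mult f g)
  then obtain M N where
    "\<forall>X Y Z. \<exists>p. degree p \<le> M \<and> (\<forall>s. f (s\<^sup>2 *\<^sub>R X + s *\<^sub>R Y + Z) = poly p s)"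
    "\<forall>X Y Z. \<exists>p. degree p \<le> N \<and> (\<forall>s. g (s\<^sup>2 *\<^sub>R X + s *\<^sub>R Y + Z) = poly p s)" by blast
  then have "\<exists>p. degree p \<le> M + N \<and> (\<forall>s. f (s\<^sup>2 *\<^sub>R X + s *\<^sub>R Y + Z) * g (s\<^sup>2 *\<^sub>R X + s *\<^sub>R Y + Z) = poly p s)"
    for X Y Z
    by (metis add_mono degree_mult_le order.trans poly_mult)
  then show ?case by blast
qed

lemma poly_over_power_tendsto:
  fixes p :: "real poly"
  assumes "\<And>i. i > j \<Longrightarrow> coeff p i = 0"
  shows "((\<lambda>s. poly p s / s ^ j) \<longlongrightarrow> coeff p j) at_top"
proof -
  have deg: "degree p \<le> j" using assms by (intro degree_le) auto
  have "poly p s = (\<Sum>i\<le>j. coeff p i * s ^ i)" for s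
    unfolding poly_altdef by (rule sum.mono_neutral_left) (use deg le_degree in auto)
  then have eq: "poly p s / s ^ j = (\<Sum>i\<le>j. coeff p i * (s ^ i / s ^ j))" for s
    by (simp add: sum_divide_distrib)
  have "((\<lambda>s. \<Sum>i\<le>j. coeff p i * (s ^ i / s ^ j)) \<longlongrightarrow> (\<Sum>i\<le>j. coeff p i * (if i = j then 1 else 0))) at_top"
  proof (intro tendsto_sum tendsto_mult tendsto_const)
    fix i assume i: "i \<in> {..j}"
    show "((\<lambda>s::real. s ^ i / s ^ j) \<longlongrightarrow> (if i = j then 1 else 0)) at_top"
    proof (cases "i = j")
      case True
      have "eventually (\<lambda>s::real. s ^ i / s ^ j = 1) at_top"
        using eventually_gt_at_top[of 0] by eventually_elim (simp add: True)
      then show ?thesis using True by (simp add: tendsto_eventually)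
    next
      case False
      with i obtain k where k: "j = i + Suc k"
        by (metis atMost_iff less_iff_Suc_add le_neq_implies_less add_Suc_right)
      have "eventually (\<lambda>s::real. inverse s ^ Suc k = s ^ i / s ^ j) at_top"
        using eventually_gt_at_top[of 0] by eventually_elim (simp add: k power_add field_simps)
      moreover have "((\<lambda>s::real. inverse s ^ Suc k) \<longlongrightarrow> 0 ^ Suc k) at_top"
        by (intro tendsto_power tendsto_inverse_0_at_top filterlim_ident)
      ultimately show ?thesis using False by (auto intro: Lim_transform_eventually)
    qed
  qed
  then show ?thesis by (simp add: eq if_distrib[of "\<lambda>x. _ * x"] cong: if_cong)
qed

lemma matrix_inverses_unique:
  fixes A B C :: "real^'n^'n"
  shows "A ** B = mat 1 \<Longrightarrow> B ** C = mat 1 \<Longrightarrow> A = C"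
  by (metis matrix_mul_assoc matrix_mul_lid matrix_mul_rid)

text \<open>Suppose that group elements, multiplied by \<open>b(s)\<close> for large \<open>s\<close>, converge projectively to an
  invertible matrix. Passing to top degree terms in \<open>s\<close>, the limit sees the line spanned by the
  Pluecker coordinates \<open>\<omega>\<close> of the space of vanishing polynomials only through the
  component of top weight, so that \<open>\<omega>\<close> itself is a weight vector of the one-parameter group \<open>b\<close>.\<close>

lemma limit_one_parameter_group_vanishing:
  fixes G :: "(real^'n^'n) set" and P\<^sub>1 P\<^sub>2 P\<^sub>3 :: "real^'n^'n"
  defines "b \<equiv> \<lambda>s::real. s\<^sup>2 *\<^sub>R P\<^sub>1 + s *\<^sub>R P\<^sub>2 + P\<^sub>3"
  assumes G: "matrix_group G"
    and b1: "b 1 = mat 1" and bm: "\<And>s r. b s ** b r = b (s * r)"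
    and \<delta>: "\<And>k. \<delta> k \<in> G" and s: "filterlim s at_top sequentially"
    and lim: "(\<lambda>k. r k *\<^sub>R (\<delta> k ** b (s k))) \<longlonglongrightarrow> M"
    and M: "M ** M' = mat 1" and comm: "\<And>s. M ** b s = b s ** M"
    and f: "f \<in> vanishing G d" and A: "A \<in> G" and t: "t > 0"
  shows "f (b t ** A) = 0"
proof -
  obtain E :: "(real^'n^'n \<Rightarrow> real) set" where E: "finite E" "{f. hpoly d f} \<subseteq> fspan E"
    using hpoly_finite_dim by blast
  have "\<exists>(m::nat) f B. (\<forall>a<m. f a \<in> vanishing G d) \<and> (\<forall>a<m. \<forall>b<m. f a (B b) = (if a = b then 1 else 0)) \<and>
     (\<forall>g\<in>vanishing G d. \<forall>x. g x = (\<Sum>b<m. g (B b) * f b x))"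
  proof (rule interpolation_basis[OF E(1)])
    show "vanishing G d \<subseteq> fspan E" using E(2) by (auto simp: vanishing_def)
    show "(\<lambda>_. 0) \<in> vanishing G d" by (auto simp: vanishing_def hpoly_def)
    show "(\<lambda>x. g x + h x) \<in> vanishing G d"
      if "g \<in> vanishing G d" "h \<in> vanishing G d" for g h
      using that by (auto simp: vanishing_def hpoly_def algebra_simps)
    show "(\<lambda>x. r * g x) \<in> vanishing G d" if "g \<in> vanishing G d" for g r
      using that by (auto simp: vanishing_def hpoly_def)
  qed
  then obtain m :: nat and F B where F0: "\<forall>a<m. F a \<in> vanishing G d"
     "\<forall>a<m. \<forall>b<m. F a (B b) = (if a = b then 1 else 0)"
     "\<forall>g\<in>vanishing G d. \<forall>x. g x = (\<Sum>b<m. g (B b) * F b x)" by (elim exE conjE)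
  then have F: "\<And>a. a < m \<Longrightarrow> F a \<in> vanishing G d"
    and FB: "\<And>a b. a < m \<Longrightarrow> b < m \<Longrightarrow> F a (B b) = (if a = b then 1 else 0)"
    and rep: "\<And>g x. g \<in> vanishing G d \<Longrightarrow> g x = (\<Sum>b<m. g (B b) * F b x)"
    by (blast, blast, blast)
  \<comment> \<open>\<open>\<omega> C\<close> is the Pluecker coordinate of the space of vanishing
    forms at the evaluation points \<open>C\<close>. Left translation by \<open>D \<in> G\<close>
    maps this space to itself, with determinant \<open>\<psi> D\<close>.\<close>
  define \<omega> where "\<omega> C = ndet m (\<lambda>i j. F i (C j))" for C :: "nat \<Rightarrow> real^'n^'n"
  define \<psi> where "\<psi> D = ndet m (\<lambda>i j. F i (D ** B j))" for D
  have \<omega>_group: "\<omega> (\<lambda>j. D ** C j) = \<psi> D * \<omega> C" if "D \<in> G" for D C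
  proof -
    have "F i (D ** x) = (\<Sum>k<m. F i (D ** B k) * F k x)" if "i < m" for i x
      using rep[OF vanishing_left_mult[OF G \<open>D \<in> G\<close> F[OF that]]] .
    then have "\<omega> (\<lambda>j. D ** C j) = ndet m (\<lambda>i j. \<Sum>k<m. F i (D ** B k) * F k (C j))"
      unfolding \<omega>_def ndet_def by (auto intro!: sum.cong prod.cong)
    then show ?thesis by (simp add: ndet_mult \<omega>_def \<psi>_def)
  qed
  have "\<forall>i\<in>{..<m}. \<exists>N. \<forall>X Y Z. \<exists>p. degree p \<le> N \<and> (\<forall>s. F i (s\<^sup>2 *\<^sub>R X + s *\<^sub>R Y + Z) = poly p s)"
    using real_polynomial_function_quadratic_curve vanishing_poly F by blast
  then obtain N where N: "\<And>i X Y Z. i < m \<Longrightarrow> \<exists>p. degree p \<le> N i \<and> (\<forall>s. F i (s\<^sup>2 *\<^sub>R X + s *\<^sub>R Y + Z) = poly p s)"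
    by (metis lessThan_iff)
  have bC: "b s ** C = s\<^sup>2 *\<^sub>R (P\<^sub>1 ** C) + s *\<^sub>R (P\<^sub>2 ** C) + P\<^sub>3 ** C" for s and C :: "real^'n^'n"
    by (simp add: b_def matrix_add_rdistrib matrix_scaleR_left)
  have "\<exists>p. degree p \<le> (\<Sum>i<m. N i) \<and> (\<forall>s. \<omega> (\<lambda>j. b s ** C j) = poly p s)" for C
  proof -
    have "\<exists>p. degree p \<le> N i \<and> (\<forall>s. F i (b s ** C j) = poly p s)" if "i < m" for i j
      unfolding bC using N[OF that] .
    then obtain p where p: "\<And>i j. i < m \<Longrightarrow> degree (p i j) \<le> N i" "\<And>i j s. i < m \<Longrightarrow> F i (b s ** C j) = poly (p i j) s"
      by metis
    let ?q = "\<Sum>\<pi> | \<pi> permutes {..<m}. smult (of_int (sign \<pi>)) (\<Prod>i<m. p i (\<pi> i))"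
    have "degree ?q \<le> (\<Sum>i<m. N i)"
    proof (rule degree_sum_le[OF finite_permutes_less])
      fix \<pi>
      have "degree (\<Prod>i<m. p i (\<pi> i)) \<le> (\<Sum>i<m. degree (p i (\<pi> i)))"
        using degree_prod_sum_le[of "{..<m}" "\<lambda>i. p i (\<pi> i)"] by (simp add: o_def)
      also have "\<dots> \<le> (\<Sum>i<m. N i)" using p(1) by (intro sum_mono) auto
      finally show "degree (smult (of_int (sign \<pi>)) (\<Prod>i<m. p i (\<pi> i))) \<le> (\<Sum>i<m. N i)"
        using degree_smult_le order_trans by blast
    qed
    moreover have "\<omega> (\<lambda>j. b s ** C j) = poly ?q s" for s
      unfolding \<omega>_def ndet_def by (auto simp: poly_sum poly_prod p(2) intro!: sum.cong)
    ultimately show ?thesis by blast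
  qed
  then obtain q where q: "\<And>C. degree (q C) \<le> (\<Sum>i<m. N i)" "\<And>C s. \<omega> (\<lambda>j. b s ** C j) = poly (q C) s"
    by metis
  \<comment> \<open>The powers of \<open>s\<close> that occur in some coordinate along
    \<open>b s\<close>; the largest of them, \<open>j\<close>, is the top weight.\<close>
  define S where "S = {j. \<exists>C. coeff (q C) j \<noteq> 0}"
  have "S \<subseteq> {..(\<Sum>i<m. N i)}" unfolding S_def using q(1) le_degree order_trans by blast
  then have finS: "finite S" by (rule finite_subset) simp
  have "\<omega> B = 1"
  proof (cases "m = 0")
    case True
    then have "{p. p permutes {..<m}} = {id}" by auto
    then show ?thesis by (simp add: \<omega>_def ndet_def True)
  next
    case False
    then show ?thesis unfolding \<omega>_def by (subst ndet_unit_columns[of 0]) (auto simp: FB)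
  qed
  then have "q B \<noteq> 0" using q(2)[of 1 B] by (auto simp: b1 matrix_mul_lid)
  then have "lead_coeff (q B) \<noteq> 0" by simp
  then have neS: "S \<noteq> {}" unfolding S_def by blast
  define j where "j = Max S"
  have "j \<in> S" unfolding j_def using finS neS by simp
  then obtain C0 where C0: "coeff (q C0) j \<noteq> 0" by (auto simp: S_def)
  have high: "coeff (q C) i = 0" if "i > j" for C i
    using that Max_ge[OF finS] by (force simp: j_def S_def)
  define w where "w C k = poly (q C) (s k) / s k ^ j" for C k
  have wlim: "w C \<longlonglongrightarrow> coeff (q C) j" for C
    unfolding w_def using filterlim_compose[OF poly_over_power_tendsto s] high by blast
  \<comment> \<open>All scalars in one factor: \<open>r k\<close> enters each of the
    \<open>m\<close> rows with the degree \<open>d\<close> of the forms, \<open>\<delta> k\<close>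
    enters through its determinant, and \<open>s k ^ j\<close> undoes the normalization in
    \<open>w\<close>.\<close>
  define \<kappa> where "\<kappa> k = (r k ^ d) ^ m * \<psi> (\<delta> k) * s k ^ j" for k
  have \<kappa>w: "(\<lambda>k. \<kappa> k * w C k) \<longlonglongrightarrow> \<omega> (\<lambda>j. M ** C j)" for C
  proof -
    have "(\<lambda>k. \<omega> (\<lambda>j. (r k *\<^sub>R (\<delta> k ** b (s k))) ** C j)) \<longlonglongrightarrow> \<omega> (\<lambda>j. M ** C j)"
      unfolding \<omega>_def ndet_def
    proof (intro tendsto_sum tendsto_mult tendsto_const tendsto_prod)
      fix \<pi> i assume "i \<in> {..<m}"
      then have "isCont (F i) x" for x
        using F continuous_real_polymonial_function vanishing_poly by blast
      moreover have "(\<lambda>k. r k *\<^sub>R (\<delta> k ** b (s k)) ** C (\<pi> i)) \<longlonglongrightarrow> M ** C (\<pi> i)"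
        by (rule bounded_linear.tendsto[OF bounded_linear_matrix_mult_right lim])
      ultimately show "(\<lambda>k. F i (r k *\<^sub>R (\<delta> k ** b (s k)) ** C (\<pi> i))) \<longlonglongrightarrow> F i (M ** C (\<pi> i))"
        by (rule isCont_tendsto_compose)
    qed
    moreover have "eventually (\<lambda>k. \<omega> (\<lambda>j. (r k *\<^sub>R (\<delta> k ** b (s k))) ** C j) = \<kappa> k * w C k) sequentially"
    proof -
      have "eventually (\<lambda>k. s k > 0) sequentially"
        using s by (auto simp: filterlim_at_top_dense)
      then show ?thesis
      proof eventually_elim
        case (elim k)
        have "\<omega> (\<lambda>j. (r k *\<^sub>R (\<delta> k ** b (s k))) ** C j) = (r k ^ d) ^ m * \<omega> (\<lambda>j. \<delta> k ** (b (s k) ** C j))"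
          using F unfolding \<omega>_def ndet_def sum_distrib_left
          by (auto simp: matrix_scaleR_left matrix_mul_assoc vanishing_def hpoly_def prod.distrib intro!: sum.cong)
        also have "\<dots> = (r k ^ d) ^ m * (\<psi> (\<delta> k) * poly (q C) (s k))"
          using \<omega>_group[OF \<delta>[of k]] q(2) by simp
        finally show ?case using elim by (simp add: \<kappa>_def w_def)
      qed
    qed
    ultimately show ?thesis by (rule Lim_transform_eventually)
  qed
  \<comment> \<open>One coordinate with nonzero top coefficient forces \<open>\<kappa>\<close> to
    converge. Hence the coordinates at the limit \<open>M\<close> are proportional to the top
    coefficients, with the same factor for all \<open>C\<close>.\<close>
  define c where "c = \<omega> (\<lambda>j. M ** C0 j) / coeff (q C0) j"
  have "eventually (\<lambda>k. w C0 k \<noteq> 0) sequentially"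
    using tendsto_imp_eventually_ne[OF wlim C0] .
  then have "eventually (\<lambda>k. (\<kappa> k * w C0 k) / w C0 k = \<kappa> k) sequentially"
    by eventually_elim simp
  then have "\<kappa> \<longlonglongrightarrow> c"
    using tendsto_divide[OF \<kappa>w wlim C0] unfolding c_def by (rule Lim_transform_eventually[rotated])
  then have \<omega>M: "\<omega> (\<lambda>j. M ** C j) = c * coeff (q C) j" for C
    using tendsto_mult[OF _ wlim] \<kappa>w LIMSEQ_unique by blast
  \<comment> \<open>Translating the points by \<open>b t\<close> substitutes \<open>s * t\<close>
    for \<open>s\<close>, by the group law of \<open>b\<close>.\<close>
  have coeff_b: "coeff (q (\<lambda>j. b t ** C j)) j = t ^ j * coeff (q C) j" for t C
  proof -
    have "poly (q (\<lambda>j. b t ** C j)) s = poly (pcompose (q C) [:0, t:]) s" for s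
      using q(2)[of s "\<lambda>j. b t ** C j"] q(2)[of "s * t" C]
      by (simp add: poly_pcompose matrix_mul_assoc bm mult.commute)
    then have "q (\<lambda>j. b t ** C j) = pcompose (q C) [:0, t:]"
      by (intro poly_eqI_degree_lead_coeff poly_ext) auto
    then show ?thesis by (simp add: coeff_pcompose_linear)
  qed
  have weight: "\<omega> (\<lambda>j. b t ** C j) = t ^ j * \<omega> C" for t C
  proof -
    have MM: "M ** (M' ** X) = X" for X :: "real^'n^'n" using M by (simp add: matrix_mul_assoc matrix_mul_lid)
    have "\<omega> (\<lambda>j. M ** (b t ** (M' ** C j))) = t ^ j * \<omega> (\<lambda>j. M ** (M' ** C j))"
      unfolding \<omega>M coeff_b by simp
    moreover have "M ** (b t ** (M' ** X)) = b t ** X" for X :: "real^'n^'n"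
      using MM comm by (metis matrix_mul_assoc)
    ultimately show ?thesis by (simp add: MM)
  qed
  have "F i (b t ** A) = 0" if i: "i < m" for i
  proof -
    \<comment> \<open>The points are chosen so that after translation by \<open>b t\<close> all
      columns but column \<open>i\<close> are those of the identity, leaving
      \<open>F i (b t ** A)\<close>. Before the translation column \<open>i\<close> consists of
      values at \<open>A\<close> and is zero.\<close>
    let ?C = "\<lambda>k. if k = i then A else b (1 / t) ** B k"
    have "b t ** ?C k = (if k = i then b t ** A else B k)" for k
      using t by (simp add: matrix_mul_assoc bm b1 matrix_mul_lid)
    then have "\<omega> (\<lambda>k. b t ** ?C k) = \<omega> (\<lambda>k. if k = i then b t ** A else B k)" by presburger
    also have "\<dots> = F i (b t ** A)"
      unfolding \<omega>_def by (subst ndet_unit_columns[OF i]) (auto simp: FB)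
    finally have "F i (b t ** A) = t ^ j * \<omega> ?C" by (simp add: weight)
    moreover have "\<omega> ?C = 0"
      unfolding \<omega>_def by (rule ndet_zero_column[OF i]) (simp add: vanishing_zero[OF F A])
    ultimately show ?thesis by simp
  qed
  with rep[OF f, of "b t ** A"] show ?thesis by simp
qed

text \<open>The derivative of \<open>b\<close> at 1 is
  \<open>2 *\<^sub>R P\<^sub>1 + P\<^sub>2\<close>. As the identity matrix is tangent as well,
  \<open>b 1 = mat 1\<close> may be subtracted, which leaves
  \<open>P\<^sub>1 - P\<^sub>3\<close>.\<close>

lemma limit_one_parameter_group_tangent:
  fixes G :: "(real^'n^'n) set" and P\<^sub>1 P\<^sub>2 P\<^sub>3 :: "real^'n^'n"
  defines "b \<equiv> \<lambda>s::real. s\<^sup>2 *\<^sub>R P\<^sub>1 + s *\<^sub>R P\<^sub>2 + P\<^sub>3"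
  assumes G: "matrix_group G"
    and b1: "b 1 = mat 1" and bm: "\<And>s r. b s ** b r = b (s * r)"
    and \<delta>: "\<And>k. \<delta> k \<in> G" and s: "filterlim s at_top sequentially"
    and lim: "(\<lambda>k. r k *\<^sub>R (\<delta> k ** b (s k))) \<longlonglongrightarrow> M"
    and M: "M ** M' = mat 1" and comm: "\<And>s. M ** b s = b s ** M"
  shows "P\<^sub>1 - P\<^sub>3 \<in> tangent_algebra G"
proof -
  have "2 *\<^sub>R P\<^sub>1 + P\<^sub>2 \<in> tangent_algebra G"
    unfolding tangent_algebra_def
  proof clarify
    fix d f A assume f: "f \<in> vanishing G d" and A: "A \<in> G"
    have van: "f (b t ** A) = 0" if "t > 0" for t
      using limit_one_parameter_group_vanishing[OF G b1[unfolded b_def] bm[unfolded b_def] \<delta> s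
          lim[unfolded b_def] M comm[unfolded b_def] f A that] by (simp add: b_def)
    have "(b has_derivative (\<lambda>h. h *\<^sub>R (2 *\<^sub>R P\<^sub>1 + P\<^sub>2))) (at 1)"
      unfolding b_def by (auto intro!: derivative_eq_intros simp: algebra_simps)
    then have "((\<lambda>t. b t ** A) has_derivative (\<lambda>h. (h *\<^sub>R (2 *\<^sub>R P\<^sub>1 + P\<^sub>2)) ** A)) (at 1)"
      by (rule bounded_linear.has_derivative[OF bounded_linear_matrix_mult_right])
    from has_derivative_compose[OF this real_polynomial_function_has_derivative[OF vanishing_poly[OF f]]]
    have "((\<lambda>t. f (b t ** A)) has_derivative
        (\<lambda>h. frechet_derivative f (at A) ((h *\<^sub>R (2 *\<^sub>R P\<^sub>1 + P\<^sub>2)) ** A))) (at 1)"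
      by (simp add: b1 matrix_mul_lid)
    moreover have "((\<lambda>t. f (b t ** A)) has_derivative (\<lambda>h. 0)) (at 1)"
    proof (rule has_derivative_transform_within_open[OF has_derivative_const])
      show "open {0::real<..}" "1 \<in> {0::real<..}" by auto
    qed (simp add: van)
    ultimately have "(\<lambda>h. frechet_derivative f (at A) ((h *\<^sub>R (2 *\<^sub>R P\<^sub>1 + P\<^sub>2)) ** A)) = (\<lambda>h. 0)"
      by (rule has_derivative_unique)
    from fun_cong[OF this, of 1] show "frechet_derivative f (at A) ((2 *\<^sub>R P\<^sub>1 + P\<^sub>2) ** A) = 0" by simp
  qed
  then have "(2 *\<^sub>R P\<^sub>1 + P\<^sub>2) - mat 1 \<in> tangent_algebra G"
    using subspace_diff[OF subspace_tangent_algebra] mat_1_in_tangent_algebra by blast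
  moreover have "(2 *\<^sub>R P\<^sub>1 + P\<^sub>2) - mat 1 = P\<^sub>1 - P\<^sub>3"
    using b1[symmetric] by (simp add: b_def scaleR_2)
  ultimately show ?thesis by simp
qed

section \<open>The Lorentzian form\<close>

text \<open>Multiplication by the Gram matrix of \<open>Q\<close>, which is its own inverse; it
  makes \<open>bq\<close> the polar form of \<open>Q\<close>.\<close>

definition flat :: "real^'n::{finite,linorder} \<Rightarrow> real^'n::_" where
  "flat x = (\<chi> i. if i = ix_first then - x $ ix_last else if i = ix_last then - x $ ix_first else x $ i)"

definition bq :: "real^'n::{finite,linorder} \<Rightarrow> real^'n::_ \<Rightarrow> real" where
  "bq x y = x \<bullet> flat y"

definition ot :: "real^'n::{finite,linorder} \<Rightarrow> real^'n::_ \<Rightarrow> real^'n::_^'n::_" where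
  "ot x y = (\<chi> i j. x $ i * flat y $ j)"

text \<open>\<open>ot x y\<close> is the rank one map taking \<open>v\<close> to
  \<open>bq y v *\<^sub>R x\<close>. Its antisymmetrizations \<open>wdg x y\<close> are
  infinitesimal isometries of \<open>Q\<close> and span their Lie algebra.\<close>

definition wdg :: "real^'n::{finite,linorder} \<Rightarrow> real^'n::_ \<Rightarrow> real^'n::_^'n::_" where
  "wdg x y = ot x y - ot y x"

definition isoQ :: "real^'n::{finite,linorder}^'n::_ \<Rightarrow> bool" where
  "isoQ A \<longleftrightarrow> (\<forall>x. Q (A *v x) = Q x)"

definition e2 :: "real^'n::{finite,linorder}" where
  "e2 = axis ix_second 1"

definition proj :: "real^'n::{finite,linorder} \<Rightarrow> real^'n::_" where
  "proj x = x - x $ ix_second *\<^sub>R e2"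

type_synonym 'n rvec = "(real, 'n) vec"
type_synonym 'n rmat = "((real, 'n) vec, 'n) vec"

locale dim_ge_4 =
  fixes dim_type :: "'n::{finite,linorder} itself"
  assumes card_ge_4: "CARD('n) \<ge> 4"
begin

lemma ix_distinct [simp]:
  "(ix_first :: 'n) \<noteq> ix_second" "(ix_second :: 'n) \<noteq> ix_first"
  "(ix_first :: 'n) \<noteq> ix_last" "(ix_last :: 'n) \<noteq> ix_first"
  "(ix_second :: 'n) \<noteq> ix_last" "(ix_last :: 'n) \<noteq> ix_second"
proof -
  have ne: "(UNIV - {ix_first :: 'n}) \<noteq> {}"
  proof
    assume "UNIV - {ix_first :: 'n} = {}"
    then have "(UNIV :: 'n set) = {ix_first}" by auto
    then have "CARD('n) = card {ix_first :: 'n}" by simp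
    then show False using card_ge_4 by simp
  qed
  have s: "(ix_second :: 'n) \<in> UNIV - {ix_first}" unfolding ix_second_def using ne by (intro Min_in) auto
  then show 1: "(ix_second :: 'n) \<noteq> ix_first" "(ix_first :: 'n) \<noteq> ix_second" by auto
  have f: "(ix_first :: 'n) \<le> i" for i unfolding ix_first_def by (rule Min_le) auto
  have l: "i \<le> (ix_last :: 'n)" for i unfolding ix_last_def by (rule Max_ge) auto
  show 2: "(ix_first :: 'n) \<noteq> ix_last"
    using f[of ix_second] l[of ix_second] 1 by (metis order.antisym)
  then show "(ix_last :: 'n) \<noteq> ix_first" by simp
  show 3: "(ix_second :: 'n) \<noteq> ix_last"
  proof
    assume eq: "(ix_second :: 'n) = ix_last"
    have "i = ix_first \<or> i = ix_last" for i :: 'n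
    proof (cases "i = ix_first")
      case False
      then have "ix_second \<le> i" unfolding ix_second_def by (intro Min_le) auto
      then show ?thesis using eq l[of i] by auto
    qed simp
    then have "(UNIV :: 'n set) = {ix_first, ix_last}" by auto
    then have "CARD('n) = card {ix_first, ix_last :: 'n}" by simp
    then show False using card_ge_4 by (simp add: 2)
  qed
  then show "(ix_last :: 'n) \<noteq> ix_second" by simp
qed

lemma flat_add [simp]: "flat (x + y :: 'n rvec) = flat x + flat y"
  and flat_scaleR [simp]: "flat (c *\<^sub>R x) = c *\<^sub>R flat (x :: 'n rvec)"
  and flat_diff [simp]: "flat (x - y) = flat x - flat (y :: 'n rvec)"
  and flat_minus [simp]: "flat (- x) = - flat (x :: 'n rvec)"
  and flat_zero [simp]: "flat (0 :: 'n rvec) = 0"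
  and flat_flat [simp]: "flat (flat x) = (x :: 'n rvec)"
  by (auto simp: flat_def vec_eq_iff)

lemma flat_second [simp]: "flat x $ ix_second = (x :: 'n rvec) $ ix_second"
  by (simp add: flat_def)

lemma linear_flat: "linear (flat :: 'n rvec \<Rightarrow> _)"
  by (auto intro: linearI)

lemma bq_alt: "bq x y = (\<Sum>i\<in>UNIV - {ix_first, ix_last}. x $ i * y $ i)
    - x $ ix_first * y $ ix_last - x $ ix_last * (y :: 'n rvec) $ ix_first"
proof -
  have "bq x y = (\<Sum>i\<in>UNIV. x $ i * flat y $ i)" by (simp add: bq_def inner_vec_def)
  also have "\<dots> = (\<Sum>i\<in>{ix_first, ix_last}. x $ i * flat y $ i) + (\<Sum>i\<in>UNIV - {ix_first, ix_last}. x $ i * flat y $ i)"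
    by (subst sum.subset_diff[of "{ix_first, ix_last}"]) auto
  also have "(\<Sum>i\<in>UNIV - {ix_first, ix_last}. x $ i * flat y $ i) = (\<Sum>i\<in>UNIV - {ix_first, ix_last}. x $ i * y $ i)"
    by (intro sum.cong) (auto simp: flat_def)
  also have "(\<Sum>i\<in>{ix_first, ix_last}. x $ i * flat y $ i) = - x $ ix_first * y $ ix_last - x $ ix_last * y $ ix_first"
    by (simp add: flat_def)
  finally show ?thesis by simp
qed

lemma bq_commute: "bq x y = bq y (x :: 'n rvec)"
  by (simp add: bq_alt mult.commute)

lemma Q_bq: "Q x = bq x (x :: 'n rvec)"
  by (simp add: bq_alt Q_def power2_eq_square)

lemma bq_linear [simp]:
  "bq (x + y) z = bq x z + bq y (z :: 'n rvec)" "bq z (x + y) = bq z x + bq z y"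
  "bq (x - y) z = bq x z - bq y z" "bq z (x - y) = bq z x - bq z y"
  "bq (c *\<^sub>R x) z = c * bq x z" "bq z (c *\<^sub>R x) = c * bq z x"
  "bq (- x) z = - bq x z" "bq z (- x) = - bq z x" "bq 0 z = 0" "bq z 0 = 0"
  by (auto simp: bq_def inner_simps)

lemma bq_flat: "bq x (flat y) = x \<bullet> (y :: 'n rvec)"
  by (simp add: bq_def)

lemma bq_nondegenerate: "(\<And>y. bq x y = 0) \<Longrightarrow> x = (0 :: 'n rvec)"
  by (metis bq_flat inner_eq_zero_iff)

lemma bq_e2 [simp]: "bq x e2 = x $ ix_second" "bq e2 x = (x :: 'n rvec) $ ix_second"
proof -
  show "bq x e2 = x $ ix_second"
    using bq_flat[of x "flat e2"]
      by (simp add: bq_def e2_def flat_def axis_def inner_vec_def if_distrib cong: if_cong)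
  then show "bq e2 x = x $ ix_second" by (simp add: bq_commute)
qed

lemma e2_nth [simp]: "e2 $ ix_second = (1 :: real)" "e2 $ (ix_first :: 'n) = (0 :: real)" "e2 $ (ix_last :: 'n) = (0 :: real)"
  by (auto simp: e2_def axis_def)

lemma flat_e2: "flat (e2 :: 'n rvec) = e2"
  by (auto simp: flat_def e2_def axis_def vec_eq_iff)

lemma Q_add: "Q (x + y) = Q x + 2 * bq x y + Q (y :: 'n rvec)"
  by (simp add: Q_bq bq_commute[of y x])

lemma Q_scaleR: "Q (c *\<^sub>R x) = c\<^sup>2 * Q (x :: 'n rvec)"
  by (simp add: Q_bq power2_eq_square)

lemma isoQ_bq: "isoQ A \<Longrightarrow> bq (A *v x) (A *v y) = bq x (y :: 'n rvec)"
proof -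
  assume A: "isoQ A"
  have "Q (A *v (x + y)) = Q (x + y)" using A by (simp add: isoQ_def)
  then show ?thesis using A by (simp add: isoQ_def matrix_vector_right_distrib Q_add)
qed

lemma isoQ_mult: "isoQ A \<Longrightarrow> isoQ B \<Longrightarrow> isoQ (A ** (B :: 'n rmat))"
  by (simp add: isoQ_def matrix_vector_mul_assoc[symmetric])

lemma isoQ_inverse:
  assumes A: "isoQ (A :: 'n rmat)"
  obtains A' where "A ** A' = mat 1" "A' ** A = mat 1" "isoQ A'"
proof -
  have "x = 0" if "A *v x = 0" for x
  proof (rule bq_nondegenerate)
    fix y show "bq x y = 0" using isoQ_bq[OF A, of x y] that by simp
  qed
  then obtain A' where A': "A' ** A = mat 1"
    by (metis matrix_left_invertible_ker)
  then have "A ** A' = mat 1" by (simp add: matrix_left_right_inverse)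
  moreover have "isoQ A'"
    using A calculation by (metis isoQ_def matrix_vector_mul_assoc matrix_vector_mul_lid)
  ultimately show ?thesis using that A' by blast
qed

subsection \<open>Rank one matrices\<close>

lemma ot_vec [simp]: "ot x y *v v = bq y v *\<^sub>R (x :: 'n rvec)"
  by (subst bq_commute)
    (simp add: ot_def matrix_vector_mult_def vec_eq_iff bq_def inner_vec_def sum_distrib_left ac_simps)

lemma ot_mult: "ot x y ** ot z w = bq y z *\<^sub>R ot x (w :: 'n rvec)"
  by (simp add: matrix_eq matrix_vector_mul_assoc[symmetric] scaleR_matrix_vector_assoc[symmetric] mult.commute)

lemma matrix_mult_ot: "A ** ot x y = ot (A *v x) (y :: 'n rvec)"
  by (simp add: matrix_eq matrix_vector_mul_assoc[symmetric] matrix_vector_mult_scaleR)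

lemma ot_add [simp]: "ot (x + x') y = ot x y + ot x' (y :: 'n rvec)" "ot y (x + x') = ot y x + ot y x'"
  and ot_scaleR [simp]: "ot (c *\<^sub>R x) y = c *\<^sub>R ot x y" "ot x (c *\<^sub>R y) = c *\<^sub>R ot x y"
  and ot_diff [simp]: "ot (x - x') y = ot x y - ot x' y" "ot y (x - x') = ot y x - ot y x'"
  and ot_zero [simp]: "ot 0 y = 0" "ot y 0 = 0"
  by (auto simp: ot_def vec_eq_iff algebra_simps)

lemma ot_mult_isoQ:
  assumes "isoQ A" "A ** A' = mat 1"
  shows "ot x y ** A' = ot x (A *v (y :: 'n rvec))"
proof -
  have "bq y (A' *v v) = bq (A *v y) v" for v
    using isoQ_bq[OF assms(1), of y "A' *v v"] assms(2) by (simp add: matrix_vector_mul_assoc)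
  then show ?thesis by (simp add: matrix_eq matrix_vector_mul_assoc[symmetric])
qed

lemma wdg_conj_isoQ:
  assumes "isoQ A" "A ** A' = mat 1"
  shows "A ** wdg x y ** A' = wdg (A *v x) (A *v (y :: 'n rvec))"
  by (simp add: wdg_def matrix_diff_ldistrib matrix_diff_rdistrib matrix_mult_ot ot_mult_isoQ[OF assms])

lemma wdg_vec: "wdg x y *v v = bq y v *\<^sub>R x - bq x v *\<^sub>R (y :: 'n rvec)"
  by (simp add: wdg_def matrix_vector_mult_diff_rdistrib)

text \<open>Infinitesimal version of \<open>wdg_conj_isoQ\<close>: an infinitesimal isometry acts on
  the two factors by the Leibniz rule.\<close>

lemma wdg_bracket:
  "wdg x y ** wdg z w - wdg z w ** wdg x y = wdg (wdg x y *v z) w + wdg z (wdg x y *v (w :: 'n rvec))"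
proof (subst matrix_eq, rule allI)
  fix v
  show "(wdg x y ** wdg z w - wdg z w ** wdg x y) *v v = (wdg (wdg x y *v z) w + wdg z (wdg x y *v w)) *v v"
    by (simp add: matrix_vector_mult_diff_rdistrib matrix_vector_mult_add_rdistrib
        matrix_vector_mul_assoc[symmetric] wdg_vec bq_commute[of w x] bq_commute[of w y]
        bq_commute[of z x] bq_commute[of z y]) (simp add: algebra_simps)
qed

lemma wdg_add: "wdg (x + x') y = wdg x y + wdg x' (y :: 'n rvec)" "wdg y (x + x') = wdg y x + wdg y x'"
  and wdg_scaleR: "wdg (c *\<^sub>R x) y = c *\<^sub>R wdg x y" "wdg x (c *\<^sub>R y) = c *\<^sub>R wdg x y"
  and wdg_diff: "wdg (x - x') y = wdg x y - wdg x' y" "wdg y (x - x') = wdg y x - wdg y x'"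
  and wdg_self: "wdg x x = 0" and wdg_zero: "wdg 0 x = 0"
  by (auto simp: wdg_def algebra_simps)

subsection \<open>The hyperplane \<open>x\<^sub>2 = 0\<close>\<close>

lemma proj_second [simp]: "proj x $ ix_second = (0 :: real)"
  and proj_first [simp]: "proj (x :: 'n rvec) $ ix_first = x $ ix_first"
  and proj_last [simp]: "proj (x :: 'n rvec) $ ix_last = x $ ix_last"
  by (auto simp: proj_def)

lemma proj_eq_self: "x $ ix_second = 0 \<Longrightarrow> proj x = (x :: 'n rvec)"
  by (simp add: proj_def)

lemma proj_decomp: "x = proj x + x $ ix_second *\<^sub>R (e2 :: 'n rvec)"
  by (simp add: proj_def)

lemma linear_proj: "linear (proj :: 'n rvec \<Rightarrow> _)"
  by (auto intro!: linearI simp: proj_def algebra_simps)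

lemma Q_proj: "Q x = Q (proj x) + (x $ ix_second)\<^sup>2" for x :: "'n rvec"
  by (subst proj_decomp) (simp add: Q_bq power2_eq_square del: proj_second, simp)

lemma bq_proj: "y $ ix_second = 0 \<Longrightarrow> bq (proj x) y = bq x (y :: 'n rvec)"
  by (simp add: proj_def)

lemma exists_orthogonal:
  assumes "finite S" "card S < 4"
  shows "\<exists>x :: 'n rvec. x \<noteq> 0 \<and> (\<forall>y\<in>S. bq x y = 0)"
proof -
  have "dim (flat ` S) \<le> card (flat ` S)" by (rule dim_le_card') (use assms in auto)
  also have "\<dots> \<le> card S" by (rule card_image_le[OF assms(1)])
  finally have "dim (flat ` S) < DIM('n rvec)" using assms card_ge_4 by simp
  then obtain x where "x \<noteq> 0" "\<And>y. y \<in> span (flat ` S) \<Longrightarrow> orthogonal x y"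
    by (rule orthogonal_to_subspace_exists) blast
  then show ?thesis by (auto simp: orthogonal_def bq_def span_base)
qed

lemma exists_dual_in_hyperplane:
  assumes "x \<noteq> 0" "x $ ix_second = 0"
  obtains y :: "'n rvec" where "y $ ix_second = 0" "bq y x = 1"
proof -
  obtain z where z: "bq x z \<noteq> 0" using bq_nondegenerate assms(1) by blast
  then have "bq (proj z) x \<noteq> 0" using bq_proj[OF assms(2), of z] bq_commute[of z x] by simp
  then show ?thesis by (intro that[of "(1 / bq (proj z) x) *\<^sub>R proj z"]) auto
qed

subsection \<open>Lie algebras containing infinitesimal isometries\<close>

definition lie_subalgebra :: "('n rmat) set \<Rightarrow> bool" where
  "lie_subalgebra T \<longleftrightarrow> subspace T \<and> (\<forall>X\<in>T. \<forall>Y\<in>T. X ** Y - Y ** X \<in> T)"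

text \<open>The second hyperplane, orthogonal to \<open>a\<close>, supplies a single element
  \<open>wdg e2 w\<close> mixing \<open>e2\<close> with the first one. Brackets with the
  infinitesimal isometries of the first hyperplane then move \<open>w\<close> through all of
  it.\<close>

lemma lie_subalgebra_so:
  assumes T: "lie_subalgebra T"
    and U: "\<And>x y. x $ ix_second = 0 \<Longrightarrow> y $ ix_second = 0 \<Longrightarrow> wdg x y \<in> T"
    and a: "\<And>x y. bq a x = 0 \<Longrightarrow> bq a y = 0 \<Longrightarrow> wdg x y \<in> T"
      and pa: "proj a \<noteq> 0"
  shows "wdg x y \<in> T"
proof -
  have sub: "subspace T" and br: "\<And>X Y. X \<in> T \<Longrightarrow> Y \<in> T \<Longrightarrow> X ** Y - Y ** X \<in> T"
    using T by (auto simp: lie_subalgebra_def)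
  note add = subspace_add[OF sub] and diff = subspace_diff[OF sub] and scale = subspace_scale[OF sub]
  obtain v where v: "v $ ix_second = 0" "bq v (proj a) = 1"
    using exists_dual_in_hyperplane[OF pa] by auto
  have "card {proj a, e2} < 4" by (auto simp: card_insert_if)
  then obtain w where w: "w \<noteq> 0" "\<forall>y\<in>{proj a, e2}. bq w y = 0"
    using exists_orthogonal[of "{proj a, e2 :: 'n rvec}"] by blast
  then have wU: "w $ ix_second = 0" and aw: "bq a w = 0"
    using bq_proj[of w a] bq_commute[of "proj a" w] by auto
  \<comment> \<open>\<open>e2\<close>, corrected by a vector of the hyperplane to become orthogonal
    to \<open>a\<close>. The assumption on \<open>a\<close> yields \<open>wdg z w\<close>, and
    \<open>U\<close> yields the correction \<open>wdg v w\<close>.\<close>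
  define z where "z = e2 - (a $ ix_second) *\<^sub>R v"
  have "bq a z = 0" using v bq_proj[of v a] bq_commute[of "proj a" v] by (simp add: z_def)
  then have "wdg z w \<in> T" using a aw by blast
  moreover have "wdg v w \<in> T" using U v wU by blast
  ultimately have "wdg z w + (a $ ix_second) *\<^sub>R wdg v w \<in> T" using add scale by blast
  then have e2w: "wdg e2 w \<in> T" by (simp add: z_def wdg_diff wdg_scaleR)
  have step: "wdg e2 (bq y v *\<^sub>R x - bq x v *\<^sub>R y) \<in> T"
    if "wdg e2 v \<in> T" "x $ ix_second = 0" "y $ ix_second = 0" for x y v
  proof -
    have "wdg x y ** wdg e2 v - wdg e2 v ** wdg x y \<in> T" using br U that by blast
    then show ?thesis unfolding wdg_bracket by (simp add: wdg_vec that wdg_zero)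
  qed
  have all: "wdg e2 x \<in> T" if x: "x $ ix_second = 0" for x
  proof -
    obtain y where y: "y $ ix_second = 0" "bq y w = 1"
      using exists_dual_in_hyperplane[OF w(1) wU] by auto
    \<comment> \<open>One bracket leads from \<open>wdg e2 w\<close> only to \<open>wdg e2 v\<close>
      with \<open>v\<close> orthogonal to \<open>w\<close>, and \<open>y\<close> is not. The detour
      passes through some \<open>x1\<close> orthogonal to \<open>w\<close>, \<open>y\<close> and
      \<open>e2\<close>, which exists in dimension 4.\<close>
    have "card {w, y, e2 :: 'n rvec} < 4" by (auto simp: card_insert_if)
    then obtain x1 where x1: "x1 \<noteq> 0" "bq x1 w = 0" "bq x1 y = 0" "x1 $ ix_second = 0"
      using exists_orthogonal[of "{w, y, e2 :: 'n rvec}"] by auto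
    have "wdg e2 x1 \<in> T" using step[OF e2w x1(4) y(1)] x1 y by simp
    moreover obtain y1 where y1: "y1 $ ix_second = 0" "bq y1 x1 = 1"
      using exists_dual_in_hyperplane[OF x1(1,4)] by auto
    ultimately have "wdg e2 y \<in> T"
      using step[of x1 y y1] y x1 by (simp add: bq_commute[of y x1])
    moreover have "wdg e2 (x - bq x w *\<^sub>R y) \<in> T" using step[OF e2w x y(1)] y by simp
    ultimately have "wdg e2 (x - bq x w *\<^sub>R y) + bq x w *\<^sub>R wdg e2 y \<in> T"
      using add scale by blast
    then show ?thesis by (simp add: wdg_diff wdg_scaleR)
  qed
  have "- wdg e2 (proj x) \<in> T" by (rule subspace_neg[OF sub all[OF proj_second]])
  then have pe: "wdg (proj x) e2 \<in> T" by (simp add: wdg_def)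
  have "wdg (proj x) (proj y) + y $ ix_second *\<^sub>R wdg (proj x) e2 + x $ ix_second *\<^sub>R wdg e2 (proj y) \<in> T"
    by (intro add scale U all pe proj_second)
  moreover have "wdg x y = wdg (proj x) (proj y) + y $ ix_second *\<^sub>R wdg (proj x) e2 + x $ ix_second *\<^sub>R wdg e2 (proj y)"
    by (subst proj_decomp[of x], subst proj_decomp[of y])
      (simp add: wdg_add wdg_scaleR wdg_self del: proj_second)
  ultimately show ?thesis by simp
qed

lemma matrix_sum_ot: "X = (\<Sum>j\<in>UNIV. ot (column j X) (flat (axis j 1)))" for X :: "'n rmat"
  by (simp add: ot_def column_def vec_eq_iff axis_def if_distrib[of "\<lambda>x. _ * x"] cong: if_cong)

text \<open>Since \<open>r \<noteq> 1 / r\<close>, the two antisymmetric combinations separate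
  \<open>ot e2 u\<close> from \<open>ot u e2\<close>. Brackets of these give the rank one maps of
  the hyperplane up to multiples of \<open>ot e2 e2\<close>, and the identity matrix supplies the
  missing trace.\<close>

lemma lie_subalgebra_UNIV:
  assumes T: "lie_subalgebra T" and one: "mat 1 \<in> T"
    and so: "\<And>u. u $ ix_second = 0 \<Longrightarrow> wdg e2 u \<in> T"
    and r: "r > 0" "r \<noteq> 1"
    and tw: "\<And>u. u $ ix_second = 0 \<Longrightarrow> r *\<^sub>R ot e2 u - (1 / r) *\<^sub>R ot u e2 \<in> T"
  shows "T = UNIV"
proof -
  have sub: "subspace T" and br: "\<And>X Y. X \<in> T \<Longrightarrow> Y \<in> T \<Longrightarrow> X ** Y - Y ** X \<in> T"
    using T by (auto simp: lie_subalgebra_def)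
  note add = subspace_add[OF sub] and diff = subspace_diff[OF sub] and scale = subspace_scale[OF sub]
  have r2: "r - 1 / r \<noteq> 0" using r
    by (simp add: field_simps) (metis power2_eq_1_iff power2_eq_square less_minus_one_simps(3) order_less_asym)
  have ue: "ot u e2 \<in> T" if u: "u $ ix_second = 0" for u
  proof -
    have "(1 / (r - 1 / r)) *\<^sub>R ((r *\<^sub>R ot e2 u - (1 / r) *\<^sub>R ot u e2) - r *\<^sub>R wdg e2 u) \<in> T"
      by (intro scale[OF diff[OF tw[OF u] scale[OF so[OF u]]]])
    moreover have "(r *\<^sub>R ot e2 u - (1 / r) *\<^sub>R ot u e2) - r *\<^sub>R wdg e2 u = (r - 1 / r) *\<^sub>R ot u e2"
      by (simp add: wdg_def algebra_simps)
    ultimately show ?thesis using r2 by simp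
  qed
  have eu: "ot e2 u \<in> T" if u: "u $ ix_second = 0" for u
  proof -
    have "wdg e2 u + ot u e2 \<in> T" by (rule add[OF so[OF u] ue[OF u]])
    then show ?thesis by (simp add: wdg_def)
  qed
  have uv: "bq u v *\<^sub>R ot e2 e2 - ot v u \<in> T" if "u $ ix_second = 0" "v $ ix_second = 0" for u v
    using br[OF eu[OF that(1)] ue[OF that(2)]] by (simp add: ot_mult)
  let ?E = "ot e2 (e2 :: 'n rvec)"
  \<comment> \<open>The rank one maps of the standard basis add up to the identity. The sum over all
    indices but the second is therefore \<open>mat 1 - ?E\<close>, and adding \<open>mat 1\<close>
    to the total isolates a multiple of \<open>?E\<close>.\<close>
  have "(\<Sum>j\<in>UNIV - {ix_second}. ?E - ot (axis j 1) (flat (axis j 1))) \<in> T"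
  proof (intro subspace_sum[OF sub])
    fix j :: 'n assume j: "j \<in> UNIV - {ix_second}"
    have "bq (flat (axis j 1)) (axis j 1) = (1 :: real)"
      by (simp add: bq_commute[of "flat _"] bq_flat inner_axis_axis)
    then show "?E - ot (axis j 1) (flat (axis j 1)) \<in> T"
      using uv[of "flat (axis j 1)" "axis j 1"] j by (auto simp: axis_def)
  qed
  moreover have "(\<Sum>j\<in>UNIV - {ix_second}. ?E - ot (axis j 1) (flat (axis j 1))) = real CARD('n) *\<^sub>R ?E - mat 1"
  proof -
    have col: "column j (mat 1) = (axis j 1 :: 'n rvec)" for j
      by (simp add: column_def mat_def axis_def vec_eq_iff)
    have "(mat 1 :: 'n rmat) = (\<Sum>j\<in>UNIV. ot (axis j 1) (flat (axis j 1)))"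
      by (subst matrix_sum_ot) (simp add: col)
    also have "\<dots> = ot (axis ix_second 1) (flat (axis ix_second 1)) + (\<Sum>j\<in>UNIV - {ix_second}. ot (axis j 1) (flat (axis j 1)))"
      by (subst sum.remove[of _ ix_second]) auto
    also have "ot (axis ix_second 1) (flat (axis ix_second 1)) = ?E"
      using flat_e2 by (simp add: e2_def)
    finally have "(\<Sum>j\<in>UNIV - {ix_second}. ot (axis j 1) (flat (axis j 1))) = mat 1 - ?E" by simp
    moreover have "real (card (UNIV - {ix_second :: 'n})) = real CARD('n) - 1"
      using card_ge_4 by (simp add: card_Diff_singleton_if)
    ultimately show ?thesis
      by (simp add: sum_subtractf sum_constant_scaleR scaleR_diff_left del: sum_constant)
  qed
  ultimately have "(1 / real CARD('n)) *\<^sub>R ((real CARD('n) *\<^sub>R ?E - mat 1) + mat 1) \<in> T"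
    using one by (intro scale add) simp_all
  then have E: "?E \<in> T" using card_ge_4 by simp
  have uv': "ot v u \<in> T" if "u $ ix_second = 0" "v $ ix_second = 0" for u v
    using diff[OF scale[OF E, of "bq u v"] uv[OF that]] by simp
  have xy: "ot x y \<in> T" for x y
  proof -
    have "ot x y = ot (proj x) (proj y) + y $ ix_second *\<^sub>R ot (proj x) e2
        + (x $ ix_second *\<^sub>R ot e2 (proj y) + (x $ ix_second * y $ ix_second) *\<^sub>R ?E)"
      by (subst proj_decomp[of x], subst proj_decomp[of y]) (simp add: scaleR_add_right mult.commute del: proj_second)
    also have "\<dots> \<in> T" by (intro add scale uv' ue eu E) auto
    finally show ?thesis .
  qed
  have "X \<in> T" for X
    by (subst matrix_sum_ot) (intro subspace_sum[OF sub] xy)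
  then show ?thesis by auto
qed

end

section \<open>Invariance of Lebesgue measure\<close>

text \<open>The library computes the measure of a linear image only for well-ordered index types; this copy
  of an arbitrary finite type is one.\<close>

typedef 'a wo = "UNIV :: 'a set" by auto

lemma bij_Rep_wo: "bij (Rep_wo :: 'a wo \<Rightarrow> 'a)"
  by (metis Abs_wo_inverse Rep_wo_inverse UNIV_I bijI')

instance wo :: (finite) finite
proof
  show "finite (UNIV :: 'a wo set)"
    by (metis bij_Rep_wo bij_betw_finite finite)
qed

instantiation wo :: (finite) wellorder
begin

definition "x \<le> y \<longleftrightarrow> to_nat (Rep_wo x) \<le> to_nat (Rep_wo y)"
definition "x < y \<longleftrightarrow> to_nat (Rep_wo x) < to_nat (Rep_wo y)"

instance
proof
  fix P :: "'a wo \<Rightarrow> bool" and a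
  assume *: "\<And>x. (\<And>y. y < x \<Longrightarrow> P y) \<Longrightarrow> P x"
  show "P a"
    by (induction "to_nat (Rep_wo a)" arbitrary: a rule: less_induct) (rule *, simp add: less_wo_def)
qed (auto simp: less_eq_wo_def less_wo_def Rep_wo_inject)

end

lemma prod_Basis_vec: "(\<Prod>b\<in>Basis. (x :: real^'n) \<bullet> b) = (\<Prod>i\<in>UNIV. x $ i)"
proof -
  have B: "(Basis :: (real^'n) set) = range (\<lambda>i. axis i 1)" by (auto simp: Basis_vec_def)
  have i: "inj (\<lambda>i::'n. axis i (1::real))" by (auto simp: inj_on_def axis_eq_axis)
  show ?thesis unfolding B prod.reindex[OF i] by (simp add: inner_axis)
qed

lemma mem_box_vec: "(x :: real^'n) \<in> box l u \<longleftrightarrow> (\<forall>i. l $ i < x $ i \<and> x $ i < u $ i)"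
  by (auto simp: mem_box Basis_vec_def inner_axis)

definition wo_vec :: "real^'n \<Rightarrow> real^('n wo)" where
  "wo_vec x = (\<chi> i. x $ Rep_wo i)"

definition wo_mat :: "real^'n^'n \<Rightarrow> real^('n wo)^('n wo)" where
  "wo_mat A = (\<chi> i j. A $ Rep_wo i $ Rep_wo j)"

lemma linear_wo_vec: "linear wo_vec"
  by (auto intro!: linearI simp: wo_vec_def vec_eq_iff)

lemma surj_wo_vec: "surj (wo_vec :: real^'n \<Rightarrow> _)"
proof (rule surjI)
  fix y :: "real^('n wo)"
  show "wo_vec (\<chi> i. y $ Abs_wo i) = y" by (simp add: wo_vec_def vec_eq_iff Rep_wo_inverse)
qed

lemma inj_wo_vec: "inj wo_vec"
  by (rule injI) (metis (mono_tags) Abs_wo_inverse UNIV_I vec_eq_iff vec_lambda_beta wo_vec_def)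

lemma sum_wo: "(\<Sum>i\<in>UNIV. f (Rep_wo i)) = (\<Sum>i\<in>UNIV. f i)"
  by (rule sum.reindex_bij_betw) (use bij_Rep_wo in auto)

lemma prod_wo: "(\<Prod>i\<in>UNIV. f (Rep_wo i)) = (\<Prod>i\<in>UNIV. f i)"
  by (rule prod.reindex_bij_betw) (use bij_Rep_wo in auto)

lemma wo_mat_vec: "wo_mat A *v wo_vec x = wo_vec (A *v x)"
  by (simp add: wo_mat_def wo_vec_def matrix_vector_mult_def vec_eq_iff
      sum_wo[where f = "\<lambda>j. A $ i $ j * x $ j" for i])

lemma wo_mat_mult: "wo_mat A ** wo_mat B = wo_mat (A ** B)"
  by (simp add: wo_mat_def matrix_matrix_mult_def vec_eq_iff
      sum_wo[where f = "\<lambda>k. A $ i $ k * B $ k $ j" for i j])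

lemma wo_mat_one: "wo_mat (mat 1) = mat 1"
  by (simp add: wo_mat_def mat_def vec_eq_iff Rep_wo_inject)

lemma wo_mat_transpose: "wo_mat (transpose A) = transpose (wo_mat A)"
  by (simp add: wo_mat_def transpose_def vec_eq_iff)

lemma borel_measurable_linear:
  fixes f :: "'a::euclidean_space \<Rightarrow> 'b::euclidean_space"
  shows "linear f \<Longrightarrow> f \<in> borel_measurable borel"
  by (simp add: borel_measurable_continuous_onI linear_continuous_on linear_conv_bounded_linear)

lemma lborel_wo_vec: "distr lborel lborel (wo_vec :: real^'n \<Rightarrow> _) = lborel"
proof (rule lborel_eqI[symmetric])
  fix l u :: "real^('n wo)" assume lu: "\<And>b. b \<in> Basis \<Longrightarrow> l \<bullet> b \<le> u \<bullet> b"
  obtain l' u' where l': "l = wo_vec l'" "u = wo_vec u'" using surj_wo_vec by (metis surjD)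
  have lu': "l' $ i \<le> u' $ i" for i
    using lu[unfolded Ball_def[symmetric], of "axis (Abs_wo i) 1"]
    by (auto simp: Basis_vec_def l' wo_vec_def inner_axis Abs_wo_inverse)
  have "wo_vec -` box l u = box l' u'"
  proof (rule Set.set_eqI)
    fix x show "x \<in> wo_vec -` box l u \<longleftrightarrow> x \<in> box l' u'"
      unfolding vimage_eq mem_box_vec l' by (simp add: wo_vec_def) (metis Abs_wo_inverse UNIV_I)
  qed
  then have "emeasure (distr lborel lborel wo_vec) (box l u) = emeasure lborel (box l' u')"
    by (subst emeasure_distr) (auto intro!: borel_measurable_linear linear_wo_vec)
  also have "\<dots> = (\<Prod>b\<in>Basis. (u' - l') \<bullet> b)"
    using lu' by (intro emeasure_lborel_box) (auto simp: Basis_vec_def inner_axis)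
  also have "(\<Prod>b\<in>Basis. (u' - l') \<bullet> b) = (\<Prod>b\<in>Basis. (u - l) \<bullet> b)"
    unfolding prod_Basis_vec l' by (simp add: wo_vec_def prod_wo[where f = "\<lambda>i. u' $ i - l' $ i"])
  finally show "emeasure (distr lborel lborel wo_vec) (box l u) = (\<Prod>b\<in>Basis. (u - l) \<bullet> b)" .
qed simp

lemma lborel_linear_abs_det_1:
  fixes A :: "real^'n::{finite,wellorder}^'n::_"
  assumes "\<bar>det A\<bar> = 1"
  shows "distr lborel lborel ((*v) A) = lborel"
proof (rule lborel_eqI[symmetric])
  fix l u :: "real^'n::_" assume lu: "\<And>b. b \<in> Basis \<Longrightarrow> l \<bullet> b \<le> u \<bullet> b"
  obtain B where B: "A ** B = mat 1" "B ** A = mat 1"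
    using assms invertible_det_nz[of A] by (auto simp: invertible_def)
  have "det A * det B = 1" by (metis B(1) det_I det_mul)
  then have dB: "\<bar>det B\<bar> = 1" using assms by (metis abs_1 abs_mult mult_1)
  have meas: "(*v) A \<in> borel_measurable borel" by (intro borel_measurable_linear matrix_vector_mul_linear)
  have eq: "(*v) A -` box l u = (*v) B ` box l u"
    by (auto simp: image_iff matrix_vector_mul_assoc B) (metis B(2) matrix_vector_mul_assoc matrix_vector_mul_lid)
  have lm: "(*v) B ` box l u \<in> lmeasurable"
    by (intro measurable_linear_image matrix_vector_mul_linear) simp
  have "(*v) A -` box l u \<in> sets borel" using measurable_sets[OF meas, of "box l u"] by simp
  then have "emeasure (distr lborel lborel ((*v) A)) (box l u) = emeasure lebesgue ((*v) B ` box l u)"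
    using meas by (subst emeasure_distr) (auto simp: eq[symmetric])
  also have "\<dots> = measure lebesgue ((*v) B ` box l u)"
    using lm by (simp add: emeasure_eq_measure2 fmeasurableD2)
  also have "measure lebesgue ((*v) B ` box l u) = measure lebesgue (box l u)"
    by (subst measure_linear_image) (auto simp: matrix_of_matrix_vector_mul dB)
  also have "\<dots> = (\<Prod>b\<in>Basis. (u - l) \<bullet> b)"
    using lu by (simp add: measure_lborel_box_eq inner_diff_left)
  finally show "emeasure (distr lborel lborel ((*v) A)) (box l u) = (\<Prod>b\<in>Basis. (u - l) \<bullet> b)" .
qed simp

text \<open>A matrix preserving an invertible form has determinant 1 or -1. The change of variables
  is carried out in the well-ordered copy of the index type and transported back.\<close>

lemma emeasure_lborel_linear_vimage:
  fixes A J :: "real^'n^'n"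
  assumes A: "transpose A ** J ** A = J" and J: "J ** J = mat 1" and N: "N \<in> sets borel"
  shows "emeasure lborel {x. A *v x \<in> N} = emeasure lborel N"
proof -
  have "wo_mat J ** wo_mat J = mat 1" by (simp add: wo_mat_mult J wo_mat_one)
  then have "det (wo_mat J) * det (wo_mat J) = 1" by (metis det_I det_mul)
  then have nz: "det (wo_mat J) \<noteq> 0" by auto
  have "transpose (wo_mat A) ** wo_mat J ** wo_mat A = wo_mat J"
    by (simp add: wo_mat_transpose[symmetric] wo_mat_mult A)
  then have "det (transpose (wo_mat A) ** wo_mat J ** wo_mat A) = det (wo_mat J)" by simp
  then have "det (wo_mat A) * det (wo_mat A) * det (wo_mat J) = det (wo_mat J)"
    by (simp add: det_mul det_transpose ac_simps)
  then have "(det (wo_mat A))\<^sup>2 = 1" using nz by (simp add: power2_eq_square)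
  then have d: "\<bar>det (wo_mat A)\<bar> = 1" by (auto simp: power2_eq_1_iff)
  define N' where "N' = wo_vec ` N"
  have pre: "wo_vec -` N' = N" unfolding N'_def using inj_wo_vec by (auto simp: inj_def)
  obtain g :: "real^('n wo) \<Rightarrow> real^'n" where g: "linear g" "g \<circ> wo_vec = id"
    using linear_injective_left_inverse[OF linear_wo_vec inj_wo_vec] by blast
  have gw: "g (wo_vec x) = x" for x using g(2) by (metis comp_eq_dest_lhs id_apply)
  have "N' = g -` N"
    unfolding N'_def using gw by (auto simp: image_iff) (metis surj_wo_vec surjD gw)
  then have N': "N' \<in> sets borel" using measurable_sets[OF borel_measurable_linear[OF g(1)] N] by simp
  have wm: "wo_vec \<in> measurable (lborel :: (real^'n) measure) lborel"
    using borel_measurable_linear[OF linear_wo_vec] by simp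
  have am: "(*v) (wo_mat A) \<in> measurable lborel lborel"
    using borel_measurable_linear[OF matrix_vector_mul_linear] by simp
  have "emeasure lborel N = emeasure (lborel :: (real^'n wo) measure) N'"
    using N' by (subst lborel_wo_vec[symmetric], subst emeasure_distr[OF wm]) (simp_all add: pre)
  also have "\<dots> = emeasure lborel ((*v) (wo_mat A) -` N')"
    using N' by (subst lborel_linear_abs_det_1[OF d, symmetric], subst emeasure_distr[OF am]) simp_all
  also have "\<dots> = emeasure lborel (wo_vec -` (*v) (wo_mat A) -` N')"
    using measurable_sets[OF am, of N'] N'
    by (subst lborel_wo_vec[symmetric], subst emeasure_distr[OF wm]) simp_all
  also have "wo_vec -` (*v) (wo_mat A) -` N' = {x. A *v x \<in> N}"
    by (auto simp: wo_mat_vec) (use pre in blast)+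
  finally show ?thesis by simp
qed

text \<open>Cover \<open>N\<close> by pieces, each consisting of the points that a given
  \<open>h\<close> moves into \<open>F\<close>. A piece keeps its measure under \<open>h\<close>,
  and the moved pieces are disjoint subsets of \<open>F\<close> because different translates of
  \<open>N\<close> do not meet.\<close>

lemma wandering_emeasure_le:
  fixes a :: "'h \<Rightarrow> 'b \<Rightarrow> 'b" and i :: "'h \<Rightarrow> 'h"
  assumes H: "countable H" and sp: "space M = UNIV"
    and N: "N \<in> sets M" and F: "F \<in> sets M"
    and a: "\<And>h. h \<in> H \<Longrightarrow> a h \<in> measurable M M"
    and pres: "\<And>h X. h \<in> H \<Longrightarrow> X \<in> sets M \<Longrightarrow> emeasure M (a h -` X) = emeasure M X"
    and i: "\<And>h. h \<in> H \<Longrightarrow> i h \<in> H" "\<And>h x. h \<in> H \<Longrightarrow> a h (a (i h) x) = x"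
    and cover: "\<And>x. x \<in> N \<Longrightarrow> \<exists>h\<in>H. a h x \<in> F"
    and disj: "\<And>h h' x. h \<in> H \<Longrightarrow> h' \<in> H \<Longrightarrow> a (i h) x \<in> N \<Longrightarrow> a (i h') x \<in> N \<Longrightarrow> h = h'"
  shows "emeasure M N \<le> emeasure M F"
proof (cases "H = {}")
  case True
  then have "N = {}" using cover by auto
  then show ?thesis by simp
next
  case False
  have vim: "a h -` X \<in> sets M" if "h \<in> H" "X \<in> sets M" for h X
    using measurable_sets[OF a[OF that(1)] that(2)] sp by simp
  \<comment> \<open>Numbers that encode no element of \<open>H\<close> get empty pieces, since
    \<open>from_nat_into\<close> also maps them into \<open>H\<close> and a piece would be counted
    more than once.\<close>
  define A where "A k = (if k \<in> to_nat_on H ` H then N \<inter> a (from_nat_into H k) -` F else {})" for k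
  define B where "B k = (if k \<in> to_nat_on H ` H then a (i (from_nat_into H k)) -` N \<inter> F else {})" for k
  have fH: "from_nat_into H k \<in> H" for k using False by (rule from_nat_into)
  have As: "A k \<in> sets M" and Bs: "B k \<in> sets M" for k
    using vim[OF fH F] vim[OF i(1)[OF fH] N] N F by (auto simp: A_def B_def)
  have AB: "emeasure M (A k) = emeasure M (B k)" for k
  proof (cases "k \<in> to_nat_on H ` H")
    case True
    have "a (i (from_nat_into H k)) -` A k = B k"
      using True i(2)[OF fH] by (auto simp: A_def B_def)
    then show ?thesis using pres[OF i(1)[OF fH] As] by metis
  qed (simp add: A_def B_def)
  have "disjoint_family B"
    unfolding disjoint_family_on_def
  proof (intro ballI impI)
    fix k l :: nat assume "k \<noteq> l"
    show "B k \<inter> B l = {}"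
    proof (rule ccontr)
      assume "B k \<inter> B l \<noteq> {}"
      then obtain x where x: "x \<in> B k" "x \<in> B l" by auto
      then have kl: "k \<in> to_nat_on H ` H" "l \<in> to_nat_on H ` H" by (auto simp: B_def split: if_splits)
      then have "from_nat_into H k = from_nat_into H l"
        using x by (intro disj[OF fH fH, of _ x]) (auto simp: B_def)
      then have "k = l" using kl H by (metis to_nat_on_from_nat_into)
      with \<open>k \<noteq> l\<close> show False by simp
    qed
  qed
  then have "(\<Sum>k. emeasure M (B k)) = emeasure M (\<Union>k. B k)"
    using Bs by (intro suminf_emeasure) auto
  also have "\<dots> \<le> emeasure M F" using F by (intro emeasure_mono) (auto simp: B_def)
  finally have B: "(\<Sum>k. emeasure M (B k)) \<le> emeasure M F" .
  have "N \<subseteq> (\<Union>k. A k)"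
  proof
    fix x assume x: "x \<in> N"
    then obtain h where "h \<in> H" "a h x \<in> F" using cover by blast
    then have "x \<in> A (to_nat_on H h)" using x H by (auto simp: A_def)
    then show "x \<in> (\<Union>k. A k)" by blast
  qed
  then have "emeasure M N \<le> emeasure M (\<Union>k. A k)" using As by (intro emeasure_mono) auto
  also have "\<dots> \<le> (\<Sum>k. emeasure M (A k))"
    using As by (intro emeasure_subadditive_countably) auto
  also have "\<dots> \<le> emeasure M F" using B by (simp add: AB)
  finally show ?thesis .
qed

lemma lborel_PiM_vec: "distr (Pi\<^sub>M UNIV (\<lambda>_. lborel)) borel (\<lambda>f. \<chi> i. f i) = (lborel :: (real^'n) measure)"
proof (rule lborel_eqI[symmetric])
  interpret product_sigma_finite "\<lambda>_::'n. lborel :: real measure" by standard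
  have m: "(\<lambda>f. \<chi> i. f i) \<in> measurable (Pi\<^sub>M (UNIV :: 'n set) (\<lambda>_. lborel)) (borel :: (real^'n) measure)"
    by (subst borel_measurable_euclidean_space) (auto simp: Basis_vec_def inner_axis)
  fix l u :: "real^'n" assume lu: "\<And>b. b \<in> Basis \<Longrightarrow> l \<bullet> b \<le> u \<bullet> b"
  have lu': "l $ i \<le> u $ i" for i
    using lu[of "axis i 1"] by (auto simp: Basis_vec_def inner_axis)
  have "(\<lambda>f. \<chi> i. f i) -` box l u \<inter> space (Pi\<^sub>M UNIV (\<lambda>_. lborel)) = Pi\<^sub>E UNIV (\<lambda>i. {l $ i <..< u $ i})"
    by (auto simp: space_PiM mem_box_vec PiE_def Pi_def)
  then have "emeasure (distr (Pi\<^sub>M UNIV (\<lambda>_. lborel)) borel (\<lambda>f. \<chi> i. f i)) (box l u) = (\<Prod>i\<in>UNIV. ennreal (u $ i - l $ i))"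
    using lu' by (subst emeasure_distr[OF m]) (auto simp: emeasure_PiM)
  also have "\<dots> = ennreal (\<Prod>i\<in>UNIV. (u - l) $ i)" using lu' by (simp add: prod_ennreal)
  finally show "emeasure (distr (Pi\<^sub>M UNIV (\<lambda>_. lborel)) borel (\<lambda>f. \<chi> i. f i)) (box l u) = (\<Prod>b\<in>Basis. (u - l) \<bullet> b)"
    by (simp add: prod_Basis_vec)
qed simp

section \<open>Invariance of Lebesgue measure under isometries of the form, and volumes as measures
  of cones\<close>

context dim_ge_4
begin

lemma emeasure_isoQ:
  assumes A: "isoQ (A :: 'n rmat)" and N: "N \<in> sets borel"
  shows "emeasure lborel {x. A *v x \<in> N} = emeasure lborel N"
proof -
  define J where "J = (matrix flat :: 'n rmat)"
  have J: "J *v x = flat x" for x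
    unfolding J_def using fun_cong[OF matrix_vector_mul(2)[OF linear_flat], of x] by simp
  have "transpose A ** J ** A = J"
  proof (subst matrix_eq, rule allI, rule vector_eq_ldot[THEN iffD1], rule allI)
    fix x y
    have "y \<bullet> ((transpose A ** J ** A) *v x) = (A *v y) \<bullet> flat (A *v x)"
      by (simp add: matrix_vector_mul_assoc[symmetric] J) (metis dot_lmul_matrix inner_commute)
    then show "y \<bullet> ((transpose A ** J ** A) *v x) = y \<bullet> (J *v x)"
      using isoQ_bq[OF A, of y x] by (simp add: bq_def J)
  qed
  moreover have "J ** J = mat 1" by (simp add: matrix_eq matrix_vector_mul_assoc[symmetric] J)
  ultimately show ?thesis using N by (rule emeasure_lborel_linear_vimage)
qed

definition cone_set :: "('n rvec) set \<Rightarrow> ('n rvec) set" where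
  "cone_set D = {x. 0 < x $ ix_last \<and> -1 < Q x \<and> x /\<^sub>R (x $ ix_last) \<in> D}"

lemma measurable_nth [measurable]: "(\<lambda>x :: 'n rvec. x $ i) \<in> borel_measurable borel"
  by (intro borel_measurable_continuous_onI continuous_intros)

lemma measurable_Q [measurable]: "(Q :: 'n rvec \<Rightarrow> real) \<in> borel_measurable borel"
  unfolding Q_def by measurable

lemma continuous_Q [continuous_intros]: "continuous_on S f \<Longrightarrow> continuous_on S (\<lambda>x. Q (f x :: 'n rvec))"
  unfolding Q_def by (intro continuous_intros)

lemma continuous_bq [continuous_intros]:
  "continuous_on S f \<Longrightarrow> continuous_on S g \<Longrightarrow> continuous_on S (\<lambda>x. bq (f x) (g x :: 'n rvec))"
  unfolding bq_alt by (intro continuous_intros)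

lemma continuous_proj [continuous_intros]:
  "continuous_on S f \<Longrightarrow> continuous_on S (\<lambda>x. proj (f x :: 'n rvec))"
  unfolding proj_def by (intro continuous_intros)

lemma cone_set_borel: "D \<in> sets borel \<Longrightarrow> cone_set D \<in> sets borel"
proof -
  assume [measurable]: "D \<in> sets borel"
  have m: "(\<lambda>x :: 'n rvec. x /\<^sub>R (x $ ix_last)) \<in> borel_measurable borel" by measurable
  have "(\<lambda>x :: 'n rvec. x /\<^sub>R (x $ ix_last)) -` D \<in> sets borel"
    using measurable_sets[OF m \<open>D \<in> sets borel\<close>] by simp
  moreover have "{x :: 'n rvec. 0 < x $ ix_last \<and> -1 < Q x} \<in> sets borel" by measurable
  moreover have "cone_set D = {x. 0 < x $ ix_last \<and> -1 < Q x} \<inter> (\<lambda>x. x /\<^sub>R (x $ ix_last)) -` D"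
    by (auto simp: cone_set_def)
  ultimately show ?thesis by auto
qed

lemma hyp_volume_UNIV:
  assumes "D \<in> sets borel"
  shows "hyp_volume UNIV D = of_nat CARD('n) * emeasure lborel (cone_set D)"
proof -
  have m: "(\<lambda>f. \<chi> i. f i) \<in> measurable (Pi\<^sub>M (UNIV :: 'n set) (\<lambda>_. lborel)) (borel :: ('n rvec) measure)"
    by (subst borel_measurable_euclidean_space) (auto simp: Basis_vec_def inner_axis)
  have "hyp_cone UNIV D = (\<lambda>f. \<chi> i. f i) -` cone_set D \<inter> space (Pi\<^sub>M UNIV (\<lambda>_. lborel))"
    by (auto simp: hyp_cone_def cone_set_def Let_def)
  then have "emeasure lborel (cone_set D) = emeasure (Pi\<^sub>M UNIV (\<lambda>_. lborel)) (hyp_cone UNIV D)"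
    using cone_set_borel[OF assms]
    by (subst lborel_PiM_vec[symmetric], subst emeasure_distr[OF m]) auto
  then show ?thesis by (simp add: hyp_volume_def)
qed

text \<open>Fubini in the second coordinate: the slab has twice the measure of the cone in the
  hyperplane. This trades volume in the hyperplane for Lebesgue measure on the space where the
  isometries act.\<close>

lemma hyp_volume_hyperplane_finite:
  assumes D: "D \<in> sets borel" and fin: "hyp_volume (UNIV - {ix_second :: 'n}) D < \<infinity>"
  shows "emeasure lborel {x. \<bar>x $ ix_second\<bar> \<le> 1 \<and> proj x \<in> cone_set D} < \<infinity>"
proof -
  let ?J = "UNIV - {ix_second :: 'n}"
  let ?v = "\<lambda>f. (\<chi> i. if i \<in> ?J then f i else 0) :: 'n rvec"
  interpret product_sigma_finite "\<lambda>_::'n. lborel :: real measure" by standard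
  let ?S = "{x. \<bar>x $ ix_second\<bar> \<le> 1 \<and> proj x \<in> cone_set D}"
  have pj: "proj (\<chi> i. f i) = ?v f" for f
    by (auto simp: proj_def vec_eq_iff e2_def axis_def)
  have "proj \<in> borel_measurable (borel :: ('n rvec) measure)"
    by (intro borel_measurable_linear linear_proj)
  from measurable_sets[OF this cone_set_borel[OF D]] have 1: "proj -` cone_set D \<in> sets borel" by simp
  have "{x :: 'n rvec. \<bar>x $ ix_second\<bar> \<le> 1} \<in> sets borel" by measurable
  then have S: "?S \<in> sets borel" using sets.Int[OF _ 1] by (simp add: vimage_def Collect_conj_eq)
  have m: "(\<lambda>f. \<chi> i. f i) \<in> measurable (Pi\<^sub>M (UNIV :: 'n set) (\<lambda>_. lborel)) (borel :: ('n rvec) measure)"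
    by (subst borel_measurable_euclidean_space) (auto simp: Basis_vec_def inner_axis)
  have "(\<lambda>f. if i \<in> ?J then f i else 0) \<in> borel_measurable (Pi\<^sub>M ?J (\<lambda>_. lborel))" for i
    by (cases "i \<in> ?J") auto
  then have v: "?v \<in> measurable (Pi\<^sub>M ?J (\<lambda>_. lborel)) borel"
    by (subst borel_measurable_euclidean_space) (auto simp: Basis_vec_def inner_axis)
  have hc: "hyp_cone ?J D = ?v -` cone_set D \<inter> space (Pi\<^sub>M ?J (\<lambda>_. lborel))"
    by (auto simp: hyp_cone_def cone_set_def Let_def)
  then have hcs: "hyp_cone ?J D \<in> sets (Pi\<^sub>M ?J (\<lambda>_. lborel))"
    using measurable_sets[OF v cone_set_borel[OF D]] by simp
  let ?T = "(\<lambda>f. \<chi> i. f i) -` ?S \<inter> space (Pi\<^sub>M (UNIV :: 'n set) (\<lambda>_. lborel))"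
  have T: "?T \<in> sets (Pi\<^sub>M UNIV (\<lambda>_. lborel))" using measurable_sets[OF m S] .
  have ins: "insert ix_second ?J = (UNIV :: 'n set)" by auto
  have "emeasure lborel ?S = emeasure (Pi\<^sub>M UNIV (\<lambda>_. lborel)) ?T"
    using S by (subst lborel_PiM_vec[symmetric], subst emeasure_distr[OF m]) auto
  also have "\<dots> = (\<integral>\<^sup>+f. indicator ?T f \<partial>Pi\<^sub>M (insert ix_second ?J) (\<lambda>_. lborel))"
    using T by (simp add: ins)
  also have "\<dots> = (\<integral>\<^sup>+f. (\<integral>\<^sup>+y. indicator ?T (f(ix_second := y)) \<partial>lborel) \<partial>Pi\<^sub>M ?J (\<lambda>_. lborel))"
    using T by (intro product_nn_integral_insert) (auto simp: ins)
  also have "\<dots> = (\<integral>\<^sup>+f. 2 * indicator (hyp_cone ?J D) f \<partial>Pi\<^sub>M ?J (\<lambda>_. lborel))"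
  proof (rule nn_integral_cong)
    fix f assume f: "f \<in> space (Pi\<^sub>M ?J (\<lambda>_. lborel :: real measure))"
    have vf: "?v (f(ix_second := y)) = ?v f" for y by (auto simp: vec_eq_iff)
    have "indicator ?T (f(ix_second := y)) = (indicator (hyp_cone ?J D) f * indicator {-1..1} y :: ennreal)" for y
    proof -
      have "f(ix_second := y) \<in> ?T \<longleftrightarrow> \<bar>y\<bar> \<le> 1 \<and> ?v f \<in> cone_set D"
        unfolding vimage_eq Int_iff mem_Collect_eq pj vf by (simp add: space_PiM)
      moreover have "f \<in> hyp_cone ?J D \<longleftrightarrow> ?v f \<in> cone_set D"
        unfolding hc Int_iff vimage_eq using f by blast
      ultimately show ?thesis unfolding indicator_def by (auto simp: abs_le_iff)
    qed
    then have "(\<integral>\<^sup>+y. indicator ?T (f(ix_second := y)) \<partial>lborel) = indicator (hyp_cone ?J D) f * 2"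
      by (simp add: nn_integral_cmult)
    then show "(\<integral>\<^sup>+y. indicator ?T (f(ix_second := y)) \<partial>lborel) = 2 * indicator (hyp_cone ?J D) f"
      by (simp add: mult.commute)
  qed
  also have "\<dots> = 2 * emeasure (Pi\<^sub>M ?J (\<lambda>_. lborel)) (hyp_cone ?J D)"
    using hcs by (simp add: nn_integral_cmult)
  also have "\<dots> < \<infinity>"
  proof -
    have "card ?J \<noteq> 0" using card_ge_4 by (simp add: card_Diff_singleton_if)
    moreover have "hyp_volume ?J D \<noteq> \<infinity>" using fin by auto
    ultimately have "emeasure (Pi\<^sub>M ?J (\<lambda>_. lborel)) (hyp_cone ?J D) \<noteq> \<infinity>"
      by (auto simp: hyp_volume_def ennreal_mult_eq_top_iff)
    then have "emeasure (Pi\<^sub>M ?J (\<lambda>_. lborel)) (hyp_cone ?J D) < \<infinity>"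
      by (simp add: less_top)
    then show ?thesis by (simp add: ennreal_mult_less_top)
  qed
  finally show ?thesis .
qed

section \<open>The future cone\<close>

definition future :: "'n rvec \<Rightarrow> bool" where
  "future x \<longleftrightarrow> Q x < 0 \<and> 0 < x $ ix_last"

lemma Q_last_0:
  assumes "x $ ix_last = 0" shows "Q (x :: 'n rvec) = (\<Sum>i\<in>UNIV - {ix_first, ix_last}. (x $ i)\<^sup>2)" "Q x \<ge> 0"
  using assms by (auto simp: Q_def intro: sum_nonneg)

lemma future_proj: "future x \<Longrightarrow> future (proj x)"
  using Q_proj[of x] zero_le_power2[of "x $ ix_second"] unfolding future_def proj_last by linarith

lemma bq_Q_diff: "2 * bq x y = Q x + Q y - Q (x - y :: 'n rvec)"
  by (simp add: Q_bq bq_commute)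

text \<open>Reversed Cauchy-Schwarz: scale both vectors to last coordinate 1. Their difference then
  has last coordinate 0, where \<open>Q\<close> is nonnegative, and \<open>bq_Q_diff\<close> gives
  the sign.\<close>

lemma bq_future:
  assumes "future x" "future y" shows "bq x y < 0"
proof -
  let ?x = "(1 / x $ ix_last) *\<^sub>R x" and ?y = "(1 / y $ ix_last) *\<^sub>R y"
  have p: "0 < x $ ix_last" "0 < y $ ix_last" "Q x < 0" "Q y < 0" using assms by (auto simp: future_def)
  have "Q (?x - ?y) \<ge> 0" by (rule Q_last_0) (use p in simp)
  moreover have "Q ?x < 0" "Q ?y < 0" using p by (auto simp: Q_scaleR mult_pos_neg divide_neg_pos)
  ultimately have "bq ?x ?y < 0" using bq_Q_diff[of ?x ?y] by linarith
  then show ?thesis using p by (simp add: divide_less_0_iff mult_less_0_iff zero_less_mult_iff)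
qed

lemma future_iff_bq:
  assumes "future y" "Q x < 0" shows "future x \<longleftrightarrow> bq x y < 0"
proof
  assume b: "bq x y < 0"
  have "x $ ix_last \<noteq> 0" using assms(2) Q_last_0(2)[of x] by auto
  moreover have "\<not> x $ ix_last < 0"
  proof
    assume "x $ ix_last < 0"
    then have "future (- x)" using assms(2) Q_scaleR[of "-1" x] by (simp add: future_def)
    from bq_future[OF this assms(1)] b show False by simp
  qed
  ultimately show "future x" using assms(2) by (simp add: future_def)
qed (rule bq_future, use assms in auto)

text \<open>Here the signature \<open>(d, 1)\<close> enters. With both last coordinates scaled to 1,
  \<open>Q\<close> is nonnegative on the difference, and by orthogonality its value there is the sum
  of the two values of \<open>Q\<close>.\<close>

lemma Q_pos_orthogonal:
  assumes y: "Q y < 0" and w: "bq w y = 0" "w \<noteq> 0" shows "Q (w :: 'n rvec) > 0"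
proof (cases "w $ ix_last = 0")
  case True
  show ?thesis
  proof (rule ccontr)
    assume "\<not> Q w > 0"
    then have "(\<Sum>i\<in>UNIV - {ix_first, ix_last}. (w $ i)\<^sup>2) = 0"
      using Q_last_0[OF True] by simp
    then have mid: "w $ i = 0" if "i \<noteq> ix_first" "i \<noteq> ix_last" for i
      using that by (subst (asm) sum_nonneg_eq_0_iff) auto
    then have "bq w y = - w $ ix_first * y $ ix_last"
      using True by (simp add: bq_alt)
    moreover have "y $ ix_last \<noteq> 0" using y Q_last_0(2)[of y] by auto
    ultimately have "w $ ix_first = 0" using w by simp
    with mid True have "w = 0" by (metis vec_eq_iff zero_index)
    with w show False by simp
  qed
next
  case False
  have yl: "y $ ix_last \<noteq> 0" using y Q_last_0(2)[of y] by auto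
  let ?w = "(1 / w $ ix_last) *\<^sub>R w" and ?y = "(1 / y $ ix_last) *\<^sub>R y"
  have "Q (?w - ?y) \<ge> 0" by (rule Q_last_0) (use False yl in simp)
  moreover have "bq ?w ?y = 0" using w by simp
  moreover have "Q ?y < 0" using y yl by (simp add: Q_scaleR mult_pos_neg)
  ultimately have "Q ?w > 0" using bq_Q_diff[of ?w ?y] by linarith
  then show ?thesis using False by (simp add: Q_scaleR zero_less_mult_iff)
qed

end

section \<open>Recurrence of the geodesic flow\<close>

context dim_ge_4
begin

text \<open>The isometries of \<open>Q\<close> that preserve the hyperplane where the second
  coordinate vanishes, and with it the normal line.\<close>

definition adm :: "'n rmat \<Rightarrow> bool" where
  "adm A \<longleftrightarrow> isoQ A \<and> (\<forall>x. proj (A *v x) = A *v proj x)"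

text \<open>For \<open>z\<close> in the hyperplane, this is the point reflection in \<open>z\<close> of the hyperplane, extended by the
  identity on its normal.\<close>

definition Rm :: "'n rvec \<Rightarrow> 'n rmat" where
  "Rm z = (2 / Q z) *\<^sub>R ot z z - mat 1 + 2 *\<^sub>R ot e2 e2"

lemma Rm_vec: "Rm z *v x = (2 * bq z x / Q z) *\<^sub>R z - x + (2 * x $ ix_second) *\<^sub>R e2"
  by (simp add: Rm_def matrix_vector_mult_diff_rdistrib matrix_vector_mult_add_rdistrib
      scaleR_matrix_vector_assoc[symmetric])

lemma proj_add: "proj (x + y) = proj x + proj (y :: 'n rvec)"
  and proj_diff: "proj (x - y) = proj x - proj (y :: 'n rvec)"
  and proj_scaleR: "proj (c *\<^sub>R x) = c *\<^sub>R proj (x :: 'n rvec)"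
  by (auto simp: proj_def algebra_simps)

lemma proj_e2: "proj e2 = (0 :: 'n rvec)"
  by (simp add: proj_def)

lemma proj_proj: "proj (proj x) = proj (x :: 'n rvec)"
  by (simp add: proj_eq_self)

lemma bq_proj2: "bq (proj x) (proj y) = bq (proj x) (y :: 'n rvec)"
  by (simp add: bq_commute[of "proj x"] bq_proj)

text \<open>For \<open>Q z = 0\<close> the quotient \<open>2 / Q z\<close> is 0 and
  \<open>Rm z\<close> is minus the identity on the hyperplane, still an isometry. Hence all fibre
  maps of \<open>tau\<close> are isometries, also outside the cone.\<close>

lemma adm_Rm:
  assumes z: "z $ ix_second = 0" shows "adm (Rm z)"
  unfolding adm_def isoQ_def
proof (intro conjI allI)
  fix x
  have pz: "proj z = z" using z by (rule proj_eq_self)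
  show "proj (Rm z *v x) = Rm z *v proj x"
    using bq_proj[OF z, of x] by (simp add: Rm_vec proj_add proj_diff proj_scaleR proj_e2 pz bq_commute[of z])
  have bz: "bq x z = bq z x" by (rule bq_commute)
  show "Q (Rm z *v x) = Q x"
  proof (cases "Q z = 0")
    case True
    then show ?thesis by (simp add: Rm_vec Q_bq bq_commute algebra_simps power2_eq_square)
  next
    case False
    then have "bq z z \<noteq> 0" by (simp add: Q_bq)
    then show ?thesis using z by (simp add: Rm_vec Q_bq bz field_simps power2_eq_square)
  qed
qed

lemma adm_isoQ: "adm A \<Longrightarrow> isoQ A"
  and adm_proj: "adm A \<Longrightarrow> proj (A *v x) = A *v proj x"
  by (auto simp: adm_def)

lemma adm_e2:
  assumes A: "adm A"
  obtains c where "c\<^sup>2 = 1" "A *v e2 = c *\<^sub>R e2" "\<And>x. (A *v x) $ ix_second = c * x $ ix_second"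
proof -
  define c where "c = (A *v e2) $ ix_second"
  have "proj (A *v e2) = 0" using adm_proj[OF A, of e2] by (simp add: proj_e2)
  then have e: "A *v e2 = c *\<^sub>R e2" by (simp add: proj_def c_def)
  have "Q (A *v e2) = Q (e2 :: 'n rvec)" using A by (simp add: adm_def isoQ_def)
  then have c1: "c\<^sup>2 = 1" by (simp add: e Q_scaleR Q_bq power2_eq_square)
  have "(A *v x) $ ix_second = c * x $ ix_second" for x
  proof -
    have "bq (A *v x) (A *v e2) = bq x e2" by (rule isoQ_bq[OF adm_isoQ[OF A]])
    then have "c * (A *v x) $ ix_second = x $ ix_second" by (simp add: e)
    then have "(c * c) * (A *v x) $ ix_second = c * x $ ix_second" by (simp only: mult.assoc)
    moreover have cc: "c * c = 1" using c1 by (simp add: power2_eq_square)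
    ultimately show ?thesis unfolding cc by simp
  qed
  with c1 e that show ?thesis by blast
qed

lemma adm_abs_second: "adm A \<Longrightarrow> \<bar>(A *v x) $ ix_second\<bar> = \<bar>x $ ix_second\<bar>"
  by (erule adm_e2) (auto simp: power2_eq_1_iff)

lemma adm_mult: "adm A \<Longrightarrow> adm B \<Longrightarrow> adm (A ** B)"
  by (simp add: adm_def isoQ_mult matrix_vector_mul_assoc[symmetric])

lemma adm_one: "adm (mat 1)"
  by (simp add: adm_def isoQ_def)

lemma Rm_equivariant:
  assumes A: "adm A"
  shows "Rm (A *v z) *v (A *v x) = A *v (Rm z *v x)"
proof -
  obtain c where c: "A *v e2 = c *\<^sub>R e2" "\<And>x. (A *v x) $ ix_second = c * x $ ix_second"
    using adm_e2[OF A] by metis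
  have "Q (A *v z) = Q z" using A by (simp add: adm_def isoQ_def)
  then show ?thesis
    by (simp add: Rm_vec isoQ_bq[OF adm_isoQ[OF A]] c matrix_vector_mult_diff_distrib
        matrix_vector_right_distrib matrix_vector_mult_scaleR)
qed

lemma Rm_self: "Q (proj x) \<noteq> 0 \<Longrightarrow> Rm (proj x) *v x = x"
proof -
  assume nz: "Q (proj x) \<noteq> 0"
  have "bq (proj x) x = Q (proj x)" using bq_proj2[of x x] by (simp add: Q_bq)
  with nz have "Rm (proj x) *v x = 2 *\<^sub>R proj x - x + (2 * x $ ix_second) *\<^sub>R e2"
    by (simp add: Rm_vec)
  also have "\<dots> = x" by (simp add: proj_def scaleR_2 scaleR_right_diff_distrib)
  finally show ?thesis .
qed

definition pm :: "'n rmat \<Rightarrow> 'n rvec \<times> 'n rvec \<Rightarrow> 'n rvec \<times> 'n rvec" where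
  "pm A p = (A *v fst p, A *v snd p)"

text \<open>One step of a discrete geodesic flow: a pair stands for the geodesic through the
  projections of its two points to the hyperplane, and \<open>tau\<close> advances along it by their
  distance.\<close>

definition tau :: "'n rvec \<times> 'n rvec \<Rightarrow> 'n rvec \<times> 'n rvec" where
  "tau p = (snd p, Rm (proj (snd p)) *v fst p)"

text \<open>A product of two point reflections is the translation by twice the distance of the
  points. Two steps of \<open>tau\<close> move a pair by its own translation; a single step is not
  given by one isometry in this way.\<close>

definition hh :: "'n rvec \<times> 'n rvec \<Rightarrow> 'n rmat" where
  "hh p = Rm (proj (snd p)) ** Rm (proj (fst p))"

definition sg :: "'n rvec \<times> 'n rvec \<Rightarrow> 'n rvec \<times> 'n rvec" where
  "sg p = tau (tau p)"

primrec mpow :: "'n rmat \<Rightarrow> nat \<Rightarrow> 'n rmat" where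
  "mpow A 0 = mat 1"
| "mpow A (Suc k) = mpow A k ** A"

lemma pm_mult: "pm A (pm B p) = pm (A ** B) p"
  by (simp add: pm_def matrix_vector_mul_assoc)

lemma pm_one: "pm (mat 1) p = p"
  by (simp add: pm_def)

lemma tau_pm: "adm A \<Longrightarrow> tau (pm A p) = pm A (tau p)"
  by (simp add: tau_def pm_def adm_proj Rm_equivariant)

lemma sg_pm: "adm A \<Longrightarrow> sg (pm A p) = pm A (sg p)"
  by (simp add: sg_def tau_pm)

lemma sg_pow_pm: "adm A \<Longrightarrow> (sg ^^ k) (pm A p) = pm A ((sg ^^ k) p)"
  by (induction k) (auto simp: sg_pm)

lemma adm_hh: "adm (hh p)"
  by (simp add: hh_def adm_mult adm_Rm)

lemma adm_mpow: "adm A \<Longrightarrow> adm (mpow A k)"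
  by (induction k) (auto simp: adm_one adm_mult)

lemma sg_eq:
  assumes "Q (proj (fst p)) \<noteq> 0" "Q (proj (snd p)) \<noteq> 0"
  shows "sg p = pm (hh p) p"
proof -
  let ?x = "fst p" and ?y = "snd p"
  let ?A = "Rm (proj ?y)"
  have A: "adm ?A" by (simp add: adm_Rm)
  have "Rm (proj (?A *v ?x)) *v ?y = Rm (?A *v proj ?x) *v (?A *v ?y)"
    using assms(2) by (simp add: Rm_self adm_proj[OF A])
  also have "\<dots> = ?A *v (Rm (proj ?x) *v ?y)" by (rule Rm_equivariant[OF A])
  finally show ?thesis
    using assms(1) by (simp add: sg_def tau_def pm_def hh_def matrix_vector_mul_assoc[symmetric] Rm_self)
qed

lemma sg_pow:
  assumes "Q (proj (fst p)) \<noteq> 0" "Q (proj (snd p)) \<noteq> 0"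
  shows "(sg ^^ k) p = pm (mpow (hh p) k) p"
proof (induction k)
  case (Suc k)
  then show ?case
    using sg_pm[OF adm_mpow[OF adm_hh], of p k p] sg_eq[OF assms] by (simp add: pm_mult)
qed (simp add: pm_one)

text \<open>A region invariant under \<open>tau\<close> and, as will be shown, of finite measure
  modulo a lattice. The last condition bounds the distance of the two projected points: its
  hyperbolic cosine is less than 2.\<close>

definition EE :: "('n rvec \<times> 'n rvec) set" where
  "EE = {p. \<bar>fst p $ ix_second\<bar> < 1 \<and> \<bar>snd p $ ix_second\<bar> < 1 \<and>
     Q (proj (fst p)) < 0 \<and> 0 < fst p $ ix_last \<and> Q (proj (snd p)) < 0 \<and> 0 < snd p $ ix_last \<and>
     -1 < Q (proj (fst p)) \<and> -1 < Q (proj (snd p)) \<and>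
     (bq (proj (fst p)) (proj (snd p)))\<^sup>2 < 4 * (Q (proj (fst p)) * Q (proj (snd p)))}"

lemma EE_future: "p \<in> EE \<Longrightarrow> future (proj (fst p))" "p \<in> EE \<Longrightarrow> future (proj (snd p))"
  by (auto simp: EE_def future_def)

lemma open_EE: "open EE"
  unfolding EE_def by (intro open_Collect_conj open_Collect_less continuous_intros)

lemma Q_isoQ: "isoQ A \<Longrightarrow> Q (A *v x) = Q x"
  by (simp add: isoQ_def)

lemma EE_pm:
  assumes A: "adm A" and fut: "\<And>x. future x \<Longrightarrow> future (A *v x)" and p: "p \<in> EE"
  shows "pm A p \<in> EE"
proof -
  have "future (A *v proj (fst p))" "future (A *v proj (snd p))" using fut EE_future[OF p] by auto
  then have "0 < (A *v fst p) $ ix_last" "0 < (A *v snd p) $ ix_last"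
    using adm_proj[OF A, symmetric] by (auto simp: future_def)
  then show ?thesis
    using p A by (auto simp: EE_def pm_def adm_abs_second adm_proj Q_isoQ adm_isoQ isoQ_bq)
qed

text \<open>The reflection fixes the projection of the second point, and whether a timelike vector
  is in the future cone can be read off from \<open>bq\<close> with that point.\<close>

lemma tau_EE: "tau p \<in> EE \<longleftrightarrow> p \<in> EE"
proof (cases "future (proj (snd p)) \<and> Q (proj (fst p)) < 0")
  case True
  let ?A = "Rm (proj (snd p))"
  have A: "adm ?A" by (simp add: adm_Rm)
  have self: "?A *v proj (snd p) = proj (snd p)"
    using Rm_self[of "proj (snd p)"] True by (simp add: proj_proj future_def)
  have b: "bq (proj (snd p)) (?A *v proj (fst p)) = bq (proj (fst p)) (proj (snd p))"
    using isoQ_bq[OF adm_isoQ[OF A], of "proj (snd p)" "proj (fst p)"] by (simp add: self bq_commute)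
  have "future (?A *v proj (fst p)) \<longleftrightarrow> future (proj (fst p))"
    using True b future_iff_bq[of "proj (snd p)" "proj (fst p)"] future_iff_bq[of "proj (snd p)" "?A *v proj (fst p)"]
    by (simp add: Q_isoQ[OF adm_isoQ[OF A]] bq_commute)
  then have "0 < (?A *v fst p) $ ix_last \<longleftrightarrow> 0 < fst p $ ix_last"
    using True Q_isoQ[OF adm_isoQ[OF A], of "proj (fst p)"]
      by (simp add: future_def adm_proj[OF A, symmetric])
  then show ?thesis
    using b
      by (auto simp: EE_def tau_def adm_abs_second[OF A] adm_proj[OF A] Q_isoQ[OF adm_isoQ[OF A]] mult.commute)
next
  case False
  then show ?thesis
    by (auto simp: EE_def tau_def future_def adm_proj[OF adm_Rm] Q_isoQ[OF adm_isoQ[OF adm_Rm]])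
qed

lemma sg_pow_EE: "(sg ^^ k) p \<in> EE \<longleftrightarrow> p \<in> EE"
  by (induction k) (auto simp: sg_def tau_EE)

lemma tau_alt: "tau = (\<lambda>p. (snd p, (2 * bq (proj (snd p)) (fst p) / Q (proj (snd p))) *\<^sub>R proj (snd p)
    - fst p + (2 * fst p $ ix_second) *\<^sub>R e2))"
  by (auto simp: tau_def Rm_vec)

lemma tau_continuous: "continuous_on EE tau"
  unfolding tau_alt by (intro continuous_intros) (auto simp: EE_def)

lemma sg_pow_continuous: "continuous_on EE (sg ^^ k)"
proof (induction k)
  case (Suc k)
  have "continuous_on EE sg"
    unfolding sg_def[abs_def]
      by (rule continuous_on_compose2[OF tau_continuous tau_continuous]) (auto simp: tau_EE)
  then have "continuous_on EE (\<lambda>p. sg ((sg ^^ k) p))"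
    by (rule continuous_on_compose2[OF _ Suc]) (auto simp: sg_pow_EE)
  then show ?case by (simp add: o_def)
qed (simp add: continuous_on_id id_def)

lemma continuous_mult_vec [continuous_intros]:
  "continuous_on S f \<Longrightarrow> continuous_on S (\<lambda>x. (A :: 'n rmat) *v f x)"
  by (rule bounded_linear.continuous_on[OF matrix_vector_mul_bounded_linear])

lemma pm_continuous: "continuous_on S (pm A)"
  unfolding pm_def[abs_def] by (intro continuous_intros)

subsection \<open>Invariant measures\<close>

text \<open>Fubini: for each fixed second point the fibre map is a single isometry and preserves the
  measure. That it varies with the second point does no harm.\<close>

lemma skew_emeasure:
  fixes B :: "'n rvec \<Rightarrow> 'n rmat"
  assumes B: "\<And>y. isoQ (B y)"
    and m: "(\<lambda>p. (snd p, B (snd p) *v fst p)) \<in> borel_measurable borel"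
      and N: "N \<in> sets borel"
  shows "emeasure lborel ((\<lambda>p. (snd p, B (snd p) *v fst p)) -` N) = emeasure lborel (N :: ('n rvec \<times> 'n rvec) set)"
proof -
  let ?T = "\<lambda>p. (snd p, B (snd p) *v fst p)"
  have TN: "?T -` N \<in> sets (lborel \<Otimes>\<^sub>M lborel)"
    using measurable_sets[OF m N] unfolding lborel_prod by simp
  have N': "N \<in> sets (lborel \<Otimes>\<^sub>M lborel)" using N unfolding lborel_prod by simp
  have "emeasure lborel (?T -` N) = (\<integral>\<^sup>+y. emeasure lborel ((\<lambda>x. (x, y)) -` (?T -` N)) \<partial>lborel)"
    using lborel_pair.emeasure_pair_measure_alt2[OF TN] by (simp add: lborel_prod)
  also have "\<dots> = (\<integral>\<^sup>+y. emeasure lborel (Pair y -` N) \<partial>lborel)"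
  proof (rule nn_integral_cong)
    fix y
    have "(\<lambda>x. (x, y)) -` (?T -` N) = {x. B y *v x \<in> Pair y -` N}" by auto
    moreover have "Pair y -` N \<in> sets borel" using sets_Pair1[OF N'] by simp
    ultimately show "emeasure lborel ((\<lambda>x. (x, y)) -` (?T -` N)) = emeasure lborel (Pair y -` N)"
      using emeasure_isoQ[OF B] by (simp only:)
  qed
  also have "\<dots> = emeasure lborel N"
    using lborel.emeasure_pair_measure_alt[OF N'] by (simp add: lborel_prod)
  finally show ?thesis .
qed

lemma tau_borel: "tau \<in> borel_measurable borel"
proof -
  have p: "(proj :: 'n rvec \<Rightarrow> _) \<in> borel_measurable borel"
    by (intro borel_measurable_linear linear_proj)
  have [measurable]: "(\<lambda>p. proj (snd p)) \<in> borel_measurable (borel :: ('n rvec \<times> 'n rvec) measure)"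
    by (intro borel_measurable_continuous_onI continuous_intros)
  have [measurable]: "(\<lambda>p. bq (proj (snd p)) (fst p)) \<in> borel_measurable (borel :: ('n rvec \<times> 'n rvec) measure)"
    by (intro borel_measurable_continuous_onI continuous_intros)
  have [measurable]: "(\<lambda>p. Q (proj (snd p))) \<in> borel_measurable (borel :: ('n rvec \<times> 'n rvec) measure)"
    by (intro borel_measurable_continuous_onI continuous_intros)
  have [measurable]: "(\<lambda>p. fst p $ ix_second) \<in> borel_measurable (borel :: ('n rvec \<times> 'n rvec) measure)"
    by (intro borel_measurable_continuous_onI continuous_intros)
  have [measurable]: "fst \<in> borel_measurable (borel :: ('n rvec \<times> 'n rvec) measure)"
    by (intro borel_measurable_continuous_onI continuous_intros)
  have [measurable]: "snd \<in> borel_measurable (borel :: ('n rvec \<times> 'n rvec) measure)"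
    by (intro borel_measurable_continuous_onI continuous_intros)
  show ?thesis unfolding tau_alt by (intro borel_measurable_Pair) measurable
qed

lemma tau_emeasure:
  assumes "N \<in> sets borel" shows "emeasure lborel (tau -` N) = emeasure lborel N"
  unfolding tau_def[abs_def]
  by (rule skew_emeasure[where B = "\<lambda>y. Rm (proj y)"])
    (use assms tau_borel in \<open>auto simp: tau_def[abs_def] adm_isoQ adm_Rm\<close>)

lemma sg_pow_emeasure:
  assumes N: "N \<in> sets borel"
  shows "(sg ^^ k) -` N \<in> sets borel \<and> emeasure lborel ((sg ^^ k) -` N) = emeasure lborel N"
proof (induction k)
  case (Suc k)
  let ?X = "(sg ^^ k) -` N"
  have 1: "tau -` ?X \<in> sets borel" using measurable_sets[OF tau_borel, of ?X] Suc by simp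
  then have 2: "tau -` (tau -` ?X) \<in> sets borel"
    using measurable_sets[OF tau_borel, of "tau -` ?X"] by simp
  have eq: "(sg ^^ Suc k) -` N = tau -` (tau -` ?X)"
    unfolding funpow_Suc_right by (auto simp: sg_def)
  show ?case unfolding eq using 1 2 Suc by (simp add: tau_emeasure)
qed (use N in simp)

lemma pm_borel: "pm A \<in> borel_measurable borel"
  by (intro borel_measurable_continuous_onI pm_continuous)

lemma pm_emeasure:
  assumes A: "isoQ A" and N: "N \<in> sets borel"
  shows "emeasure lborel (pm A -` N) = emeasure lborel N"
proof -
  let ?T = "\<lambda>p. (snd p, A *v fst p)"
  have m: "?T \<in> borel_measurable borel"
    by (intro borel_measurable_continuous_onI continuous_intros)
  have s: "?T -` N \<in> sets borel" using measurable_sets[OF m N] by simp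
  have "pm A -` N = ?T -` (?T -` N)" by (auto simp: pm_def)
  then show ?thesis
    using skew_emeasure[of "\<lambda>_. A", OF A m s] skew_emeasure[of "\<lambda>_. A", OF A m N] by simp
qed

text \<open>By homogeneity it is enough to bound the measure at one point \<open>o'\<close>, where
  the set is bounded.\<close>

lemma finite_fibre_measure:
  "\<exists>C < \<infinity>. \<forall>x. future x \<longrightarrow> x $ ix_second = 0 \<longrightarrow>
     emeasure lborel {y. \<bar>y $ ix_second\<bar> \<le> 1 \<and> -1 < Q (proj y) \<and> Q (proj y) < 0 \<and>
        (bq x (proj y))\<^sup>2 < 4 * (Q x * Q (proj y))} \<le> C"
proof -
  define Y where "Y x = {y. \<bar>y $ ix_second\<bar> \<le> 1 \<and> -1 < Q (proj y) \<and> Q (proj y) < 0 \<and>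
        (bq x (proj y))\<^sup>2 < 4 * (Q x * Q (proj y))}" for x :: "'n rvec"
  define o' :: "'n rvec" where "o' = axis ix_first 1 + axis ix_last 1"
  have on: "o' $ ix_first = 1" "o' $ ix_last = 1" "o' $ i = 0"
    if "i \<noteq> ix_first" "i \<noteq> ix_last" for i
    using that by (auto simp: o'_def axis_def)
  have on: "o' $ ix_first = 1" "o' $ ix_last = 1" "\<And>i. i \<noteq> ix_first \<Longrightarrow> i \<noteq> ix_last \<Longrightarrow> o' $ i = 0"
    by (auto simp: o'_def axis_def)
  have bo: "bq o' y = - (y $ ix_first + y $ ix_last)" for y
    by (simp add: bq_alt on)
  have Qo: "Q o' = -2" by (simp add: Q_bq bo on)
  have Ys: "Y x \<in> sets borel" for x
  proof -
    have [measurable]: "proj \<in> borel_measurable (borel :: ('n rvec) measure)"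
      by (intro borel_measurable_linear linear_proj)
    have [measurable]: "(\<lambda>y. bq x (proj y)) \<in> borel_measurable borel"
      by (intro borel_measurable_continuous_onI continuous_intros)
    show ?thesis unfolding Y_def by measurable
  qed
  \<comment> \<open>The bound on \<open>bq o' (proj y)\<close> controls the sum of the first and the
    last coordinate, and \<open>Q y < 1\<close> then controls the norm.\<close>
  have "bounded (Y o')"
  proof (rule boundedI)
    fix y assume y: "y \<in> Y o'"
    let ?a = "y $ ix_first" and ?b = "y $ ix_last"
    let ?I = "UNIV - {ix_first, ix_last :: 'n}"
    have s: "(y $ ix_second)\<^sup>2 \<le> 1"
      using y by (simp add: Y_def abs_le_square_iff[of _ 1, simplified])
    have "(bq o' (proj y))\<^sup>2 < - 8 * Q (proj y)" "-1 < Q (proj y)" using y by (simp_all add: Y_def Qo)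
    moreover have "(bq o' (proj y))\<^sup>2 = (?a + ?b)\<^sup>2"
      unfolding bo proj_first proj_last by (rule power2_minus)
    ultimately have ab: "(?a + ?b)\<^sup>2 < 8" by linarith
    have Qy: "Q y < 1" using y s Q_proj[of y] by (simp add: Y_def)
    have mid: "(\<Sum>i\<in>?I. (y $ i)\<^sup>2) < 1 + 2 * ?a * ?b" using Qy by (simp add: Q_def)
    have "0 \<le> (\<Sum>i\<in>?I. (y $ i)\<^sup>2)" by (rule sum_nonneg) simp
    have "norm y ^ 2 = (\<Sum>i\<in>UNIV. (y $ i)\<^sup>2)"
      by (simp add: norm_vec_def L2_set_def sum_nonneg)
    also have "\<dots> = ?a\<^sup>2 + ?b\<^sup>2 + (\<Sum>i\<in>?I. (y $ i)\<^sup>2)"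
      by (subst sum.subset_diff[of "{ix_first, ix_last}"]) auto
    also have "\<dots> < ?a\<^sup>2 + ?b\<^sup>2 + (1 + 2 * ?a * ?b)" using mid by simp
    also have "\<dots> = (?a + ?b)\<^sup>2 + 1" by (simp add: power2_eq_square algebra_simps)
    also have "\<dots> < 3\<^sup>2" using ab by simp
    finally have "norm y ^ 2 \<le> 3 ^ 2" by (rule less_imp_le)
    then show "norm y \<le> 3" by (rule power2_le_imp_le) simp
  qed
  then have fin: "emeasure lborel (Y o') < \<infinity>"
    by (rule emeasure_bounded_finite)
  have "emeasure lborel (Y x) \<le> emeasure lborel (Y o')" if x: "future x" "x $ ix_second = 0" for x
  proof -
    have Qx: "Q x < 0" using x by (simp add: future_def)
    \<comment> \<open>\<open>c\<close> scales \<open>x\<close> to the value \<open>-2\<close> that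
      \<open>Q\<close> takes at \<open>o'\<close>. Then \<open>z\<close> points to the midpoint of
      the two, and the reflection \<open>Rm z\<close> exchanges them.\<close>
    define c where "c = sqrt (2 / (- Q x))"
    have c: "c > 0" "c\<^sup>2 * Q x = -2" using Qx by (auto simp: c_def field_simps)
    define z where "z = c *\<^sub>R x + o'"
    have "future o'" by (simp add: future_def Qo on)
    then have b: "bq (c *\<^sub>R x) o' < 0" using bq_future[OF x(1)] c by (simp add: mult_pos_neg)
    have zs: "z $ ix_second = 0" using x on by (simp add: z_def)
    have Qz: "Q z = 2 * bq (c *\<^sub>R x) o' - 4" using c by (simp only: z_def Q_add Q_scaleR Qo)
    have "bq z (c *\<^sub>R x) = bq (c *\<^sub>R x) o' - 2"
      using c by (simp add: z_def bq_commute[of o'] Q_bq[symmetric] power2_eq_square mult.assoc distrib_left)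
    then have "2 * bq z (c *\<^sub>R x) / Q z = 1" using Qz b by (simp add: field_simps)
    then have "Rm z *v (c *\<^sub>R x) = 1 *\<^sub>R z - c *\<^sub>R x + (2 * (c *\<^sub>R x) $ ix_second) *\<^sub>R e2"
      by (simp only: Rm_vec)
    also have "\<dots> = o'" using x by (simp add: z_def)
    finally have Rz: "Rm z *v (c *\<^sub>R x) = o'" .
    have A: "adm (Rm z)" by (rule adm_Rm[OF zs])
    have "Y x \<subseteq> {y. Rm z *v y \<in> Y o'}"
    proof
      fix y assume y: "y \<in> Y x"
      have "bq o' (Rm z *v proj y) = bq (Rm z *v (c *\<^sub>R x)) (Rm z *v proj y)" by (simp only: Rz)
      also have "\<dots> = c * bq x (proj y)" by (simp only: isoQ_bq[OF adm_isoQ[OF A]] bq_linear)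
      finally have "(bq o' (Rm z *v proj y))\<^sup>2 = c\<^sup>2 * (bq x (proj y))\<^sup>2"
        by (simp add: power_mult_distrib)
      also have "\<dots> < c\<^sup>2 * (4 * (Q x * Q (proj y)))" using y c by (simp add: Y_def)
      also have "\<dots> = 4 * ((c\<^sup>2 * Q x) * Q (proj y))" by (simp only: ac_simps)
      also have "\<dots> = 4 * (Q o' * Q (proj y))" by (simp only: c(2) Qo)
      finally show "y \<in> {y. Rm z *v y \<in> Y o'}"
        using y by (simp add: Y_def adm_abs_second[OF A] adm_proj[OF A] Q_isoQ[OF adm_isoQ[OF A]])
    qed
    moreover have "{y. Rm z *v y \<in> Y o'} \<in> sets borel"
    proof -
      have "(*v) (Rm z) \<in> borel_measurable borel"
        by (intro borel_measurable_linear matrix_vector_mul_linear)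
      from measurable_sets[OF this Ys[of o']] show ?thesis by (simp add: vimage_def)
    qed
    ultimately have "emeasure lborel (Y x) \<le> emeasure lborel {y. Rm z *v y \<in> Y o'}"
      by (intro emeasure_mono) auto
    then show ?thesis using emeasure_isoQ[OF adm_isoQ[OF A] Ys] by simp
  qed
  with fin show ?thesis unfolding Y_def by blast
qed

end

section \<open>Density of lattices of the hyperplane\<close>

definition nrm :: "real^'n::{finite,linorder} \<Rightarrow> real^'n::_" where
  "nrm z = z /\<^sub>R (z $ ix_last)"

lemma emeasure_open_pos:
  fixes N :: "'a::euclidean_space set"
  assumes "open N" "x \<in> N" shows "emeasure lborel N > 0"
proof -
  obtain a b where "x \<in> box a b" "box a b \<subseteq> N"
    using open_contains_box assms by (metis)
  then have "emeasure lborel (box a b) \<le> emeasure lborel N" using assms by (intro emeasure_mono) auto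
  moreover have "emeasure lborel (box a b) > 0"
    using \<open>x \<in> box a b\<close>
      by (subst emeasure_lborel_box) (auto simp: mem_box prod_pos inner_diff_left intro!: prod_pos less_imp_le dest: less_trans)
  ultimately show ?thesis by (rule less_le_trans[rotated])
qed

text \<open>A lattice of the hyperplane in terms of matrices. The assumption \<open>disc\<close>
  combines freeness and discreteness of the action; \<open>D0\<close> meets every orbit, and its
  volume is measured by the slab over the cone on it.\<close>

locale hyperplane_lattice = dim_ge_4 dim_type
  for dim_type :: "'n::{finite,linorder} itself" +
  fixes L :: "('n rmat) set" and D0 :: "('n rvec) set"
  assumes group: "matrix_group L" and countable: "countable L"
    and adm: "A \<in> L \<Longrightarrow> adm A"
    and fut: "A \<in> L \<Longrightarrow> future x \<Longrightarrow> future (A *v x)"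
    and disc: "future x \<Longrightarrow> x $ ix_second = 0 \<Longrightarrow> \<exists>e>0. \<forall>A\<in>L. A \<noteq> mat 1 \<longrightarrow>
      (\<forall>z. future z \<longrightarrow> z $ ix_second = 0 \<longrightarrow> dist (nrm z) (nrm x) < e \<longrightarrow> \<not> dist (nrm (A *v z)) (nrm x) < e)"
    and D0_borel: "D0 \<in> sets borel"
    and D0_cover: "future x \<Longrightarrow> x $ ix_second = 0 \<Longrightarrow> \<exists>A\<in>L. nrm (A *v x) \<in> D0"
    and D0_finite: "emeasure lborel {x. \<bar>x $ ix_second\<bar> \<le> 1 \<and> proj x \<in> cone_set D0} < \<infinity>"
begin

definition FF :: "('n rvec \<times> 'n rvec) set" where
  "FF = {p \<in> EE. nrm (proj (fst p)) \<in> D0}"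

lemma nrm_proj_continuous: "continuous_on EE (\<lambda>p. nrm (proj (fst p)))"
  unfolding nrm_def by (intro continuous_intros) (auto simp: EE_def)

lemma FF_borel: "FF \<in> sets borel"
proof -
  have "(\<lambda>p. nrm (proj (fst p))) -` D0 \<inter> space (restrict_space borel EE) \<in> sets (restrict_space borel EE)"
    using borel_measurable_continuous_on_restrict[OF nrm_proj_continuous] D0_borel by (rule measurable_sets)
  moreover have "(\<lambda>p. nrm (proj (fst p))) -` D0 \<inter> space (restrict_space borel EE) = FF"
    by (auto simp: FF_def space_restrict_space)
  ultimately show ?thesis using open_EE by (auto simp: sets_restrict_space_iff)
qed

text \<open>The first point of a pair ranges over a slab of finite measure and the second, for a
  fixed first point, over a set of uniformly bounded measure.\<close>

lemma FF_finite: "emeasure lborel FF < \<infinity>"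
proof -
  let ?K = "{x. \<bar>x $ ix_second\<bar> \<le> 1 \<and> proj x \<in> cone_set D0}"
  have "proj \<in> borel_measurable (borel :: ('n rvec) measure)"
    by (intro borel_measurable_linear linear_proj)
  from measurable_sets[OF this cone_set_borel[OF D0_borel]] have 1: "proj -` cone_set D0 \<in> sets borel" by simp
  have "{x :: 'n rvec. \<bar>x $ ix_second\<bar> \<le> 1} \<in> sets borel" by measurable
  then have K: "?K \<in> sets borel" using sets.Int[OF _ 1] by (simp add: vimage_def Collect_conj_eq)
  obtain C where C: "C < \<infinity>" "\<And>x. future x \<Longrightarrow> x $ ix_second = 0 \<Longrightarrow>
     emeasure lborel {y. \<bar>y $ ix_second\<bar> \<le> 1 \<and> -1 < Q (proj y) \<and> Q (proj y) < 0 \<and>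
        (bq x (proj y))\<^sup>2 < 4 * (Q x * Q (proj y))} \<le> C"
    using finite_fibre_measure by blast
  have F': "FF \<in> sets (lborel \<Otimes>\<^sub>M lborel)" using FF_borel unfolding lborel_prod by simp
  have "emeasure lborel FF = (\<integral>\<^sup>+x. emeasure lborel (Pair x -` FF) \<partial>lborel)"
    using lborel.emeasure_pair_measure_alt[OF F'] unfolding lborel_prod .
  also have "\<dots> \<le> (\<integral>\<^sup>+x. C * indicator ?K x \<partial>lborel)"
  proof (rule nn_integral_mono)
    fix x
    show "emeasure lborel (Pair x -` FF) \<le> C * indicator ?K x"
    proof (cases "Pair x -` FF = {}")
      case False
      then obtain y where y: "(x, y) \<in> FF" by auto
      then have xK: "x \<in> ?K" by (auto simp: FF_def EE_def cone_set_def nrm_def)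
      have x: "future (proj x)" using y EE_future(1)[of "(x, y)"] by (auto simp: FF_def)
      let ?Y = "{y. \<bar>y $ ix_second\<bar> \<le> 1 \<and> -1 < Q (proj y) \<and> Q (proj y) < 0 \<and>
        (bq (proj x) (proj y))\<^sup>2 < 4 * (Q (proj x) * Q (proj y))}"
      have [measurable]: "proj \<in> borel_measurable (borel :: ('n rvec) measure)"
        by (intro borel_measurable_linear linear_proj)
      have [measurable]: "(\<lambda>y. bq (proj x) (proj y)) \<in> borel_measurable borel"
        by (intro borel_measurable_continuous_onI continuous_intros)
      have "?Y \<in> sets borel" by measurable
      then have "emeasure lborel (Pair x -` FF) \<le> emeasure lborel ?Y"
        by (intro emeasure_mono) (auto simp: FF_def EE_def)
      also have "\<dots> \<le> C" using C(2)[OF x] by simp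
      finally show ?thesis using xK by simp
    qed simp
  qed
  also have "\<dots> = C * emeasure lborel ?K" using K by (simp add: nn_integral_cmult)
  also have "\<dots> < \<infinity>" using C(1) D0_finite by (simp add: ennreal_mult_less_top)
  finally show ?thesis .
qed

lemma L_inverse: "A \<in> L \<Longrightarrow> \<exists>B\<in>L. A ** B = mat 1 \<and> B ** A = mat 1"
  using group by (auto simp: matrix_group_def)

lemma L_mult: "A \<in> L \<Longrightarrow> B \<in> L \<Longrightarrow> A ** B \<in> L"
  and L_one: "mat 1 \<in> L"
  using group by (auto simp: matrix_group_def)

lemma L_EE: "A \<in> L \<Longrightarrow> p \<in> EE \<Longrightarrow> pm A p \<in> EE"
  by (rule EE_pm) (auto simp: adm fut)

text \<open>Poincare recurrence modulo \<open>L\<close>, by the pigeonhole principle.\<close>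

lemma weak_recurrence:
  assumes N: "open N" "N \<subseteq> EE" "N \<noteq> {}"
    and small: "\<And>p A. p \<in> N \<Longrightarrow> A \<in> L \<Longrightarrow> pm A p \<in> N \<Longrightarrow> A = mat 1"
    and m: "m > 0"
  shows "\<exists>p\<in>N. \<exists>A\<in>L. \<exists>k\<ge>m. pm A ((sg ^^ k) p) \<in> N"
proof (rule ccontr)
  assume "\<not> ?thesis"
  then have nr: "pm A ((sg ^^ k) p) \<notin> N" if "p \<in> N" "A \<in> L" "k \<ge> m" for p A k
    using that by blast
  \<comment> \<open>Without returns modulo \<open>L\<close>, the preimages \<open>Ni i\<close> are
    disjoint even up to translation by \<open>L\<close>. They all have the measure of
    \<open>N\<close>, while their union can be no larger than \<open>FF\<close>.\<close>
  define Ni where "Ni i = (sg ^^ (m * i)) -` N" for i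
  define N' where "N' = (\<Union>i. Ni i)"
  have Nb: "N \<in> sets borel" using N(1) by auto
  have Ni: "Ni i \<in> sets borel" "emeasure lborel (Ni i) = emeasure lborel N" for i
    using sg_pow_emeasure[OF Nb] by (auto simp: Ni_def)
  have key: "A = B"
    if A: "A \<in> L" "B \<in> L" "pm A x \<in> Ni i" "pm B x \<in> Ni j" and ij: "i \<le> j" for A B x i j
  proof -
    obtain A' where A': "A' \<in> L" "A ** A' = mat 1" "A' ** A = mat 1" using L_inverse A(1) by blast
    let ?z = "(sg ^^ (m * i)) (pm A x)"
    have z: "?z \<in> N" using A(3) by (simp add: Ni_def)
    have "(sg ^^ (m * j)) (pm B x) = (sg ^^ (m * (j - i))) ((sg ^^ (m * i)) (pm B x))"
      using ij by (simp add: funpow_add[symmetric, THEN fun_cong, unfolded o_def] distrib_left[symmetric])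
    also have "(sg ^^ (m * i)) (pm B x) = pm (B ** A') ?z"
      using A A' by (simp add: sg_pow_pm adm pm_mult matrix_mul_assoc[symmetric] matrix_mul_rid)
    also have "(sg ^^ (m * (j - i))) (pm (B ** A') ?z) = pm (B ** A') ((sg ^^ (m * (j - i))) ?z)"
      using A A' by (intro sg_pow_pm adm L_mult)
    finally have r: "pm (B ** A') ((sg ^^ (m * (j - i))) ?z) \<in> N" using A(4) by (simp add: Ni_def)
    have BA: "B ** A' \<in> L" using A A' by (intro L_mult)
    have "i = j"
    proof (rule ccontr)
      assume "i \<noteq> j"
      then have "m * (j - i) \<ge> m" using ij by (cases "j - i") auto
      with nr[OF z BA] r show False by blast
    qed
    then have "pm (B ** A') ?z \<in> N" using r by simp
    then have "B ** A' = mat 1" using small[OF z BA] by blast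
    then show "A = B" by (metis A'(3) matrix_mul_assoc matrix_mul_lid matrix_mul_rid)
  qed
  have key': "A = B" if AB: "A \<in> L" "B \<in> L" "pm A x \<in> N'" "pm B x \<in> N'" for A B x
  proof -
    obtain i j where ij: "pm A x \<in> Ni i" "pm B x \<in> Ni j" using AB(3,4) by (auto simp: N'_def)
    show ?thesis
    proof (cases "i \<le> j")
      case True
      then show ?thesis using key AB(1,2) ij by blast
    next
      case False
      then show ?thesis using key[OF AB(2,1) ij(2,1)] by simp
    qed
  qed
  have disj: "disjoint_family Ni"
    unfolding disjoint_family_on_def
  proof (intro ballI impI)
    have no: "Ni i \<inter> Ni j = {}" if "i < j" for i j
    proof (rule ccontr)
      assume "Ni i \<inter> Ni j \<noteq> {}"
      then obtain x where x: "(sg ^^ (m * i)) x \<in> N" "(sg ^^ (m * j)) x \<in> N"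
        unfolding Ni_def by blast
      have "(sg ^^ (m * j)) x = (sg ^^ (m * (j - i))) ((sg ^^ (m * i)) x)"
        using that by (simp add: funpow_add[symmetric, THEN fun_cong, unfolded o_def] distrib_left[symmetric])
      moreover have "m * (j - i) \<ge> m" using that by (cases "j - i") auto
      ultimately show False using nr[OF x(1) L_one] x(2) by (simp add: pm_one)
    qed
    fix i j :: nat assume "i \<noteq> j"
    then show "Ni i \<inter> Ni j = {}" using no[of i j] no[of j i] by (cases "i < j") auto
  qed
  define inv' where "inv' A = (SOME B. B \<in> L \<and> A ** B = mat 1 \<and> B ** A = mat 1)" for A
  have inv': "inv' A \<in> L" "A ** inv' A = mat 1" "inv' A ** A = mat 1" if "A \<in> L" for A
    using someI_ex[of "\<lambda>B. B \<in> L \<and> A ** B = mat 1 \<and> B ** A = mat 1"] L_inverse[OF that]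
    unfolding inv'_def by blast+
  have N'b: "N' \<in> sets borel" unfolding N'_def using Ni by auto
  have N'E: "N' \<subseteq> EE" using N(2) sg_pow_EE unfolding N'_def Ni_def by blast
  have "emeasure lborel N' \<le> emeasure lborel FF"
  proof (rule wandering_emeasure_le[of L lborel N' FF pm inv'])
    show "\<exists>A\<in>L. pm A p \<in> FF" if p': "p \<in> N'" for p
    proof -
      have p: "p \<in> EE" using p' N'E by auto
      then obtain A where A: "A \<in> L" "nrm (A *v proj (fst p)) \<in> D0"
        using D0_cover[OF EE_future(1)[OF p] proj_second] by blast
      then have "pm A p \<in> FF" using L_EE[OF A(1) p] by (simp add: FF_def pm_def adm_proj[OF adm])
      with A show ?thesis by blast
    qed
    show "A = B" if "A \<in> L" "B \<in> L" "pm (inv' A) x \<in> N'" "pm (inv' B) x \<in> N'" for A B x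
    proof -
      have "inv' A = inv' B" using key'[OF inv'(1) inv'(1)] that by blast
      then show ?thesis using inv'(2,3)[OF that(1)] inv'(2,3)[OF that(2)] matrix_inverses_unique by metis
    qed
  qed (auto simp: countable N'b FF_borel pm_borel pm_emeasure adm adm_isoQ inv' pm_mult pm_one)
  then have fin: "emeasure lborel N' < \<infinity>" using FF_finite by (rule le_less_trans)
  have pos: "emeasure lborel N > 0" using emeasure_open_pos N by blast
  have "(\<Sum>i. emeasure lborel (Ni i)) = emeasure lborel N'"
    unfolding N'_def using Ni disj by (intro suminf_emeasure) auto
  then have "(\<Sum>i::nat. emeasure lborel N) < \<infinity>" using fin Ni by simp
  moreover have "(\<Sum>i::nat. emeasure lborel N) = \<infinity>"
  proof -
    have "(\<Sum>i::nat. emeasure lborel N) = (\<integral>\<^sup>+i. emeasure lborel N \<partial>count_space (UNIV :: nat set))"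
      by (rule nn_integral_count_space_nat[symmetric])
    also have "\<dots> = \<infinity>" using pos by (simp add: ennreal_mult_top)
    finally show ?thesis .
  qed
  ultimately show False by simp
qed

lemma small_neighbourhood:
  assumes p: "p \<in> EE"
  shows "\<exists>r>0. ball p r \<subseteq> EE \<and> (\<forall>q\<in>ball p r. \<forall>A\<in>L. pm A q \<in> ball p r \<longrightarrow> A = mat 1)"
proof -
  obtain e where e: "e > 0" "\<And>A z. A \<in> L \<Longrightarrow> A \<noteq> mat 1 \<Longrightarrow> future z \<Longrightarrow> z $ ix_second = 0 \<Longrightarrow>
      dist (nrm z) (nrm (proj (fst p))) < e \<Longrightarrow> \<not> dist (nrm (A *v z)) (nrm (proj (fst p))) < e"
    using disc[OF EE_future(1)[OF p] proj_second] by blast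
  have "isCont (\<lambda>p. nrm (proj (fst p))) p"
    using nrm_proj_continuous open_EE p by (simp add: continuous_on_eq_continuous_at)
  then have "\<exists>d>0. \<forall>q. dist q p < d \<longrightarrow> dist (nrm (proj (fst q))) (nrm (proj (fst p))) < e"
    using e(1) unfolding continuous_at_eps_delta by blast
  then obtain d where d: "d > 0" "\<And>q. dist q p < d \<Longrightarrow> dist (nrm (proj (fst q))) (nrm (proj (fst p))) < e"
    by blast
  obtain d' where d': "d' > 0" "ball p d' \<subseteq> EE" using open_EE p open_contains_ball by blast
  show ?thesis
  proof (intro exI[of _ "min d d'"] conjI ballI impI)
    fix q A assume q: "q \<in> ball p (min d d')" and A: "A \<in> L" "pm A q \<in> ball p (min d d')"
    show "A = mat 1"
    proof (rule ccontr)
      assume "A \<noteq> mat 1"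
      moreover have "q \<in> EE" using q by (intro subsetD[OF d'(2)]) simp
      then have "future (proj (fst q))" by (rule EE_future)
      moreover have "dist q p < d" "dist (pm A q) p < d" using q A(2) by (simp_all add: dist_commute)
      note d(2)[OF this(1)] d(2)[OF this(2)]
      moreover have "proj (fst (pm A q)) = A *v proj (fst q)" by (simp add: pm_def adm_proj[OF adm[OF A(1)]])
      ultimately show False using e(2) A(1) by simp
    qed
  qed (use d d' in auto)
qed

text \<open>Weak recurrence returns some point of a small ball to that ball, so the points returning
  \<open>1 / Suc m\<close>-close to themselves after at least \<open>m\<close> steps are open and
  dense. Baire's theorem gives a point that does so for all \<open>m\<close>.\<close>

lemma recurrent_point:
  assumes W: "open W" "W \<subseteq> EE" "W \<noteq> {}"
  shows "\<exists>p\<in>W. \<forall>m. \<exists>A\<in>L. \<exists>k\<ge>m. dist (pm A ((sg ^^ k) p)) p < 1 / Suc m"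
proof -
  obtain p0 where "p0 \<in> W" using W by auto
  then obtain r where r: "r > 0" "cball p0 r \<subseteq> W" using W open_contains_cball by blast
  let ?S = "cball p0 r"
  have SE: "?S \<subseteq> EE" using r W by auto
  define T where "T m = {p \<in> ?S. \<exists>A\<in>L. \<exists>k\<ge>m. dist (pm A ((sg ^^ k) p)) p < 1 / Suc m}" for m
  have "?S \<subseteq> closure (\<Inter>(range T))"
  proof (rule Baire)
    fix X assume "X \<in> range T"
    then obtain m where X: "X = T m" by auto
    have op: "open {p \<in> EE. dist (pm A ((sg ^^ k) p)) p < 1 / Suc m}" for A k
    proof -
      have "continuous_on EE (\<lambda>p. pm A ((sg ^^ k) p))"
        by (rule continuous_on_compose2[OF pm_continuous sg_pow_continuous]) auto
      then have "continuous_on EE (\<lambda>p. dist (pm A ((sg ^^ k) p)) p)"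
        by (intro continuous_intros)
      then have "open (EE \<inter> (\<lambda>p. dist (pm A ((sg ^^ k) p)) p) -` {..<1 / Suc m})"
        using open_EE by (intro continuous_open_preimage) auto
      moreover have "EE \<inter> (\<lambda>p. dist (pm A ((sg ^^ k) p)) p) -` {..<1 / Suc m} =
          {p \<in> EE. dist (pm A ((sg ^^ k) p)) p < 1 / Suc m}"
        by (rule Set.set_eqI) simp
      ultimately show ?thesis by (simp only:)
    qed
    have "T m = ?S \<inter> (\<Union>A\<in>L. \<Union>k\<in>{m..}. {p \<in> EE. dist (pm A ((sg ^^ k) p)) p < 1 / Suc m})"
      using SE unfolding T_def by blast
    moreover have "open (\<Union>A\<in>L. \<Union>k\<in>{m..}. {p \<in> EE. dist (pm A ((sg ^^ k) p)) p < 1 / Suc m})"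
      by (intro open_UN ballI op)
    ultimately have "openin (top_of_set ?S) (T m)" by (simp only: openin_open_Int)
    moreover have "?S \<subseteq> closure (T m)"
    proof
      fix p assume p: "p \<in> ?S"
      show "p \<in> closure (T m)"
        unfolding closure_approachable
      proof (intro allI impI)
        fix e :: real assume e: "e > 0"
        have "p \<in> closure (ball p0 r)" using p r by simp
        then obtain q where q: "q \<in> ball p0 r" "dist q p < e" using e closure_approachable by blast
        obtain d1 where d1: "d1 > 0" "ball q d1 \<subseteq> ball p0 r"
          using q open_contains_ball by (metis open_ball)
        have "q \<in> EE" using q SE by auto
        then obtain d2 where d2: "d2 > 0" "ball q d2 \<subseteq> EE"
          "\<And>q' A. q' \<in> ball q d2 \<Longrightarrow> A \<in> L \<Longrightarrow> pm A q' \<in> ball q d2 \<Longrightarrow> A = mat 1"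
          using small_neighbourhood by blast
        \<comment> \<open>Two points of a ball of radius \<open>1 / (2 * Suc m)\<close> are less
          than \<open>1 / Suc m\<close> apart; the other bounds keep the ball within
          \<open>ball p0 r\<close>, within \<open>e\<close> of \<open>p\<close> and free of returns
          by \<open>L\<close> alone.\<close>
        define \<rho> where "\<rho> = min (min d1 d2) (min (e - dist q p) (1 / (2 * Suc m)))"
        have \<rho>: "\<rho> > 0" "\<rho> \<le> d1" "\<rho> \<le> d2" "\<rho> \<le> e - dist q p" "\<rho> \<le> 1 / (2 * Suc m)"
          using d1 d2 q by (auto simp: \<rho>_def)
        \<comment> \<open>\<open>Suc m\<close> in place of \<open>m\<close>, because
          \<open>weak_recurrence\<close> asks for a positive number of steps.\<close>
        have "\<exists>q'\<in>ball q \<rho>. \<exists>A\<in>L. \<exists>k\<ge>Suc m. pm A ((sg ^^ k) q') \<in> ball q \<rho>"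
        proof (rule weak_recurrence)
          show "ball q \<rho> \<subseteq> EE" using d2(2) \<rho>(3) by (auto simp: subset_ball)
          show "A = mat 1" if "p \<in> ball q \<rho>" "A \<in> L" "pm A p \<in> ball q \<rho>" for p A
            using d2(3)[of p A] that \<rho>(3) by auto
        qed (use \<rho> in auto)
        then obtain q' A k where *: "q' \<in> ball q \<rho>" "A \<in> L" "k \<ge> Suc m" "pm A ((sg ^^ k) q') \<in> ball q \<rho>" by blast
        have "dist (pm A ((sg ^^ k) q')) q' < \<rho> + \<rho>"
          using *(1,4) dist_triangle2[of "pm A ((sg ^^ k) q')" q' q] by (simp add: dist_commute)
        also have "\<dots> \<le> 1 / Suc m" using \<rho>(5) by (simp add: field_simps)
        finally have "dist (pm A ((sg ^^ k) q')) q' < 1 / Suc m" .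
        moreover have "q' \<in> ?S" using subsetD[OF d1(2), of q'] *(1) \<rho>(2) by simp
        ultimately have "q' \<in> T m" using * by (auto simp: T_def intro!: bexI[of _ A] exI[of _ k])
        moreover have "dist q' p < e"
          using *(1) \<rho>(4) dist_triangle[of q' p q] by (simp add: dist_commute)
        ultimately show "\<exists>y\<in>T m. dist y p < e" by blast
      qed
    qed
    ultimately show "openin (top_of_set ?S) X \<and> ?S \<subseteq> closure X" using X by blast
  qed auto
  then have "\<Inter>(range T) \<noteq> {}" using r(1) by auto
  then obtain p where "\<And>m. p \<in> T m" by auto
  then show ?thesis using r(2) by (intro bexI[of _ p]) (auto simp: T_def)
qed

end

section \<open>Bounded sequences of isometries, and translations as polynomials in their
  generator\<close>

context dim_ge_4
begin

text \<open>Each timelike vector determines a positive definite form, which an isometry carries to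
  the form of the image vector. If the images stay in a compact set, these forms are uniformly
  comparable with the norm.\<close>

lemma matrix_seq_bounded:
  fixes g :: "nat \<Rightarrow> 'n rmat"
  assumes g: "\<And>k. isoQ (g k)" and x: "Q x < 0"
    and lim: "(\<lambda>k. g k *v x) \<longlonglongrightarrow> x"
  shows "bounded (range g)"
proof -
  \<comment> \<open>\<open>P z\<close> is \<open>Q\<close> with the sign reversed on the line of
    \<open>z\<close>.\<close>
  define P where "P z w = Q w - 2 * (bq w z)\<^sup>2 / Q z" for z w :: "'n rvec"
  have "isCont Q x"
    using continuous_Q[OF continuous_on_id, of UNIV] by (simp add: continuous_on_eq_continuous_at)
  then have "eventually (\<lambda>z. Q z < 0) (nhds x)"
    using order_tendstoD(2)[of Q "Q x" "nhds x" 0] x by (simp add: isCont_def tendsto_at_iff_tendsto_nhds)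
  then obtain r where r: "r > 0" "\<And>z. dist z x \<le> r \<Longrightarrow> Q z < 0"
    by (auto simp: eventually_nhds_metric_le)
  let ?C = "cball x r \<times> sphere (0 :: 'n rvec) 1"
  have P_pos: "P z w > 0" if "Q z < 0" "w \<noteq> 0" for z w
  proof -
    define k where "k = bq w z / Q z"
    define u where "u = w - k *\<^sub>R z"
    have uz: "bq u z = 0" using that by (simp add: u_def k_def Q_bq)
    have w: "w = u + k *\<^sub>R z" by (simp add: u_def)
    have "Q w = Q (u + k *\<^sub>R z)" using w by simp
    also have "\<dots> = Q u + k\<^sup>2 * Q z" by (simp add: Q_add Q_scaleR uz)
    finally have "Q w = Q u + (bq w z / Q z)\<^sup>2 * Q z" by (simp add: k_def)
    then have eq: "P z w = Q u - (bq w z)\<^sup>2 / Q z"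
      using that(1) by (simp add: P_def power2_eq_square field_simps)
    show ?thesis
    proof (cases "u = 0")
      case True
      then have "k \<noteq> 0" using w that by auto
      then have "bq w z \<noteq> 0" by (simp add: k_def)
      then have "(bq w z)\<^sup>2 / Q z < 0" using that by (simp add: divide_pos_neg)
      then show ?thesis using eq True by (simp add: Q_bq)
    next
      case False
      then have "Q u > 0" using Q_pos_orthogonal[OF that(1) uz] by blast
      moreover have "(bq w z)\<^sup>2 / Q z \<le> 0" using that by (simp add: divide_nonneg_neg)
      ultimately show ?thesis using eq by simp
    qed
  qed
  have "compact ?C" by (intro compact_Times) auto
  moreover have "(x, axis ix_first 1) \<in> ?C" using r by simp
  then have "?C \<noteq> {}" by blast
  moreover have "continuous_on ?C (\<lambda>p. P (fst p) (snd p))"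
  proof -
    have "Q (fst p) \<noteq> 0" if "p \<in> ?C" for p using r(2)[of "fst p"] that by (auto simp: dist_commute)
    then show ?thesis unfolding P_def by (intro continuous_intros) blast
  qed
  ultimately have "\<exists>p0\<in>?C. \<forall>p\<in>?C. P (fst p0) (snd p0) \<le> P (fst p) (snd p)"
    by (rule continuous_attains_inf)
  then obtain p0 where p0: "p0 \<in> ?C" "\<And>p. p \<in> ?C \<Longrightarrow> P (fst p0) (snd p0) \<le> P (fst p) (snd p)"
    by blast
  define c where "c = P (fst p0) (snd p0)"
  have "Q (fst p0) < 0" "snd p0 \<noteq> 0" using p0(1) r(2) by (auto simp: dist_commute)
  then have c: "c > 0" unfolding c_def by (rule P_pos)
  have P_ge: "c * (norm w)\<^sup>2 \<le> P z w" if z: "dist z x \<le> r" for z w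
  proof (cases "w = 0")
    case False
    have "c \<le> P z ((1 / norm w) *\<^sub>R w)"
      using p0(2)[of "(z, (1 / norm w) *\<^sub>R w)"] z False by (auto simp: c_def dist_commute)
    also have "\<dots> = P z w / (norm w)\<^sup>2"
      by (simp add: P_def Q_scaleR power_divide diff_divide_distrib)
    finally show ?thesis using False by (simp add: field_simps)
  qed (simp add: P_def Q_bq)
  obtain k0 where k0: "\<And>k. k \<ge> k0 \<Longrightarrow> dist (g k *v x) x < r"
    using lim r(1) by (auto simp: lim_sequentially)
  have "norm (g k) \<le> (\<Sum>i\<in>(UNIV :: 'n set). \<Sum>j\<in>(UNIV :: 'n set). sqrt (P x (axis j 1) / c))" if "k \<ge> k0" for k
  proof -
    have "\<bar>g k $ i $ j\<bar> \<le> sqrt (P x (axis j 1) / c)" for i j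
    proof -
      let ?v = "axis j 1 :: 'n rvec"
      have "Q (g k *v x) = Q x" "bq (g k *v ?v) (g k *v x) = bq ?v x" "Q (g k *v ?v) = Q ?v"
        using g[of k] by (auto simp: isoQ_bq isoQ_def)
      then have "P (g k *v x) (g k *v ?v) = P x ?v" by (simp add: P_def)
      then have "c * (norm (g k *v ?v))\<^sup>2 \<le> P x ?v"
        using P_ge[of "g k *v x" "g k *v ?v"] k0[OF that] by simp
      then have "(norm (g k *v ?v))\<^sup>2 \<le> P x ?v / c" using c by (simp add: field_simps)
      then have "norm (g k *v ?v) \<le> sqrt (P x ?v / c)" by (rule real_le_rsqrt)
      moreover have "g k $ i $ j = (g k *v ?v) $ i"
        by (simp add: matrix_vector_mult_basis column_def)
      ultimately show ?thesis using component_le_norm_cart[of "g k *v ?v" i] by simp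
    qed
    note entry = this
    have "(\<Sum>i\<in>UNIV. norm (g k $ i)) \<le> (\<Sum>i\<in>(UNIV :: 'n set). \<Sum>j\<in>(UNIV :: 'n set). sqrt (P x (axis j 1) / c))"
    proof (rule sum_mono)
      fix i
      have "norm (g k $ i) \<le> (\<Sum>j\<in>UNIV. \<bar>g k $ i $ j\<bar>)" by (rule norm_le_l1_cart)
      also have "\<dots> \<le> (\<Sum>j\<in>(UNIV :: 'n set). sqrt (P x (axis j 1) / c))"
        by (intro sum_mono entry)
      finally show "norm (g k $ i) \<le> (\<Sum>j\<in>(UNIV :: 'n set). sqrt (P x (axis j 1) / c))" .
    qed
    moreover have "norm (g k) \<le> (\<Sum>i\<in>UNIV. norm (g k $ i))"
      unfolding norm_vec_def by (rule L2_set_le_sum) simp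
    ultimately show ?thesis by simp
  qed
  then have "bounded (g ` {k0..})" by (auto simp: bounded_iff intro!: exI)
  moreover have "bounded (g ` {..<k0})" by (intro finite_imp_bounded) auto
  ultimately have "bounded (g ` {k0..} \<union> g ` {..<k0})" by simp
  moreover have "{k0..} \<union> {..<k0} = (UNIV :: nat set)" by auto
  then have "range g = g ` {k0..} \<union> g ` {..<k0}" by (metis image_Un)
  ultimately show ?thesis by simp
qed

definition boost :: "'n rvec \<Rightarrow> 'n rvec \<Rightarrow> real" where
  "boost x y = sqrt ((bq x y)\<^sup>2 - Q x * Q y)"

lemma wdg_square:
  "wdg x y ** wdg x y = bq x y *\<^sub>R (ot x y + ot y x) - Q y *\<^sub>R ot x x - Q x *\<^sub>R ot y (y :: 'n rvec)"
  by (simp add: wdg_def matrix_diff_ldistrib matrix_diff_rdistrib ot_mult Q_bq bq_commute[of y x]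
      scaleR_add_right)

text \<open>\<open>wdg x y\<close> vanishes on the vectors orthogonal to \<open>x\<close> and
  \<open>y\<close>, and on the span of \<open>x\<close> and \<open>y\<close> its square is the
  scalar on the right.\<close>

lemma wdg_cube:
  "wdg x y ** wdg x y ** wdg x y = ((bq x y)\<^sup>2 - Q x * Q y) *\<^sub>R wdg x (y :: 'n rvec)"
proof (subst matrix_eq, rule allI)
  fix v
  have "(wdg x y ** wdg x y ** wdg x y) *v v = wdg x y *v (wdg x y *v (wdg x y *v v))"
    by (simp add: matrix_vector_mul_assoc[symmetric])
  also have "\<dots> = ((bq x y)\<^sup>2 - Q x * Q y) *\<^sub>R (wdg x y *v v)"
    by (simp add: wdg_vec bq_commute[of y x] Q_bq[symmetric])
      (simp add: algebra_simps power2_eq_square)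
  finally show "(wdg x y ** wdg x y ** wdg x y) *v v = (((bq x y)\<^sup>2 - Q x * Q y) *\<^sub>R wdg x y) *v v"
    by (simp add: scaleR_matrix_vector_assoc)
qed

text \<open>The translation along the line through \<open>x\<close> and \<open>y\<close> as a
  quadratic polynomial in its generator \<open>wdg x y\<close>; in this form it can be recognized as
  a value of the one-parameter group in \<open>boost_group\<close>.\<close>

lemma hh_eq:
  assumes x: "x $ ix_second = 0" "Q x \<noteq> 0" and y: "y $ ix_second = 0" "Q y \<noteq> 0"
  shows "Rm y ** Rm x = mat 1 + (2 / (Q x * Q y)) *\<^sub>R (wdg x y ** wdg x y - bq x y *\<^sub>R wdg x y)"
proof (subst matrix_eq, rule allI)
  fix v
  show "(Rm y ** Rm x) *v v = (mat 1 + (2 / (Q x * Q y)) *\<^sub>R (wdg x y ** wdg x y - bq x y *\<^sub>R wdg x y)) *v v"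
    unfolding wdg_square using assms
    by (simp add: matrix_vector_mul_assoc[symmetric] Rm_vec matrix_vector_mult_add_rdistrib
        matrix_vector_mult_diff_rdistrib scaleR_matrix_vector_assoc[symmetric] wdg_def bq_commute[of y x])
      (simp add: vec_eq_iff field_simps)
qed

text \<open>The one-parameter group generated by \<open>wdg x y\<close>, with eigenvalues \<open>s\<^sup>2\<close>, \<open>s\<close> and \<open>1\<close> after
  multiplication by \<open>s\<close>.\<close>

lemma boost_group:
  fixes W :: "'n rmat"
  assumes W3: "W ** W ** W = \<kappa>\<^sup>2 *\<^sub>R W" and \<kappa>: "\<kappa> > 0"
  defines "P\<^sub>1 \<equiv> (1 / (2 * \<kappa>\<^sup>2)) *\<^sub>R (W ** W + \<kappa> *\<^sub>R W)"
    and "P\<^sub>2 \<equiv> mat 1 - (1 / \<kappa>\<^sup>2) *\<^sub>R (W ** W)"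
    and "P\<^sub>3 \<equiv> (1 / (2 * \<kappa>\<^sup>2)) *\<^sub>R (W ** W - \<kappa> *\<^sub>R W)"
  defines "b \<equiv> \<lambda>s::real. s\<^sup>2 *\<^sub>R P\<^sub>1 + s *\<^sub>R P\<^sub>2 + P\<^sub>3"
  shows "b s = s *\<^sub>R mat 1 + ((s - 1)\<^sup>2 / (2 * \<kappa>\<^sup>2)) *\<^sub>R (W ** W) + ((s\<^sup>2 - 1) / (2 * \<kappa>)) *\<^sub>R W" (is "_ = ?c s")
    and "b 1 = mat 1" and "b s ** b r = b (s * r)" and "P\<^sub>1 - P\<^sub>3 = (1 / \<kappa>) *\<^sub>R W"
proof -
  show alt: "b s = ?c s" for s
  proof -
    have "b s = s *\<^sub>R mat 1 + (s\<^sup>2 * (1 / (2 * \<kappa>\<^sup>2)) - s * (1 / \<kappa>\<^sup>2) + 1 / (2 * \<kappa>\<^sup>2)) *\<^sub>R (W ** W)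
       + (s\<^sup>2 * (1 / (2 * \<kappa>\<^sup>2)) * \<kappa> - 1 / (2 * \<kappa>\<^sup>2) * \<kappa>) *\<^sub>R W"
      by (simp add: b_def P\<^sub>1_def P\<^sub>2_def P\<^sub>3_def algebra_simps)
    moreover have "s\<^sup>2 * (1 / (2 * \<kappa>\<^sup>2)) - s * (1 / \<kappa>\<^sup>2) + 1 / (2 * \<kappa>\<^sup>2) = (s - 1)\<^sup>2 / (2 * \<kappa>\<^sup>2)"
      using \<kappa> by (simp add: field_simps power2_eq_square)
    moreover have "s\<^sup>2 * (1 / (2 * \<kappa>\<^sup>2)) * \<kappa> - 1 / (2 * \<kappa>\<^sup>2) * \<kappa> = (s\<^sup>2 - 1) / (2 * \<kappa>)"
      using \<kappa> by (simp add: field_simps power2_eq_square)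
    ultimately show ?thesis by simp
  qed
  show "b 1 = mat 1" by (simp add: alt)
  show "P\<^sub>1 - P\<^sub>3 = (1 / \<kappa>) *\<^sub>R W"
  proof -
    have "P\<^sub>1 - P\<^sub>3 = (1 / (2 * \<kappa>\<^sup>2) * \<kappa> + 1 / (2 * \<kappa>\<^sup>2) * \<kappa>) *\<^sub>R W"
      by (simp add: P\<^sub>1_def P\<^sub>3_def vec_eq_iff field_simps)
    moreover have "1 / (2 * \<kappa>\<^sup>2) * \<kappa> + 1 / (2 * \<kappa>\<^sup>2) * \<kappa> = 1 / \<kappa>"
      using \<kappa> by (simp add: field_simps power2_eq_square)
    ultimately show ?thesis by simp
  qed
  have W4: "W ** W ** (W ** W) = \<kappa>\<^sup>2 *\<^sub>R (W ** W)"
    by (simp add: matrix_mul_assoc W3 matrix_scaleR_left)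
  have W3': "W ** (W ** W) = \<kappa>\<^sup>2 *\<^sub>R W" using W3 by (simp add: matrix_mul_assoc)
  define \<beta> where "\<beta> s = (s - 1)\<^sup>2 / (2 * \<kappa>\<^sup>2)" for s
  define \<gamma> where "\<gamma> s = (s\<^sup>2 - 1) / (2 * \<kappa>)" for s
  have "b s ** b r = (s * r) *\<^sub>R mat 1 + (s * \<beta> r + \<beta> s * r + \<beta> s * \<beta> r * \<kappa>\<^sup>2 + \<gamma> s * \<gamma> r) *\<^sub>R (W ** W)
      + (s * \<gamma> r + \<gamma> s * r + (\<beta> s * \<gamma> r + \<gamma> s * \<beta> r) * \<kappa>\<^sup>2) *\<^sub>R W"
    unfolding alt \<beta>_def[symmetric] \<gamma>_def[symmetric]
    by (simp add: matrix_add_ldistrib matrix_add_rdistrib matrix_scaleR_left matrix_scaleR_right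
        matrix_mul_lid matrix_mul_rid W4 W3 W3') (simp add: algebra_simps)
  moreover have "s * \<beta> r + \<beta> s * r + \<beta> s * \<beta> r * \<kappa>\<^sup>2 + \<gamma> s * \<gamma> r = \<beta> (s * r)"
    using \<kappa> by (simp add: \<beta>_def \<gamma>_def field_simps power2_eq_square)
  moreover have "s * \<gamma> r + \<gamma> s * r + (\<beta> s * \<gamma> r + \<gamma> s * \<beta> r) * \<kappa>\<^sup>2 = \<gamma> (s * r)"
    using \<kappa> by (simp add: \<beta>_def \<gamma>_def field_simps power2_eq_square)
  ultimately show "b s ** b r = b (s * r)"
    unfolding alt \<beta>_def[symmetric] \<gamma>_def[symmetric] by simp
qed

end

section \<open>From recurrent pairs to tangent vectors\<close>

context hyperplane_lattice
begin

text \<open>Recurrence makes lattice elements times powers of the translation \<open>h\<close>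
  nearly fix \<open>X\<close> and \<open>Y\<close>. They are bounded, and a limit \<open>M\<close>
  fixes \<open>X\<close> and \<open>Y\<close>, so it commutes with \<open>wdg X Y\<close>. As powers
  of \<open>h\<close> are multiples of values of \<open>b\<close>, the limit argument for
  one-parameter groups applies.\<close>

lemma recurrent_wdg_tangent:
  assumes G: "matrix_group G" "L \<subseteq> G"
    and p: "p \<in> EE" and pos: "(bq (proj (fst p)) (proj (snd p)))\<^sup>2 - Q (proj (fst p)) * Q (proj (snd p)) > 0"
    and rec: "\<And>m. \<exists>A\<in>L. \<exists>k\<ge>m. dist (pm A ((sg ^^ k) p)) p < 1 / Suc m"
  shows "wdg (proj (fst p)) (proj (snd p)) \<in> tangent_algebra G"
proof -
  define X where "X = proj (fst p)"
  define Y where "Y = proj (snd p)"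
  define W where "W = wdg X Y"
  define \<kappa> where "\<kappa> = sqrt ((bq X Y)\<^sup>2 - Q X * Q Y)"
  have XY: "future X" "future Y" "X $ ix_second = 0" "Y $ ix_second = 0"
    using EE_future[OF p] by (auto simp: X_def Y_def)
  have QX: "Q X < 0" "Q Y < 0" using XY by (auto simp: future_def)
  have B: "bq X Y < 0" using bq_future XY by blast
  have \<kappa>2: "\<kappa>\<^sup>2 = (bq X Y)\<^sup>2 - Q X * Q Y" and \<kappa>: "\<kappa> > 0"
    using pos by (auto simp: \<kappa>_def X_def Y_def)
  \<comment> \<open>By this equation \<open>P\<^sub>1\<close>, \<open>P\<^sub>2\<close> and
    \<open>P\<^sub>3\<close> below are the spectral projections of \<open>W\<close> for the
    eigenvalues \<open>\<kappa>\<close>, 0 and \<open>- \<kappa>\<close>.\<close>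
  have W3: "W ** W ** W = \<kappa>\<^sup>2 *\<^sub>R W" unfolding W_def \<kappa>2 by (rule wdg_cube)
  define P\<^sub>1 where "P\<^sub>1 = (1 / (2 * \<kappa>\<^sup>2)) *\<^sub>R (W ** W + \<kappa> *\<^sub>R W)"
  define P\<^sub>2 where "P\<^sub>2 = mat 1 - (1 / \<kappa>\<^sup>2) *\<^sub>R (W ** W)"
  define P\<^sub>3 where "P\<^sub>3 = (1 / (2 * \<kappa>\<^sup>2)) *\<^sub>R (W ** W - \<kappa> *\<^sub>R W)"
  define b where "b s = s\<^sup>2 *\<^sub>R P\<^sub>1 + s *\<^sub>R P\<^sub>2 + P\<^sub>3" for s
  note bg = boost_group[OF W3 \<kappa>, folded P\<^sub>1_def P\<^sub>2_def P\<^sub>3_def, folded b_def]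
  define q where "q = Q X * Q Y"
  have q: "q > 0" using QX by (simp add: q_def mult_neg_neg)
  \<comment> \<open>\<open>\<mu>\<close> and \<open>\<mu>'\<close> are the eigenvalues of
    \<open>h\<close> where \<open>W\<close> is \<open>\<kappa>\<close> and
    \<open>- \<kappa>\<close>; elsewhere \<open>h\<close> is 1. As
    \<open>\<mu> * \<mu>' = 1\<close>, the multiple \<open>\<mu> *\<^sub>R h\<close> has the
    eigenvalues of \<open>b \<mu>\<close>.\<close>
  define \<mu> where "\<mu> = 1 + (2 / q) * (\<kappa>\<^sup>2 - bq X Y * \<kappa>)"
  define \<mu>' where "\<mu>' = 1 + (2 / q) * (\<kappa>\<^sup>2 + bq X Y * \<kappa>)"
  have \<mu>1: "\<mu> > 1"
  proof -
    have "\<kappa>\<^sup>2 - bq X Y * \<kappa> > 0"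
      using \<kappa> B by (smt (verit) mult_neg_pos zero_less_power2)
    then show ?thesis using q by (simp add: \<mu>_def)
  qed
  have "\<mu> * \<mu>' = (1 + 2 * \<kappa>\<^sup>2 / q)\<^sup>2 - (2 * (bq X Y * \<kappa>) / q)\<^sup>2"
    by (simp add: \<mu>_def \<mu>'_def power2_eq_square algebra_simps diff_divide_distrib add_divide_distrib)
  also have "\<dots> = 1 + (4 * \<kappa>\<^sup>2 * (q + \<kappa>\<^sup>2 - (bq X Y)\<^sup>2)) / q\<^sup>2"
    using q by (simp add: field_simps power2_eq_square)
  also have "q + \<kappa>\<^sup>2 - (bq X Y)\<^sup>2 = 0" by (simp add: \<kappa>2 q_def)
  finally have \<mu>\<mu>': "\<mu> * \<mu>' = 1" by simp
  define h where "h = hh p"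
  have h: "h = mat 1 + (2 / q) *\<^sub>R (W ** W - bq X Y *\<^sub>R W)"
    unfolding h_def hh_def X_def[symmetric] Y_def[symmetric] W_def q_def
    by (rule hh_eq) (use XY QX in auto)
  have hb: "\<mu> *\<^sub>R h = b \<mu>"
  proof -
    have 1: "(\<mu> - 1)\<^sup>2 / (2 * \<kappa>\<^sup>2) = \<mu> * (2 / q)"
    proof -
      have "(\<mu> - 1)\<^sup>2 = \<mu> * (\<mu> + \<mu>' - 2)"
        using \<mu>\<mu>' by (simp add: power2_eq_square algebra_simps)
      also have "\<mu> + \<mu>' - 2 = 4 * \<kappa>\<^sup>2 / q"
        by (simp add: \<mu>_def \<mu>'_def algebra_simps)
      finally show ?thesis using \<kappa> q by (simp add: field_simps)
    qed
    have 2: "(\<mu>\<^sup>2 - 1) / (2 * \<kappa>) = - \<mu> * ((2 / q) * bq X Y)"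
    proof -
      have "\<mu>\<^sup>2 - 1 = \<mu> * (\<mu> - \<mu>')"
        using \<mu>\<mu>' by (simp add: power2_eq_square algebra_simps)
      also have "\<mu> - \<mu>' = - 4 * bq X Y * \<kappa> / q"
        by (simp add: \<mu>_def \<mu>'_def algebra_simps)
      finally show ?thesis using \<kappa> q by (simp add: field_simps)
    qed
    show ?thesis unfolding bg(1) 1 2 h by (simp add: algebra_simps)
  qed
  have hpow: "\<mu> ^ k *\<^sub>R mpow h k = b (\<mu> ^ k)" for k
  proof (induction k)
    case (Suc k)
    have "b (\<mu> ^ Suc k) = b (\<mu> ^ k) ** b \<mu>" by (simp add: bg(3) mult.commute)
    also have "\<dots> = (\<mu> ^ k *\<^sub>R mpow h k) ** (\<mu> *\<^sub>R h)" by (simp add: Suc hb)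
    finally show ?case by (simp add: matrix_scaleR_left matrix_scaleR_right mult.commute)
  qed (simp add: bg(2))
  have "\<forall>m. \<exists>A k. A \<in> L \<and> k \<ge> m \<and> dist (pm A ((sg ^^ k) p)) p < 1 / Suc m" using rec by blast
  then obtain A n where A: "\<And>m. A m \<in> L" and n: "\<And>m. n m \<ge> m"
    and d: "\<And>m. dist (pm (A m) ((sg ^^ n m) p)) p < 1 / Suc m" by metis
  define g where "g m = A m ** mpow h (n m)" for m
  have adm_g: "adm (g m)" for m
    unfolding g_def h_def by (intro adm_mult adm A adm_mpow adm_hh)
  have "Q (proj (fst p)) \<noteq> 0" "Q (proj (snd p)) \<noteq> 0" using QX by (auto simp: X_def Y_def)
  then have gp: "pm (A m) ((sg ^^ n m) p) = pm (g m) p" for m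
    using sg_pow by (simp add: g_def h_def pm_mult)
  have glim: "(\<lambda>m. pm (g m) p) \<longlonglongrightarrow> p"
  proof (rule metric_LIMSEQ_I)
    fix e :: real assume "e > 0"
    then obtain N where N: "1 / Suc N < e" using nat_approx_posE by blast
    have "dist (pm (g m) p) p < e" if "m \<ge> N" for m
    proof -
      have "dist (pm (g m) p) p < 1 / Suc m" using d gp by simp
      also have "\<dots> \<le> 1 / Suc N" using that by (simp add: frac_le)
      finally show ?thesis using N by simp
    qed
    then show "\<exists>N. \<forall>m\<ge>N. dist (pm (g m) p) p < e" by blast
  qed
  have cp: "isCont proj x" for x :: "'n rvec"
    using continuous_proj[OF continuous_on_id, of UNIV] by (simp add: continuous_on_eq_continuous_at)
  have "(\<lambda>m. g m *v fst p) \<longlonglongrightarrow> fst p" "(\<lambda>m. g m *v snd p) \<longlonglongrightarrow> snd p"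
    using tendsto_fst[OF glim] tendsto_snd[OF glim] by (simp_all add: pm_def)
  then have gX: "(\<lambda>m. g m *v X) \<longlonglongrightarrow> X"
    and gY: "(\<lambda>m. g m *v Y) \<longlonglongrightarrow> Y"
    using isCont_tendsto_compose[OF cp] adm_proj[OF adm_g] by (force simp: X_def Y_def)+
  have "bounded (range g)" by (rule matrix_seq_bounded[OF adm_isoQ[OF adm_g] QX(1) gX])
  then obtain M r where r: "strict_mono r" "(g \<circ> r) \<longlonglongrightarrow> M"
    using bounded_imp_convergent_subsequence by blast
  have Mlim: "(\<lambda>m. g (r m) *v x) \<longlonglongrightarrow> M *v x" for x
  proof -
    have "bounded_linear (\<lambda>B :: 'n rmat. B *v x)"
      by (auto intro!: linear_conv_bounded_linear[THEN iffD1] linearI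
          simp: matrix_vector_mult_add_rdistrib scaleR_matrix_vector_assoc)
    from bounded_linear.tendsto[OF this r(2)] show ?thesis by (simp add: o_def)
  qed
  have MX: "M *v X = X"
    using LIMSEQ_unique[OF Mlim LIMSEQ_subseq_LIMSEQ[OF gX r(1), unfolded o_def]] .
  have MY: "M *v Y = Y"
    using LIMSEQ_unique[OF Mlim LIMSEQ_subseq_LIMSEQ[OF gY r(1), unfolded o_def]] .
  have MQ: "isoQ M"
    unfolding isoQ_def
  proof
    fix x
    have "isCont Q y" for y :: "'n rvec"
      using continuous_Q[OF continuous_on_id, of UNIV] by (simp add: continuous_on_eq_continuous_at)
    then have "(\<lambda>m. Q (g (r m) *v x)) \<longlonglongrightarrow> Q (M *v x)"
      by (rule isCont_tendsto_compose) (rule Mlim)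
    moreover have "Q (g (r m) *v x) = Q x" for m by (rule Q_isoQ[OF adm_isoQ[OF adm_g]])
    ultimately show "Q (M *v x) = Q x" by (simp add: LIMSEQ_const_iff)
  qed
  obtain M' where M': "M ** M' = mat 1" "M' ** M = mat 1" using isoQ_inverse[OF MQ] by metis
  have "M ** W ** M' = W" unfolding W_def using wdg_conj_isoQ[OF MQ M'(1)] by (simp add: MX MY)
  then have MW: "M ** W = W ** M"
    by (metis M'(2) matrix_mul_assoc matrix_mul_rid)
  then have MWW: "M ** (W ** W) = W ** W ** M" by (metis matrix_mul_assoc)
  have comm: "M ** b s = b s ** M" for s
    unfolding bg(1) by (simp add: matrix_add_ldistrib matrix_add_rdistrib matrix_scaleR_left
        matrix_scaleR_right matrix_mul_lid matrix_mul_rid MW MWW)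
  have "P\<^sub>1 - P\<^sub>3 \<in> tangent_algebra G"
  proof (rule limit_one_parameter_group_tangent[OF G(1) _ _ _ _ _ M'(1)])
    show "1\<^sup>2 *\<^sub>R P\<^sub>1 + 1 *\<^sub>R P\<^sub>2 + P\<^sub>3 = mat 1"
      using bg(2) by (simp add: b_def)
    show "(s\<^sup>2 *\<^sub>R P\<^sub>1 + s *\<^sub>R P\<^sub>2 + P\<^sub>3) ** (r\<^sup>2 *\<^sub>R P\<^sub>1 + r *\<^sub>R P\<^sub>2 + P\<^sub>3) =
        (s * r)\<^sup>2 *\<^sub>R P\<^sub>1 + (s * r) *\<^sub>R P\<^sub>2 + P\<^sub>3" for s r using bg(3) unfolding b_def .
    show "(A \<circ> r) k \<in> G" for k using A G(2) by auto
    have "filterlim (\<lambda>m. n (r m)) at_top sequentially"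
    proof (rule filterlim_at_top_mono[OF filterlim_subseq[OF r(1)]])
      show "eventually (\<lambda>m. r m \<le> n (r m)) sequentially" using n by simp
    qed
    moreover have "filterlim (\<lambda>k. \<mu> ^ k) at_top sequentially"
      using \<mu>1
        by (intro filterlim_at_infinity_imp_filterlim_at_top filterlim_realpow_sequentially_gt1) auto
    ultimately show "filterlim (\<lambda>k. \<mu> ^ n (r k)) at_top sequentially"
      by (rule filterlim_compose[rotated])
    have "(1 / \<mu> ^ n (r k)) *\<^sub>R ((A \<circ> r) k ** b (\<mu> ^ n (r k))) = g (r k)" for k
      using \<mu>1 by (simp add: hpow[symmetric] g_def matrix_scaleR_right)
    then show "(\<lambda>k. (1 / \<mu> ^ n (r k)) *\<^sub>R ((A \<circ> r) k **
        ((\<mu> ^ n (r k))\<^sup>2 *\<^sub>R P\<^sub>1 + (\<mu> ^ n (r k)) *\<^sub>R P\<^sub>2 + P\<^sub>3))) \<longlonglongrightarrow> M"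
      using r(2) by (simp add: b_def o_def)
    show "M ** (s\<^sup>2 *\<^sub>R P\<^sub>1 + s *\<^sub>R P\<^sub>2 + P\<^sub>3) = (s\<^sup>2 *\<^sub>R P\<^sub>1 + s *\<^sub>R P\<^sub>2 + P\<^sub>3) ** M" for s
      using comm unfolding b_def .
  qed
  then have "\<kappa> *\<^sub>R ((1 / \<kappa>) *\<^sub>R W) \<in> tangent_algebra G"
    unfolding bg(4) by (rule subspace_scale[OF subspace_tangent_algebra])
  then show ?thesis using \<kappa> by (simp add: W_def X_def Y_def)
qed

text \<open>Recurrent pairs are dense in an open set of pairs, and the tangent algebra is closed, so
  it contains \<open>wdg\<close> of all pairs in that set. Second differences recover a bilinear map
  from its values on an open set.\<close>

theorem hyperplane_wdg_tangent:
  assumes G: "matrix_group G" "L \<subseteq> G"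
    and u: "u $ ix_second = 0" and v: "v $ ix_second = 0"
  shows "wdg u v \<in> tangent_algebra G"
proof -
  let ?T = "tangent_algebra G"
  note sub = subspace_tangent_algebra[of G]
  define f where "f p = wdg (proj (fst p)) (proj (snd p))" for p :: "'n rvec \<times> 'n rvec"
  define W where "W = {p \<in> EE. 0 < (bq (proj (fst p)) (proj (snd p)))\<^sup>2 - Q (proj (fst p)) * Q (proj (snd p))}"
  have "W = EE \<inter> {p. 0 < (bq (proj (fst p)) (proj (snd p)))\<^sup>2 - Q (proj (fst p)) * Q (proj (snd p))}"
    by (auto simp: W_def)
  then have opW: "open W"
    by (simp only:) (intro open_Int open_EE open_Collect_less continuous_intros)
  have fcont: "continuous_on UNIV f"
  proof -
    have "bounded_linear (flat :: 'n rvec \<Rightarrow> _)"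
      by (simp add: linear_flat linear_conv_bounded_linear[symmetric])
    note flat_cont = bounded_linear.continuous_on[OF this]
    show ?thesis
      unfolding f_def wdg_def ot_def by (intro continuous_intros continuous_on_vec_lambda flat_cont)
  qed
  have inT: "f p \<in> ?T" if p: "p \<in> W" for p
  proof (rule ccontr)
    assume "f p \<notin> ?T"
    have "closed ?T" by (rule closed_subspace[OF sub])
    then have "open (f -` (- ?T))" using fcont by (simp add: continuous_on_open_vimage open_Compl)
    then have "open (W \<inter> f -` (- ?T))" using opW by blast
    moreover have "W \<inter> f -` (- ?T) \<subseteq> EE" by (auto simp: W_def)
    moreover have "W \<inter> f -` (- ?T) \<noteq> {}" using p \<open>f p \<notin> ?T\<close> by blast
    ultimately obtain q where q: "q \<in> W \<inter> f -` (- ?T)"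
      "\<forall>m. \<exists>A\<in>L. \<exists>k\<ge>m. dist (pm A ((sg ^^ k) q)) q < 1 / Suc m"
      using recurrent_point by meson
    then have "f q \<in> ?T" unfolding f_def by (intro recurrent_wdg_tangent[OF G]) (auto simp: W_def)
    with q show False by blast
  qed
  \<comment> \<open>Two points at positive distance, with squared hyperbolic cosine 9/8, below the
    bound 4 in \<open>EE\<close>; the factor 1/4 brings both inside the truncation
    \<open>Q > -1\<close>.\<close>
  define x0 :: "'n rvec" where "x0 = (1/4) *\<^sub>R (axis ix_first 1 + axis ix_last 1)"
  define y0 :: "'n rvec" where "y0 = (1/4) *\<^sub>R (2 *\<^sub>R axis ix_first 1 + axis ix_last 1)"
  have xn: "x0 $ ix_first = 1/4" "x0 $ ix_last = 1/4" "\<And>i. i \<noteq> ix_first \<Longrightarrow> i \<noteq> ix_last \<Longrightarrow> x0 $ i = 0"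
    and yn: "y0 $ ix_first = 1/2" "y0 $ ix_last = 1/4" "\<And>i. i \<noteq> ix_first \<Longrightarrow> i \<noteq> ix_last \<Longrightarrow> y0 $ i = 0"
    by (auto simp: x0_def y0_def axis_def)
  have px: "proj x0 = x0" "proj y0 = y0" using xn yn by (auto intro!: proj_eq_self)
  have "Q x0 = -1/8" "Q y0 = -1/4" "bq x0 y0 = -3/16"
    by (auto simp: Q_bq bq_alt xn yn)
  then have "(x0, y0) \<in> W"
    using xn yn by (auto simp: W_def EE_def px power2_eq_square)
  then obtain r where r: "r > 0" "ball (x0, y0) r \<subseteq> W" using opW open_contains_ball by blast
  define e where "e = r / (2 * (norm u + norm v + 1))"
  have den: "norm u + norm v + 1 > 0" by (simp add: add_nonneg_pos)
  then have e: "e > 0" using r(1) by (simp add: e_def)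
  have near: "(x0 + a *\<^sub>R u, y0 + c *\<^sub>R v) \<in> W" if "a \<in> {0, e}" "c \<in> {0, e}" for a c
  proof -
    have "norm (a *\<^sub>R u, c *\<^sub>R v) \<le> norm (a *\<^sub>R u) + norm (c *\<^sub>R v)"
      by (rule norm_Pair_le)
    also have "\<dots> \<le> e * (norm u + norm v)" using that e by (auto simp: algebra_simps)
    also have "\<dots> < e * (2 * (norm u + norm v + 1))"
      using e by (intro mult_strict_left_mono) (auto simp: add_nonneg_pos)
    also have "\<dots> = r" using den by (simp add: e_def)
    finally have "norm (a *\<^sub>R u, c *\<^sub>R v) < r" .
    moreover have "dist (x0, y0) (x0 + a *\<^sub>R u, y0 + c *\<^sub>R v) = norm (a *\<^sub>R u, c *\<^sub>R v)"
      by (simp add: dist_norm norm_Pair)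
    ultimately show ?thesis using r(2) by (auto simp: subset_iff)
  qed
  have fT: "wdg (x0 + a *\<^sub>R u) (y0 + c *\<^sub>R v) \<in> ?T"
    if "a \<in> {0, e}" "c \<in> {0, e}" for a c
    using inT[OF near[OF that]] u v by (simp add: f_def proj_add proj_scaleR px proj_eq_self)
  have "wdg (x0 + e *\<^sub>R u) (y0 + e *\<^sub>R v) - wdg (x0 + e *\<^sub>R u) y0 - (wdg x0 (y0 + e *\<^sub>R v) - wdg x0 y0) \<in> ?T"
    using fT[of e e] fT[of e 0] fT[of 0 e] fT[of 0 0] by (intro subspace_diff[OF sub]) simp_all
  moreover have "wdg (x0 + e *\<^sub>R u) (y0 + e *\<^sub>R v) - wdg (x0 + e *\<^sub>R u) y0 - (wdg x0 (y0 + e *\<^sub>R v) - wdg x0 y0)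
      = (e * e) *\<^sub>R wdg u v"
    by (simp add: wdg_add wdg_scaleR scaleR_add_right)
  ultimately have "(e * e) *\<^sub>R wdg u v \<in> ?T" by simp
  then have "(1 / (e * e)) *\<^sub>R ((e * e) *\<^sub>R wdg u v) \<in> ?T" by (rule subspace_scale[OF sub])
  then show ?thesis using e by simp
qed

end

section \<open>The projective linear group\<close>

lemma GL_simps [simp]:
  "carrier GL = {A. invertible A}" "A \<otimes>\<^bsub>GL\<^esub> B = A ** B" "\<one>\<^bsub>GL\<^esub> = mat 1"
  by (auto simp: GL_def)

lemma invertible_scaleR: "c \<noteq> 0 \<Longrightarrow> invertible (A :: real^'n^'n) \<Longrightarrow> invertible (c *\<^sub>R A)"
  unfolding invertible_def
proof (elim exE conjE)
  fix B assume "c \<noteq> 0" "A ** B = mat 1" "B ** A = mat 1"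
  then show "\<exists>A'. c *\<^sub>R A ** A' = mat 1 \<and> A' ** c *\<^sub>R A = mat 1"
    by (intro exI[of _ "(1 / c) *\<^sub>R B"]) (simp add: matrix_scaleR_left matrix_scaleR_right)
qed

lemma invertible_one: "invertible (mat 1 :: real^'n^'n)"
  by (auto simp: invertible_def intro!: exI[of _ "mat 1"] simp: matrix_mul_lid)

lemma group_GL: "group (GL :: (real^'n^'n) monoid)"
proof (rule groupI)
  fix A assume "A \<in> carrier (GL :: (real^'n^'n) monoid)"
  then show "\<exists>B\<in>carrier GL. B \<otimes>\<^bsub>GL\<^esub> A = \<one>\<^bsub>GL\<^esub>"
    by (auto simp: invertible_def)
qed (auto simp: invertible_one invertible_mult matrix_mul_assoc matrix_mul_lid)

lemma scalars_normal: "scalars \<lhd> (GL :: (real^'n^'n) monoid)"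
proof (rule group.normalI[OF group_GL])
  interpret group "GL :: (real^'n^'n) monoid" by (rule group_GL)
  show "subgroup (scalars :: (real^'n^'n) set) GL"
  proof (rule subgroupI)
    show "scalars \<subseteq> carrier (GL :: (real^'n^'n) monoid)"
      by (auto simp: scalars_def invertible_scaleR invertible_one)
    show "scalars \<noteq> ({} :: (real^'n^'n) set)" by (auto simp: scalars_def intro!: exI[of _ 1])
    show "inv\<^bsub>GL\<^esub> A \<in> scalars" if A: "A \<in> scalars" for A :: "real^'n^'n"
    proof -
      obtain c where c: "A = c *\<^sub>R mat 1" "c \<noteq> 0" using A by (auto simp: scalars_def)
      have "inv\<^bsub>GL\<^esub> A = (1 / c) *\<^sub>R mat 1"
        by (rule inv_equality) (use c in \<open>auto simp: matrix_scaleR_left matrix_scaleR_right invertible_scaleR invertible_one matrix_mul_lid\<close>)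
      then show ?thesis using c by (auto simp: scalars_def)
    qed
    show "A \<otimes>\<^bsub>GL\<^esub> B \<in> scalars"
      if "A \<in> scalars" "B \<in> scalars" for A B :: "real^'n^'n"
      using that by (auto simp: scalars_def matrix_scaleR_left matrix_scaleR_right matrix_mul_lid)
  qed
  show "\<forall>A\<in>carrier GL. scalars #>\<^bsub>GL\<^esub> A = A <#\<^bsub>GL\<^esub> scalars"
    by (auto simp: r_coset_def l_coset_def scalars_def matrix_scaleR_left matrix_scaleR_right
        matrix_mul_lid matrix_mul_rid)
qed

lemma group_PGL: "group (PGL :: (real^'n^'n) set monoid)"
  unfolding PGL_def by (rule normal.factorgroup_is_group[OF scalars_normal])

lemma pgl_class_alt: "pgl_class A = {c *\<^sub>R A | c. c \<noteq> 0}"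
  by (auto simp: pgl_class_def r_coset_def scalars_def matrix_scaleR_left matrix_mul_lid)

lemma pgl_class_self: "A \<in> pgl_class A"
  by (auto simp: pgl_class_alt intro!: exI[of _ 1])

lemma carrier_PGL: "carrier PGL = pgl_class ` {A. invertible A}"
  by (auto simp: PGL_def FactGroup_def RCOSETS_def pgl_class_def)

lemma pgl_class_mult: "invertible A \<Longrightarrow> invertible B \<Longrightarrow> pgl_class A \<otimes>\<^bsub>PGL\<^esub> pgl_class B = pgl_class (A ** B)"
  using normal.rcos_sum[OF scalars_normal, of A B] by (simp add: PGL_def FactGroup_def pgl_class_def)

lemma PGL_one: "\<one>\<^bsub>PGL\<^esub> = pgl_class (mat 1)"
  by (auto simp: PGL_def FactGroup_def pgl_class_alt scalars_def)

lemma pgl_class_inv: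
  assumes "A ** B = mat 1" "B ** (A :: real^'n^'n) = mat 1"
  shows "inv\<^bsub>PGL\<^esub> pgl_class A = pgl_class B"
proof -
  interpret group "PGL :: (real^'n^'n) set monoid" by (rule group_PGL)
  have "invertible A" "invertible B" using assms by (auto simp: invertible_def)
  then show ?thesis
    by (intro inv_equality) (auto simp: pgl_class_mult PGL_one carrier_PGL assms)
qed

lemma pgl_class_eqD: "pgl_class A = pgl_class B \<Longrightarrow> \<exists>c. c \<noteq> 0 \<and> A = c *\<^sub>R B"
  using pgl_class_self[of A] by (auto simp: pgl_class_alt)

lemma pgl_class_scaleR:
  assumes "c \<noteq> 0" shows "pgl_class (c *\<^sub>R A) = pgl_class A"
proof -
  have 1: "\<exists>r. k *\<^sub>R (c *\<^sub>R A) = r *\<^sub>R A \<and> r \<noteq> 0"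
    if "k \<noteq> 0" for k
    using that assms by (intro exI[of _ "k * c"]) simp
  have 2: "\<exists>r. k *\<^sub>R A = r *\<^sub>R (c *\<^sub>R A) \<and> r \<noteq> 0"
    if "k \<noteq> 0" for k
    using that assms by (intro exI[of _ "k / c"]) simp
  show ?thesis unfolding pgl_class_alt using 1 2 by blast
qed

lemma matrix_group_cone_over:
  assumes H: "subgroup H (PGL :: (real^'n^'n) set monoid)"
  shows "matrix_group (\<Union>H)"
proof -
  have HC: "H \<subseteq> pgl_class ` {A. invertible A}"
    using subgroup.subset[OF H] by (simp add: carrier_PGL)
  have mem: "A \<in> \<Union>H \<longleftrightarrow> invertible A \<and> pgl_class A \<in> H" for A
  proof
    assume "A \<in> \<Union>H"
    then obtain B where B: "invertible B" "pgl_class B \<in> H" "A \<in> pgl_class B" using HC by blast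
    then obtain c where "c \<noteq> 0" "A = c *\<^sub>R B" by (auto simp: pgl_class_alt)
    then show "invertible A \<and> pgl_class A \<in> H"
      using B by (simp add: invertible_scaleR pgl_class_scaleR)
  qed (use pgl_class_self in blast)
  have 1: "mat 1 \<in> \<Union>H"
    using subgroup.one_closed[OF H] unfolding mem by (simp add: PGL_one invertible_one)
  have 2: "A ** B \<in> \<Union>H" if "A \<in> \<Union>H" "B \<in> \<Union>H" for A B
    using that subgroup.m_closed[OF H, of "pgl_class A" "pgl_class B"]
    unfolding mem by (simp add: pgl_class_mult invertible_mult)
  have 3: "\<exists>B\<in>\<Union>H. A ** B = mat 1 \<and> B ** A = mat 1" if A: "A \<in> \<Union>H" for A
  proof -
    obtain B where B: "A ** B = mat 1" "B ** A = mat 1" using A unfolding mem by (auto simp: invertible_def)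
    then have "invertible B" by (auto simp: invertible_def)
    moreover have "pgl_class B \<in> H" using subgroup.m_inv_closed[OF H, of "pgl_class A"] A
      unfolding mem by (simp add: pgl_class_inv[OF B])
    ultimately have "B \<in> \<Union>H" unfolding mem by blast
    with B show ?thesis by blast
  qed
  show ?thesis unfolding matrix_group_def using 1 2 3 by blast
qed

lemma nrm_scaleR: "c \<noteq> 0 \<Longrightarrow> nrm (c *\<^sub>R x) = nrm x"
  by (simp add: nrm_def)

lemma act_pgl_class: "act (pgl_class A) x = nrm (A *v x)"
proof -
  have "(SOME B. B \<in> pgl_class A) \<in> pgl_class A" using pgl_class_self by (rule someI)
  then obtain c where c: "c \<noteq> 0" "(SOME B. B \<in> pgl_class A) = c *\<^sub>R A"
    by (auto simp: pgl_class_alt)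
  have "act (pgl_class A) x = nrm ((c *\<^sub>R A) *v x)"
    unfolding act_def c(2) by (simp add: nrm_def Let_def)
  also have "\<dots> = nrm (c *\<^sub>R (A *v x))" by (simp add: scaleR_matrix_vector_assoc)
  also have "\<dots> = nrm (A *v x)" using c(1) by (rule nrm_scaleR)
  finally show ?thesis .
qed

section \<open>Lifts of isometries\<close>

context dim_ge_4
begin

text \<open>The representative singled out in the definition of \<open>PSO\<close>. By
  \<open>lift_unique\<close> a class has at most one: \<open>Q\<close> determines the scalar up to
  sign and the future cone determines the sign. So the group can be handled as a group of
  matrices.\<close>

definition lift :: "'n rmat \<Rightarrow> bool" where
  "lift A \<longleftrightarrow> isoQ A \<and> det A = 1 \<and> (\<forall>x\<in>hyp. 0 < (A *v x) $ ix_last)"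

lemma hyp_future: "x \<in> hyp \<longleftrightarrow> future x \<and> (x :: 'n rvec) $ ix_last = 1"
  by (auto simp: hyp_def future_def)

lemma nrm_hyp: "future x \<Longrightarrow> nrm x \<in> hyp"
  by (simp add: nrm_def hyp_def future_def Q_scaleR mult_pos_neg)

lemma nrm_id: "x \<in> hyp \<Longrightarrow> nrm x = (x :: 'n rvec)"
  by (simp add: nrm_def hyp_def)

lemma nrm_mult: "future x \<Longrightarrow> nrm (A *v nrm x) = nrm (A *v (x :: 'n rvec))"
proof -
  assume "future x"
  then have "inverse (x $ ix_last) \<noteq> 0" by (simp add: future_def)
  moreover have "A *v nrm x = inverse (x $ ix_last) *\<^sub>R (A *v x)"
    by (simp add: nrm_def matrix_vector_mult_scaleR)
  ultimately show ?thesis by (simp add: nrm_scaleR)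
qed

lemma nrm_second: "future x \<Longrightarrow> nrm x $ ix_second = 0 \<longleftrightarrow> x $ ix_second = 0"
  by (simp add: nrm_def future_def)

lemma lift_future: "lift A \<Longrightarrow> future x \<Longrightarrow> future (A *v x)"
proof -
  assume A: "lift A" and x: "future x"
  have "0 < (A *v nrm x) $ ix_last" using A nrm_hyp[OF x] by (simp add: lift_def)
  moreover have "A *v x = (x $ ix_last) *\<^sub>R (A *v nrm x)"
    using x by (simp add: nrm_def future_def matrix_vector_mult_scaleR)
  ultimately have "0 < (A *v x) $ ix_last" using x by (simp add: future_def)
  then show ?thesis using A x by (simp add: future_def lift_def Q_isoQ)
qed

lemma lift_isoQ: "lift A \<Longrightarrow> isoQ A"
  by (simp add: lift_def)

lemma lift_invertible: "lift A \<Longrightarrow> invertible A"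
  by (simp add: lift_def invertible_det_nz)

lemma lift_one: "lift (mat 1)"
  by (auto simp: lift_def isoQ_def hyp_def)

lemma lift_mult: "lift A \<Longrightarrow> lift B \<Longrightarrow> lift (A ** B)"
  unfolding lift_def[of "A ** B"]
  using lift_future[of B] lift_future[of A]
  by (auto simp: isoQ_mult lift_isoQ det_mul lift_def[of A] lift_def[of B] matrix_vector_mul_assoc[symmetric]
      hyp_future) (metis (no_types) future_def lift_def)

lemma lift_inverse:
  assumes A: "lift A"
  obtains B where "lift B" "A ** B = mat 1" "B ** A = mat 1"
proof -
  obtain B where B: "A ** B = mat 1" "B ** A = mat 1" "isoQ B"
    using isoQ_inverse[OF lift_isoQ[OF A]] by metis
  have "det A * det B = 1" by (metis B(1) det_I det_mul)
  then have "det B = 1" using A by (simp add: lift_def)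
  moreover have "0 < (B *v x) $ ix_last" if x: "x \<in> hyp" for x
  proof (rule ccontr)
    assume n: "\<not> 0 < (B *v x) $ ix_last"
    have Q: "Q (B *v x) < 0" using x B(3) by (simp add: hyp_def Q_isoQ)
    then have "(B *v x) $ ix_last \<noteq> 0" using Q_last_0(2)[of "B *v x"] by auto
    then have "future (- (B *v x))" using n Q Q_scaleR[of "-1" "B *v x"] by (simp add: future_def)
    from lift_future[OF A this] have "future (- x)"
      using matrix_vector_mult_scaleR[of A "-1" "B *v x"] B(1) by (simp add: matrix_vector_mul_assoc)
    then show False using x by (simp add: hyp_def future_def)
  qed
  ultimately have "lift B" using B by (simp add: lift_def)
  with B that show ?thesis by blast
qed

lemma lift_unique:
  assumes "lift A" "lift B" "pgl_class A = pgl_class B" shows "A = B"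
proof -
  obtain c where c: "c \<noteq> 0" "A = c *\<^sub>R B" using pgl_class_eqD[OF assms(3)] by blast
  define x :: "'n rvec" where "x = axis ix_first 1 + axis ix_last 1"
  have xn: "x $ ix_first = 1" "x $ ix_last = 1" "\<And>i. i \<noteq> ix_first \<Longrightarrow> i \<noteq> ix_last \<Longrightarrow> x $ i = 0"
    by (auto simp: x_def axis_def)
  have Qx: "Q x = -2" by (simp add: Q_bq bq_alt xn)
  have "future x" by (simp add: future_def Qx xn)
  then have "future (A *v x)" "future (B *v x)" using assms lift_future by auto
  moreover have Ax: "A *v x = c *\<^sub>R (B *v x)" by (simp add: c scaleR_matrix_vector_assoc)
  ultimately have "c > 0" by (simp add: future_def zero_less_mult_iff)
  have "Q (A *v x) = Q x" "Q (B *v x) = Q x" using assms by (simp_all add: lift_isoQ Q_isoQ)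
  then have "c\<^sup>2 = 1" using Ax Qx by (simp add: Q_scaleR)
  then have "c = 1" using \<open>c > 0\<close> by (simp add: power2_eq_1_iff)
  then show ?thesis using c by simp
qed

lemma PSO_lift: "PSO = pgl_class ` {A :: 'n rmat. lift A}"
  by (auto simp: PSO_def lift_def isoQ_def)

lemma lift_hyp: "lift A \<Longrightarrow> x \<in> hyp \<Longrightarrow> nrm (A *v x) \<in> hyp"
  by (intro nrm_hyp lift_future) (auto simp: hyp_future)

lemma nrm_lift_mult: "lift B \<Longrightarrow> x \<in> hyp \<Longrightarrow> nrm (A *v nrm (B *v x)) = nrm ((A ** B) *v x)"
  by (subst nrm_mult) (auto simp: hyp_future lift_future matrix_vector_mul_assoc)

lemma hyp0_alt: "hyp0 = {x :: 'n rvec. x \<in> hyp \<and> x $ ix_second = 0}"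
  by (auto simp: hyp0_def)

definition base :: "'n rvec" where
  "base = axis ix_first 1 + axis ix_last 1"

lemma base_nth: "base $ ix_first = 1" "base $ ix_last = 1" "i \<noteq> ix_first \<Longrightarrow> i \<noteq> ix_last \<Longrightarrow> base $ i = 0"
  by (auto simp: base_def axis_def)

lemma base_hyp0: "base \<in> hyp0" "base \<in> hyp"
proof -
  have "Q base = -2" by (simp add: Q_bq bq_alt base_nth)
  then show "base \<in> hyp0" "base \<in> hyp" by (simp_all add: hyp0_alt hyp_def base_nth)
qed

lemma open_future: "open {x. future x}"
  unfolding future_def by (intro open_Collect_conj open_Collect_less continuous_intros)

lemma future_perturb:
  assumes "future x"
  obtains e where "e > 0" "future (x + e *\<^sub>R u)"
proof -
  have "((\<lambda>e. x + e *\<^sub>R u) \<longlongrightarrow> x + 0 *\<^sub>R u) (at_right 0)"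
    by (intro tendsto_intros)
  then have "eventually (\<lambda>e. x + e *\<^sub>R u \<in> {x. future x}) (at_right 0)"
    using topological_tendstoD[OF _ open_future] assms by fastforce
  then have "eventually (\<lambda>e. e > 0 \<and> future (x + e *\<^sub>R u)) (at_right (0::real))"
    using eventually_at_right_less[of 0] by eventually_elim auto
  then obtain e where "e > 0" "future (x + e *\<^sub>R u)"
    using eventually_happens'[of "at_right (0::real)"] by force
  with that show ?thesis by blast
qed

text \<open>The future vectors of the hyperplane span it, since a small multiple of any
  \<open>u\<close> may be added to \<open>base\<close>. So the condition on points is linear, and
  duality under \<open>bq\<close> turns it into one on the normal \<open>e2\<close>.\<close>

lemma lift_preserves_hyp0_iff:
  assumes A: "lift A"
  shows "(\<lambda>x. nrm (A *v x)) ` hyp0 = hyp0 \<longleftrightarrow> proj (A *v e2) = 0"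
proof
  assume p: "proj (A *v e2) = 0"
  have U: "(B *v u) $ ix_second = 0" if "lift B" "proj (B *v e2) = 0" "u $ ix_second = 0" for B u
  proof -
    define c where "c = (B *v e2) $ ix_second"
    have e: "B *v e2 = c *\<^sub>R e2" using that(2) by (simp add: proj_def c_def)
    have "Q (B *v e2) = Q (e2 :: 'n rvec)" using that(1) by (simp add: lift_isoQ Q_isoQ)
    then have "c \<noteq> 0" by (auto simp: e Q_scaleR Q_bq)
    have "bq (B *v u) (B *v e2) = bq u e2" by (rule isoQ_bq[OF lift_isoQ[OF that(1)]])
    then show ?thesis using that(3) \<open>c \<noteq> 0\<close> by (simp add: e)
  qed
  have sub: "(\<lambda>x. nrm (B *v x)) ` hyp0 \<subseteq> hyp0" if B: "lift B" "proj (B *v e2) = 0" for B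
  proof
    fix y assume "y \<in> (\<lambda>x. nrm (B *v x)) ` hyp0"
    then obtain x where x: "x \<in> hyp" "x $ ix_second = 0" "y = nrm (B *v x)" by (auto simp: hyp0_alt)
    then have "future (B *v x)" using B by (intro lift_future) (auto simp: hyp_future)
    then show "y \<in> hyp0" using x U[OF B x(2)] by (simp add: hyp0_alt nrm_hyp nrm_second)
  qed
  obtain B where B: "lift B" "A ** B = mat 1" "B ** A = mat 1" using lift_inverse[OF A] .
  define c where "c = (A *v e2) $ ix_second"
  have e: "A *v e2 = c *\<^sub>R e2" using p by (simp add: proj_def c_def)
  have "c *\<^sub>R (B *v e2) = B *v (A *v e2)" by (simp add: e matrix_vector_mult_scaleR)
  also have "\<dots> = e2" by (simp add: matrix_vector_mul_assoc B)
  finally have ce: "c *\<^sub>R (B *v e2) = e2" .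
  then have "c *\<^sub>R proj (B *v e2) = 0" using proj_scaleR[of c "B *v e2"] by (simp add: proj_e2)
  moreover have "c \<noteq> 0"
  proof
    assume "c = 0"
    then have "(e2 :: 'n rvec) = 0" using ce by simp
    then show False by (metis e2_nth(1) zero_index zero_neq_one)
  qed
  ultimately have pB: "proj (B *v e2) = 0" by simp
  show "(\<lambda>x. nrm (A *v x)) ` hyp0 = hyp0"
  proof
    show "(\<lambda>x. nrm (A *v x)) ` hyp0 \<subseteq> hyp0" by (rule sub[OF A p])
    show "hyp0 \<subseteq> (\<lambda>x. nrm (A *v x)) ` hyp0"
    proof
      fix x :: "'n rvec" assume x: "x \<in> hyp0"
      then have "nrm (B *v x) \<in> hyp0" using sub[OF B(1) pB] by blast
      moreover have "nrm (A *v nrm (B *v x)) = x"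
        using x nrm_lift_mult[OF B(1), of x A] by (simp add: hyp0_alt B nrm_id)
      ultimately show "x \<in> (\<lambda>x. nrm (A *v x)) ` hyp0" by (metis image_eqI)
    qed
  qed
next
  assume im: "(\<lambda>x. nrm (A *v x)) ` hyp0 = hyp0"
  obtain B where B: "lift B" "A ** B = mat 1" "B ** A = mat 1" using lift_inverse[OF A] .
  have h0: "(B *v x) $ ix_second = 0" if x: "future x" "x $ ix_second = 0" for x
  proof -
    have "nrm x \<in> hyp0" using x by (simp add: hyp0_alt nrm_hyp nrm_second)
    then obtain y where y: "y \<in> hyp" "y $ ix_second = 0" "nrm x = nrm (A *v y)"
      using im by (force simp: hyp0_alt)
    have "nrm (B *v x) = nrm (B *v nrm (A *v y))" using nrm_mult[OF x(1), of B] y by simp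
    also have "\<dots> = y" using y nrm_lift_mult[OF A, of y B] by (simp add: B nrm_id)
    finally show ?thesis using y(2) nrm_second[OF lift_future[OF B(1) x(1)]] by simp
  qed
  have U: "(B *v u) $ ix_second = 0" if u: "u $ ix_second = 0" for u
  proof -
    have fb: "future base" "base $ ix_second = 0" using base_hyp0 by (auto simp: hyp0_alt hyp_future)
    obtain e where e: "e > 0" "future (base + e *\<^sub>R u)" using future_perturb[OF fb(1)] .
    have "(B *v (base + e *\<^sub>R u)) $ ix_second = 0" by (rule h0[OF e(2)]) (use fb u in simp)
    then show ?thesis using h0[OF fb] e(1)
      by (simp add: matrix_vector_right_distrib matrix_vector_mult_scaleR)
  qed
  show "proj (A *v e2) = 0"
  proof (rule ccontr)
    assume nz: "proj (A *v e2) \<noteq> 0"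
    obtain y where y: "y $ ix_second = 0" "bq y (proj (A *v e2)) = 1"
      using exists_dual_in_hyperplane[OF nz] by auto
    have "bq (A *v e2) y = 1" using y bq_proj[OF y(1), of "A *v e2"] by (simp add: bq_commute)
    moreover have "bq (A *v e2) (A *v (B *v y)) = bq e2 (B *v y)" by (rule isoQ_bq[OF lift_isoQ[OF A]])
    moreover have "A *v (B *v y) = y" by (simp add: matrix_vector_mul_assoc B)
    ultimately show False using U[OF y(1)] by simp
  qed
qed

lemma lift_adm:
  assumes A: "lift A" and p: "proj (A *v e2) = 0"
  shows "adm A"
proof -
  define c where "c = (A *v e2) $ ix_second"
  have e: "A *v e2 = c *\<^sub>R e2" using p by (simp add: proj_def c_def)
  have "Q (A *v e2) = Q (e2 :: 'n rvec)" using A by (simp add: lift_isoQ Q_isoQ)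
  then have "c \<noteq> 0" by (auto simp: e Q_scaleR Q_bq)
  have "proj (A *v x) = A *v proj x" for x
  proof -
    have "bq (A *v proj x) (A *v e2) = bq (proj x) e2" by (rule isoQ_bq[OF lift_isoQ[OF A]])
    then have "(A *v proj x) $ ix_second = 0" using \<open>c \<noteq> 0\<close> by (simp add: e)
    then have "proj (A *v proj x) = A *v proj x" by (rule proj_eq_self)
    moreover have "A *v x = A *v proj x + x $ ix_second *\<^sub>R (A *v e2)"
      by (subst proj_decomp[of x]) (simp only: matrix_vector_right_distrib matrix_vector_mult_scaleR)
    ultimately show ?thesis by (simp add: proj_add proj_scaleR p)
  qed
  with A show ?thesis by (simp add: adm_def lift_isoQ)
qed

end

section \<open>The action on hyperbolic space\<close>

locale hyp_manifold = dim_ge_4 dim_type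
  for dim_type :: "'n::{finite,linorder} itself" +
  fixes \<Gamma> :: "('n rmat) set set"
  assumes sub: "subgroup \<Gamma> PGL" and PSO: "\<Gamma> \<subseteq> PSO"
    and fpd: "free_properly_discontinuous \<Gamma>"
begin

definition lifts :: "('n rmat) set" where
  "lifts = {A. lift A \<and> pgl_class A \<in> \<Gamma>}"

abbreviation pa :: "'n rmat \<Rightarrow> 'n rvec \<Rightarrow> 'n rvec" where
  "pa A \<equiv> \<lambda>x. nrm (A *v x)"

lemma act_eq: "act (pgl_class A) = pa A"
  by (rule ext) (rule act_pgl_class)

lemma lifts_lift: "A \<in> lifts \<Longrightarrow> lift A"
  by (simp add: lifts_def)

lemma lifts_\<Gamma>: "A \<in> lifts \<Longrightarrow> pgl_class A \<in> \<Gamma>"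
  by (simp add: lifts_def)

lemma \<Gamma>_lifts: "\<gamma> \<in> \<Gamma> \<Longrightarrow> \<exists>A\<in>lifts. \<gamma> = pgl_class A"
  using PSO by (auto simp: lifts_def PSO_lift)

lemma lifts_one: "mat 1 \<in> lifts"
  using subgroup.one_closed[OF sub] by (simp add: lifts_def lift_one PGL_one)

lemma lifts_mult: "A \<in> lifts \<Longrightarrow> B \<in> lifts \<Longrightarrow> A ** B \<in> lifts"
  using subgroup.m_closed[OF sub, of "pgl_class A" "pgl_class B"]
  by (simp add: lifts_def lift_mult pgl_class_mult lift_invertible)

lemma lifts_inverse:
  assumes "A \<in> lifts"
  obtains B where "B \<in> lifts" "A ** B = mat 1" "B ** A = mat 1"
proof -
  obtain B where B: "lift B" "A ** B = mat 1" "B ** A = mat 1" using lift_inverse[OF lifts_lift[OF assms]] .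
  moreover have "pgl_class B \<in> \<Gamma>"
    using subgroup.m_inv_closed[OF sub lifts_\<Gamma>[OF assms]] by (simp add: pgl_class_inv[OF B(2,3)])
  ultimately show ?thesis using that by (simp add: lifts_def)
qed

lemma lifts_eq_one: "A \<in> lifts \<Longrightarrow> pgl_class A = \<one>\<^bsub>PGL\<^esub> \<Longrightarrow> A = mat 1"
  using lift_unique[OF lifts_lift lift_one] by (simp add: PGL_one)

lemma pa_hyp: "A \<in> lifts \<Longrightarrow> x \<in> hyp \<Longrightarrow> pa A x \<in> hyp"
  by (rule lift_hyp[OF lifts_lift])

lemma pa_mult: "B \<in> lifts \<Longrightarrow> x \<in> hyp \<Longrightarrow> pa A (pa B x) = pa (A ** B) x"
  by (rule nrm_lift_mult[OF lifts_lift])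

lemma pa_one: "x \<in> hyp \<Longrightarrow> pa (mat 1) x = x"
  by (simp add: nrm_id)

lemma pa_inverse: "B \<in> lifts \<Longrightarrow> A ** B = mat 1 \<Longrightarrow> x \<in> hyp \<Longrightarrow> pa A (pa B x) = x"
  by (simp add: pa_mult nrm_id)

lemma pa_isCont:
  assumes "A \<in> lifts" "x \<in> hyp" shows "isCont (pa A) x"
proof -
  have "future (A *v x)" using assms by (intro lift_future lifts_lift) (auto simp: hyp_future)
  then have "(A *v x) $ ix_last \<noteq> 0" by (simp add: future_def)
  then show ?thesis unfolding nrm_def
    by (intro continuous_intros bounded_linear.isCont[OF matrix_vector_mul_bounded_linear]) auto
qed

lemma pa_continuous_on: "A \<in> lifts \<Longrightarrow> X \<subseteq> hyp \<Longrightarrow> continuous_on X (pa A)"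
  by (intro continuous_at_imp_continuous_on ballI pa_isCont) auto

lemma pa_image_mult: "B \<in> lifts \<Longrightarrow> X \<subseteq> hyp \<Longrightarrow> pa A ` pa B ` X = pa (A ** B) ` X"
  unfolding image_image by (intro image_cong refl pa_mult) auto

lemma pa_image_one: "X \<subseteq> hyp \<Longrightarrow> pa (mat 1) ` X = X"
proof -
  assume X: "X \<subseteq> hyp"
  then have "pa (mat 1) ` X = (\<lambda>x. x) ` X" by (intro image_cong refl pa_one) auto
  then show ?thesis by simp
qed

lemma pa_image_hyp: "A \<in> lifts \<Longrightarrow> X \<subseteq> hyp \<Longrightarrow> pa A ` X \<subseteq> hyp"
  using pa_hyp by blast

lemma pa_openin:
  assumes A: "A \<in> lifts" and W: "openin (top_of_set hyp) W"
  shows "openin (top_of_set hyp) (pa A ` W)"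
proof -
  obtain B where B: "B \<in> lifts" "A ** B = mat 1" "B ** A = mat 1" using lifts_inverse[OF A] .
  have Wh: "W \<subseteq> hyp" using openin_imp_subset[OF W] .
  have "openin (top_of_set hyp) (hyp \<inter> pa B -` W)"
    by (rule continuous_openin_preimage[OF pa_continuous_on[OF B(1) order_refl] _ W])
      (use pa_hyp[OF B(1)] in auto)
  moreover have "hyp \<inter> pa B -` W = pa A ` W"
  proof
    show "hyp \<inter> pa B -` W \<subseteq> pa A ` W"
    proof
      fix x assume "x \<in> hyp \<inter> pa B -` W"
      then show "x \<in> pa A ` W" using pa_inverse[OF B(1,2), of x] by (metis IntD1 IntD2 image_eqI vimageD)
    qed
    show "pa A ` W \<subseteq> hyp \<inter> pa B -` W"
    proof
      fix y assume "y \<in> pa A ` W"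
      then obtain x where "x \<in> W" "y = pa A x" by blast
      then show "y \<in> hyp \<inter> pa B -` W" using Wh pa_hyp[OF A] pa_inverse[OF A B(3), of x] by auto
    qed
  qed
  ultimately show ?thesis by simp
qed

lemma pa_image_components:
  assumes A: "A \<in> lifts" and X: "X \<subseteq> hyp" "\<And>B. B \<in> lifts \<Longrightarrow> pa B ` X \<subseteq> X" and C: "C \<in> components X"
  shows "pa A ` C \<in> components X"
proof -
  have sub: "\<exists>C'\<in>components X. pa A ` C \<subseteq> C'" if A: "A \<in> lifts"
    and C: "C \<in> components X" for A C
  proof -
    have CX: "C \<subseteq> X" "C \<noteq> {}" "connected C"
      using C by (auto simp: in_components_subset in_components_nonempty in_components_connected)
    have "connected (pa A ` C)"
      using CX X(1) by (intro connected_continuous_image pa_continuous_on[OF A]) auto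
    moreover have "pa A ` C \<subseteq> X" "X \<noteq> {}" using CX X(2)[OF A] by auto
    ultimately show ?thesis using exists_component_superset[of "pa A ` C" X] by blast
  qed
  obtain B where B: "B \<in> lifts" "A ** B = mat 1" "B ** A = mat 1" using lifts_inverse[OF A] .
  obtain C' where C': "C' \<in> components X" "pa A ` C \<subseteq> C'" using sub[OF A C] by blast
  obtain C'' where C'': "C'' \<in> components X" "pa B ` C' \<subseteq> C''" using sub[OF B(1) C'(1)] by blast
  have Ch: "C \<subseteq> hyp" "C' \<subseteq> hyp" using C C'(1) X(1) in_components_subset by blast+
  have "C = pa B ` pa A ` C" using pa_image_mult[OF A Ch(1), of B] pa_image_one[OF Ch(1)] by (simp add: B)
  also have "\<dots> \<subseteq> pa B ` C'" using C'(2) by (rule image_mono)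
  finally have CB: "C \<subseteq> pa B ` C'" .
  then have "C \<subseteq> C''" using C''(2) by simp
  then have "C = C''"
    using C C''(1) in_components_nonempty[OF C] components_nonoverlap[OF C C''(1)] by blast
  then have eq: "pa B ` C' = C" using CB C''(2) by simp
  have "C' = pa A ` pa B ` C'"
    using pa_image_mult[OF B(1) Ch(2), of A] pa_image_one[OF Ch(2)] by (simp add: B)
  then show ?thesis using eq C'(1) by simp
qed

lemma pa_hyp_closure:
  assumes A: "A \<in> lifts" and C: "C \<subseteq> hyp"
  shows "pa A ` hyp_closure C = hyp_closure (pa A ` C)"
proof -
  have sub: "pa A ` hyp_closure C \<subseteq> hyp_closure (pa A ` C)" if A: "A \<in> lifts"
    and C: "C \<subseteq> hyp" for A C
  proof
    fix y assume "y \<in> pa A ` hyp_closure C"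
    then obtain x where x: "x \<in> hyp" "x \<in> closure C" "y = pa A x" by (auto simp: hyp_closure_def)
    obtain f where f: "\<And>k. f k \<in> C" "f \<longlonglongrightarrow> x"
      using x(2) by (auto simp: closure_sequential)
    have "(\<lambda>k. pa A (f k)) \<longlonglongrightarrow> pa A x"
      by (rule isCont_tendsto_compose[OF pa_isCont[OF A x(1)] f(2)])
    then have "pa A x \<in> closure (pa A ` C)"
      unfolding closure_sequential using f(1) by (intro exI[of _ "\<lambda>k. pa A (f k)"]) blast
    then show "y \<in> hyp_closure (pa A ` C)" using x pa_hyp[OF A x(1)] by (simp add: hyp_closure_def)
  qed
  obtain B where B: "B \<in> lifts" "A ** B = mat 1" "B ** A = mat 1" using lifts_inverse[OF A] .
  have hh: "hyp_closure X \<subseteq> hyp" for X by (auto simp: hyp_closure_def)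
  have "hyp_closure (pa A ` C) = pa A ` pa B ` hyp_closure (pa A ` C)"
    using pa_image_mult[OF B(1) hh, of A] pa_image_one[OF hh] by (simp add: B)
  also have "\<dots> \<subseteq> pa A ` hyp_closure (pa B ` pa A ` C)"
    by (intro image_mono sub B(1) pa_image_hyp A C)
  also have "pa B ` pa A ` C = C" using pa_image_mult[OF A C, of B] pa_image_one[OF C] by (simp add: B)
  finally show ?thesis using sub[OF A C] by blast
qed

text \<open>Only finitely many nontrivial elements bring the compact set \<open>K\<close> around
  \<open>x\<close> back to itself, and none of them fixes \<open>x\<close>.\<close>

lemma free_small_neighbourhood:
  assumes x: "x \<in> hyp"
  shows "\<exists>e>0. \<forall>A\<in>lifts. A \<noteq> mat 1 \<longrightarrow> (\<forall>z\<in>hyp. dist z x < e \<longrightarrow> \<not> dist (pa A z) x < e)"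
proof -
  have "open {z. future z}" by (rule open_future)
  moreover have "x \<in> {z. future z}" using x by (simp add: hyp_future)
  ultimately obtain r where r: "r > 0" "cball x r \<subseteq> {z. future z}"
    using open_contains_cball by blast
  define K where "K = cball x r \<inter> {z. z $ ix_last = 1}"
  have "closed {z :: 'n rvec. z $ ix_last = 1}" by (intro closed_Collect_eq continuous_intros)
  then have "compact K" unfolding K_def by (intro compact_Int_closed compact_cball)
  moreover have Kh: "K \<subseteq> hyp" using r by (auto simp: K_def hyp_future)
  ultimately have fin: "finite {\<gamma> \<in> \<Gamma>. act \<gamma> ` K \<inter> K \<noteq> {}}"
    using fpd by (auto simp: free_properly_discontinuous_def)
  define \<Phi> where "\<Phi> = {A \<in> lifts. A \<noteq> mat 1 \<and> pa A ` K \<inter> K \<noteq> {}}"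
  have "pgl_class ` \<Phi> \<subseteq> {\<gamma> \<in> \<Gamma>. act \<gamma> ` K \<inter> K \<noteq> {}}"
    unfolding \<Phi>_def by (auto simp: lifts_\<Gamma> act_pgl_class)
  moreover have "inj_on pgl_class \<Phi>"
    by (rule inj_onI) (auto simp: \<Phi>_def intro: lift_unique lifts_lift)
  ultimately have fin\<Phi>: "finite \<Phi>" using finite_imageD[OF finite_subset[OF _ fin]] by blast
  have "\<exists>e>0. \<forall>z\<in>hyp. dist z x < e \<longrightarrow> \<not> dist (pa A z) x < e"
    if A: "A \<in> \<Phi>" for A
  proof -
    have Al: "A \<in> lifts" "A \<noteq> mat 1" using A by (auto simp: \<Phi>_def)
    have "pa A x \<noteq> x"
    proof
      assume "pa A x = x"
      then have "act (pgl_class A) x = x" by (simp add: act_pgl_class)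
      then have "pgl_class A = \<one>\<^bsub>PGL\<^esub>"
        using fpd x lifts_\<Gamma>[OF Al(1)] by (auto simp: free_properly_discontinuous_def)
      then show False using lifts_eq_one Al by blast
    qed
    then have d: "dist (pa A x) x / 2 > 0" by simp
    have "\<exists>e>0. \<forall>z. dist z x < e \<longrightarrow> dist (pa A z) (pa A x) < dist (pa A x) x / 2"
      using pa_isCont[OF Al(1) x] d unfolding continuous_at_eps_delta by blast
    then obtain e where e: "e > 0" "\<And>z. dist z x < e \<Longrightarrow> dist (pa A z) (pa A x) < dist (pa A x) x / 2" by blast
    show ?thesis
    proof (intro exI[of _ "min e (dist (pa A x) x / 2)"] conjI ballI impI notI)
      fix z assume "dist z x < min e (dist (pa A x) x / 2)" "dist (pa A z) x < min e (dist (pa A x) x / 2)"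
      then have "dist (pa A z) (pa A x) < dist (pa A x) x / 2" "dist (pa A z) x < dist (pa A x) x / 2"
        using e(2) by auto
      then show False using dist_triangle3[of "pa A x" x "pa A z"] by simp
    qed (use e d in auto)
  qed
  then obtain \<epsilon> where \<epsilon>: "\<And>A. A \<in> \<Phi> \<Longrightarrow> \<epsilon> A > 0"
    "\<And>A z. A \<in> \<Phi> \<Longrightarrow> z \<in> hyp \<Longrightarrow> dist z x < \<epsilon> A \<Longrightarrow> \<not> dist (pa A z) x < \<epsilon> A" by metis
  define e where "e = Min (insert r (\<epsilon> ` \<Phi>))"
  have e: "e > 0" "e \<le> r" "\<And>A. A \<in> \<Phi> \<Longrightarrow> e \<le> \<epsilon> A"
    using fin\<Phi> \<epsilon>(1) r(1) by (auto simp: e_def)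
  show ?thesis
  proof (intro exI[of _ e] conjI ballI impI notI)
    fix A z assume A: "A \<in> lifts" "A \<noteq> mat 1"
      and z: "z \<in> hyp" "dist z x < e" "dist (pa A z) x < e"
    have "z \<in> K" "pa A z \<in> K"
      using z e(2) pa_hyp[OF A(1) z(1)] by (auto simp: K_def hyp_future dist_commute)
    then have "A \<in> \<Phi>" using A by (auto simp: \<Phi>_def)
    then show False using \<epsilon>(2)[of A z] e(3)[of A] z by auto
  qed (use e in auto)
qed

text \<open>\<open>hyp\<close> is exhausted by the compact sets \<open>K m\<close>. Every element
  takes \<open>base\<close> to a point of one of them, and only finitely many bring a given
  \<open>K m\<close> back to itself.\<close>

lemma countable_lifts: "countable lifts"
proof -
  define K where "K m = {z :: 'n rvec. z $ ix_last = 1} \<inter> {z. Q z \<le> - 1 / Suc m} \<inter> cball 0 (real m)" for m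
  have K: "compact (K m)" "K m \<subseteq> hyp" for m
  proof -
    have "closed {z :: 'n rvec. z $ ix_last = 1}" "closed {z :: 'n rvec. Q z \<le> - 1 / Suc m}"
      by (intro closed_Collect_eq closed_Collect_le continuous_intros)+
    then show "compact (K m)" unfolding K_def by (metis closed_Int closed_Int_compact compact_cball)
    have "- 1 / Suc m < (0::real)" by simp
    then show "K m \<subseteq> hyp" unfolding K_def hyp_def by (auto intro: le_less_trans)
  qed
  have Kmono: "K m \<subseteq> K m'" if "m \<le> m'" for m m'
  proof -
    have "1 / real (Suc m') \<le> 1 / real (Suc m)" using that by (simp add: frac_le)
    then show ?thesis using that by (auto simp: K_def)
  qed
  have ex: "\<exists>m. z \<in> K m" if z: "z \<in> hyp" for z
  proof -
    obtain m1 where m1: "1 / Suc m1 < - Q z" using z nat_approx_posE[of "- Q z"] by (auto simp: hyp_def)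
    obtain m2 where m2: "norm z \<le> real m2" using real_arch_simple by blast
    have "z \<in> {z. Q z \<le> - 1 / Suc (max m1 m2)}"
    proof -
      have "1 / real (Suc (max m1 m2)) \<le> 1 / real (Suc m1)" by (simp add: frac_le)
      then show ?thesis using m1 by simp
    qed
    then show ?thesis using z m2 by (intro exI[of _ "max m1 m2"]) (auto simp: K_def hyp_def)
  qed
  have "pgl_class ` lifts \<subseteq> (\<Union>m. {\<gamma> \<in> \<Gamma>. act \<gamma> ` K m \<inter> K m \<noteq> {}})"
  proof clarify
    fix A assume A: "A \<in> lifts"
    obtain m1 m2 where "base \<in> K m1" "pa A base \<in> K m2" using ex base_hyp0 pa_hyp[OF A] by meson
    then have "base \<in> K (max m1 m2)" "pa A base \<in> K (max m1 m2)"
      using Kmono by (meson max.cobounded1 max.cobounded2 subsetD)+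
    then have "act (pgl_class A) ` K (max m1 m2) \<inter> K (max m1 m2) \<noteq> {}"
      by (auto simp: act_pgl_class)
    then show "pgl_class A \<in> (\<Union>m. {\<gamma> \<in> \<Gamma>. act \<gamma> ` K m \<inter> K m \<noteq> {}})" using lifts_\<Gamma>[OF A] by blast
  qed
  moreover have "finite {\<gamma> \<in> \<Gamma>. act \<gamma> ` K m \<inter> K m \<noteq> {}}" for m
    using fpd K[of m] unfolding free_properly_discontinuous_def by blast
  then have "countable (\<Union>m. {\<gamma> \<in> \<Gamma>. act \<gamma> ` K m \<inter> K m \<noteq> {}})"
    by (intro countable_UN countable_finite countableI_type)
  ultimately have "countable (pgl_class ` lifts)" using countable_subset by blast
  moreover have "inj_on pgl_class lifts" by (rule inj_onI) (auto intro: lift_unique lifts_lift)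
  ultimately show ?thesis using countable_image_inj_on by blast
qed

definition lifts0 :: "('n rmat) set" where
  "lifts0 = {A \<in> lifts. proj (A *v e2) = 0}"

lemma lifts0_iff: "A \<in> lifts0 \<longleftrightarrow> A \<in> lifts \<and> pa A ` hyp0 = hyp0"
  using lift_preserves_hyp0_iff[OF lifts_lift] by (auto simp: lifts0_def)

lemma stab_hyp0: "stab \<Gamma> hyp0 = pgl_class ` lifts0"
proof
  show "stab \<Gamma> hyp0 \<subseteq> pgl_class ` lifts0"
  proof
    fix \<gamma> assume "\<gamma> \<in> stab \<Gamma> hyp0"
    then have g: "\<gamma> \<in> \<Gamma>" "act \<gamma> ` hyp0 = hyp0" by (auto simp: stab_def)
    then obtain A where A: "A \<in> lifts" "\<gamma> = pgl_class A" using \<Gamma>_lifts by blast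
    then show "\<gamma> \<in> pgl_class ` lifts0" using g by (simp add: act_eq lifts0_iff)
  qed
  show "pgl_class ` lifts0 \<subseteq> stab \<Gamma> hyp0"
  proof
    fix \<gamma> assume "\<gamma> \<in> pgl_class ` lifts0"
    then obtain A where A: "A \<in> lifts0" "\<gamma> = pgl_class A" by blast
    then have "A \<in> lifts" "pa A ` hyp0 = hyp0" by (simp_all add: lifts0_iff)
    then show "\<gamma> \<in> stab \<Gamma> hyp0" using A(2) by (simp add: stab_def act_eq lifts_\<Gamma>)
  qed
qed

lemma hyp0_hyp: "(hyp0 :: ('n rvec) set) \<subseteq> hyp"
  by (auto simp: hyp0_alt)

lemma lifts0_group: "matrix_group lifts0"
proof -
  have "mat 1 \<in> lifts0" by (simp add: lifts0_def lifts_one proj_e2)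
  moreover have "A ** B \<in> lifts0" if "A \<in> lifts0" "B \<in> lifts0" for A B
  proof -
    have "pa (A ** B) ` hyp0 = hyp0"
      using that pa_image_mult[OF _ hyp0_hyp, of B A] by (auto simp: lifts0_iff)
    then show ?thesis using that by (simp add: lifts0_iff lifts_mult)
  qed
  moreover have "\<exists>B\<in>lifts0. A ** B = mat 1 \<and> B ** A = mat 1" if "A \<in> lifts0" for A
  proof -
    have A: "A \<in> lifts" "pa A ` hyp0 = hyp0" using that by (auto simp: lifts0_iff)
    obtain B where B: "B \<in> lifts" "A ** B = mat 1" "B ** A = mat 1" using lifts_inverse[OF A(1)] .
    have "pa B ` hyp0 = pa B ` pa A ` hyp0" using A(2) by simp
    also have "\<dots> = hyp0"
      using pa_image_mult[OF A(1) hyp0_hyp, of B] pa_image_one[OF hyp0_hyp] by (simp add: B)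
    finally show ?thesis using B by (intro bexI[of _ B]) (auto simp: lifts0_iff)
  qed
  ultimately show ?thesis by (auto simp: matrix_group_def)
qed

lemma wdg_tangent:
  assumes fv: "finite_volume_quotient (UNIV - {ix_second}) hyp0 (stab \<Gamma> hyp0)"
    and G: "matrix_group G" "lifts0 \<subseteq> G"
    and uv: "u $ ix_second = 0" "v $ ix_second = 0"
  shows "wdg u v \<in> tangent_algebra G"
proof -
  obtain D where D: "D \<in> sets borel" "D \<subseteq> hyp0" "\<forall>x\<in>hyp0. \<exists>!y. y \<in> D \<inter> orbit (stab \<Gamma> hyp0) x"
    "hyp_volume (UNIV - {ix_second :: 'n}) D < \<infinity>"
    using fv unfolding finite_volume_quotient_def by (elim exE conjE)
  have "hyperplane_lattice lifts0 D"
  proof unfold_locales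
    show "matrix_group lifts0" by (rule lifts0_group)
    show "countable lifts0" using countable_lifts by (rule countable_subset[rotated]) (auto simp: lifts0_def)
    show "adm A" if "A \<in> lifts0" for A using that lift_adm lifts_lift by (auto simp: lifts0_def)
    show "future (A *v x)" if "A \<in> lifts0" "future x" for A x
      using that lift_future lifts_lift by (auto simp: lifts0_def)
    show "D \<in> sets borel" by (rule D)
    show "emeasure lborel {x. \<bar>x $ ix_second\<bar> \<le> 1 \<and> proj x \<in> cone_set D} < \<infinity>"
      by (rule hyp_volume_hyperplane_finite[OF D(1,4)])
    show "\<exists>A\<in>lifts0. nrm (A *v x) \<in> D" if x: "future x" "x $ ix_second = 0" for x
    proof -
      have "nrm x \<in> hyp0" using x by (simp add: hyp0_alt nrm_hyp nrm_second)
      then have "\<exists>y. y \<in> D \<inter> orbit (stab \<Gamma> hyp0) (nrm x)"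
        using D(3) ex1_implies_ex by metis
      then obtain \<gamma> where "\<gamma> \<in> stab \<Gamma> hyp0" "act \<gamma> (nrm x) \<in> D"
        by (auto simp: orbit_def)
      then obtain A where A: "A \<in> lifts0" "nrm (A *v nrm x) \<in> D"
        by (auto simp: stab_hyp0 act_pgl_class)
      then show ?thesis using nrm_mult[OF x(1), of A] by (intro bexI[of _ A]) simp_all
    qed
    show "\<exists>e>0. \<forall>A\<in>lifts0. A \<noteq> mat 1 \<longrightarrow> (\<forall>z. future z \<longrightarrow> z $ ix_second = 0 \<longrightarrow>
        dist (nrm z) (nrm x) < e \<longrightarrow> \<not> dist (nrm (A *v z)) (nrm x) < e)"
      if x: "future x" "x $ ix_second = 0" for x
    proof -
      obtain e where e: "e > 0" "\<And>A z. A \<in> lifts \<Longrightarrow> A \<noteq> mat 1 \<Longrightarrow> z \<in> hyp \<Longrightarrow>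
          dist z (nrm x) < e \<Longrightarrow> \<not> dist (pa A z) (nrm x) < e"
        using free_small_neighbourhood[OF nrm_hyp[OF x(1)]] by blast
      show ?thesis
      proof (intro exI[of _ e] conjI ballI impI allI)
        fix A z assume A: "A \<in> lifts0" "A \<noteq> mat 1" and z: "future z" "dist (nrm z) (nrm x) < e"
        then show "\<not> dist (nrm (A *v z)) (nrm x) < e"
          using e(2)[of A "nrm z"] nrm_hyp[OF z(1)] nrm_mult[OF z(1), of A] by (auto simp: lifts0_def)
      qed (rule e)
    qed
  qed
  then show ?thesis using hyperplane_lattice.hyperplane_wdg_tangent G uv by blast
qed

end

section \<open>Components of the complement of the hypersurface\<close>

locale hyp_hypersurface = hyp_manifold dim_type \<Gamma>
  for dim_type :: "'n::{finite,linorder} itself" and \<Gamma> :: "('n rmat) set set" +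
  fixes S :: "('n rvec) set set"
  assumes hypersurface: "complete_totally_geodesic_hypersurface \<Gamma> S"
    and connectedS: "connectedin (quotient_top \<Gamma>) S"
    and hyp0_component: "hyp0 \<in> components (\<Union>S)"
    and two_sided: "stab \<Gamma> hyp0 \<subseteq> PSO0"
begin

abbreviation T :: "('n rvec) set" where
  "T \<equiv> \<Union>S"

definition side :: "real \<Rightarrow> ('n rvec) set" where
  "side s = {x \<in> hyp. 0 < s * x $ ix_second}"

lemma orbit_alt: "orbit \<Gamma> x = (\<lambda>A. pa A x) ` lifts"
proof
  show "orbit \<Gamma> x \<subseteq> (\<lambda>A. pa A x) ` lifts"
  proof
    fix y assume "y \<in> orbit \<Gamma> x"
    then obtain \<gamma> where "\<gamma> \<in> \<Gamma>" "y = act \<gamma> x" by (auto simp: orbit_def)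
    moreover then obtain A where "A \<in> lifts" "\<gamma> = pgl_class A" using \<Gamma>_lifts by blast
    ultimately show "y \<in> (\<lambda>A. pa A x) ` lifts" by (simp add: act_pgl_class)
  qed
  show "(\<lambda>A. pa A x) ` lifts \<subseteq> orbit \<Gamma> x"
  proof
    fix y assume "y \<in> (\<lambda>A. pa A x) ` lifts"
    then obtain A where "A \<in> lifts" "y = pa A x" by blast
    then have "pgl_class A \<in> \<Gamma>" "y = act (pgl_class A) x"
      by (simp_all add: lifts_\<Gamma> act_pgl_class)
    then show "y \<in> orbit \<Gamma> x" unfolding orbit_def by blast
  qed
qed

lemma orbit_hyp: "x \<in> hyp \<Longrightarrow> orbit \<Gamma> x \<subseteq> hyp"
  by (auto simp: orbit_alt pa_hyp)

lemma orbit_self: "x \<in> hyp \<Longrightarrow> x \<in> orbit \<Gamma> x"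
  unfolding orbit_alt using image_eqI[OF _ lifts_one, of x "\<lambda>A. pa A x"] pa_one[of x] by simp

lemma orbit_pa: "x \<in> hyp \<Longrightarrow> y \<in> orbit \<Gamma> x \<Longrightarrow> A \<in> lifts \<Longrightarrow> pa A y \<in> orbit \<Gamma> x"
proof -
  assume x: "x \<in> hyp" and y: "y \<in> orbit \<Gamma> x" and A: "A \<in> lifts"
  obtain B where B: "B \<in> lifts" "y = pa B x" using y by (auto simp: orbit_alt)
  then have "pa A y = pa (A ** B) x" using pa_mult[OF B(1) x, of A] by simp
  then show ?thesis using lifts_mult[OF A B(1)] by (simp add: orbit_alt)
qed

lemma orbit_eq:
  assumes "x \<in> hyp" "y \<in> orbit \<Gamma> x" shows "orbit \<Gamma> y = orbit \<Gamma> x"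
proof -
  obtain A where A: "A \<in> lifts" "y = pa A x" using assms(2) by (auto simp: orbit_alt)
  obtain B where B: "B \<in> lifts" "A ** B = mat 1" "B ** A = mat 1" using lifts_inverse[OF A(1)] .
  have "y \<in> hyp" using pa_hyp A assms(1) by blast
  have "pa C y \<in> orbit \<Gamma> x" if "C \<in> lifts" for C using orbit_pa[OF assms that] .
  moreover have "pa C x \<in> orbit \<Gamma> y" if "C \<in> lifts" for C
  proof -
    have "pa C x = pa C (pa B y)" using pa_inverse[OF A(1) B(3) assms(1)] by (simp only: A(2))
    also have "\<dots> = pa (C ** B) y" using pa_mult[OF B(1) \<open>y \<in> hyp\<close>] .
    finally show ?thesis using lifts_mult[OF that B(1)] by (simp add: orbit_alt)
  qed
  ultimately show ?thesis by (auto simp: orbit_alt)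
qed

lemma union_invariant:
  assumes X: "X \<subseteq> hyp_quotient \<Gamma>" and x: "x \<in> \<Union>X" and A: "A \<in> lifts"
  shows "pa A x \<in> \<Union>X"
proof -
  obtain ob where O: "ob \<in> X" "x \<in> ob" using x by blast
  then obtain z where "z \<in> hyp" "ob = orbit \<Gamma> z" using X by (auto simp: hyp_quotient_def)
  then have "pa A x \<in> ob" using orbit_pa O(2) A by blast
  then show ?thesis using O(1) by blast
qed

lemma union_hyp: "X \<subseteq> hyp_quotient \<Gamma> \<Longrightarrow> \<Union>X \<subseteq> hyp"
  using orbit_hyp by (fastforce simp: hyp_quotient_def)

lemma quotient_disjoint:
  assumes "X \<subseteq> hyp_quotient \<Gamma>" "Y \<subseteq> hyp_quotient \<Gamma>" "x \<in> \<Union>X" "x \<in> \<Union>Y"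
  shows "orbit \<Gamma> x \<in> X \<inter> Y"
proof -
  have "orbit \<Gamma> x \<in> X" if X: "X \<subseteq> hyp_quotient \<Gamma>" "x \<in> \<Union>X" for X
  proof -
    obtain ob where ob: "ob \<in> X" "x \<in> ob" using X(2) by blast
    then obtain z where z: "z \<in> hyp" "ob = orbit \<Gamma> z" using X(1) by (auto simp: hyp_quotient_def)
    then show ?thesis using orbit_eq[of z x] ob by simp
  qed
  then show ?thesis using assms by blast
qed

lemma S_quotient: "S \<subseteq> hyp_quotient \<Gamma>"
  using hypersurface by (simp add: complete_totally_geodesic_hypersurface_def)

lemma T_hyp: "T \<subseteq> hyp"
  by (rule union_hyp[OF S_quotient])

lemma T_invariant: "A \<in> lifts \<Longrightarrow> x \<in> T \<Longrightarrow> pa A x \<in> T"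
  using union_invariant[OF S_quotient] by blast

lemma complement_invariant: "A \<in> lifts \<Longrightarrow> pa A ` (hyp - T) \<subseteq> hyp - T"
proof -
  assume A: "A \<in> lifts"
  obtain B where B: "B \<in> lifts" "A ** B = mat 1" "B ** A = mat 1" using lifts_inverse[OF A] .
  show ?thesis
  proof clarify
    fix x assume x: "x \<in> hyp" "x \<notin> T"
    have "pa A x \<notin> T" using T_invariant[OF B(1), of "pa A x"] pa_inverse[OF A B(3) x(1)] x(2) by auto
    then show "pa A x \<in> hyp - T" using pa_hyp[OF A x(1)] by blast
  qed
qed

lemma component_image: "A \<in> lifts \<Longrightarrow> C \<in> components (hyp - T) \<Longrightarrow> pa A ` C \<in> components (hyp - T)"
  by (rule pa_image_components) (use complement_invariant in auto)

lemma T_component_image: "A \<in> lifts \<Longrightarrow> C \<in> components T \<Longrightarrow> pa A ` C \<in> components T"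
  by (rule pa_image_components) (use T_hyp in \<open>auto intro!: image_subsetI T_invariant simp del: Union_iff\<close>)

lemma hyp0_T: "hyp0 \<subseteq> T"
  using hyp0_component in_components_subset by blast

lemma convex_hyp: "convex (hyp :: ('n rvec) set)"
  unfolding convex_def
proof (intro ballI allI impI)
  fix x y :: "'n rvec" and u v :: real
  assume x: "x \<in> hyp" and y: "y \<in> hyp" and uv: "0 \<le> u" "0 \<le> v" "u + v = 1"
  have "bq x y < 0" using bq_future x y by (auto simp: hyp_future)
  moreover have "Q (u *\<^sub>R x + v *\<^sub>R y) = u\<^sup>2 * Q x + 2 * u * v * bq x y + v\<^sup>2 * Q y"
    by (simp add: Q_add Q_scaleR)
  moreover have "u > 0 \<or> v > 0" using uv by auto
  ultimately have "Q (u *\<^sub>R x + v *\<^sub>R y) < 0"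
  proof (elim disjE)
    assume eq: "Q (u *\<^sub>R x + v *\<^sub>R y) = u\<^sup>2 * Q x + 2 * u * v * bq x y + v\<^sup>2 * Q y" and b: "bq x y < 0"
    have 1: "2 * u * v * bq x y \<le> 0" using uv b by (simp add: mult_nonneg_nonpos)
    have 2: "u\<^sup>2 * Q x \<le> 0" "v\<^sup>2 * Q y \<le> 0"
      using x y by (auto simp: hyp_def mult_nonneg_nonpos)
    { assume "u > 0"
      then have "u\<^sup>2 * Q x < 0" using x by (simp add: hyp_def mult_pos_neg)
      then show ?thesis using eq 1 2 by linarith
    next
      assume "v > 0"
      then have "v\<^sup>2 * Q y < 0" using y by (simp add: hyp_def mult_pos_neg)
      then show ?thesis using eq 1 2 by linarith }
  qed
  moreover have "(u *\<^sub>R x + v *\<^sub>R y) $ ix_last = 1" using x y uv by (simp add: hyp_def)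
  ultimately show "u *\<^sub>R x + v *\<^sub>R y \<in> hyp" by (simp add: hyp_def)
qed

lemma convex_hyperplane_nth: "convex {x :: 'n rvec. x $ i = c}"
  unfolding convex_def by (auto simp: algebra_simps) (metis distrib_right mult_1 mult.commute)

lemma convex_hyp0: "convex (hyp0 :: ('n rvec) set)"
proof -
  have "(hyp0 :: ('n rvec) set) = hyp \<inter> {x. x $ ix_second = 0}" by (auto simp: hyp0_alt)
  moreover have "convex (hyp \<inter> {x :: 'n rvec. x $ ix_second = 0})"
    by (intro convex_Int convex_hyp convex_hyperplane_nth)
  ultimately show ?thesis by (simp only:)
qed

lemma inner_axis_left: "axis i 1 \<bullet> x = (x :: 'n rvec) $ i"
  by (metis cart_eq_inner_axis inner_commute)

lemma convex_side: "convex (side s)"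
proof -
  have "side s = hyp \<inter> {x. (s *\<^sub>R axis ix_second 1) \<bullet> x > 0}"
    by (auto simp: side_def inner_axis_left)
  moreover have "convex (hyp \<inter> {x. (s *\<^sub>R axis ix_second 1 :: 'n rvec) \<bullet> x > 0})"
    by (intro convex_Int convex_hyp convex_halfspace_gt)
  ultimately show ?thesis by (simp only:)
qed

text \<open>\<open>hyp\<close> is open only within the affine hyperplane of last coordinate 1, which
  is why balls are cut with that hyperplane here and below.\<close>

lemma hyp_slice_ball:
  fixes x :: "'n rvec"
  assumes "x \<in> hyp"
  obtains e where "e > 0" "ball x e \<inter> {z. z $ ix_last = 1} \<subseteq> hyp"
proof -
  have "x \<in> {z. future z}" using assms by (simp add: hyp_future)
  then obtain e where "e > 0" "ball x e \<subseteq> {z. future z}"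
    using open_future open_contains_ball by blast
  then show ?thesis by (intro that[of e]) (auto simp: hyp_future)
qed

lemma local_structure:
  assumes x: "x \<in> T"
  obtains e P where "e > 0" "ball x e \<inter> {z. z $ ix_last = 1} \<subseteq> hyp" "geodesic_hyperplane P" "T \<inter> ball x e = P \<inter> ball x e"
proof -
  obtain U P where U: "open U" "x \<in> U" "geodesic_hyperplane P" "T \<inter> U = P \<inter> U"
    using hypersurface x unfolding complete_totally_geodesic_hypersurface_def by blast
  obtain e1 where e1: "e1 > 0" "ball x e1 \<subseteq> U" using U open_contains_ball by blast
  obtain e2' where e2': "e2' > 0" "ball x e2' \<inter> {z. z $ ix_last = 1} \<subseteq> hyp"
    using hyp_slice_ball x T_hyp by blast
  show ?thesis
  proof (rule that[of "min e1 e2'" P])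
    show "T \<inter> ball x (min e1 e2') = P \<inter> ball x (min e1 e2')"
      using e1(2) U(4) by (auto simp: subset_iff)
  qed (use e1 e2' U in auto)
qed

text \<open>The hyperplane \<open>P\<close> given near \<open>x\<close> contains a piece of
  \<open>hyp0\<close>, and such a piece determines the normal vector up to a factor.\<close>

lemma local_hyp0:
  assumes x: "x \<in> hyp0"
  obtains e where "e > 0" "ball x e \<inter> {z. z $ ix_last = 1} \<subseteq> hyp" "T \<inter> ball x e = hyp0 \<inter> ball x e"
proof -
  obtain e P where e: "e > 0" "ball x e \<inter> {z. z $ ix_last = 1} \<subseteq> hyp" "geodesic_hyperplane P" "T \<inter> ball x e = P \<inter> ball x e"
    using local_structure hyp0_T x by blast
  obtain a where a: "a \<noteq> 0" "P = {x \<in> hyp. a \<bullet> x = 0}"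
    using e(3) by (auto simp: geodesic_hyperplane_def)
  have xh: "x $ ix_last = 1" "x $ ix_second = 0" using x by (auto simp: hyp0_alt hyp_def)
  have sub: "hyp0 \<inter> ball x e \<subseteq> P" using hyp0_T e(4) by blast
  have ax: "a \<bullet> x = 0" using sub x e(1) a(2) by auto
  have a0: "a \<bullet> v = 0" if v: "v $ ix_second = 0" for v
  proof -
    define w where "w = v - (v $ ix_last) *\<^sub>R x"
    have w: "w $ ix_second = 0" "w $ ix_last = 0" using v xh by (auto simp: w_def)
    define c where "c = e / (2 * (norm w + 1))"
    have n: "norm w + 1 > 0" by (simp add: add_nonneg_pos)
    have c: "c > 0" using n e(1) by (simp add: c_def)
    have "c * norm w \<le> c * (norm w + 1)" using c by simp
    also have "c * (norm w + 1) = e / 2" using n by (simp add: c_def field_simps)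
    also have "\<dots> < e" using e(1) by simp
    finally have b: "x + c *\<^sub>R w \<in> ball x e" using c by (simp add: dist_norm)
    have "(x + c *\<^sub>R w) $ ix_last = 1" using xh w by simp
    then have "x + c *\<^sub>R w \<in> hyp" using b e(2) by blast
    then have "x + c *\<^sub>R w \<in> hyp0" using xh w by (simp add: hyp0_alt)
    then have "a \<bullet> (x + c *\<^sub>R w) = 0" using sub b a(2) by blast
    then have "a \<bullet> w = 0" using ax c by (simp add: inner_add_right)
    then show ?thesis using ax by (simp add: w_def inner_diff_right)
  qed
  have "P = hyp0"
  proof -
    have "a \<bullet> y = (a \<bullet> e2) * y $ ix_second" for y
      using a0[of "proj y"] by (subst proj_decomp[of y]) (simp add: inner_add_right)
    moreover have "a \<bullet> e2 \<noteq> 0"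
    proof
      assume "a \<bullet> e2 = 0"
      then have "a \<bullet> a = 0" using calculation[of a] by simp
      then show False using a(1) by simp
    qed
    ultimately have "a \<bullet> y = 0 \<longleftrightarrow> y $ ix_second = 0" for y by (metis mult_eq_0_iff)
    then show ?thesis unfolding a(2) hyp0_alt by blast
  qed
  with e that show ?thesis by blast
qed

section \<open>The components of the complement that are adjacent to the fixed hyperplane\<close>

lemma component_side:
  assumes C: "C \<in> components (hyp - T)"
  obtains s where "s = 1 \<or> s = -1" "C \<subseteq> side s"
proof -
  have con: "connected C" and sub: "C \<subseteq> hyp - T"
    using C in_components_connected in_components_subset by blast+
  have nz: "x $ ix_second \<noteq> 0" if "x \<in> C" for x using that sub hyp0_T by (auto simp: hyp0_alt)
  have "connected ((\<lambda>x. x $ ix_second) ` C)"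
    by (intro connected_continuous_image con continuous_intros)
  then have iv: "is_interval ((\<lambda>x. x $ ix_second) ` C)" by (simp add: is_interval_connected_1)
  show ?thesis
  proof (cases "\<exists>x\<in>C. x $ ix_second < 0")
    case True
    then obtain x where x: "x \<in> C" "x $ ix_second < 0" by blast
    have "y $ ix_second < 0" if y: "y \<in> C" for y
    proof (rule ccontr)
      assume "\<not> y $ ix_second < 0"
      then have "0 \<in> (\<lambda>x. x $ ix_second) ` C"
        using mem_is_interval_1_I[OF iv, of "x $ ix_second" "y $ ix_second" 0] x y by auto
      then show False using nz by auto
    qed
    then show ?thesis using sub by (intro that[of "-1"]) (auto simp: side_def)
  next
    case False
    then have "y $ ix_second > 0" if "y \<in> C" for y using nz[OF that] that by force
    then show ?thesis using sub by (intro that[of 1]) (auto simp: side_def)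
  qed
qed

text \<open>A small half-ball at \<open>x\<close> is convex and misses \<open>T\<close>, so it lies
  in one component. \<open>C\<close> comes arbitrarily close to \<open>x\<close> and stays on the
  same side, hence meets it.\<close>

lemma component_half_ball:
  assumes C: "C \<in> components (hyp - T)" "C \<subseteq> side s" and x: "x \<in> hyp0" "x \<in> closure C"
  obtains e where "e > 0" "ball x e \<inter> {z. z $ ix_last = 1 \<and> 0 < s * z $ ix_second} \<subseteq> C"
proof -
  obtain e where e: "e > 0" "ball x e \<inter> {z. z $ ix_last = 1} \<subseteq> hyp" "T \<inter> ball x e = hyp0 \<inter> ball x e"
    using local_hyp0[OF x(1)] .
  let ?H = "ball x e \<inter> {z. z $ ix_last = 1 \<and> 0 < s * z $ ix_second}"
  have "?H = ball x e \<inter> ({z. z $ ix_last = 1} \<inter> {z. (s *\<^sub>R axis ix_second 1) \<bullet> z > 0})"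
    by (auto simp: inner_axis_left)
  moreover have "convex \<dots>" by (intro convex_Int convex_ball convex_hyperplane_nth convex_halfspace_gt)
  ultimately have "convex ?H" by (simp only:)
  then have con: "connected ?H" by (rule convex_connected)
  have sub: "?H \<subseteq> hyp - T"
  proof
    fix z assume z: "z \<in> ?H"
    then have "z \<notin> hyp0" by (auto simp: hyp0_alt)
    then have "z \<notin> T" using z e(3) by blast
    then show "z \<in> hyp - T" using z e(2) by blast
  qed
  obtain y where y: "y \<in> C" "dist y x < e" using x(2) e(1) closure_approachable by blast
  then have "y \<in> ?H" using C(2) by (auto simp: side_def hyp_def dist_commute)
  then have "?H \<subseteq> C" using components_maximal[OF C(1) con sub] y(1) by blast
  with e(1) that show ?thesis by blast
qed

lemma hyp0_side_point:
  fixes x :: "'n rvec"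
  assumes x: "x \<in> hyp0" and s: "s = 1 \<or> s = -1" and e: "e > 0"
  shows "x + (s * (e / 2)) *\<^sub>R e2 \<in> ball x e \<inter> {z. z $ ix_last = 1 \<and> 0 < s * z $ ix_second}"
proof -
  have "norm (e2 :: 'n rvec) = 1" by (simp add: e2_def)
  then show ?thesis using x s e by (auto simp: dist_norm hyp0_alt hyp_def)
qed

lemma component_unique:
  assumes C: "C \<in> components (hyp - T)" "C \<subseteq> side s" "x \<in> closure C"
    and C': "C' \<in> components (hyp - T)" "C' \<subseteq> side s" "x \<in> closure C'"
    and x: "x \<in> hyp0" and s: "s = 1 \<or> s = -1"
  shows "C = C'"
proof -
  obtain e where e: "e > 0" "ball x e \<inter> {z. z $ ix_last = 1 \<and> 0 < s * z $ ix_second} \<subseteq> C"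
    using component_half_ball[OF C(1,2) x C(3)] .
  obtain e' where e': "e' > 0" "ball x e' \<inter> {z. z $ ix_last = 1 \<and> 0 < s * z $ ix_second} \<subseteq> C'"
    using component_half_ball[OF C'(1,2) x C'(3)] .
  let ?m = "min e e'"
  have m: "?m > 0" using e(1) e'(1) by simp
  let ?z = "x + (s * (?m / 2)) *\<^sub>R e2"
  have "?z \<in> ball x ?m \<inter> {z. z $ ix_last = 1 \<and> 0 < s * z $ ix_second}"
    by (rule hyp0_side_point[OF x s m])
  then have "?z \<in> C" "?z \<in> C'" using e(2) e'(2) by auto
  then show ?thesis using components_nonoverlap[OF C(1) C'(1)] by blast
qed

text \<open>By the half-balls, the part of \<open>hyp0\<close> in the closure of \<open>C\<close> is
  open in \<open>hyp0\<close>. It is closed as well, and \<open>hyp0\<close> is connected.\<close>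

lemma component_adjacent:
  assumes C: "C \<in> components (hyp - T)" and x: "x \<in> hyp0" "x \<in> closure C"
  shows "C \<in> adjacent_components S"
proof -
  obtain s where s: "s = 1 \<or> s = -1" "C \<subseteq> side s" using component_side[OF C] .
  let ?Z = "hyp0 \<inter> closure C"
  have "closedin (top_of_set hyp0) ?Z" by (simp add: closedin_closed_Int)
  moreover have "openin (top_of_set hyp0) ?Z"
    unfolding openin_euclidean_subtopology_iff
  proof (intro conjI ballI)
    fix y assume y: "y \<in> ?Z"
    obtain e where e: "e > 0" "ball y e \<inter> {z. z $ ix_last = 1 \<and> 0 < s * z $ ix_second} \<subseteq> C"
      using component_half_ball[OF C s(2)] y by blast
    have "z \<in> closure C" if z: "z \<in> hyp0" "dist z y < e" for z
      unfolding closure_approachable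
    proof (intro allI impI)
      fix r :: real assume r: "r > 0"
      let ?r = "min r (e - dist z y)"
      have "?r > 0" using r z by simp
      then have w: "z + (s * (?r / 2)) *\<^sub>R e2 \<in> ball z ?r \<inter> {z. z $ ix_last = 1 \<and> 0 < s * z $ ix_second}" (is "?w \<in> _")
        using hyp0_side_point[OF z(1) s(1)] by blast
      then have "dist y ?w < e" using dist_triangle[of y ?w z] by (simp add: dist_commute)
      then have "?w \<in> C" using e(2) w by auto
      moreover have "dist ?w z < r" using w by (simp add: dist_commute)
      ultimately show "\<exists>y\<in>C. dist y z < r" by blast
    qed
    then show "\<exists>e>0. \<forall>x'\<in>hyp0. dist x' y < e \<longrightarrow> x' \<in> ?Z"
      using e(1) by blast
  qed simp
  ultimately have "?Z = {} \<or> ?Z = hyp0"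
    using convex_connected[OF convex_hyp0] unfolding connected_clopen by blast
  then have "hyp0 \<subseteq> closure C" using x by blast
  then show ?thesis using C by (simp add: adjacent_components_def)
qed

lemma adjacent_component: "C \<in> adjacent_components S \<Longrightarrow> C \<in> components (hyp - T)"
  and adjacent_closure: "C \<in> adjacent_components S \<Longrightarrow> hyp0 \<subseteq> closure C"
  by (auto simp: adjacent_components_def)

lemma adjacent_unique:
  assumes "C \<in> adjacent_components S" "C \<subseteq> side s" "C' \<in> adjacent_components S" "C' \<subseteq> side s" "s = 1 \<or> s = -1"
  shows "C = C'"
  using component_unique[of C s base C'] assms adjacent_component adjacent_closure base_hyp0 by blast

text \<open>Here two-sidedness enters: elements of \<open>PSO0\<close> preserve each component of
  the complement of \<open>hyp0\<close>, and the component containing a side is that side.\<close>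

lemma lifts0_side:
  assumes A: "A \<in> lifts0" and x: "x \<in> side s" and s: "s = 1 \<or> s = -1"
  shows "pa A x \<in> side s"
proof -
  have "pgl_class A \<in> PSO0" using A two_sided by (auto simp: stab_hyp0)
  then have pres: "\<And>C. C \<in> components (hyp - hyp0) \<Longrightarrow> pa A ` C = C"
    by (simp add: PSO0_def act_eq)
  have sub: "side s \<subseteq> hyp - hyp0" by (auto simp: side_def hyp0_alt)
  obtain C where C: "C \<in> components (hyp - hyp0)" "side s \<subseteq> C"
    using exists_component_superset[OF sub _ convex_connected[OF convex_side]] x sub by blast
  have Cs: "C \<subseteq> side s"
  proof
    fix y assume y: "y \<in> C"
    have Ch: "C \<subseteq> hyp - hyp0" using C(1) in_components_subset by blast
    have nz: "z $ ix_second \<noteq> 0" if "z \<in> C" for z using that Ch by (auto simp: hyp0_alt)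
    have "connected ((\<lambda>x. s * x $ ix_second) ` C)"
      by (intro connected_continuous_image in_components_connected[OF C(1)] continuous_intros)
    then have iv: "is_interval ((\<lambda>x. s * x $ ix_second) ` C)" by (simp add: is_interval_connected_1)
    show "y \<in> side s"
    proof (rule ccontr)
      assume "y \<notin> side s"
      then have "s * y $ ix_second \<le> 0" using y Ch by (auto simp: side_def)
      moreover have "0 \<le> s * x $ ix_second" "x \<in> C" using x C(2) by (auto simp: side_def)
      ultimately have "0 \<in> (\<lambda>x. s * x $ ix_second) ` C"
        using mem_is_interval_1_I[OF iv, of "s * y $ ix_second" "s * x $ ix_second" 0] y by blast
      then show False using nz s by auto
    qed
  qed
  have "pa A x \<in> C" using pres[OF C(1)] C(2) x by blast
  then show ?thesis using Cs by blast
qed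

lemma lifts0_adjacent:
  assumes A: "A \<in> lifts0" and C: "C \<in> adjacent_components S"
  shows "pa A ` C = C"
proof -
  have Al: "A \<in> lifts" "pa A ` hyp0 = hyp0" using A by (auto simp: lifts0_iff)
  obtain s where s: "s = 1 \<or> s = -1" "C \<subseteq> side s"
    using component_side[OF adjacent_component[OF C]] .
  have Ch: "C \<subseteq> hyp" using in_components_subset[OF adjacent_component[OF C]] by blast
  have "pa A ` hyp_closure C = hyp_closure (pa A ` C)" by (rule pa_hyp_closure[OF Al(1) Ch])
  moreover have "hyp0 \<subseteq> hyp_closure C"
    using adjacent_closure[OF C] hyp0_hyp by (auto simp: hyp_closure_def)
  then have "pa A ` hyp0 \<subseteq> pa A ` hyp_closure C" by (rule image_mono)
  ultimately have "hyp0 \<subseteq> hyp_closure (pa A ` C)" unfolding Al(2) by simp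
  then have "hyp0 \<subseteq> closure (pa A ` C)" by (auto simp: hyp_closure_def)
  then have "pa A ` C \<in> adjacent_components S"
    using component_image[OF Al(1) adjacent_component[OF C]] by (simp add: adjacent_components_def)
  moreover have "pa A ` C \<subseteq> side s" using lifts0_side[OF A _ s(1)] s(2) by blast
  ultimately show ?thesis using adjacent_unique[OF _ _ C s(2,1)] by blast
qed

section \<open>The quotient topology and the components of the preimage of the hypersurface\<close>

lemma openin_quotient_top:
  "openin (quotient_top \<Gamma>) U \<longleftrightarrow> U \<subseteq> hyp_quotient \<Gamma> \<and> openin (top_of_set hyp) (\<Union>U)"
proof -
  have "istopology (\<lambda>U. U \<subseteq> hyp_quotient \<Gamma> \<and> openin (top_of_set hyp) (\<Union>U))"
    unfolding istopology_def
  proof (intro conjI allI impI)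
    fix U V assume U: "U \<subseteq> hyp_quotient \<Gamma> \<and> openin (top_of_set hyp) (\<Union>U)"
      and V: "V \<subseteq> hyp_quotient \<Gamma> \<and> openin (top_of_set hyp) (\<Union>V)"
    show "U \<inter> V \<subseteq> hyp_quotient \<Gamma>" using U by blast
    have "\<Union>(U \<inter> V) = \<Union>U \<inter> \<Union>V"
    proof
      show "\<Union>U \<inter> \<Union>V \<subseteq> \<Union>(U \<inter> V)"
      proof
        fix x assume x: "x \<in> \<Union>U \<inter> \<Union>V"
        then have "orbit \<Gamma> x \<in> U \<inter> V" using quotient_disjoint U V by blast
        moreover have "x \<in> hyp" using x U union_hyp by blast
        ultimately show "x \<in> \<Union>(U \<inter> V)" using orbit_self by blast
      qed
    qed blast
    then show "openin (top_of_set hyp) (\<Union>(U \<inter> V))" using U V by auto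
  next
    fix K assume K: "\<forall>U\<in>K. U \<subseteq> hyp_quotient \<Gamma> \<and> openin (top_of_set hyp) (\<Union>U)"
    show "\<Union>K \<subseteq> hyp_quotient \<Gamma>" using K by blast
    have "\<Union>(\<Union>K) = (\<Union>U\<in>K. \<Union>U)" by blast
    then show "openin (top_of_set hyp) (\<Union>(\<Union>K))" using K by auto
  qed
  then show ?thesis by (simp add: quotient_top_def topology_inverse')
qed

text \<open>The union \<open>Om\<close> of the translates of \<open>hyp0\<close> and its complement
  in \<open>T\<close> are invariant unions of components. Both are relatively open, as
  \<open>T\<close> is locally a hyperplane, so they would separate the connected set
  \<open>S\<close>.\<close>

lemma T_components_transitive:
  assumes P: "P \<in> components T"
  shows "\<exists>A\<in>lifts. P = pa A ` hyp0"
proof -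
  define Om where "Om = (\<Union>A\<in>lifts. pa A ` hyp0)"
  \<comment> \<open>The largest open set of \<open>hyp\<close> whose trace on \<open>T\<close> lies
    in \<open>X\<close>. Openness in the quotient refers to open sets of \<open>hyp\<close>, so a
    relatively open part of \<open>T\<close> has to be extended; for invariant \<open>X\<close> the
    extension is invariant.\<close>
  define V where "V X = \<Union>{W. openin (top_of_set hyp) W \<and> T \<inter> W \<subseteq> X}" for X
  have OT: "Om \<subseteq> T" unfolding Om_def
    by (intro UN_least image_subsetI T_invariant) (use hyp0_T in blast)+
  have local_component: "\<exists>W. openin (top_of_set hyp) W \<and> x \<in> W \<and> T \<inter> W \<subseteq> C"
    if x: "x \<in> C" and C: "C \<in> components T" for x C
  proof -
    have xT: "x \<in> T" using x C in_components_subset by blast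
    obtain e P where e: "e > 0" "geodesic_hyperplane P" "T \<inter> ball x e = P \<inter> ball x e"
      using local_structure[OF xT] by metis
    obtain a where a: "P = {x \<in> hyp. a \<bullet> x = 0}"
      using e(2) by (auto simp: geodesic_hyperplane_def)
    have "convex (hyp \<inter> {x. a \<bullet> x = 0} \<inter> ball x e)"
      by (intro convex_Int convex_hyp convex_hyperplane convex_ball)
    moreover have "hyp \<inter> {x. a \<bullet> x = 0} \<inter> ball x e = T \<inter> ball x e"
      using e(3) a by blast
    ultimately have "connected (T \<inter> ball x e)" using convex_connected by metis
    then have "T \<inter> ball x e \<subseteq> C"
      using components_maximal[OF C] x xT e(1) by (metis IntI Int_lower1 centre_in_ball disjoint_iff)
    then show ?thesis using x xT T_hyp e(1)
      by (intro exI[of _ "hyp \<inter> ball x e"]) (auto simp: openin_open_Int)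
  qed
  have VX: "T \<inter> V X \<subseteq> X" for X unfolding V_def by blast
  have opV: "openin (top_of_set hyp) (V X)" for X unfolding V_def by (rule openin_Union) blast
  have Vinv: "pa A x \<in> V X" if X: "\<And>A y. A \<in> lifts \<Longrightarrow> y \<in> X \<Longrightarrow> pa A y \<in> X" and x: "x \<in> V X" and A: "A \<in> lifts" for X A x
  proof -
    obtain W where W: "openin (top_of_set hyp) W" "T \<inter> W \<subseteq> X" "x \<in> W"
      using x unfolding V_def by blast
    have Wh: "W \<subseteq> hyp" using openin_imp_subset[OF W(1)] .
    obtain B where B: "B \<in> lifts" "A ** B = mat 1" "B ** A = mat 1" using lifts_inverse[OF A] .
    have "T \<inter> pa A ` W \<subseteq> X"
    proof
      fix y assume y: "y \<in> T \<inter> pa A ` W"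
      then obtain w where w: "w \<in> W" "y = pa A w" by blast
      then have "w = pa B y" using pa_inverse[OF A B(3)] Wh by auto
      then have "w \<in> X" using T_invariant[OF B(1)] y w W(2) by blast
      then show "y \<in> X" using X[OF A] w by blast
    qed
    then show ?thesis using pa_openin[OF A W(1)] W(3) unfolding V_def by blast
  qed
  have Oinv: "pa A y \<in> Om" if A: "A \<in> lifts" and y: "y \<in> Om" for A y
  proof -
    obtain B x where B: "B \<in> lifts" "x \<in> hyp0" "y = pa B x" using y by (auto simp: Om_def)
    then have "pa A y = pa (A ** B) x" using pa_mult[OF B(1)] hyp0_hyp by blast
    then show ?thesis using lifts_mult[OF A B(1)] B(2) by (auto simp: Om_def)
  qed
  have Om'inv: "pa A y \<in> T - Om" if A: "A \<in> lifts" "y \<in> T - Om" for A y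
  proof -
    obtain B where B: "B \<in> lifts" "A ** B = mat 1" "B ** A = mat 1" using lifts_inverse[OF A(1)] .
    have eq: "pa B (pa A y) = y" using pa_inverse[OF A(1) B(3)] A(2) T_hyp by blast
    have "pa A y \<notin> Om"
    proof
      assume "pa A y \<in> Om"
      then have "pa B (pa A y) \<in> Om" by (rule Oinv[OF B(1)])
      then show False using A(2) unfolding eq by (rule DiffD2[rotated])
    qed
    then show ?thesis using T_invariant A by blast
  qed
  have hyp0_comp: "pa A ` hyp0 \<in> components T" if "A \<in> lifts" for A
    using T_component_image[OF that hyp0_component] .
  have OV: "Om \<subseteq> V Om"
  proof
    fix x assume "x \<in> Om"
    then obtain A where A: "A \<in> lifts" "x \<in> pa A ` hyp0" by (auto simp: Om_def)
    obtain W where "openin (top_of_set hyp) W" "x \<in> W" "T \<inter> W \<subseteq> pa A ` hyp0"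
      using local_component[OF A(2) hyp0_comp[OF A(1)]] by blast
    moreover have "pa A ` hyp0 \<subseteq> Om" using A(1) by (auto simp: Om_def)
    ultimately show "x \<in> V Om" unfolding V_def by blast
  qed
  have Om'V: "T - Om \<subseteq> V (T - Om)"
  proof
    fix x assume x: "x \<in> T - Om"
    then obtain C where C: "C \<in> components T" "x \<in> C" by (metis DiffD1 Union_components UnionE)
    obtain W where W: "openin (top_of_set hyp) W" "x \<in> W" "T \<inter> W \<subseteq> C"
      using local_component[OF C(2,1)] by blast
    have "C \<inter> Om = {}"
    proof (rule ccontr)
      assume "C \<inter> Om \<noteq> {}"
      then obtain y A where y: "y \<in> C" "A \<in> lifts" "y \<in> pa A ` hyp0" by (auto simp: Om_def)
      then have "C = pa A ` hyp0" using components_nonoverlap[OF C(1) hyp0_comp[OF y(2)]] by blast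
      then have "x \<in> Om" using C(2) y(2) unfolding Om_def by blast
      then show False using x by blast
    qed
    then have "T \<inter> W \<subseteq> T - Om" using W(3) by blast
    then show "x \<in> V (T - Om)" using W unfolding V_def by blast
  qed
  define U where "U X = orbit \<Gamma> ` V X" for X
  have Vh: "V X \<subseteq> hyp" for X using openin_imp_subset[OF opV] .
  have UV: "\<Union>(U X) = V X" if "\<And>A y. A \<in> lifts \<Longrightarrow> y \<in> X \<Longrightarrow> pa A y \<in> X" for X
  proof
    show "\<Union>(U X) \<subseteq> V X" using Vinv[OF that] by (auto simp: U_def orbit_alt)
    show "V X \<subseteq> \<Union>(U X)" using Vh orbit_self by (auto simp: U_def)
  qed
  have Uq: "U X \<subseteq> hyp_quotient \<Gamma>" for X
    unfolding U_def hyp_quotient_def by (rule image_mono[OF Vh])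
  have "\<Union>(U Om) = V Om" using UV[of Om] Oinv by blast
  then have opU1: "openin (quotient_top \<Gamma>) (U Om)" unfolding openin_quotient_top using Uq opV by metis
  have "\<Union>(U (T - Om)) = V (T - Om)" using UV[of "T - Om"] Om'inv by blast
  then have opU2: "openin (quotient_top \<Gamma>) (U (T - Om))"
    unfolding openin_quotient_top using Uq opV by metis
  have inU: "orb \<in> U X" if orb: "orb \<in> S" "x \<in> orb" "x \<in> V X" for orb x X
  proof -
    have "x \<in> hyp" using orb T_hyp by blast
    have "\<exists>z\<in>hyp. orb = orbit \<Gamma> z" using orb(1) S_quotient by (auto simp: hyp_quotient_def)
    then have "orb = orbit \<Gamma> x" using orbit_eq orb(2) by metis
    then show ?thesis using orb(3) by (simp add: U_def)
  qed
  have cover: "S \<subseteq> U Om \<union> U (T - Om)"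
  proof
    fix orb assume orb: "orb \<in> S"
    then obtain z where z: "z \<in> hyp" "orb = orbit \<Gamma> z"
      using S_quotient by (auto simp: hyp_quotient_def)
    then have zo: "z \<in> orb" using orbit_self by blast
    then have "z \<in> T" using orb by blast
    then have "z \<in> V Om \<or> z \<in> V (T - Om)" using OV Om'V by blast
    then show "orb \<in> U Om \<union> U (T - Om)" using inU[OF orb zo] by blast
  qed
  have disj: "U Om \<inter> U (T - Om) \<inter> S = {}"
  proof (rule ccontr)
    assume "U Om \<inter> U (T - Om) \<inter> S \<noteq> {}"
    then obtain orb where orb: "orb \<in> U Om" "orb \<in> U (T - Om)" "orb \<in> S" by blast
    then obtain z where z: "z \<in> V Om" "orb = orbit \<Gamma> z" by (auto simp: U_def)
    then have "z \<in> orb" using Vh orbit_self by blast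
    then have "z \<in> V (T - Om)" "z \<in> T" using orb UV[of "T - Om"] Om'inv by blast+
    then show False using VX[of Om] VX[of "T - Om"] z(1) by blast
  qed
  have "base \<in> Om"
    unfolding Om_def using lifts_one base_hyp0 pa_image_one[OF hyp0_hyp] by blast
  then obtain orb where "orb \<in> S" "base \<in> orb" using OT by blast
  then have "U Om \<inter> S \<noteq> {}" using inU[of orb base Om] \<open>base \<in> Om\<close> OV by blast
  then have "U (T - Om) \<inter> S = {}"
    using connectedS opU1 opU2 cover disj unfolding connectedin by blast
  moreover have "orb' \<in> U (T - Om) \<inter> S"
    if "orb' \<in> S" "x \<in> orb'" "x \<in> T - Om" for orb' x
    using inU[OF that(1,2), of "T - Om"] Om'V that by blast
  ultimately have "T \<subseteq> Om" by blast
  obtain x where x: "x \<in> P" using in_components_nonempty[OF P] by blast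
  then have "x \<in> Om" using \<open>T \<subseteq> Om\<close> in_components_subset[OF P] by blast
  then obtain A where A: "A \<in> lifts" "x \<in> pa A ` hyp0" by (auto simp: Om_def)
  then have "P = pa A ` hyp0" using components_nonoverlap[OF P hyp0_comp[OF A(1)]] x by blast
  with A(1) show ?thesis by blast
qed

section \<open>No half-space is a component of the complement\<close>

lemma side_closure:
  assumes s: "s = 1 \<or> s = -1" and disj: "side s \<inter> T = {}"
  shows "T \<inter> hyp_closure (side s) = hyp0"
proof
  have "side s \<subseteq> {x. 0 \<le> s * x $ ix_second}" by (auto simp: side_def)
  moreover have "closed {x :: 'n rvec. 0 \<le> s * x $ ix_second}"
    by (intro closed_Collect_le continuous_intros)
  ultimately have cl: "closure (side s) \<subseteq> {x. 0 \<le> s * x $ ix_second}" by (rule closure_minimal)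
  show "T \<inter> hyp_closure (side s) \<subseteq> hyp0"
  proof
    fix x assume x: "x \<in> T \<inter> hyp_closure (side s)"
    then have h: "x \<in> hyp" "0 \<le> s * x $ ix_second" using cl by (auto simp: hyp_closure_def)
    have "x \<notin> side s" using x disj by blast
    then have "s * x $ ix_second = 0" using h by (simp add: side_def)
    then show "x \<in> hyp0" using h s by (auto simp: hyp0_alt)
  qed
  show "hyp0 \<subseteq> T \<inter> hyp_closure (side s)"
  proof
    fix x :: "'n rvec" assume x: "x \<in> hyp0"
    then have xh: "x \<in> hyp" using hyp0_hyp by blast
    obtain e where e: "e > 0" "ball x e \<inter> {z. z $ ix_last = 1} \<subseteq> hyp"
      using hyp_slice_ball[OF xh] .
    have "x \<in> closure (side s)"
      unfolding closure_approachable
    proof (intro allI impI)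
      fix r :: real assume "r > 0"
      then have "min r e > 0" using e by simp
      from hyp0_side_point[OF x s this] obtain z where
        z: "z \<in> ball x (min r e)" "z $ ix_last = 1" "0 < s * z $ ix_second" by blast
      then have "z \<in> side s" "dist z x < r" using e(2) by (auto simp: side_def dist_commute)
      then show "\<exists>y\<in>side s. dist y x < r" by blast
    qed
    then show "x \<in> T \<inter> hyp_closure (side s)" using xh x hyp0_T by (auto simp: hyp_closure_def)
  qed
qed

text \<open>Elements of the group permute the components. One that brings a point of the side back
  to the side thus preserves it, together with the part of \<open>T\<close> in its closure, which is
  \<open>hyp0\<close>.\<close>

lemma side_component_lifts0:
  assumes s: "s = 1 \<or> s = -1" and comp: "side s \<in> components (hyp - T)"
    and A: "A \<in> lifts" and x: "x \<in> side s" "pa A x \<in> side s"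
  shows "A \<in> lifts0"
proof -
  have disj: "side s \<inter> T = {}" using in_components_subset[OF comp] by blast
  have sh: "side s \<subseteq> hyp" by (auto simp: side_def)
  have "pa A ` side s \<in> components (hyp - T)" by (rule component_image[OF A comp])
  then have im: "pa A ` side s = side s"
    using components_nonoverlap[OF _ comp, of "pa A ` side s"] x by blast
  obtain B where B: "B \<in> lifts" "A ** B = mat 1" "B ** A = mat 1" using lifts_inverse[OF A] .
  have imB: "pa B ` side s = side s"
    using pa_image_mult[OF A sh, of B] pa_image_one[OF sh] by (simp add: im B)
  have sub: "pa C ` hyp0 \<subseteq> hyp0" if C: "C \<in> lifts" "pa C ` side s = side s" for C
  proof
    fix y assume "y \<in> pa C ` hyp0"
    then obtain z where z: "z \<in> hyp0" "y = pa C z" by blast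
    then have z': "z \<in> T" "z \<in> hyp_closure (side s)" using side_closure[OF s disj] by auto
    have "y \<in> T" using T_invariant[OF C(1) z'(1)] z(2) by simp
    moreover have "y \<in> pa C ` hyp_closure (side s)" unfolding z(2) using z'(2) by (rule imageI)
    then have "y \<in> hyp_closure (side s)" unfolding pa_hyp_closure[OF C(1) sh] C(2) .
    ultimately show "y \<in> hyp0" using side_closure[OF s disj] by blast
  qed
  have "hyp0 = pa A ` pa B ` hyp0"
    using pa_image_mult[OF B(1) hyp0_hyp, of A] pa_image_one[OF hyp0_hyp] by (simp add: B)
  also have "\<dots> \<subseteq> pa A ` hyp0" using sub[OF B(1) imB] by (rule image_mono)
  finally show ?thesis using sub[OF A im] A by (auto simp: lifts0_iff)
qed

text \<open>If a half-space were a component of the complement, only elements preserving \<open>hyp0\<close> could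
  return to it, and its part above a small ball of \<open>hyp0\<close> would embed in the quotient. A
  translation along a geodesic orthogonal to \<open>hyp0\<close> maps that part to a proper subset, so its volume
  is infinite.\<close>

lemma side_not_component:
  assumes fv: "finite_volume_quotient UNIV hyp \<Gamma>" and s: "s = 1 \<or> s = -1"
  shows "side s \<notin> components (hyp - T)"
proof
  assume comp: "side s \<in> components (hyp - T)"
  define p :: "'n rvec" where "p = (1 / 2) *\<^sub>R axis ix_first 1 + axis ix_last 1"
  have pn: "p $ ix_first = 1 / 2" "p $ ix_last = 1" "p $ ix_second = 0"
    "\<And>i. i \<noteq> ix_first \<Longrightarrow> i \<noteq> ix_last \<Longrightarrow> p $ i = 0"
    by (auto simp: p_def axis_def)
  have Qp: "bq p p = -1" by (simp add: bq_alt pn)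
  have pp: "proj p = p" by (rule proj_eq_self) (rule pn)
  have fp: "future p" by (simp add: future_def Q_bq Qp pn)
  have ss: "s * s = 1" "s * (s * c) = c" for c :: real using s by auto
  have ph: "p \<in> hyp" by (simp add: hyp_future fp pn)
  obtain e where e: "e > 0" "\<And>A z. A \<in> lifts \<Longrightarrow> A \<noteq> mat 1 \<Longrightarrow> z \<in> hyp \<Longrightarrow> dist z p < e \<Longrightarrow> \<not> dist (pa A z) p < e"
    using free_small_neighbourhood[OF ph] by blast
  \<comment> \<open>The truncated cone over the points that lie on the side \<open>s\<close>, not
    too close to \<open>hyp0\<close>, and above a small ball around \<open>p\<close>.
    \<open>V1\<close> is the part farther away and \<open>V2\<close> the part nearer to
    \<open>hyp0\<close>.\<close>
  define V where "V = {x. future x \<and> -1 < Q x \<and> 0 < s * x $ ix_second \<and> - Q x < (x $ ix_second)\<^sup>2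
    \<and> dist (nrm (proj x)) p < e}"
  define V1 where "V1 = {x \<in> V. 25 / 16 * (- Q x) < (x $ ix_second)\<^sup>2}"
  define V2 where "V2 = {x \<in> V. (x $ ix_second)\<^sup>2 < 25 / 16 * (- Q x)}"
  have "continuous_on {x. future x} (\<lambda>x. nrm (proj x))"
    unfolding nrm_def by (intro continuous_intros) (auto simp: future_def)
  then have "continuous_on {x. future x} (\<lambda>x. dist (nrm (proj x)) p)" by (intro continuous_intros)
  then have "open ({x. future x} \<inter> (\<lambda>x. dist (nrm (proj x)) p) -` {..<e})"
    by (rule continuous_open_preimage) (auto intro: open_future)
  moreover have "open {x :: 'n rvec. -1 < Q x \<and> 0 < s * x $ ix_second \<and> - Q x < (x $ ix_second)\<^sup>2}"
    by (intro open_Collect_conj open_Collect_less continuous_intros)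
  moreover have "V = ({x. future x} \<inter> (\<lambda>x. dist (nrm (proj x)) p) -` {..<e}) \<inter>
      {x. -1 < Q x \<and> 0 < s * x $ ix_second \<and> - Q x < (x $ ix_second)\<^sup>2}"
    by (auto simp: V_def)
  ultimately have oV: "open V" by (simp only: open_Int)
  have "open {x :: 'n rvec. 25 / 16 * (- Q x) < (x $ ix_second)\<^sup>2}" "open {x :: 'n rvec. (x $ ix_second)\<^sup>2 < 25 / 16 * (- Q x)}"
    by (intro open_Collect_less continuous_intros)+
  moreover have "V1 = V \<inter> {x. 25 / 16 * (- Q x) < (x $ ix_second)\<^sup>2}" "V2 = V \<inter> {x. (x $ ix_second)\<^sup>2 < 25 / 16 * (- Q x)}"
    by (auto simp: V1_def V2_def)
  ultimately have oV12: "open V1" "open V2" using oV by (simp_all only: open_Int)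
  \<comment> \<open>The translation in the plane of \<open>p\<close> and \<open>e2\<close> away from
    \<open>hyp0\<close>, with hyperbolic cosine 5/4 and sine 3/4. The factor 25/16 that separates
    \<open>V1\<close> from \<open>V2\<close> is the square of this cosine.\<close>
  define B :: "'n rmat" where "B = mat 1 - (1 / 4) *\<^sub>R ot p p + (3 / 4 * s) *\<^sub>R ot p e2
      - (3 / 4 * s) *\<^sub>R ot e2 p + (1 / 4) *\<^sub>R ot e2 e2"
  have Bx: "B *v x = x + (- (1 / 4) * bq p x + 3 / 4 * (s * x $ ix_second)) *\<^sub>R p
      + (s * (- (3 / 4) * bq p x + 1 / 4 * (s * x $ ix_second))) *\<^sub>R e2" for x
    unfolding B_def
    by (simp add: matrix_vector_mult_add_rdistrib matrix_vector_mult_diff_rdistrib scaleR_matrix_vector_assoc[symmetric]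
        algebra_simps scaleR_add_left[symmetric] ss)
  have iso: "isoQ B"
    unfolding isoQ_def
  proof
    fix x
    define a b where "a = - bq p x" and "b = s * x $ ix_second"
    have x2: "x $ ix_second = s * b" by (simp add: b_def ss)
    have "B *v x = x + ((1 / 4 * a + 3 / 4 * b) *\<^sub>R p + (s * (3 / 4 * a + 1 / 4 * b)) *\<^sub>R e2)"
      unfolding Bx a_def b_def by simp
    moreover have "bq x p = - a" by (simp add: a_def bq_commute[of x])
    ultimately have "Q (B *v x) = Q x + 2 * (- (1 / 4 * a + 3 / 4 * b) * a + (s * s) * ((3 / 4 * a + 1 / 4 * b) * b))
        + (- (1 / 4 * a + 3 / 4 * b)\<^sup>2 + (s * s) * (3 / 4 * a + 1 / 4 * b)\<^sup>2)"
      by (simp add: Q_add Q_scaleR x2 pn Q_bq[of p] Q_bq[of e2] Qp power2_eq_square algebra_simps)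
    also have "\<dots> = Q x" unfolding ss(1) by (simp add: power2_eq_square algebra_simps)
    finally show "Q (B *v x) = Q x" .
  qed
  have BV: "B *v x \<in> V1" if x: "x \<in> V" for x
  proof -
    define a b where "a = - bq p x" and "b = s * x $ ix_second"
    have xV: "future x" "-1 < Q x" "0 < b" "- Q x < (x $ ix_second)\<^sup>2" "dist (nrm (proj x)) p < e"
      using x by (auto simp: V_def b_def)
    have a: "a > 0" using bq_future[OF fp xV(1)] by (simp add: a_def)
    define k where "k = 1 / 4 * a + 3 / 4 * b"
    have k: "k > 0" using a xV by (simp add: k_def)
    have eq: "B *v x = x + k *\<^sub>R p + (s * (3 / 4 * a + 1 / 4 * b)) *\<^sub>R e2"
      unfolding Bx a_def b_def k_def by simp
    have xl: "x $ ix_last > 0" using xV by (simp add: future_def)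
    have QB: "Q (B *v x) = Q x" by (rule Q_isoQ[OF iso])
    have f: "future (B *v x)" using xV(1) k by (simp add: future_def QB) (simp add: eq pn)
    have b2: "s * (B *v x) $ ix_second = 3 / 4 * a + 5 / 4 * b"
      by (simp add: eq pn ss algebra_simps b_def[symmetric])
    have "(5 / 4 * b)\<^sup>2 < (3 / 4 * a + 5 / 4 * b)\<^sup>2" using a xV by (intro power_strict_mono) auto
    moreover have "(s * (B *v x) $ ix_second)\<^sup>2 = ((B *v x) $ ix_second)\<^sup>2" "b\<^sup>2 = (x $ ix_second)\<^sup>2"
      using s by (auto simp: b_def power2_eq_square)
    ultimately have big: "25 / 16 * (- Q x) < ((B *v x) $ ix_second)\<^sup>2"
      using xV(4) by (simp add: b2 power_mult_distrib power2_eq_square[of "5/4"] power_divide)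
    have pB: "proj (B *v x) = proj x + k *\<^sub>R p" by (simp add: eq proj_add proj_scaleR pp proj_e2)
    have Bl: "(B *v x) $ ix_last = x $ ix_last + k" by (simp add: eq pn)
    have sc: "inverse (r + k) * (y + k * q) - q = r / (r + k) * (inverse r * y - q)"
      if "r > 0" for r y q :: real
    proof -
      have "r + k \<noteq> 0" "r \<noteq> 0" using that k by auto
      then show ?thesis by (simp add: divide_simps) (simp add: algebra_simps)
    qed
    \<comment> \<open>Adding a positive multiple of \<open>p\<close> to the projection moves the
      normalized point towards \<open>p\<close>, so it stays in the ball.\<close>
    have "nrm (proj (B *v x)) - p = (x $ ix_last / (x $ ix_last + k)) *\<^sub>R (nrm (proj x) - p)"
      unfolding vec_eq_iff using sc[OF xl] by (simp add: nrm_def Bl pB pn(2))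
    then have "dist (nrm (proj (B *v x))) p = (x $ ix_last / (x $ ix_last + k)) * dist (nrm (proj x)) p"
      using xl k by (simp add: dist_norm)
    also have "\<dots> \<le> 1 * dist (nrm (proj x)) p"
      using xl k by (intro mult_right_mono) (auto simp: field_simps)
    finally have "dist (nrm (proj (B *v x))) p < e" using xV by simp
    moreover have "- Q x < ((B *v x) $ ix_second)\<^sup>2" using big xV(1) by (simp add: future_def)
    ultimately show ?thesis using f xV a big by (auto simp: V1_def V_def QB b2)
  qed
  have le: "emeasure lborel V \<le> emeasure lborel V1"
  proof -
    have "{x. B *v x \<in> V1} \<in> sets borel"
      using measurable_sets[OF borel_measurable_linear[OF matrix_vector_mul_linear], of V1 B] oV12
      by (simp add: vimage_def)
    then have "emeasure lborel V \<le> emeasure lborel {x. B *v x \<in> V1}"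
      using BV by (intro emeasure_mono) auto
    also have "\<dots> = emeasure lborel V1" using oV12 by (intro emeasure_isoQ iso) simp
    finally show ?thesis .
  qed
  \<comment> \<open>At \<open>x0\<close> the conditions of \<open>V2\<close> read 7/16 < 9/16 <
    175/256.\<close>
  define x0 where "x0 = p + (3 / 4 * s) *\<^sub>R e2"
  have x02: "x0 $ ix_second = 3 / 4 * s" by (simp add: x0_def pn)
  have x0p: "proj x0 = p" by (simp add: x0_def proj_add proj_scaleR pp proj_e2)
  have "Q x0 = - 1 + (3 / 4 * s)\<^sup>2" using Q_proj[of x0] by (simp add: x0p x02 Q_bq[of p] Qp)
  moreover have sq: "(3 / 4 * s)\<^sup>2 = 9 / 16" using s by (auto simp: power2_eq_square)
  ultimately have Qx0: "Q x0 = - (7 / 16)" by simp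
  have "x0 $ ix_last = 1" by (simp add: x0_def pn)
  then have "x0 \<in> V2" using s e(1)
    by (auto simp: V2_def V_def future_def Qx0 x02 x0p nrm_id[OF ph] power2_eq_square)
  then have pos: "emeasure lborel V2 > 0" using emeasure_open_pos[OF oV12(2)] by blast
  \<comment> \<open>\<open>V1\<close> is at least as large as \<open>V\<close>, which contains
    \<open>V1\<close> and the disjoint set \<open>V2\<close> of positive measure; so the measure is
    infinite.\<close>
  have "V1 \<inter> V2 = {}" by (auto simp: V1_def V2_def)
  then have "emeasure lborel V1 + emeasure lborel V2 = emeasure lborel (V1 \<union> V2)"
    using oV12 by (intro plus_emeasure) auto
  also have "\<dots> \<le> emeasure lborel V" using oV by (intro emeasure_mono) (auto simp: V1_def V2_def)
  also note le
  finally have inf: "emeasure lborel V1 = \<infinity>"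
    using pos ennreal_add_left_cancel_le[of "emeasure lborel V1" "emeasure lborel V2" 0]
      by (auto simp: top_unique)
  obtain D where D: "D \<in> sets borel" "D \<subseteq> hyp" "\<forall>x\<in>hyp. \<exists>!y. y \<in> D \<inter> orbit \<Gamma> x" "hyp_volume UNIV D < \<infinity>"
    using fv unfolding finite_volume_quotient_def by (elim exE conjE)
  have "emeasure lborel (cone_set D) < \<infinity>"
  proof -
    have "of_nat CARD('n) * emeasure lborel (cone_set D) \<noteq> \<infinity>"
      using D(4) hyp_volume_UNIV[OF D(1)] by auto
    then have "emeasure lborel (cone_set D) \<noteq> \<infinity>" by (auto simp: ennreal_mult_eq_top_iff)
    then show ?thesis by (simp add: less_top)
  qed
  moreover have "\<exists>i. \<forall>A\<in>lifts. i A \<in> lifts \<and> A ** i A = mat 1 \<and> i A ** A = mat 1"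
    by (rule bchoice) (metis lifts_inverse)
  then obtain i where i: "\<And>A. A \<in> lifts \<Longrightarrow> i A \<in> lifts" "\<And>A. A \<in> lifts \<Longrightarrow> A ** i A = mat 1"
    "\<And>A. A \<in> lifts \<Longrightarrow> i A ** A = mat 1" by blast
  have "emeasure lborel V \<le> emeasure lborel (cone_set D)"
  proof (rule wandering_emeasure_le[where H = lifts and a = "(*v)" and i = i])
    show "(*v) A \<in> measurable lborel lborel" for A :: "'n rmat"
      using borel_measurable_linear[OF matrix_vector_mul_linear, of A] by simp
    show "emeasure lborel ((*v) A -` X) = emeasure lborel X" if "A \<in> lifts" "X \<in> sets lborel" for A X
      using emeasure_isoQ[OF lift_isoQ[OF lifts_lift[OF that(1)]], of X] that(2) by (simp add: vimage_def)
    show "\<exists>A\<in>lifts. A *v x \<in> cone_set D" if x: "x \<in> V" for x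
    proof -
      have f: "future x" "-1 < Q x" using x by (auto simp: V_def)
      have "\<exists>y. y \<in> D \<inter> orbit \<Gamma> (nrm x)"
        using D(3) nrm_hyp[OF f(1)] ex1_implies_ex by metis
      then obtain A where A: "A \<in> lifts" "pa A (nrm x) \<in> D" by (auto simp: orbit_alt)
      have "future (A *v x)" by (rule lift_future[OF lifts_lift[OF A(1)] f(1)])
      moreover have "Q (A *v x) = Q x" by (rule Q_isoQ[OF lift_isoQ[OF lifts_lift[OF A(1)]]])
      moreover have "nrm (A *v x) \<in> D" using A(2) nrm_mult[OF f(1), of A] by simp
      ultimately have "A *v x \<in> cone_set D" using f(2) by (simp add: cone_set_def future_def nrm_def)
      then show ?thesis using A(1) by blast
    qed
    show "A = A'" if A: "A \<in> lifts" "A' \<in> lifts"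
      and x: "i A *v x \<in> V" "i A' *v x \<in> V" for A A' x
    proof -
      \<comment> \<open>An element taking a point of \<open>V\<close> to a point of \<open>V\<close>
        preserves \<open>hyp0\<close>, so it commutes with the projection and takes a point near
        \<open>p\<close> to a point near \<open>p\<close>. By the choice of \<open>e\<close> it is
        the identity.\<close>
      define u C where "u = i A *v x" and "C = i A' ** A"
      have C: "C \<in> lifts" unfolding C_def by (intro lifts_mult i A)
      have Cu: "C *v u = i A' *v x"
        unfolding u_def C_def matrix_vector_mul_assoc matrix_mul_assoc[symmetric] by (simp add: i A)
      have u: "u \<in> V" "C *v u \<in> V" using x unfolding Cu by (simp_all add: u_def)
      have f: "future u" "future (C *v u)" using u by (auto simp: V_def)
      have sd: "nrm z \<in> side s" if z: "z \<in> V" for z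
      proof -
        have z': "future z" "0 < s * z $ ix_second" "0 < inverse (z $ ix_last)"
          using z by (auto simp: V_def future_def)
        have "s * nrm z $ ix_second = inverse (z $ ix_last) * (s * z $ ix_second)" by (simp add: nrm_def)
        then have "0 < s * nrm z $ ix_second" using z'(2,3) by (simp only: mult_pos_pos)
        then show ?thesis using nrm_hyp[OF z'(1)] by (simp add: side_def)
      qed
      have "pa C (nrm u) \<in> side s" using sd[OF u(2)] nrm_mult[OF f(1), of C] by simp
      then have "C \<in> lifts0" by (rule side_component_lifts0[OF s comp C sd[OF u(1)]])
      then have "adm C" using lift_adm[OF lifts_lift[OF C]] by (simp add: lifts0_def)
      then have "proj (C *v u) = C *v proj u" by (simp add: adm_def)
      then have "pa C (nrm (proj u)) = nrm (proj (C *v u))"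
        using nrm_mult[OF future_proj[OF f(1)], of C] by simp
      then have "dist (pa C (nrm (proj u))) p < e" "dist (nrm (proj u)) p < e" using u by (auto simp: V_def)
      then have "C = mat 1" using e(2)[OF C _ nrm_hyp[OF future_proj[OF f(1)]]] by blast
      then have "A' ** (i A' ** A) = A'" by (simp add: C_def)
      then show ?thesis using i(2)[OF A(2)] by (simp add: matrix_mul_assoc)
    qed
  qed (use countable_lifts oV cone_set_borel[OF D(1)] i in \<open>auto simp: matrix_vector_mul_assoc\<close>)
  moreover have "emeasure lborel V1 \<le> emeasure lborel V"
    using oV by (intro emeasure_mono) (auto simp: V1_def)
  ultimately show False using inf by (auto simp: top_unique)
qed

end

section \<open>The preimage of the hypersurface is closed\<close>

context dim_ge_4
begin

text \<open>Bessel's inequality: what remains of \<open>v\<close> after removing its components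
  along \<open>w\<close> and \<open>n\<close> is orthogonal to the timelike \<open>w\<close>, so
  \<open>Q\<close> is nonnegative on it.\<close>

lemma bq_orthogonal_bound:
  fixes v w n :: "'n rvec"
  assumes w: "Q w < 0" and n: "bq w n = 0" "Q n = 1"
  shows "(bq v n)\<^sup>2 \<le> Q v - (bq v w)\<^sup>2 / Q w"
proof -
  define \<alpha> \<beta> where "\<alpha> = bq v w / Q w" and "\<beta> = bq v n"
  define u where "u = v - \<alpha> *\<^sub>R w - \<beta> *\<^sub>R n"
  have vw: "bq v w = \<alpha> * Q w" using w by (simp add: \<alpha>_def)
  have nw: "bq n w = 0" using n(1) by (simp only: bq_commute[of n w])
  have "bq u w = 0" by (simp add: u_def vw nw Q_bq)
  then have "Q u \<ge> 0" using Q_pos_orthogonal[OF w, of u] by (cases "u = 0") (auto simp: Q_bq)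
  moreover have "Q u = Q v - \<alpha>\<^sup>2 * Q w - \<beta>\<^sup>2"
  proof -
    have c: "bq w v = \<alpha> * Q w" "bq n v = \<beta>" by (simp_all only: bq_commute[of _ v] vw \<beta>_def)
    have q: "bq v v = Q v" "bq w w = Q w" "bq n n = 1" using n(2) by (simp_all only: Q_bq)
    have "Q u = bq v v - \<alpha> * bq v w - \<beta> * bq v n - \<alpha> * (bq w v - \<alpha> * bq w w - \<beta> * bq w n)
        - \<beta> * (bq n v - \<alpha> * bq n w - \<beta> * bq n n)"
      unfolding Q_bq u_def by (simp add: algebra_simps)
    then show ?thesis
      unfolding c nw n(1) vw q \<beta>_def[symmetric] by (simp add: power2_eq_square algebra_simps)
  qed
  moreover have "\<alpha>\<^sup>2 * Q w = (bq v w)\<^sup>2 / Q w" using w by (simp add: vw power2_eq_square)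
  ultimately show ?thesis by (simp add: \<beta>_def)
qed

end

context hyp_hypersurface
begin

text \<open>If \<open>T\<close> were not closed, infinitely many of its components would meet each neighbourhood of a
  limit point \<open>z\<close>. The pull-backs of one small set near \<open>z\<close> by the corresponding elements of \<open>\<Gamma>\<close> are
  disjoint modulo the stabilizer of \<open>hyp0\<close> and lie close to \<open>hyp0\<close>, against the finite volume of its
  quotient.\<close>

lemma T_closedin:
  assumes fv: "finite_volume_quotient (UNIV - {ix_second}) hyp0 (stab \<Gamma> hyp0)"
  shows "closedin (top_of_set hyp) T"
proof -
  have "z \<in> T" if z: "z \<in> hyp" "z \<in> closure T" for z
  proof (rule ccontr)
    assume zT: "z \<notin> T"
    \<comment> \<open>\<open>g (v, w)\<close> is \<open>Q\<close> of the part of \<open>v\<close>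
      orthogonal to \<open>w\<close>. It is 0 on the diagonal and, by
      \<open>bq_orthogonal_bound\<close>, limits how far \<open>v\<close> can be from a hyperplane
      through \<open>w\<close>.\<close>
    define g where "g q = Q (fst q) - (bq (fst q) (snd q))\<^sup>2 / Q (snd q)" for q :: "'n rvec \<times> 'n rvec"
    have Qz: "Q z < 0" using z by (simp add: hyp_def)
    let ?O = "{q :: 'n rvec \<times> 'n rvec. Q (snd q) < 0}"
    have "continuous_on ?O g" unfolding g_def by (intro continuous_intros) auto
    moreover have "open ?O" by (intro open_Collect_less continuous_intros)
    ultimately have "open (?O \<inter> g -` {..<1/4})" by (rule continuous_open_preimage) simp
    moreover have "g (z, z) = 0" using Qz by (simp add: g_def Q_bq[symmetric] power2_eq_square)
    then have "(z, z) \<in> ?O \<inter> g -` {..<1/4}" using Qz by simp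
    ultimately obtain U1 U2 where U: "open U1" "open U2" "(z, z) \<in> U1 \<times> U2" "U1 \<times> U2 \<subseteq> ?O \<inter> g -` {..<1/4}"
      by (rule open_prod_elim)
    obtain e1 where e1: "e1 > 0" "ball z e1 \<subseteq> U1 \<inter> U2"
      using open_contains_ball_eq[OF open_Int[OF U(1,2)]] U(3) by auto
    obtain e0 where e0: "e0 > 0" "\<And>A y. A \<in> lifts \<Longrightarrow> A \<noteq> mat 1 \<Longrightarrow> y \<in> hyp \<Longrightarrow> dist y z < e0 \<Longrightarrow> \<not> dist (pa A y) z < e0"
      using free_small_neighbourhood[OF z(1)] by blast
    define e where "e = min e0 e1"
    have e: "e > 0" "e \<le> e0" "e \<le> e1" using e0 e1 by (auto simp: e_def)
    have gle: "g (v, w) < 1/4" if "dist v z < e" "dist w z < e" for v w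
    proof -
      have "v \<in> U1" "w \<in> U2" using that e1(2) e(3) by (auto simp: dist_commute subset_iff)
      then show ?thesis using U(4) by blast
    qed
    \<comment> \<open>The bounds 1/2 here and 1/4 in \<open>W_near\<close> leave room for the
      truncation: projecting a pulled-back point lowers \<open>Q\<close> by less than 1/4, so it
      stays above -1.\<close>
    define W where "W = {y. future y \<and> - (1/2) < Q y \<and> y $ ix_last < 1 \<and> dist (nrm y) z < e}"
    have "continuous_on {y. future y} (\<lambda>y. dist (nrm y) z)"
      unfolding nrm_def by (intro continuous_intros) (auto simp: future_def)
    then have "open ({y. future y} \<inter> (\<lambda>y. dist (nrm y) z) -` {..<e})"
      by (rule continuous_open_preimage) (auto intro: open_future)
    moreover have "open {y :: 'n rvec. - (1/2) < Q y \<and> y $ ix_last < 1}"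
      by (intro open_Collect_conj open_Collect_less continuous_intros)
    moreover have "W = ({y. future y} \<inter> (\<lambda>y. dist (nrm y) z) -` {..<e}) \<inter> {y. - (1/2) < Q y \<and> y $ ix_last < 1}"
      by (auto simp: W_def)
    ultimately have oW: "open W" by (simp only: open_Int)
    define r where "r = 1 / (2 * (1 - Q z))"
    have r: "r > 0" "r < 1" "r * (- Q z) < 1 / 2" using Qz by (auto simp: r_def field_simps)
    have "r * (r * (- Q z)) < 1 * (1 / 2)"
      using r Qz by (intro mult_strict_mono) (auto simp: mult_nonneg_nonpos)
    then have "- (1/2) < Q (r *\<^sub>R z)" by (simp add: Q_scaleR power2_eq_square)
    moreover have "future (r *\<^sub>R z)" using r z by (simp add: future_def Q_scaleR hyp_def mult_pos_neg)
    ultimately have "r *\<^sub>R z \<in> W"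
      using r z e(1) by (simp add: W_def nrm_scaleR nrm_id) (simp add: hyp_def)
    then have Wpos: "emeasure lborel W > 0" by (rule emeasure_open_pos[OF oW])
    have W_inj: "A = A'" if A: "A \<in> lifts" "A' \<in> lifts" "A *v x \<in> W" "A' *v x \<in> W" for A A' x
    proof -
      obtain B where B: "B \<in> lifts" "A ** B = mat 1" "B ** A = mat 1" using lifts_inverse[OF A(1)] .
      have "A' *v x = (A' ** B) *v (A *v x)"
        by (simp add: matrix_vector_mul_assoc matrix_mul_assoc[symmetric] B)
      moreover have f: "future (A *v x)" using A(3) by (simp add: W_def)
      ultimately have "pa (A' ** B) (nrm (A *v x)) = nrm (A' *v x)" using nrm_mult[OF f, of "A' ** B"] by simp
      then have "A' ** B = mat 1"
        using e0(2)[OF lifts_mult[OF A(2) B(1)] _ nrm_hyp[OF f]] A(3,4) e(2) by (auto simp: W_def)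
      then have "A' ** B ** A = A" by simp
      then show ?thesis by (simp add: matrix_mul_assoc[symmetric] B)
    qed
    \<comment> \<open>If the translate of \<open>hyp0\<close> by \<open>A\<close> passes near
      \<open>z\<close>, then the pull-back of \<open>W\<close> by \<open>A\<close> lies near
      \<open>hyp0\<close>: the second coordinate of \<open>x\<close> is \<open>bq\<close> of
      \<open>A *v x\<close> with the normal of the translate.\<close>
    have W_near: "(x $ ix_second)\<^sup>2 < 1 / 4"
      if A: "A \<in> lifts" "pa A ` hyp0 \<inter> ball z e \<noteq> {}" "A *v x \<in> W" for A x
    proof -
      let ?y = "A *v x" and ?n = "A *v e2"
      have iso: "isoQ A" by (rule lift_isoQ[OF lifts_lift[OF A(1)]])
      obtain w where w: "w \<in> hyp0" "dist (pa A w) z < e" using A(2) by (auto simp: dist_commute)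
      have "bq (A *v w) ?n = 0" using isoQ_bq[OF iso, of w e2] w(1) by (simp add: hyp0_alt)
      then have wn: "bq (pa A w) ?n = 0" by (simp add: nrm_def)
      have "pa A w \<in> hyp" using pa_hyp[OF A(1)] w(1) hyp0_hyp by blast
      then have "Q (pa A w) < 0" by (simp add: hyp_def)
      moreover have "Q ?n = 1" using Q_isoQ[OF iso, of e2] by (simp add: Q_bq[of e2])
      ultimately have "(bq (nrm ?y) ?n)\<^sup>2 \<le> g (nrm ?y, pa A w)"
        using bq_orthogonal_bound[OF _ wn] by (simp add: g_def)
      also have "\<dots> < 1 / 4" using A(3) w(2) by (intro gle) (auto simp: W_def)
      finally have b: "(bq (nrm ?y) ?n)\<^sup>2 < 1 / 4" .
      have yl: "0 < ?y $ ix_last" "?y $ ix_last < 1" using A(3) by (auto simp: W_def future_def)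
      have "?y = (?y $ ix_last) *\<^sub>R nrm ?y" using yl by (simp add: nrm_def)
      then have "bq ?y ?n = ?y $ ix_last * bq (nrm ?y) ?n" by (metis bq_linear(5))
      moreover have "bq ?y ?n = x $ ix_second" using isoQ_bq[OF iso, of x e2] by simp
      ultimately have "(x $ ix_second)\<^sup>2 = (?y $ ix_last)\<^sup>2 * (bq (nrm ?y) ?n)\<^sup>2"
        by (simp add: power_mult_distrib)
      also have "\<dots> \<le> 1 * (bq (nrm ?y) ?n)\<^sup>2"
        using yl by (intro mult_right_mono) (auto simp: power_le_one)
      finally show ?thesis using b by simp
    qed
    obtain D where D: "D \<in> sets borel" "D \<subseteq> hyp0" "\<forall>x\<in>hyp0. \<exists>!y. y \<in> D \<inter> orbit (stab \<Gamma> hyp0) x"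
      "hyp_volume (UNIV - {ix_second :: 'n}) D < \<infinity>"
      using fv unfolding finite_volume_quotient_def by (elim exE conjE)
    define F where "F = {x. \<bar>x $ ix_second\<bar> \<le> 1 \<and> proj x \<in> cone_set D}"
    have Ffin: "emeasure lborel F < \<infinity>"
      unfolding F_def by (rule hyp_volume_hyperplane_finite[OF D(1,4)])
    have FB: "F \<in> sets borel"
    proof -
      have "proj \<in> borel_measurable (borel :: ('n rvec) measure)"
        by (intro borel_measurable_linear linear_proj)
      from measurable_sets[OF this cone_set_borel[OF D(1)]] have "proj -` cone_set D \<in> sets borel" by simp
      moreover have "{x :: 'n rvec. \<bar>x $ ix_second\<bar> \<le> 1} \<in> sets borel" by measurable
      moreover have "F = {x. \<bar>x $ ix_second\<bar> \<le> 1} \<inter> proj -` cone_set D"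
        by (auto simp: F_def)
      ultimately show ?thesis by auto
    qed
    have "\<exists>i. \<forall>A\<in>lifts0. i A \<in> lifts0 \<and> A ** i A = mat 1 \<and> i A ** A = mat 1"
      by (rule bchoice) (use lifts0_group in \<open>auto simp: matrix_group_def\<close>)
    then obtain i where i: "\<And>A. A \<in> lifts0 \<Longrightarrow> i A \<in> lifts0" "\<And>A. A \<in> lifts0 \<Longrightarrow> A ** i A = mat 1"
      "\<And>A. A \<in> lifts0 \<Longrightarrow> i A ** A = mat 1" by blast
    have l0: "A \<in> lifts" "pa A ` hyp0 = hyp0" if "A \<in> lifts0" for A
      using that by (auto simp: lifts0_iff)
    define \<P> where "\<P> = {P \<in> components T. P \<inter> ball z e \<noteq> {}}"
    \<comment> \<open>Finitely many components, each closed in \<open>hyp\<close>, would have a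
      closed union, and the limit point \<open>z\<close> would belong to it.\<close>
    have inf: "infinite \<P>"
    proof
      assume fin: "finite \<P>"
      have "ball z e \<inter> T \<subseteq> \<Union>\<P>"
      proof
        fix t assume t: "t \<in> ball z e \<inter> T"
        then obtain P where P: "P \<in> components T" "t \<in> P" by (metis IntD2 Union_components UnionE)
        then have "P \<in> \<P>" using t unfolding \<P>_def by blast
        then show "t \<in> \<Union>\<P>" using P(2) by blast
      qed
      moreover have "z \<in> closure (ball z e \<inter> T)"
        using open_Int_closure_subset[of "ball z e" T] z(2) e(1) by auto
      ultimately have "z \<in> closure (\<Union>\<P>)" using closure_mono by blast
      moreover have "closure (\<Union>\<P>) \<subseteq> (\<Union>P\<in>\<P>. closure P)"
      proof (rule closure_minimal)
        show "\<Union>\<P> \<subseteq> (\<Union>P\<in>\<P>. closure P)" using closure_subset by blast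
        show "closed (\<Union>P\<in>\<P>. closure P)" using fin by (intro closed_UN) auto
      qed
      ultimately obtain P where P: "P \<in> \<P>" "z \<in> closure P" by blast
      then have PT: "P \<in> components T" by (simp add: \<P>_def)
      then have "geodesic_hyperplane P"
        using hypersurface by (simp add: complete_totally_geodesic_hypersurface_def)
      then obtain a where a: "P = {x \<in> hyp. a \<bullet> x = 0}" by (auto simp: geodesic_hyperplane_def)
      have "closure P \<subseteq> {x. a \<bullet> x = 0}"
        unfolding a by (intro closure_minimal closed_hyperplane) auto
      then have "z \<in> P" using P(2) z(1) a by auto
      then show False using in_components_subset[OF PT] zT by blast
    qed
    \<comment> \<open>Each of \<open>m\<close> components is the image of \<open>hyp0\<close> under
      some group element, which gives \<open>m\<close> disjoint pull-backs of \<open>W\<close>. A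
      coincidence modulo \<open>lifts0\<close> would identify two components, as
      \<open>lifts0\<close> preserves \<open>hyp0\<close>.\<close>
    have bound: "of_nat m * emeasure lborel W \<le> emeasure lborel F" for m
    proof -
      obtain \<Q> where \<Q>: "finite \<Q>" "card \<Q> = m" "\<Q> \<subseteq> \<P>"
        using infinite_arbitrarily_large[OF inf] by blast
      have "\<forall>P\<in>\<Q>. \<exists>A. A \<in> lifts \<and> pa A ` hyp0 = P"
        using T_components_transitive \<Q>(3) unfolding \<P>_def by blast
      from bchoice[OF this] obtain c where cc: "\<forall>P\<in>\<Q>. c P \<in> lifts \<and> pa (c P) ` hyp0 = P" ..
      then have c: "\<And>P. P \<in> \<Q> \<Longrightarrow> c P \<in> lifts" "\<And>P. P \<in> \<Q> \<Longrightarrow> pa (c P) ` hyp0 = P" by simp_all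
      define N where "N P = {x. c P *v x \<in> W}" for P
      have NB: "N P \<in> sets borel" for P
        using measurable_sets[OF borel_measurable_linear[OF matrix_vector_mul_linear], of W "c P"] oW
        by (simp add: N_def vimage_def)
      have NW: "emeasure lborel (N P) = emeasure lborel W" if "P \<in> \<Q>" for P
        unfolding N_def using oW lift_isoQ[OF lifts_lift[OF c(1)[OF that]]] by (intro emeasure_isoQ) auto
      have "disjoint_family_on N \<Q>"
        unfolding disjoint_family_on_def
      proof (intro ballI impI)
        fix P P' assume P: "P \<in> \<Q>" "P' \<in> \<Q>" "P \<noteq> P'"
        then have "c P \<noteq> c P'" using c(2) by metis
        then show "N P \<inter> N P' = {}" using W_inj[OF c(1) c(1)] P unfolding N_def by blast
      qed
      then have "(\<Sum>P\<in>\<Q>. emeasure lborel (N P)) = emeasure lborel (\<Union>P\<in>\<Q>. N P)"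
        using \<Q>(1) NB by (intro sum_emeasure) auto
      then have "of_nat m * emeasure lborel W = emeasure lborel (\<Union>P\<in>\<Q>. N P)"
        using NW \<Q>(2) by simp
      also have "\<dots> \<le> emeasure lborel F"
      proof (rule wandering_emeasure_le[where H = lifts0 and a = "(*v)" and i = i])
        show "countable lifts0"
          using countable_lifts by (rule countable_subset[rotated]) (auto simp: lifts0_def)
        show "(*v) A \<in> measurable lborel lborel" for A :: "'n rmat"
          using borel_measurable_linear[OF matrix_vector_mul_linear, of A] by simp
        show "emeasure lborel ((*v) A -` X) = emeasure lborel X"
          if "A \<in> lifts0" "X \<in> sets lborel" for A X
          using emeasure_isoQ[OF lift_isoQ[OF lifts_lift[OF l0(1)[OF that(1)]]], of X] that(2)
            by (simp add: vimage_def)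
        show "(\<Union>P\<in>\<Q>. N P) \<in> sets lborel" using \<Q>(1) NB by auto
        show "\<exists>h\<in>lifts0. h *v x \<in> F" if x: "x \<in> (\<Union>P\<in>\<Q>. N P)" for x
        proof -
          obtain P where P: "P \<in> \<Q>" "c P *v x \<in> W" using x by (auto simp: N_def)
          have A: "c P \<in> lifts" "pa (c P) ` hyp0 \<inter> ball z e \<noteq> {}"
            using c[OF P(1)] \<Q>(3) P(1) by (auto simp: \<P>_def)
          have x2: "(x $ ix_second)\<^sup>2 < 1 / 4" by (rule W_near[OF A P(2)])
          then have "(x $ ix_second)\<^sup>2 \<le> 1" by linarith
          then have x2': "\<bar>x $ ix_second\<bar> \<le> 1" by (simp only: abs_square_le_1)
          obtain B where B: "B \<in> lifts" "c P ** B = mat 1" "B ** c P = mat 1"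
            using lifts_inverse[OF A(1)] .
          have "future (B *v (c P *v x))"
            using P(2) by (intro lift_future[OF lifts_lift[OF B(1)]]) (simp add: W_def)
          then have "future x" by (simp add: matrix_vector_mul_assoc B)
          then have fp: "future (proj x)" by (rule future_proj)
          have "Q x = Q (c P *v x)" by (simp add: Q_isoQ lift_isoQ lifts_lift A)
          then have "- 1 < Q (proj x)" using Q_proj[of x] x2 P(2) by (simp add: W_def)
          have "nrm (proj x) \<in> hyp0" using fp by (simp add: hyp0_alt nrm_hyp nrm_second)
          then have "\<exists>y. y \<in> D \<inter> orbit (stab \<Gamma> hyp0) (nrm (proj x))"
            using D(3) ex1_implies_ex by metis
          then obtain \<gamma> where "\<gamma> \<in> stab \<Gamma> hyp0" "act \<gamma> (nrm (proj x)) \<in> D" by (auto simp: orbit_def)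
          then obtain h where h: "h \<in> lifts0" "nrm (h *v nrm (proj x)) \<in> D"
            by (auto simp: stab_hyp0 act_pgl_class)
          have hl: "lift h" by (rule lifts_lift[OF l0(1)[OF h(1)]])
          have ah: "adm h" using lift_adm[OF hl] h(1) by (simp add: lifts0_def)
          have "nrm (h *v proj x) \<in> D" using h(2) nrm_mult[OF fp, of h] by simp
          moreover have "future (h *v proj x)" by (rule lift_future[OF hl fp])
          moreover have "Q (h *v proj x) = Q (proj x)" by (rule Q_isoQ[OF lift_isoQ[OF hl]])
          ultimately have "h *v proj x \<in> cone_set D"
            using \<open>- 1 < Q (proj x)\<close> by (simp add: cone_set_def future_def nrm_def)
          then have "h *v x \<in> F"
            using x2' adm_abs_second[OF ah, of x] adm_proj[OF ah, of x] by (simp add: F_def)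
          then show ?thesis using h(1) by blast
        qed
        show "h = h'" if h: "h \<in> lifts0" "h' \<in> lifts0"
          "i h *v x \<in> (\<Union>P\<in>\<Q>. N P)" "i h' *v x \<in> (\<Union>P\<in>\<Q>. N P)" for h h' x
        proof -
          obtain P P' where P: "P \<in> \<Q>" "P' \<in> \<Q>" "c P *v (i h *v x) \<in> W" "c P' *v (i h' *v x) \<in> W"
            using h(3,4) by (auto simp: N_def)
          have eq: "c P ** i h = c P' ** i h'"
            using P by (intro W_inj[of _ _ x] lifts_mult c l0 i h) (simp_all add: matrix_vector_mul_assoc)
          have im: "pa (c R ** i k) ` hyp0 = R" if "R \<in> \<Q>" "k \<in> lifts0" for R k
            using pa_image_mult[OF l0(1)[OF i(1)[OF that(2)]] hyp0_hyp, of "c R"]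
              l0(2)[OF i(1)[OF that(2)]] c(2)[OF that(1)] by simp
          have PP: "P = P'" using im[OF P(1) h(1)] im[OF P(2) h(2)] eq by simp
          obtain B where B: "B \<in> lifts" "c P ** B = mat 1" "B ** c P = mat 1"
            using lifts_inverse[OF c(1)[OF P(1)]] .
          have "B ** (c P ** i h) = B ** (c P ** i h')" using eq PP by simp
          then have "i h = i h'" by (simp add: matrix_mul_assoc B)
          then have "h ** i h' ** h' = h'" using i(2)[OF h(1)] by simp
          then show ?thesis using i(3)[OF h(2)] by (simp add: matrix_mul_assoc[symmetric])
        qed
      qed (use FB i in \<open>auto simp: matrix_vector_mul_assoc\<close>)
      finally show ?thesis .
    qed
    have "emeasure lborel W \<le> emeasure lborel F" using bound[of 1] by simp
    then have "emeasure lborel W < \<infinity>" using Ffin by (rule le_less_trans)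
    then obtain w f where wf: "emeasure lborel W = ennreal w" "emeasure lborel F = ennreal f" "w \<ge> 0" "f \<ge> 0"
      using Ffin by (metis ennreal_cases infinity_ennreal_def less_irrefl)
    have "w > 0" using Wpos wf by simp
    then obtain m :: nat where "f < real m * w" using reals_Archimedean3 by blast
    moreover have "of_nat m * emeasure lborel W = ennreal (real m * w)"
      using wf by (simp add: ennreal_mult ennreal_of_nat_eq_real_of_nat)
    ultimately show False using bound[of m] wf by simp
  qed
  then have "T = hyp \<inter> closure T" using T_hyp closure_subset by blast
  then show ?thesis by (metis closedin_closed_Int closed_closure)
qed

text \<open>A boundary component of \<open>C1\<close> other than \<open>hyp0\<close> is the image of \<open>hyp0\<close> under an element of
  \<open>\<Gamma>\<close>. The inverse of that element takes \<open>C1\<close> to a component over \<open>M1\<close> adjacent to \<open>hyp0\<close>, which is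
  \<open>C1\<close> again.\<close>

lemma exists_transverse:
  assumes fv: "finite_volume_quotient UNIV hyp \<Gamma>"
    and fv0: "finite_volume_quotient (UNIV - {ix_second}) hyp0 (stab \<Gamma> hyp0)"
    and M: "M1 \<subseteq> hyp_quotient \<Gamma>" "M2 \<subseteq> hyp_quotient \<Gamma>" "M1 \<inter> M2 = {}"
    and C1: "C1 \<in> adjacent_components S" "C1 \<subseteq> \<Union>M1"
    and C2: "C2 \<in> adjacent_components S" "C2 \<subseteq> \<Union>M2"
  shows "\<exists>A\<in>lifts. pa A ` C1 = C1 \<and> proj (A *v e2) \<noteq> 0"
proof -
  note cl = T_closedin[OF fv0]
  have comp: "C1 \<in> components (hyp - T)" by (rule adjacent_component[OF C1(1)])
  obtain s where s: "s = 1 \<or> s = -1" "C1 \<subseteq> side s" using component_side[OF comp] .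
  obtain s' where s': "s' = 1 \<or> s' = -1" "C2 \<subseteq> side s'"
    using component_side[OF adjacent_component[OF C2(1)]] .
  have disj: "C \<noteq> C2" if "C \<subseteq> \<Union>M1" for C
  proof
    assume "C = C2"
    obtain x where "x \<in> C2" using in_components_nonempty[OF adjacent_component[OF C2(1)]] by blast
    then have "orbit \<Gamma> x \<in> M1 \<inter> M2"
      using quotient_disjoint[OF M(1,2)] that C2(2) \<open>C = C2\<close> by blast
    then show False using M(3) by blast
  qed
  \<comment> \<open>\<open>C2\<close> occupies the other side of \<open>hyp0\<close>, which leaves
    room for one adjacent component over \<open>M1\<close>.\<close>
  have unique: "C = C1" if C: "C \<in> adjacent_components S" "C \<subseteq> \<Union>M1" for C
  proof -
    obtain s'' where s'': "s'' = 1 \<or> s'' = -1" "C \<subseteq> side s''"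
      using component_side[OF adjacent_component[OF C(1)]] .
    have "s \<noteq> s'" using adjacent_unique[OF C1(1) s(2) C2(1) _ s(1)] s' disj[OF C1(2)] by blast
    moreover have "s'' \<noteq> s'"
      using adjacent_unique[OF C(1) s''(2) C2(1) _ s''(1)] s' disj[OF C(2)] by blast
    ultimately have "s'' = s" using s(1) s'(1) s''(1) by auto
    then show ?thesis using adjacent_unique[OF C(1) _ C1(1) s(2,1)] s'' by blast
  qed
  have sh: "side s \<subseteq> hyp" by (auto simp: side_def)
  \<comment> \<open>Otherwise \<open>C1\<close> would be open and closed in the side
    \<open>s\<close>, hence equal to it, against \<open>side_not_component\<close>. That
    \<open>C1\<close> is open uses the closedness of \<open>T\<close>.\<close>
  have "\<exists>z. z \<in> T \<and> z \<in> side s \<and> z \<in> closure C1"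
  proof (rule ccontr)
    assume none: "\<nexists>z. z \<in> T \<and> z \<in> side s \<and> z \<in> closure C1"
    have "closedin (top_of_set (hyp - T)) C1" by (rule closedin_component[OF comp])
    then obtain K where K: "closed K" "C1 = (hyp - T) \<inter> K" by (auto simp: closedin_closed)
    then have "closure C1 \<subseteq> K" by (intro closure_minimal) auto
    then have "C1 = side s \<inter> closure C1" using none K sh s(2) closure_subset[of C1] by blast
    then have 1: "closedin (top_of_set (side s)) C1" by (metis closedin_closed_Int closed_closure)
    have "openin (top_of_set hyp) (hyp - T)" using cl by (metis closedin_def topspace_euclidean_subtopology)
    moreover then have "locally connected (hyp - T)"
      by (rule locally_open_subset[OF convex_imp_locally_connected[OF convex_hyp]])
    then have "openin (top_of_set (hyp - T)) C1" by (rule openin_components_locally_connected[OF _ comp])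
    ultimately have "openin (top_of_set hyp) C1" by (meson openin_trans)
    then have 2: "openin (top_of_set (side s)) C1" using s(2) sh by (rule openin_subset_trans)
    have "C1 \<noteq> {}" by (rule in_components_nonempty[OF comp])
    then have "C1 = side s" using 1 2 convex_connected[OF convex_side] unfolding connected_clopen by blast
    then show False using side_not_component[OF fv s(1)] comp by simp
  qed
  then obtain z where z: "z \<in> T" "z \<in> side s" "z \<in> closure C1" by blast
  obtain P where P: "P \<in> components T" "z \<in> P" using z(1) by (metis Union_components UnionE)
  then obtain A where A: "A \<in> lifts" "z \<in> pa A ` hyp0" using T_components_transitive by blast
  then obtain y where y: "y \<in> hyp0" "z = pa A y" by blast
  obtain B where B: "B \<in> lifts" "A ** B = mat 1" "B ** A = mat 1" using lifts_inverse[OF A(1)] .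
  have Bz: "pa B z \<in> hyp0" using y pa_inverse[OF A(1) B(3)] hyp0_hyp by auto
  have C1h: "C1 \<subseteq> hyp" using in_components_subset[OF comp] by blast
  have "z \<in> hyp_closure C1" using z sh by (auto simp: hyp_closure_def)
  then have "pa B z \<in> pa B ` hyp_closure C1" by (rule imageI)
  then have "pa B z \<in> closure (pa B ` C1)"
    unfolding pa_hyp_closure[OF B(1) C1h] by (simp add: hyp_closure_def)
  then have "pa B ` C1 \<in> adjacent_components S"
    by (rule component_adjacent[OF component_image[OF B(1) comp] Bz])
  moreover have "pa B ` C1 \<subseteq> \<Union>M1"
  proof (rule image_subsetI)
    fix x assume "x \<in> C1"
    then have "x \<in> \<Union>M1" using C1(2) by blast
    then show "pa B x \<in> \<Union>M1" by (rule union_invariant[OF M(1) _ B(1)])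
  qed
  ultimately have "pa B ` C1 = C1" by (rule unique)
  \<comment> \<open>An element preserving \<open>hyp0\<close> would keep \<open>z\<close> on its
    side, but \<open>pa B z\<close> lies in \<open>hyp0\<close>.\<close>
  moreover have "proj (B *v e2) \<noteq> 0"
  proof
    assume "proj (B *v e2) = 0"
    then have "pa B z \<in> side s" using B(1) lifts0_side[OF _ z(2) s(1), of B] by (simp add: lifts0_def)
    then show False using Bz by (auto simp: side_def hyp0_alt)
  qed
  ultimately show ?thesis using B(1) by blast
qed

end

section \<open>Zariski density\<close>

text \<open>Products of forms are forms, so the generating sets are closed under finite
  intersections and are a base of the topology.\<close>

lemma zariski_PGL_basic_open:
  fixes U :: "(real^'n^'n) set set"
  assumes "openin zariski_PGL U" "g \<in> U"
  shows "\<exists>k f. hpoly k f \<and> (\<forall>A\<in>g. f A \<noteq> 0) \<and> {h \<in> carrier PGL. \<forall>A\<in>h. f A \<noteq> 0} \<subseteq> U"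
proof -
  define D :: "(real^'n^'n \<Rightarrow> real) \<Rightarrow> (real^'n^'n) set set"
    where "D f = {h \<in> carrier PGL. \<forall>A\<in>h. f A \<noteq> 0}" for f
  have "generate_topology_on {D f | f. homogeneous_polynomial_function f} U"
    using assms(1) by (simp add: zariski_PGL_def openin_topology_generated_by_iff D_def)
  then have ex: "g \<in> U \<Longrightarrow> \<exists>k f. hpoly k f \<and> g \<in> D f \<and> D f \<subseteq> U"
  proof (induction arbitrary: g)
    case (Int a b)
    have g: "g \<in> a" "g \<in> b" using Int.prems by auto
    from Int.IH(1)[OF g(1)] obtain k f where f: "hpoly k f" "g \<in> D f" "D f \<subseteq> a"
      by (elim exE conjE)
    from Int.IH(2)[OF g(2)] obtain l h where h: "hpoly l h" "g \<in> D h" "D h \<subseteq> b"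
      by (elim exE conjE)
    have fh: "hpoly (k + l) (\<lambda>A. f A * h A)"
      using f(1) h(1) by (auto simp: hpoly_def power_add intro: real_polynomial_function.intros)
    have "D (\<lambda>A. f A * h A) = D f \<inter> D h" by (auto simp: D_def)
    then have "g \<in> D (\<lambda>A. f A * h A)" "D (\<lambda>A. f A * h A) \<subseteq> a \<inter> b"
      using f h by auto
    with fh show ?case by (intro exI conjI)
  next
    case (UN K)
    then obtain k where "k \<in> K" "g \<in> k" by blast
    then obtain l f where "hpoly l f" "g \<in> D f" "D f \<subseteq> k" using UN.IH by metis
    then show ?case using \<open>k \<in> K\<close> by (intro exI conjI) auto
  next
    case (Basis U)
    then show ?case by (auto simp: homogeneous_polynomial_function_iff_hpoly)
  qed simp
  from ex[OF assms(2)] obtain k f where "hpoly k f" "g \<in> D f" "D f \<subseteq> U" by (elim exE conjE)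
  then show ?thesis by (intro exI[of _ k] exI[of _ f]) (simp add: D_def)
qed

lemma zariski_dense_PGL_if_tangent_UNIV:
  assumes H: "subgroup H (PGL :: (real^'n^'n) set monoid)" and T: "tangent_algebra (\<Union>H) = UNIV"
  shows "zariski_dense_PGL H"
proof -
  have HC: "H \<subseteq> carrier PGL" by (rule subgroup.subset[OF H])
  have "homogeneous_polynomial_function (\<lambda>_ :: real^'n^'n. 1)"
    by (auto simp: homogeneous_polynomial_function_def intro!: real_polynomial_function.intros exI[of _ 0])
  then have "g \<in> \<Union>{{g \<in> carrier PGL. \<forall>A\<in>g. f A \<noteq> 0} | f :: real^'n^'n \<Rightarrow> real. homogeneous_polynomial_function f}"
    if "g \<in> carrier PGL" for g :: "(real^'n^'n) set"
    using that
      by (intro UnionI[of "{g \<in> carrier PGL. \<forall>A\<in>g. (\<lambda>_ :: real^'n^'n. 1 :: real) A \<noteq> 0}"] CollectI exI[of _ "\<lambda>_. 1"] conjI) auto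
  then have ts: "topspace (zariski_PGL :: (real^'n^'n) set topology) = carrier PGL"
    unfolding zariski_PGL_def topology_generated_by_topspace by blast
  have "\<exists>h. h \<in> H \<and> h \<in> U" if U: "openin zariski_PGL U" "g \<in> U" for U g
  proof (rule ccontr)
    assume n: "\<nexists>h. h \<in> H \<and> h \<in> U"
    obtain k f where f: "hpoly k f" "\<forall>A\<in>g. f A \<noteq> 0" "{h \<in> carrier PGL. \<forall>A\<in>h. f A \<noteq> 0} \<subseteq> U"
      using zariski_PGL_basic_open[OF U] by blast
    have hom: "f (c *\<^sub>R A) = c ^ k * f A" for c A using f(1) by (simp add: hpoly_def)
    \<comment> \<open>That the class of \<open>A\<close> is not in \<open>U\<close> gives a zero of
      \<open>f\<close> at some representative only; homogeneity carries it over to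
      \<open>A\<close>.\<close>
    have "f A = 0" if A: "A \<in> \<Union>H" for A
    proof -
      obtain h where h: "h \<in> H" "A \<in> h" using A by blast
      then obtain A' where A': "A' \<in> h" "f A' = 0" using n f(3) HC by blast
      obtain B where "h = pgl_class B" using h(1) HC by (auto simp: carrier_PGL)
      then obtain c c' where c: "c \<noteq> 0" "A = c *\<^sub>R B" "c' \<noteq> 0" "A' = c' *\<^sub>R B"
        using h(2) A'(1) by (auto simp: pgl_class_alt)
      then show ?thesis using A'(2) by (simp add: hom)
    qed
    then have "f \<in> vanishing (\<Union>H) k" using f(1) unfolding vanishing_def by blast
    then have "f = (\<lambda>_. 0)" by (rule vanishing_trivial[OF matrix_group_cone_over[OF H] T])
    moreover have "g \<in> carrier PGL" using openin_subset[OF U(1)] U(2) ts by blast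
    then have "g \<noteq> {}" using pgl_class_self by (auto simp: carrier_PGL)
    ultimately show False using f(2) by blast
  qed
  then have "carrier PGL \<subseteq> zariski_PGL closure_of H" unfolding closure_of_def ts by blast
  then have "zariski_PGL closure_of H = carrier PGL"
    using closure_of_subset_topspace[of zariski_PGL H] ts by blast
  then show ?thesis using HC by (simp add: zariski_dense_PGL_def)
qed

lemma matrix_group_conj:
  assumes G: "matrix_group G" and B: "B ** B' = mat 1" "B' ** B = (mat 1 :: real^'n^'n)"
  shows "matrix_group ((\<lambda>A. B ** A ** B') ` G)"
proof -
  have m: "(B ** X ** B') ** (B ** Y ** B') = B ** (X ** Y) ** B'" for X Y
    by (metis B(2) matrix_mul_assoc matrix_mul_rid)
  have 1: "B ** mat 1 ** B' = mat 1" by (simp add: B)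
  show ?thesis
    unfolding matrix_group_def
  proof (intro conjI ballI)
    show "mat 1 \<in> (\<lambda>A. B ** A ** B') ` G" using G 1 by (force simp: matrix_group_def)
    fix X assume "X \<in> (\<lambda>A. B ** A ** B') ` G"
    then obtain A where A: "A \<in> G" "X = B ** A ** B'" by blast
    show "X ** Y \<in> (\<lambda>A. B ** A ** B') ` G" if "Y \<in> (\<lambda>A. B ** A ** B') ` G" for Y
      using that A G m by (auto simp: matrix_group_def)
    obtain C where C: "C \<in> G" "A ** C = mat 1" "C ** A = mat 1"
      using G A(1) by (auto simp: matrix_group_def)
    then show "\<exists>Y\<in>(\<lambda>A. B ** A ** B') ` G. X ** Y = mat 1 \<and> Y ** X = mat 1"
      by (intro bexI[of _ "B ** C ** B'"]) (auto simp: A m B)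
  qed
qed

section \<open>Bending\<close>

context dim_ge_4
begin

lemma c_mat_vec: "c_mat t *v x = exp (- t) *\<^sub>R proj x + (exp (t * (real CARD('n) - 1)) * x $ ix_second) *\<^sub>R (e2 :: 'n rvec)"
proof -
  have "(c_mat t *v x) $ i = (exp (- t) *\<^sub>R proj x + (exp (t * (real CARD('n) - 1)) * x $ ix_second) *\<^sub>R e2) $ i" for i
  proof -
    have "(c_mat t *v x) $ i = (\<Sum>j\<in>UNIV. if j = i then (if i = ix_second then exp (t * (real CARD('n) - 1)) else exp (- t)) * x $ i else 0)"
      unfolding matrix_vector_mult_def c_mat_def vec_lambda_beta by (intro sum.cong) auto
    then show ?thesis by (simp add: proj_def e2_def axis_def)
  qed
  then show ?thesis by (simp add: vec_eq_iff)
qed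

lemma c_mat_inverse: "c_mat t ** c_mat (- t) = (mat 1 :: 'n rmat)"
proof -
  have "c_mat t *v (c_mat (- t) *v x) = x" for x :: "'n rvec"
    unfolding c_mat_vec[of "- t"]
    by (simp add: c_mat_vec proj_add proj_scaleR proj_proj proj_e2 exp_add[symmetric] mult.assoc[symmetric])
      (metis proj_decomp)
  then show ?thesis by (simp add: matrix_eq matrix_vector_mul_assoc[symmetric])
qed

text \<open>\<open>c_mat (- t)\<close> is self-adjoint for \<open>bq\<close>, whereas the adjoint of
  an isometry is its inverse. So, unlike in \<open>wdg_conj_isoQ\<close>, the two factors are
  transformed by mutually inverse matrices.\<close>

lemma c_mat_conj_ot: "c_mat t ** ot x y ** c_mat (- t) = ot (c_mat t *v x) (c_mat (- t) *v (y :: 'n rvec))"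
proof -
  have "bq y (c_mat (- t) *v v) = bq (c_mat (- t) *v y) v" for v
  proof -
    have "bq y (proj v) = bq (proj y) v" by (metis bq_commute bq_proj2)
    then show ?thesis by (simp add: c_mat_vec)
  qed
  then have "ot z y ** c_mat (- t) = ot z (c_mat (- t) *v y)" for z
    by (simp add: matrix_eq matrix_vector_mul_assoc[symmetric])
  then show ?thesis by (simp add: matrix_mult_ot)
qed

lemma tangent_algebra_UNIV:
  assumes so: "\<And>x y :: 'n rvec. wdg x y \<in> tangent_algebra G"
    and tw: "\<And>x y :: 'n rvec. c_mat t ** wdg x y ** c_mat (- t) \<in> tangent_algebra G"
      and t: "t \<noteq> 0"
  shows "tangent_algebra G = UNIV"
proof -
  have lie: "lie_subalgebra (tangent_algebra G)"
    by (simp add: lie_subalgebra_def subspace_tangent_algebra tangent_algebra_bracket)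
  \<comment> \<open>The ratio \<open>l / m\<close> of the two eigenvalues of \<open>c_mat t\<close>;
    it differs from 1 exactly for \<open>t \<noteq> 0\<close>.\<close>
  let ?r = "exp (t * real CARD('n))"
  have "?r \<noteq> 1" using t by simp
  moreover have "?r *\<^sub>R ot e2 u - (1 / ?r) *\<^sub>R ot u e2 \<in> tangent_algebra G"
    if u: "u $ ix_second = 0" for u :: "'n rvec"
  proof -
    define l m where "l = exp (t * (real CARD('n) - 1))" and "m = exp (- t)"
    have lm: "exp (- t * (real CARD('n) - 1)) = 1 / l" "exp t = 1 / m"
      by (simp_all add: l_def m_def exp_minus inverse_eq_divide)
    have lm': "?r = l / m"
      unfolding l_def m_def exp_diff[symmetric] by (simp add: algebra_simps)
    have c: "c_mat t *v e2 = l *\<^sub>R (e2 :: 'n rvec)" "c_mat t *v u = m *\<^sub>R u"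
      "c_mat (- t) *v e2 = (1 / l) *\<^sub>R (e2 :: 'n rvec)" "c_mat (- t) *v u = (1 / m) *\<^sub>R u"
      using u proj_eq_self[OF u] unfolding c_mat_vec lm minus_minus by (simp_all add: proj_e2 l_def m_def)
    have sc: "ot (a *\<^sub>R x) (b *\<^sub>R y) = (a * b) *\<^sub>R ot x y" for a b and x y :: "'n rvec"
      by (simp add: matrix_eq scaleR_matrix_vector_assoc[symmetric] mult.commute mult.left_commute)
    have "c_mat t ** wdg e2 u ** c_mat (- t) = ?r *\<^sub>R ot e2 u - (1 / ?r) *\<^sub>R ot u e2"
      unfolding wdg_def lm' by (simp add: matrix_diff_ldistrib matrix_diff_rdistrib c_mat_conj_ot c sc)
    then show ?thesis using tw[of e2 u] by (simp only:)
  qed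
  ultimately show ?thesis using so by (intro lie_subalgebra_UNIV[OF lie mat_1_in_tangent_algebra, of ?r]) auto
qed

end

context hyp_hypersurface
begin

lemma so_tangent:
  assumes fv0: "finite_volume_quotient (UNIV - {ix_second}) hyp0 (stab \<Gamma> hyp0)"
    and G: "matrix_group G" "lifts0 \<subseteq> G"
    and A: "A \<in> lifts" "proj (A *v e2) \<noteq> 0"
    and B: "B \<in> lifts" "A ** B = mat 1" "B ** A = mat 1"
    and conj: "\<And>D. D \<in> lifts0 \<Longrightarrow> B ** D ** A \<in> G"
  shows "wdg x y \<in> tangent_algebra G"
proof (rule lie_subalgebra_so[where a = "B *v e2"])
  have iso: "isoQ A" by (rule lift_isoQ[OF lifts_lift[OF A(1)]])
  show "lie_subalgebra (tangent_algebra G)"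
    by (simp add: lie_subalgebra_def subspace_tangent_algebra tangent_algebra_bracket)
  show "wdg x y \<in> tangent_algebra G" if "x $ ix_second = 0" "y $ ix_second = 0" for x y
    by (rule wdg_tangent[OF fv0 G that])
  show "wdg x y \<in> tangent_algebra G" if xy: "bq (B *v e2) x = 0" "bq (B *v e2) y = 0" for x y
  proof (rule tangent_algebra_conj[OF B(2,3)])
    have "(A *v v) $ ix_second = bq (B *v e2) v" for v
      using isoQ_bq[OF iso, of "B *v e2" v] by (simp add: matrix_vector_mul_assoc B)
    then have "(A *v x) $ ix_second = 0" "(A *v y) $ ix_second = 0" using xy by simp_all
    moreover have "lifts0 \<subseteq> (\<lambda>X. A ** X ** B) ` G"
    proof
      fix D assume D: "D \<in> lifts0"
      have "A ** (B ** D ** A) ** B = (A ** B) ** D ** (A ** B)" by (simp only: matrix_mul_assoc)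
      then have "D = A ** (B ** D ** A) ** B" by (simp add: B)
      then show "D \<in> (\<lambda>X. A ** X ** B) ` G" using conj[OF D] by (rule image_eqI)
    qed
    ultimately have "wdg (A *v x) (A *v y) \<in> tangent_algebra ((\<lambda>X. A ** X ** B) ` G)"
      by (intro wdg_tangent[OF fv0 matrix_group_conj[OF G(1) B(2,3)]])
    then show "A ** wdg x y ** B \<in> tangent_algebra ((\<lambda>X. A ** X ** B) ` G)"
      by (simp add: wdg_conj_isoQ[OF iso B(2)])
  qed
  show "proj (B *v e2) \<noteq> 0"
  proof
    assume "proj (B *v e2) = 0"
    then have "B \<in> lifts0" using B(1) by (simp add: lifts0_def)
    then obtain A' where "A' \<in> lifts0" "B ** A' = mat 1"
      using lifts0_group by (auto simp: matrix_group_def)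
    moreover then have "A = A'" using B(2) by (metis matrix_mul_assoc matrix_mul_lid matrix_mul_rid)
    ultimately show False using A(2) by (simp add: lifts0_def)
  qed
qed

lemma stab_hyp_closure:
  assumes A: "A \<in> lifts" and C: "C \<subseteq> hyp" "pa A ` C = C"
  shows "pgl_class A \<in> stab \<Gamma> (hyp_closure C)"
  using pa_hyp_closure[OF A C(1)] C(2) lifts_\<Gamma>[OF A] by (simp add: stab_def act_eq)

lemma adjacent_hyp: "C \<in> adjacent_components S \<Longrightarrow> C \<subseteq> hyp"
  using in_components_subset[OF adjacent_component] by blast

lemma lifts0_stab: "D \<in> lifts0 \<Longrightarrow> C \<in> adjacent_components S \<Longrightarrow> pgl_class D \<in> stab \<Gamma> (hyp_closure C)"
  by (rule stab_hyp_closure) (auto simp: lifts0_def lifts0_adjacent adjacent_hyp)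

lemma tangent_UNIV_separating:
  assumes fv: "finite_volume_quotient UNIV hyp \<Gamma>"
    and fv0: "finite_volume_quotient (UNIV - {ix_second}) hyp0 (stab \<Gamma> hyp0)"
    and bend: "bends_separating \<Gamma> S t \<rho>" and t: "t \<noteq> 0"
    and G: "matrix_group (\<Union>(\<rho> ` \<Gamma>))"
  shows "tangent_algebra (\<Union>(\<rho> ` \<Gamma>)) = UNIV"
proof -
  let ?G = "\<Union>(\<rho> ` \<Gamma>)" and ?c = "c_mat t :: 'n rmat" and ?c' = "c_mat (- t) :: 'n rmat"
  obtain M1 M2 C1 C2 where M12: "M1 \<noteq> M2"
      "connected_components_of (subtopology (quotient_top \<Gamma>) (hyp_quotient \<Gamma> - S)) = {M1, M2}"
    and C1: "C1 \<in> adjacent_components S" "C1 \<subseteq> \<Union>M1"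
    and C2: "C2 \<in> adjacent_components S" "C2 \<subseteq> \<Union>M2"
    and \<rho>1: "\<forall>\<gamma>\<in>stab \<Gamma> (hyp_closure C1). \<rho> \<gamma> = \<gamma>"
    and \<rho>2: "\<forall>\<gamma>\<in>stab \<Gamma> (hyp_closure C2). \<rho> \<gamma> = bend_elt t \<otimes>\<^bsub>PGL\<^esub> \<gamma> \<otimes>\<^bsub>PGL\<^esub> inv\<^bsub>PGL\<^esub> bend_elt t"
    using bend unfolding bends_separating_def by (elim exE conjE)
  let ?X = "subtopology (quotient_top \<Gamma>) (hyp_quotient \<Gamma> - S)"
  have "M1 \<subseteq> topspace ?X" "M2 \<subseteq> topspace ?X"
    by (rule connected_components_of_subset, simp add: M12(2))+
  moreover have "topspace ?X \<subseteq> hyp_quotient \<Gamma>" unfolding topspace_subtopology by blast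
  ultimately have M: "M1 \<subseteq> hyp_quotient \<Gamma>" "M2 \<subseteq> hyp_quotient \<Gamma>"
    by (metis subset_trans)+
  have M': "M1 \<inter> M2 = {}" "M2 \<inter> M1 = {}"
    using pairwise_disjoint_connected_components_of[of ?X] M12
    by (auto simp only: pairwise_def disjnt_def insert_iff empty_iff)
  have cc: "?c ** ?c' = mat 1" "?c' ** ?c = mat 1"
    using c_mat_inverse[of t] c_mat_inverse[of "- t"] by simp_all
  have st: "pgl_class A \<in> \<Gamma>" if "pgl_class A \<in> stab \<Gamma> X" for A X
    using that by (simp add: stab_def)
  have G1: "A \<in> ?G" if "pgl_class A \<in> stab \<Gamma> (hyp_closure C1)" for A
    using \<rho>1 that st[OF that] pgl_class_self[of A] by force
  have G2: "?c ** A ** ?c' \<in> ?G" if A: "pgl_class A \<in> stab \<Gamma> (hyp_closure C2)" "invertible A" for A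
  proof -
    have "invertible ?c" "invertible ?c'" using cc by (auto simp: invertible_def)
    moreover have "inv\<^bsub>PGL\<^esub> pgl_class ?c = pgl_class ?c'" by (rule pgl_class_inv[OF cc])
    ultimately have "\<rho> (pgl_class A) = pgl_class (?c ** A ** ?c')"
      using \<rho>2 A by (simp add: bend_elt_def pgl_class_mult invertible_mult)
    then show ?thesis using st[OF A(1)] pgl_class_self[of "?c ** A ** ?c'"] by force
  qed
  have conj: "B ** D ** A \<in> H" if H: "matrix_group H" "lifts0 \<subseteq> H" "A \<in> H" "A ** B = mat 1" "B ** A = mat 1" "D \<in> lifts0"
    for H and A B D :: "'n rmat"
  proof -
    obtain B' where "B' \<in> H" "A ** B' = mat 1" "B' ** A = mat 1" using H by (auto simp: matrix_group_def)
    moreover then have "B' = B" using H(4) by (metis matrix_mul_assoc matrix_mul_lid matrix_mul_rid)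
    ultimately show ?thesis using H unfolding matrix_group_def by blast
  qed
  obtain A1 where A1: "A1 \<in> lifts" "pa A1 ` C1 = C1" "proj (A1 *v e2) \<noteq> 0"
    using exists_transverse[OF fv fv0 M(1,2) M'(1) C1 C2] by blast
  obtain B1 where B1: "B1 \<in> lifts" "A1 ** B1 = mat 1" "B1 ** A1 = mat 1" using lifts_inverse[OF A1(1)] .
  have "A1 \<in> ?G" by (rule G1[OF stab_hyp_closure[OF A1(1) adjacent_hyp[OF C1(1)] A1(2)]])
  moreover have l1: "lifts0 \<subseteq> ?G" using G1 lifts0_stab[OF _ C1(1)] by blast
  ultimately have so: "wdg x y \<in> tangent_algebra ?G" for x y
    using conj[OF G l1 _ B1(2,3)] by (intro so_tangent[OF fv0 G l1 A1(1,3) B1])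
  obtain A2 where A2: "A2 \<in> lifts" "pa A2 ` C2 = C2" "proj (A2 *v e2) \<noteq> 0"
    using exists_transverse[OF fv fv0 M(2,1) M'(2) C2 C1] by blast
  obtain B2 where B2: "B2 \<in> lifts" "A2 ** B2 = mat 1" "B2 ** A2 = mat 1" using lifts_inverse[OF A2(1)] .
  \<comment> \<open>Conjugating the whole group back by \<open>c_mat t\<close> makes the second
    factor the unbent one, so that the argument for the first factor can be repeated in
    \<open>?H\<close>.\<close>
  let ?H = "(\<lambda>A. ?c' ** A ** ?c) ` ?G"
  have H: "matrix_group ?H" by (rule matrix_group_conj[OF G cc(2,1)])
  have mem: "A \<in> ?H" if "pgl_class A \<in> stab \<Gamma> (hyp_closure C2)" "A \<in> lifts" for A
  proof -
    have "?c' ** (?c ** A ** ?c') ** ?c = (?c' ** ?c) ** A ** (?c' ** ?c)" by (simp only: matrix_mul_assoc)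
    then have "A = ?c' ** (?c ** A ** ?c') ** ?c" by (simp add: cc)
    then show ?thesis using G2[OF that(1) lift_invertible[OF lifts_lift[OF that(2)]]] by (rule image_eqI)
  qed
  have "A2 \<in> ?H" by (rule mem[OF stab_hyp_closure[OF A2(1) adjacent_hyp[OF C2(1)] A2(2)] A2(1)])
  moreover have l2: "lifts0 \<subseteq> ?H" using mem[OF lifts0_stab[OF _ C2(1)]] by (auto simp: lifts0_iff)
  ultimately have so2: "wdg x y \<in> tangent_algebra ?H" for x y
    using conj[OF H l2 _ B2(2,3)] by (intro so_tangent[OF fv0 H l2 A2(1,3) B2])
  have "?c ** wdg x y ** ?c' \<in> tangent_algebra ?G" for x y
  proof (rule tangent_algebra_conj[OF cc(2,1)])
    have "?c' ** (?c ** wdg x y ** ?c') ** ?c = (?c' ** ?c) ** wdg x y ** (?c' ** ?c)"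
      by (simp only: matrix_mul_assoc)
    then show "?c' ** (?c ** wdg x y ** ?c') ** ?c \<in> tangent_algebra ?H" using so2 by (simp add: cc)
  qed
  then show ?thesis using so t by (intro tangent_algebra_UNIV) auto
qed

lemma tangent_UNIV_nonseparating:
  assumes fv0: "finite_volume_quotient (UNIV - {ix_second}) hyp0 (stab \<Gamma> hyp0)"
    and bend: "bends_nonseparating \<Gamma> S t \<rho>" and t: "t \<noteq> 0"
    and G: "matrix_group (\<Union>(\<rho> ` \<Gamma>))"
  shows "tangent_algebra (\<Union>(\<rho> ` \<Gamma>)) = UNIV"
proof -
  let ?G = "\<Union>(\<rho> ` \<Gamma>)" and ?c = "c_mat t :: 'n rmat" and ?c' = "c_mat (- t) :: 'n rmat"
  obtain C C' s where C: "C \<noteq> C'" "adjacent_components S = {C, C'}" and s: "s \<in> \<Gamma>"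
    and cl: "hyp_closure C' = act s ` hyp_closure C"
    and \<rho>1: "\<forall>\<gamma>\<in>stab \<Gamma> (hyp_closure C). \<rho> \<gamma> = \<gamma>"
      and \<rho>s: "\<rho> s = bend_elt t \<otimes>\<^bsub>PGL\<^esub> s"
    using bend unfolding bends_nonseparating_def by (elim exE conjE)
  obtain A where A: "A \<in> lifts" "s = pgl_class A" using \<Gamma>_lifts[OF s] by blast
  obtain B where B: "B \<in> lifts" "A ** B = mat 1" "B ** A = mat 1" using lifts_inverse[OF A(1)] .
  have cl: "hyp_closure C' = pa A ` hyp_closure C" using cl by (simp add: A act_eq)
  have adj: "C \<in> adjacent_components S" "C' \<in> adjacent_components S" using C by auto
  have cc: "?c ** ?c' = mat 1" "?c' ** ?c = mat 1"
    using c_mat_inverse[of t] c_mat_inverse[of "- t"] by simp_all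
  have hh: "hyp_closure X \<subseteq> hyp" for X by (auto simp: hyp_closure_def)
  \<comment> \<open>A stable letter preserving \<open>hyp0\<close> would preserve \<open>C\<close>
    as well, but it takes the closure of \<open>C\<close> to that of \<open>C'\<close>, which lies
    on the other side.\<close>
  have pA: "proj (A *v e2) \<noteq> 0"
  proof
    assume "proj (A *v e2) = 0"
    then have "A \<in> lifts0" using A by (simp add: lifts0_def)
    then have "hyp_closure C' = hyp_closure C"
      using cl pa_hyp_closure[OF A(1) adjacent_hyp[OF adj(1)]] lifts0_adjacent[OF _ adj(1)] by simp
    moreover obtain r where r: "r = 1 \<or> r = -1" "C \<subseteq> side r"
      using component_side[OF adjacent_component[OF adj(1)]] .
    moreover obtain r' where r': "r' = 1 \<or> r' = -1" "C' \<subseteq> side r'"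
      using component_side[OF adjacent_component[OF adj(2)]] .
    moreover have "r' \<noteq> r" using adjacent_unique[OF adj(1) r(2) adj(2) _ r(1)] r'(2) C(1) by blast
    moreover have "closure C \<subseteq> {x. 0 \<le> r * x $ ix_second}"
    proof (rule closure_minimal)
      show "closed {x :: 'n rvec. 0 \<le> r * x $ ix_second}" by (intro closed_Collect_le continuous_intros)
    qed (use r(2) in \<open>auto simp: side_def\<close>)
    moreover obtain x where "x \<in> C'"
      using in_components_nonempty[OF adjacent_component[OF adj(2)]] by blast
    moreover then have "x \<in> hyp_closure C'"
      using adjacent_hyp[OF adj(2)] closure_subset by (auto simp: hyp_closure_def)
    ultimately have "0 \<le> r * x $ ix_second" "0 < r' * x $ ix_second" "r' = - r"
      by (auto simp: hyp_closure_def side_def)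
    then show False by simp
  qed
  have G1: "X \<in> ?G" if "pgl_class X \<in> stab \<Gamma> (hyp_closure C)" for X
  proof -
    have "pgl_class X \<in> \<Gamma>" "\<rho> (pgl_class X) = pgl_class X"
      using that \<rho>1 by (auto simp: stab_def)
    then show ?thesis using pgl_class_self[of X] by force
  qed
  have l0: "lifts0 \<subseteq> ?G" using G1 lifts0_stab[OF _ adj(1)] by blast
  have so: "wdg x y \<in> tangent_algebra ?G" for x y
  proof (rule so_tangent[OF fv0 G l0 A(1) pA B])
    fix D assume D: "D \<in> lifts0"
    then have Dl: "D \<in> lifts" by (simp add: lifts0_def)
    \<comment> \<open>\<open>D\<close> preserves both adjacent components. As \<open>A\<close> takes
      the closure of \<open>C\<close> to that of \<open>C'\<close>, the conjugate
      \<open>B ** D ** A\<close> stabilizes the closure of \<open>C\<close>, and on this stabilizer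
      \<open>\<rho>\<close> is the identity.\<close>
    have DC: "pa D ` hyp_closure C' = hyp_closure C'"
      using pa_hyp_closure[OF Dl adjacent_hyp[OF adj(2)]] lifts0_adjacent[OF D adj(2)] by simp
    have "pa (B ** D ** A) ` hyp_closure C = pa (B ** D) ` hyp_closure C'"
      using pa_image_mult[OF A(1) hh, of "B ** D"] by (simp add: cl)
    also have "\<dots> = pa B ` hyp_closure C'" using pa_image_mult[OF Dl hh[of C'], of B] DC by simp
    also have "\<dots> = pa (B ** A) ` hyp_closure C" unfolding cl by (rule pa_image_mult[OF A(1) hh])
    also have "\<dots> = hyp_closure C" using pa_image_one[OF hh] by (simp add: B)
    finally have "pgl_class (B ** D ** A) \<in> stab \<Gamma> (hyp_closure C)"
      using lifts_\<Gamma>[OF lifts_mult[OF lifts_mult[OF B(1) Dl] A(1)]] by (simp add: stab_def act_eq)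
    then show "B ** D ** A \<in> ?G" by (rule G1)
  qed
  have "invertible ?c" using cc by (auto simp: invertible_def)
  then have "\<rho> s = pgl_class (?c ** A)"
    using \<rho>s lift_invertible[OF lifts_lift[OF A(1)]] by (simp add: A bend_elt_def pgl_class_mult)
  then have cA: "?c ** A \<in> ?G" using s pgl_class_self[of "?c ** A"] by force
  have inv: "(?c ** A) ** (B ** ?c') = mat 1" "(B ** ?c') ** (?c ** A) = mat 1"
    by (metis B(2) cc(1) matrix_mul_assoc matrix_mul_rid, metis B(3) cc(2) matrix_mul_assoc matrix_mul_rid)
  \<comment> \<open>The bent stable letter \<open>?c ** A\<close> lies in the group. The isometry
    \<open>A\<close> only permutes the infinitesimal isometries, so conjugation by
    \<open>?c ** A\<close> amounts to conjugation by \<open>?c\<close>.\<close>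
  have "?c ** wdg x y ** ?c' \<in> tangent_algebra ?G" for x y
  proof -
    have "A ** wdg (B *v x) (B *v y) ** B = wdg x y"
      by (simp add: wdg_conj_isoQ[OF lift_isoQ[OF lifts_lift[OF A(1)]] B(2)] matrix_vector_mul_assoc B)
    moreover have "(?c ** A) ** wdg (B *v x) (B *v y) ** (B ** ?c') \<in> tangent_algebra ?G"
      by (rule tangent_algebra_Ad[OF G cA inv so])
    ultimately show ?thesis by (metis matrix_mul_assoc)
  qed
  then show ?thesis using so t by (intro tangent_algebra_UNIV) auto
qed

end

theorem theorem1p3:
  fixes d :: nat
    and \<Gamma> :: "(real^'n::{finite,linorder}^'n::_) set set"
    and S :: "(real^'n::_) set set"
    and \<rho> :: "(real^'n::_^'n::_) set \<Rightarrow> (real^'n::_^'n::_) set"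
    and t :: real
  assumes "d \<ge> 3" and "CARD('n) = d + 1"
    and "subgroup \<Gamma> PGL" and "\<Gamma> \<subseteq> PSO"
    and "free_properly_discontinuous \<Gamma>"
    and "finite_volume_quotient UNIV hyp \<Gamma>"
    and "complete_totally_geodesic_hypersurface \<Gamma> S"
    and "connectedin (quotient_top \<Gamma>) S"
    and "hyp0 \<in> components (\<Union>S)"
    and "finite_volume_quotient (UNIV - {ix_second}) hyp0 (stab \<Gamma> hyp0)"
    and "stab \<Gamma> hyp0 \<subseteq> PSO0"
    and "bending_hom \<Gamma> S t \<rho>" and "t \<noteq> 0"
  shows "zariski_dense_PGL (\<rho> ` \<Gamma>)"
proof -
  interpret hyp_hypersurface "TYPE('n)" \<Gamma> S
    by (intro hyp_hypersurface.intro hyp_manifold.intro dim_ge_4.intro hyp_manifold_axioms.intro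
        hyp_hypersurface_axioms.intro assms) (use assms(1,2) in simp)
  have "group (PGL\<lparr>carrier := \<Gamma>\<rparr>)"
    by (rule group.subgroup_imp_group[OF group_PGL assms(3)])
  then have "group_hom (PGL\<lparr>carrier := \<Gamma>\<rparr>) PGL \<rho>"
    using assms(12) group_PGL by (simp add: group_hom_def group_hom_axioms_def bending_hom_def)
  then have H: "subgroup (\<rho> ` \<Gamma>) PGL" using group_hom.img_is_subgroup by fastforce
  note G = matrix_group_cone_over[OF H]
  have "tangent_algebra (\<Union>(\<rho> ` \<Gamma>)) = UNIV"
    using assms(12) unfolding bending_hom_def
  proof (elim conjE disjE)
    assume "bends_separating \<Gamma> S t \<rho>"
    then show ?thesis by (rule tangent_UNIV_separating[OF assms(6,10) _ assms(13) G])
  next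
    assume "bends_nonseparating \<Gamma> S t \<rho>"
    then show ?thesis by (rule tangent_UNIV_nonseparating[OF assms(10) _ assms(13) G])
  qed
  then show ?thesis by (rule zariski_dense_PGL_if_tangent_UNIV[OF H])
qed

end
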